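(* Let $\mathcal{K}$ be a category and $\mu$ a regular cardinal. The following are equivalent: (1) $\mathcal{K}$ is locally $\mu$-multipresentable and all its morphisms are monomorphisms; (2) $\mathcal{K}$ is equivalent to $\mathrm{Emb}(T)$ for some universal $\mathbb{L}_{\infty,\mu}$-theory $T$; (3) $\mathcal{K}$ is equivalent to a universal $\mu$-AEC; (4) $\mathcal{K}$ is equivalent to a pseudo-universal $\mu$-AEC.
   Context: A category is $\mu$-accessible if it has $\mu$-directed colimits and a set $S$ of $\mu$-presentable objects (objects whose hom-functor preserves $\mu$-directed colimits) such that every object is a $\mu$-directed colimit of objects in $S$. A multiinitial object is a set $\mathcal{I}$ of objects such that for every object $M$ there is a unique $i\in\mathcal{I}$ admitting a morphism $i\to M$, and that morphism is unique; a multicolimit of a diagram $D$ is a multiinitial object in the category of cocones on $D$; a category is locally $\mu$-multipresentable if it is $\mu$-accessible and every small diagram has a multicolimit. A universal $\mathbb{L}_{\infty,\mu}$-sentence is one of the form $\forall\bar x\,\phi$ with $\bar x$ of length $<\mu$ and $\phi$ quantifier-free; a universal theory consists of such sentences. $\mathrm{Emb}(T)$ is the category of models of $T$ with substructure embeddings (injective maps preserving functions and relations and reflecting relations). An abstract class is a pair $\mathbf{K}=(K,\le_{\mathbf{K}})$ where $K$ is a class of structures in a fixed vocabulary with symbols of arity $<\mu$, closed under isomorphism, and $\le_{\mathbf{K}}$ a partial order respecting isomorphisms and extending the substructure relation; morphisms are $\mathbf{K}$-embeddings, i.e. maps $f:M\to N$ that are isomorphisms onto $f[M]$ with $f[M]\le_{\mathbf{K}}N$.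 A $\mu$-AEC is an abstract class satisfying: (Coherence) $M_0\subseteq M_1\le_{\mathbf{K}} M_2$ and $M_0\le_{\mathbf{K}}M_2$ imply $M_0\le_{\mathbf{K}} M_1$; (Chain axioms) for any $\mu$-directed system $\langle M_i\rangle$ in $\mathbf{K}$, $M=\bigcup_i M_i\in K$, each $M_i\le_{\mathbf{K}}M$, and $M_i\le_{\mathbf{K}}N$ for all $i$ implies $M\le_{\mathbf{K}}N$; (LST) there is $\lambda=\lambda^{<\mu}\ge|\tau(\mathbf{K})|+\mu$ such that for every $M\in K$, $A\subseteq UM$ there is $M_0\le_{\mathbf{K}}M$ with $A\subseteq UM_0$, $|UM_0|\le|A|^{<\mu}+\lambda$. A universal $\mu$-AEC is a class of structures in a vocabulary with symbols of arity $<\mu$, closed under isomorphism, substructures and unions of $\mu$-directed systems of substructure inclusions, ordered by $\le_{\mathbf{K}}=\subseteq$. A $\mu$-AEC admits intersections if for all $N$, $A\subseteq UN$, $\mathbf{cl}^N(A):=\bigcap\{UM:M\le_{\mathbf{K}}N, A\subseteq UM\}$ is the universe of some $M\le_{\mathbf{K}}N$; it is pseudo-universal if it admits intersections and any two $\mathbf{K}$-embeddings $f,g:M\to N$ agreeing on $A\subseteq UM$ agree on $\mathbf{cl}^M(A)$. *)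

theory Defs
  imports Complex_Main "HOL-Library.FuncSet"
begin

unbundle cardinal_syntax

section \<open>Size\<close>

text \<open>
  The universe of sets is modelled by a type \<open>'u\<close> whose cardinality is strongly inaccessible: a
  collection is a set (is small) if it has fewer elements than \<open>'u\<close>, and a class if it has at most as
  many. Every set then has an isomorphic copy among the small subsets of \<open>'u\<close>, so the small posets,
  small categories, vocabularies and structures below are taken with elements in \<open>'u\<close>.
\<close>

definition small :: "'u itself \<Rightarrow> 'a set \<Rightarrow> bool" where
  "small U A \<longleftrightarrow> |A| <o |UNIV :: 'u set|"

definition inaccessible_universe :: "'u itself \<Rightarrow> bool" where
  "inaccessible_universe U \<longleftrightarrow>
     natLeq <o |UNIV :: 'u set| \<and>
     regularCard |UNIV :: 'u set| \<and>
     (\<forall>A :: 'u set. small U A \<longrightarrow> small U (Pow A))"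

definition regular_cardinal :: "'u rel \<Rightarrow> bool" where
  "regular_cardinal \<mu> \<longleftrightarrow>
     Card_order \<mu> \<and> cinfinite \<mu> \<and> regularCard \<mu> \<and> \<mu> <o |UNIV :: 'u set|"


section \<open>Categories\<close>

record ('o, 'm) cat =
  Ob :: "'o set"
  Ar :: "'m set"
  Src :: "'m \<Rightarrow> 'o"
  Tgt :: "'m \<Rightarrow> 'o"
  Idt :: "'o \<Rightarrow> 'm"
  Cmp :: "'m \<Rightarrow> 'm \<Rightarrow> 'm"  \<comment> \<open>\<open>Cmp C g f\<close> is \<open>g\<close> after \<open>f\<close>\<close>

definition Hom :: "('o, 'm) cat \<Rightarrow> 'o \<Rightarrow> 'o \<Rightarrow> 'm set" where
  "Hom C A B = {f \<in> Ar C. Src C f = A \<and> Tgt C f = B}"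

definition category :: "('o, 'm) cat \<Rightarrow> bool" where
  "category C \<longleftrightarrow>
     (\<forall>f \<in> Ar C. Src C f \<in> Ob C \<and> Tgt C f \<in> Ob C) \<and>
     (\<forall>A \<in> Ob C. Idt C A \<in> Hom C A A) \<and>
     (\<forall>A \<in> Ob C. \<forall>B \<in> Ob C. \<forall>D \<in> Ob C. \<forall>f \<in> Hom C A B. \<forall>g \<in> Hom C B D.
        Cmp C g f \<in> Hom C A D) \<and>
     (\<forall>f \<in> Ar C. Cmp C f (Idt C (Src C f)) = f \<and> Cmp C (Idt C (Tgt C f)) f = f) \<and>
     (\<forall>f \<in> Ar C. \<forall>g \<in> Ar C. \<forall>h \<in> Ar C. Tgt C f = Src C g \<longrightarrow> Tgt C g = Src C h \<longrightarrow>
        Cmp C h (Cmp C g f) = Cmp C (Cmp C h g) f)"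

definition locally_small :: "'u itself \<Rightarrow> ('o, 'm) cat \<Rightarrow> bool" where
  "locally_small U C \<longleftrightarrow> (\<forall>A \<in> Ob C. \<forall>B \<in> Ob C. small U (Hom C A B))"

definition small_category :: "'u itself \<Rightarrow> ('o, 'm) cat \<Rightarrow> bool" where
  "small_category U C \<longleftrightarrow> category C \<and> small U (Ob C) \<and> small U (Ar C)"

definition mono_arrow :: "('o, 'm) cat \<Rightarrow> 'm \<Rightarrow> bool" where
  "mono_arrow C f \<longleftrightarrow> f \<in> Ar C \<and>
     (\<forall>A \<in> Ob C. \<forall>g \<in> Hom C A (Src C f). \<forall>h \<in> Hom C A (Src C f).
        Cmp C f g = Cmp C f h \<longrightarrow> g = h)"

definition iso_arrow :: "('o, 'm) cat \<Rightarrow> 'm \<Rightarrow> bool" where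
  "iso_arrow C f \<longleftrightarrow> f \<in> Ar C \<and>
     (\<exists>g \<in> Hom C (Tgt C f) (Src C f).
        Cmp C g f = Idt C (Src C f) \<and> Cmp C f g = Idt C (Tgt C f))"

record ('o, 'm, 'p, 'n) fctr =
  FO :: "'o \<Rightarrow> 'p"
  FA :: "'m \<Rightarrow> 'n"

definition is_functor :: "('o, 'm) cat \<Rightarrow> ('p, 'n) cat \<Rightarrow> ('o, 'm, 'p, 'n) fctr \<Rightarrow> bool" where
  "is_functor C D F \<longleftrightarrow>
     (\<forall>A \<in> Ob C. FO F A \<in> Ob D) \<and>
     (\<forall>f \<in> Ar C. FA F f \<in> Hom D (FO F (Src C f)) (FO F (Tgt C f))) \<and>
     (\<forall>A \<in> Ob C. FA F (Idt C A) = Idt D (FO F A)) \<and>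
     (\<forall>f \<in> Ar C. \<forall>g \<in> Ar C. Tgt C f = Src C g \<longrightarrow>
        FA F (Cmp C g f) = Cmp D (FA F g) (FA F f))"

definition id_fctr :: "('o, 'm, 'o, 'm) fctr" where
  "id_fctr = \<lparr>FO = (\<lambda>A. A), FA = (\<lambda>f. f)\<rparr>"

definition comp_fctr ::
  "('p, 'n, 'q, 'k) fctr \<Rightarrow> ('o, 'm, 'p, 'n) fctr \<Rightarrow> ('o, 'm, 'q, 'k) fctr" where
  "comp_fctr G F = \<lparr>FO = (\<lambda>A. FO G (FO F A)), FA = (\<lambda>f. FA G (FA F f))\<rparr>"

definition natural_iso :: "('o, 'm) cat \<Rightarrow> ('p, 'n) cat \<Rightarrow>
    ('o, 'm, 'p, 'n) fctr \<Rightarrow> ('o, 'm, 'p, 'n) fctr \<Rightarrow> ('o \<Rightarrow> 'n) \<Rightarrow> bool" where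
  "natural_iso C D F G \<eta> \<longleftrightarrow>
     (\<forall>A \<in> Ob C. \<eta> A \<in> Hom D (FO F A) (FO G A) \<and> iso_arrow D (\<eta> A)) \<and>
     (\<forall>f \<in> Ar C. Cmp D (\<eta> (Tgt C f)) (FA F f) = Cmp D (FA G f) (\<eta> (Src C f)))"

definition equivalent :: "('o, 'm) cat \<Rightarrow> ('p, 'n) cat \<Rightarrow> bool" where
  "equivalent C D \<longleftrightarrow>
     (\<exists>F G \<eta> \<epsilon>. is_functor C D F \<and> is_functor D C G \<and>
        natural_iso C C id_fctr (comp_fctr G F) \<eta> \<and>
        natural_iso D D (comp_fctr F G) id_fctr \<epsilon>)"

text \<open>
  Categories of sets with structure: \<open>U A\<close> is the underlying set of the object \<open>A\<close>, and the maps
  satisfying \<open>mor\<close> are required to be extensional on it.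
\<close>

definition concrete_cat ::
  "'o set \<Rightarrow> ('o \<Rightarrow> 'x set) \<Rightarrow> ('o \<Rightarrow> ('x \<Rightarrow> 'x) \<Rightarrow> 'o \<Rightarrow> bool) \<Rightarrow> ('o, 'o \<times> ('x \<Rightarrow> 'x) \<times> 'o) cat" where
  "concrete_cat K U mor =
     \<lparr>Ob = K,
      Ar = {(A, f, B). A \<in> K \<and> B \<in> K \<and> f \<in> extensional (U A) \<and> mor A f B},
      Src = (\<lambda>(A, f, B). A),
      Tgt = (\<lambda>(A, f, B). B),
      Idt = (\<lambda>A. (A, \<lambda>x\<in>U A. x, A)),
      Cmp = (\<lambda>(B, g, D) (A, f, B'). (A, compose (U A) g f, D))\<rparr>"

definition set_cat :: "'u itself \<Rightarrow> ('x set, 'x set \<times> ('x \<Rightarrow> 'x) \<times> 'x set) cat" where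
  "set_cat U = concrete_cat {X. small U X} (\<lambda>X. X) (\<lambda>X f Y. f \<in> X \<rightarrow> Y)"


section \<open>Colimits and multicolimits\<close>

definition cocone_cat :: "('o, 'm) cat \<Rightarrow> ('i, 'k) cat \<Rightarrow> ('i, 'k, 'o, 'm) fctr \<Rightarrow>
    ('o \<times> ('i \<Rightarrow> 'm), ('o \<times> ('i \<Rightarrow> 'm)) \<times> 'm \<times> ('o \<times> ('i \<Rightarrow> 'm))) cat" where
  "cocone_cat C J D =
     (let cocones = {(X, c). X \<in> Ob C \<and> c \<in> (\<Pi>\<^sub>E j\<in>Ob J. Hom C (FO D j) X) \<and>
                       (\<forall>u \<in> Ar J. Cmp C (c (Tgt J u)) (FA D u) = c (Src J u))}
      in \<lparr>Ob = cocones,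
          Ar = {((X, c), h, (Y, d)). (X, c) \<in> cocones \<and> (Y, d) \<in> cocones \<and>
                  h \<in> Hom C X Y \<and> (\<forall>j \<in> Ob J. Cmp C h (c j) = d j)},
          Src = (\<lambda>(p, h, q). p),
          Tgt = (\<lambda>(p, h, q). q),
          Idt = (\<lambda>p. (p, Idt C (fst p), p)),
          Cmp = (\<lambda>(q, g, r) (p, h, q'). (p, Cmp C g h, r))\<rparr>)"

definition initial :: "('o, 'm) cat \<Rightarrow> 'o \<Rightarrow> bool" where
  "initial C A \<longleftrightarrow> A \<in> Ob C \<and> (\<forall>B \<in> Ob C. \<exists>!f. f \<in> Hom C A B)"

definition multiinitial :: "'u itself \<Rightarrow> ('o, 'm) cat \<Rightarrow> 'o set \<Rightarrow> bool" where
  "multiinitial U C \<I> \<longleftrightarrow> \<I> \<subseteq> Ob C \<and> small U \<I> \<and>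
     (\<forall>M \<in> Ob C. (\<exists>!i. i \<in> \<I> \<and> (\<exists>f. f \<in> Hom C i M)) \<and>
        (\<forall>i \<in> \<I>. \<forall>f \<in> Hom C i M. \<forall>g \<in> Hom C i M. f = g))"

definition is_colimit :: "('o, 'm) cat \<Rightarrow> ('i, 'k) cat \<Rightarrow> ('i, 'k, 'o, 'm) fctr \<Rightarrow>
    'o \<Rightarrow> ('i \<Rightarrow> 'm) \<Rightarrow> bool" where
  "is_colimit C J D X c \<longleftrightarrow> initial (cocone_cat C J D) (X, c)"

definition has_multicolimit ::
  "'u itself \<Rightarrow> ('o, 'm) cat \<Rightarrow> ('i, 'k) cat \<Rightarrow> ('i, 'k, 'o, 'm) fctr \<Rightarrow> bool" where
  "has_multicolimit U C J D \<longleftrightarrow> (\<exists>\<I>. multiinitial U (cocone_cat C J D) \<I>)"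

definition poset_cat :: "'i set \<Rightarrow> 'i rel \<Rightarrow> ('i, 'i \<times> 'i) cat" where
  "poset_cat I r =
     \<lparr>Ob = I, Ar = r, Src = fst, Tgt = snd, Idt = (\<lambda>i. (i, i)),
      Cmp = (\<lambda>(j, k) (i, j'). (i, k))\<rparr>"

definition directed_poset :: "'u rel \<Rightarrow> 'u set \<Rightarrow> 'u rel \<Rightarrow> bool" where
  "directed_poset \<mu> I r \<longleftrightarrow> small TYPE('u) I \<and> partial_order_on I r \<and>
     (\<forall>A \<subseteq> I. |A| <o \<mu> \<longrightarrow> (\<exists>b \<in> I. \<forall>a \<in> A. (a, b) \<in> r))"


section \<open>Accessible and locally multipresentable categories\<close>

definition has_directed_colimits :: "'u rel \<Rightarrow> ('o, 'm) cat \<Rightarrow> bool" where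
  "has_directed_colimits \<mu> C \<longleftrightarrow>
     (\<forall>I r D. directed_poset \<mu> I r \<and> is_functor (poset_cat I r) C D \<longrightarrow>
        (\<exists>X c. is_colimit C (poset_cat I r) D X c))"

text \<open>
  The hom-sets are tagged with \<open>Inl\<close> so that the target category contains a copy of every small set;
  the small subsets of \<open>'m\<close> alone need not, as \<open>'m\<close> can be of smaller cardinality than \<open>'u\<close>.
\<close>

definition hom_fctr :: "('o, 'm) cat \<Rightarrow> 'o \<Rightarrow>
    ('o, 'm, ('m + 'u) set, ('m + 'u) set \<times> (('m + 'u) \<Rightarrow> ('m + 'u)) \<times> ('m + 'u) set) fctr" where
  "hom_fctr C A =
     \<lparr>FO = (\<lambda>X. Inl ` Hom C A X),
      FA = (\<lambda>f. (Inl ` Hom C A (Src C f),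
                 \<lambda>x \<in> Inl ` Hom C A (Src C f). Inl (Cmp C f (projl x)),
                 Inl ` Hom C A (Tgt C f)))\<rparr>"

definition preserves_directed_colimits ::
  "'u rel \<Rightarrow> ('o, 'm) cat \<Rightarrow> ('p, 'n) cat \<Rightarrow> ('o, 'm, 'p, 'n) fctr \<Rightarrow> bool" where
  "preserves_directed_colimits \<mu> C D F \<longleftrightarrow>
     (\<forall>I r E X c. directed_poset \<mu> I r \<and> is_functor (poset_cat I r) C E \<and>
        is_colimit C (poset_cat I r) E X c \<longrightarrow>
        is_colimit D (poset_cat I r) (comp_fctr F E) (FO F X) (\<lambda>i\<in>I. FA F (c i)))"

definition presentable :: "'u rel \<Rightarrow> ('o, 'm) cat \<Rightarrow> 'o \<Rightarrow> bool" where
  "presentable \<mu> C A \<longleftrightarrow> A \<in> Ob C \<and>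
     preserves_directed_colimits \<mu> C (set_cat TYPE('u))
       (hom_fctr C A ::
         ('o, 'm, ('m + 'u) set, ('m + 'u) set \<times> (('m + 'u) \<Rightarrow> ('m + 'u)) \<times> ('m + 'u) set) fctr)"

definition accessible :: "'u rel \<Rightarrow> ('o, 'm) cat \<Rightarrow> bool" where
  "accessible \<mu> C \<longleftrightarrow> has_directed_colimits \<mu> C \<and>
     (\<exists>S. small TYPE('u) S \<and> (\<forall>A \<in> S. presentable \<mu> C A) \<and>
        (\<forall>X \<in> Ob C. \<exists>I r D c. directed_poset \<mu> I r \<and> is_functor (poset_cat I r) C D \<and>
           (\<forall>i \<in> I. FO D i \<in> S) \<and> is_colimit C (poset_cat I r) D X c))"

definition locally_multipresentable :: "'u rel \<Rightarrow> ('o, 'm) cat \<Rightarrow> bool" where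
  "locally_multipresentable \<mu> C \<longleftrightarrow> accessible \<mu> C \<and>
     (\<forall>(J :: ('u, 'u) cat) D. small_category TYPE('u) J \<and> is_functor J C D \<longrightarrow>
        has_multicolimit TYPE('u) C J D)"


section \<open>Infinitary structures\<close>

text \<open>
  An ordinal below \<open>\<mu>\<close> is given by an element \<open>\<alpha>\<close> of the field of the well-order \<open>\<mu>\<close>, and stands for the
  set \<open>underS \<mu> \<alpha>\<close> of its predecessors. Arities and lengths of strings of variables are such ordinals.
  Structures may be empty.
\<close>

record 'u vocab =
  Fsym :: "'u set"
  Rsym :: "'u set"
  far :: "'u \<Rightarrow> 'u"
  rar :: "'u \<Rightarrow> 'u"

record 'u str =
  univ :: "'u set"
  fns :: "'u \<Rightarrow> ('u \<Rightarrow> 'u) \<Rightarrow> 'u"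
  rels :: "'u \<Rightarrow> ('u \<Rightarrow> 'u) set"

definition vocabulary :: "'u rel \<Rightarrow> 'u vocab \<Rightarrow> bool" where
  "vocabulary \<mu> \<tau> \<longleftrightarrow>
     small TYPE('u) (Fsym \<tau>) \<and> small TYPE('u) (Rsym \<tau>) \<and>
     (\<forall>s \<in> Fsym \<tau>. far \<tau> s \<in> Field \<mu>) \<and> (\<forall>s \<in> Rsym \<tau>. rar \<tau> s \<in> Field \<mu>)"

definition tuples :: "'u rel \<Rightarrow> 'u \<Rightarrow> 'u set \<Rightarrow> ('u \<Rightarrow> 'u) set" where
  "tuples \<mu> \<alpha> A = underS \<mu> \<alpha> \<rightarrow>\<^sub>E A"

text \<open>
  The interpretations are fixed outside their domains, so that equality of structures is the
  mathematical one.
\<close>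

definition str_of :: "'u rel \<Rightarrow> 'u vocab \<Rightarrow> 'u str \<Rightarrow> bool" where
  "str_of \<mu> \<tau> M \<longleftrightarrow> small TYPE('u) (univ M) \<and>
     fns M \<in> (\<Pi>\<^sub>E s\<in>Fsym \<tau>. tuples \<mu> (far \<tau> s) (univ M) \<rightarrow>\<^sub>E univ M) \<and>
     (\<forall>s \<in> Rsym \<tau>. rels M s \<subseteq> tuples \<mu> (rar \<tau> s) (univ M)) \<and>
     (\<forall>s. s \<notin> Rsym \<tau> \<longrightarrow> rels M s = {})"

definition embedding :: "'u rel \<Rightarrow> 'u vocab \<Rightarrow> 'u str \<Rightarrow> ('u \<Rightarrow> 'u) \<Rightarrow> 'u str \<Rightarrow> bool" where
  "embedding \<mu> \<tau> M f N \<longleftrightarrow> f \<in> univ M \<rightarrow> univ N \<and> inj_on f (univ M) \<and>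
     (\<forall>s \<in> Fsym \<tau>. \<forall>t \<in> tuples \<mu> (far \<tau> s) (univ M).
        f (fns M s t) = fns N s (compose (underS \<mu> (far \<tau> s)) f t)) \<and>
     (\<forall>s \<in> Rsym \<tau>. \<forall>t \<in> tuples \<mu> (rar \<tau> s) (univ M).
        t \<in> rels M s \<longleftrightarrow> compose (underS \<mu> (rar \<tau> s)) f t \<in> rels N s)"

definition str_iso :: "'u rel \<Rightarrow> 'u vocab \<Rightarrow> 'u str \<Rightarrow> ('u \<Rightarrow> 'u) \<Rightarrow> 'u str \<Rightarrow> bool" where
  "str_iso \<mu> \<tau> M f N \<longleftrightarrow> embedding \<mu> \<tau> M f N \<and> f ` univ M = univ N"

definition substr :: "'u rel \<Rightarrow> 'u vocab \<Rightarrow> 'u str \<Rightarrow> 'u str \<Rightarrow> bool" where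
  "substr \<mu> \<tau> M N \<longleftrightarrow> univ M \<subseteq> univ N \<and>
     (\<forall>s \<in> Fsym \<tau>. \<forall>t \<in> tuples \<mu> (far \<tau> s) (univ M). fns M s t = fns N s t) \<and>
     (\<forall>s \<in> Rsym \<tau>. rels M s = rels N s \<inter> tuples \<mu> (rar \<tau> s) (univ M))"

text \<open>
  In a \<open>\<mu>\<close>-directed system every tuple of the union lies in some member of the system, and the value of
  a function symbol there does not depend on the member.
\<close>

definition union_str :: "'u rel \<Rightarrow> 'u vocab \<Rightarrow> 'i set \<Rightarrow> ('i \<Rightarrow> 'u str) \<Rightarrow> 'u str" where
  "union_str \<mu> \<tau> I M =
     (let A = (\<Union>i\<in>I. univ (M i)) in
      \<lparr>univ = A,
       fns = (\<lambda>s\<in>Fsym \<tau>. \<lambda>t\<in>tuples \<mu> (far \<tau> s) A.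
                THE y. \<exists>i\<in>I. t \<in> tuples \<mu> (far \<tau> s) (univ (M i)) \<and> y = fns (M i) s t),
       rels = (\<lambda>s. \<Union>i\<in>I. rels (M i) s)\<rparr>)"


section \<open>Universal theories\<close>

text \<open>
  Conjunctions and disjunctions are of families indexed by small subsets of \<open>'u\<close>. Argument tuples and
  families are total functions of which only the values on the arity or the index set matter.
\<close>

datatype 'u trm = Var 'u | Fn 'u "'u \<Rightarrow> 'u trm"

datatype 'u qff =
    Eq "'u trm" "'u trm"
  | Rl 'u "'u \<Rightarrow> 'u trm"
  | Neg "'u qff"
  | Conj "'u set" "'u \<Rightarrow> 'u qff"
  | Disj "'u set" "'u \<Rightarrow> 'u qff"

primrec wf_trm :: "'u rel \<Rightarrow> 'u vocab \<Rightarrow> 'u set \<Rightarrow> 'u trm \<Rightarrow> bool" where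
  "wf_trm \<mu> \<tau> V (Var x) \<longleftrightarrow> x \<in> V"
| "wf_trm \<mu> \<tau> V (Fn s ts) \<longleftrightarrow> s \<in> Fsym \<tau> \<and> (\<forall>i. i \<in> underS \<mu> (far \<tau> s) \<longrightarrow> wf_trm \<mu> \<tau> V (ts i))"

primrec wf_qff :: "'u rel \<Rightarrow> 'u vocab \<Rightarrow> 'u set \<Rightarrow> 'u qff \<Rightarrow> bool" where
  "wf_qff \<mu> \<tau> V (Eq a b) \<longleftrightarrow> wf_trm \<mu> \<tau> V a \<and> wf_trm \<mu> \<tau> V b"
| "wf_qff \<mu> \<tau> V (Rl s ts) \<longleftrightarrow> s \<in> Rsym \<tau> \<and> (\<forall>i \<in> underS \<mu> (rar \<tau> s). wf_trm \<mu> \<tau> V (ts i))"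
| "wf_qff \<mu> \<tau> V (Neg \<phi>) \<longleftrightarrow> wf_qff \<mu> \<tau> V \<phi>"
| "wf_qff \<mu> \<tau> V (Conj I \<phi>s) \<longleftrightarrow> small TYPE('u) I \<and> (\<forall>i. i \<in> I \<longrightarrow> wf_qff \<mu> \<tau> V (\<phi>s i))"
| "wf_qff \<mu> \<tau> V (Disj I \<phi>s) \<longleftrightarrow> small TYPE('u) I \<and> (\<forall>i. i \<in> I \<longrightarrow> wf_qff \<mu> \<tau> V (\<phi>s i))"

primrec val :: "'u rel \<Rightarrow> 'u vocab \<Rightarrow> 'u str \<Rightarrow> ('u \<Rightarrow> 'u) \<Rightarrow> 'u trm \<Rightarrow> 'u" where
  "val \<mu> \<tau> M \<rho> (Var x) = \<rho> x"
| "val \<mu> \<tau> M \<rho> (Fn s ts) = fns M s (restrict (\<lambda>i. val \<mu> \<tau> M \<rho> (ts i)) (underS \<mu> (far \<tau> s)))"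

primrec sat :: "'u rel \<Rightarrow> 'u vocab \<Rightarrow> 'u str \<Rightarrow> ('u \<Rightarrow> 'u) \<Rightarrow> 'u qff \<Rightarrow> bool" where
  "sat \<mu> \<tau> M \<rho> (Eq a b) \<longleftrightarrow> val \<mu> \<tau> M \<rho> a = val \<mu> \<tau> M \<rho> b"
| "sat \<mu> \<tau> M \<rho> (Rl s ts) \<longleftrightarrow> (\<lambda>i\<in>underS \<mu> (rar \<tau> s). val \<mu> \<tau> M \<rho> (ts i)) \<in> rels M s"
| "sat \<mu> \<tau> M \<rho> (Neg \<phi>) \<longleftrightarrow> \<not> sat \<mu> \<tau> M \<rho> \<phi>"
| "sat \<mu> \<tau> M \<rho> (Conj I \<phi>s) \<longleftrightarrow> (\<forall>i. i \<in> I \<longrightarrow> sat \<mu> \<tau> M \<rho> (\<phi>s i))"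
| "sat \<mu> \<tau> M \<rho> (Disj I \<phi>s) \<longleftrightarrow> (\<exists>i. i \<in> I \<and> sat \<mu> \<tau> M \<rho> (\<phi>s i))"

text \<open>\<open>Forall \<alpha> \<phi>\<close> quantifies over a string of \<open>\<alpha>\<close> variables, namely those indexed by \<open>underS \<mu> \<alpha>\<close>.\<close>

datatype 'u usentence = Forall 'u "'u qff"

fun universal_sentence :: "'u rel \<Rightarrow> 'u vocab \<Rightarrow> 'u usentence \<Rightarrow> bool" where
  "universal_sentence \<mu> \<tau> (Forall \<alpha> \<phi>) \<longleftrightarrow> \<alpha> \<in> Field \<mu> \<and> wf_qff \<mu> \<tau> (underS \<mu> \<alpha>) \<phi>"

fun holds :: "'u rel \<Rightarrow> 'u vocab \<Rightarrow> 'u str \<Rightarrow> 'u usentence \<Rightarrow> bool" where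
  "holds \<mu> \<tau> M (Forall \<alpha> \<phi>) \<longleftrightarrow> (\<forall>\<rho> \<in> tuples \<mu> \<alpha> (univ M). sat \<mu> \<tau> M \<rho> \<phi>)"

definition universal_theory :: "'u rel \<Rightarrow> 'u vocab \<Rightarrow> 'u usentence set \<Rightarrow> bool" where
  "universal_theory \<mu> \<tau> T \<longleftrightarrow> small TYPE('u) T \<and> (\<forall>\<phi> \<in> T. universal_sentence \<mu> \<tau> \<phi>)"

definition models :: "'u rel \<Rightarrow> 'u vocab \<Rightarrow> 'u usentence set \<Rightarrow> 'u str set" where
  "models \<mu> \<tau> T = {M. str_of \<mu> \<tau> M \<and> (\<forall>\<phi> \<in> T. holds \<mu> \<tau> M \<phi>)}"

definition Emb :: "'u rel \<Rightarrow> 'u vocab \<Rightarrow> 'u usentence set \<Rightarrow>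
    ('u str, 'u str \<times> ('u \<Rightarrow> 'u) \<times> 'u str) cat" where
  "Emb \<mu> \<tau> T = concrete_cat (models \<mu> \<tau> T) univ (embedding \<mu> \<tau>)"


section \<open>Abstract elementary classes\<close>

definition iso_closed :: "'u rel \<Rightarrow> 'u vocab \<Rightarrow> 'u str set \<Rightarrow> bool" where
  "iso_closed \<mu> \<tau> K \<longleftrightarrow>
     (\<forall>M N f. M \<in> K \<and> str_of \<mu> \<tau> N \<and> str_iso \<mu> \<tau> M f N \<longrightarrow> N \<in> K)"

definition abstract_class :: "'u rel \<Rightarrow> 'u vocab \<Rightarrow> 'u str set \<Rightarrow> 'u str rel \<Rightarrow> bool" where
  "abstract_class \<mu> \<tau> K le \<longleftrightarrow>
     vocabulary \<mu> \<tau> \<and> (\<forall>M \<in> K. str_of \<mu> \<tau> M) \<and> iso_closed \<mu> \<tau> K \<and>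
     partial_order_on K le \<and>
     (\<forall>M N M' N' f. (M, N) \<in> le \<and> str_of \<mu> \<tau> M' \<and> str_of \<mu> \<tau> N' \<and>
        str_iso \<mu> \<tau> N f N' \<and> str_iso \<mu> \<tau> M f M' \<longrightarrow> (M', N') \<in> le) \<and>
     (\<forall>M N. (M, N) \<in> le \<longrightarrow> substr \<mu> \<tau> M N)"

definition K_embedding ::
  "'u rel \<Rightarrow> 'u vocab \<Rightarrow> 'u str rel \<Rightarrow> 'u str \<Rightarrow> ('u \<Rightarrow> 'u) \<Rightarrow> 'u str \<Rightarrow> bool" where
  "K_embedding \<mu> \<tau> le M f N \<longleftrightarrow> (\<exists>M'. str_of \<mu> \<tau> M' \<and> str_iso \<mu> \<tau> M f M' \<and> (M', N) \<in> le)"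

definition class_cat :: "'u rel \<Rightarrow> 'u vocab \<Rightarrow> 'u str set \<Rightarrow> 'u str rel \<Rightarrow>
    ('u str, 'u str \<times> ('u \<Rightarrow> 'u) \<times> 'u str) cat" where
  "class_cat \<mu> \<tau> K le = concrete_cat K univ (K_embedding \<mu> \<tau> le)"

definition directed_system ::
  "'u rel \<Rightarrow> 'u str set \<Rightarrow> 'u str rel \<Rightarrow> 'u set \<Rightarrow> 'u rel \<Rightarrow> ('u \<Rightarrow> 'u str) \<Rightarrow> bool" where
  "directed_system \<mu> K le I r M \<longleftrightarrow> directed_poset \<mu> I r \<and>
     (\<forall>i \<in> I. M i \<in> K) \<and> (\<forall>(i, j) \<in> r. (M i, M j) \<in> le)"

text \<open>\<open>card_pow_less \<mu> A\<close> is \<open>|A|\<^bsup><\<mu>\<^esup>\<close>, the number of sequences in \<open>A\<close> of length less than \<open>\<mu>\<close>.\<close>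

definition card_pow_less :: "'u rel \<Rightarrow> 'u set \<Rightarrow> ('u \<times> ('u \<Rightarrow> 'u)) rel" where
  "card_pow_less \<mu> A = |SIGMA \<alpha> : Field \<mu>. tuples \<mu> \<alpha> A|"

definition coherence :: "'u rel \<Rightarrow> 'u vocab \<Rightarrow> 'u str set \<Rightarrow> 'u str rel \<Rightarrow> bool" where
  "coherence \<mu> \<tau> K le \<longleftrightarrow>
     (\<forall>M0 \<in> K. \<forall>M1 \<in> K. \<forall>M2 \<in> K.
        substr \<mu> \<tau> M0 M1 \<and> (M1, M2) \<in> le \<and> (M0, M2) \<in> le \<longrightarrow> (M0, M1) \<in> le)"

definition chain_axioms :: "'u rel \<Rightarrow> 'u vocab \<Rightarrow> 'u str set \<Rightarrow> 'u str rel \<Rightarrow> bool" where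
  "chain_axioms \<mu> \<tau> K le \<longleftrightarrow>
     (\<forall>I r M. directed_system \<mu> K le I r M \<longrightarrow>
        union_str \<mu> \<tau> I M \<in> K \<and>
        (\<forall>i \<in> I. (M i, union_str \<mu> \<tau> I M) \<in> le) \<and>
        (\<forall>N \<in> K. (\<forall>i \<in> I. (M i, N) \<in> le) \<longrightarrow> (union_str \<mu> \<tau> I M, N) \<in> le))"

definition LST :: "'u rel \<Rightarrow> 'u vocab \<Rightarrow> 'u str set \<Rightarrow> 'u str rel \<Rightarrow> bool" where
  "LST \<mu> \<tau> K le \<longleftrightarrow>
     (\<exists>lam :: 'u rel. Card_order lam \<and> lam <o |UNIV :: 'u set| \<and>
        lam =o card_pow_less \<mu> (Field lam) \<and>
        |Fsym \<tau> <+> Rsym \<tau>| +c \<mu> \<le>o lam \<and>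
        (\<forall>M \<in> K. \<forall>A \<subseteq> univ M. \<exists>M0. (M0, M) \<in> le \<and> A \<subseteq> univ M0 \<and>
           |univ M0| \<le>o card_pow_less \<mu> A +c lam))"

definition mu_AEC :: "'u rel \<Rightarrow> 'u vocab \<Rightarrow> 'u str set \<Rightarrow> 'u str rel \<Rightarrow> bool" where
  "mu_AEC \<mu> \<tau> K le \<longleftrightarrow> abstract_class \<mu> \<tau> K le \<and>
     coherence \<mu> \<tau> K le \<and> chain_axioms \<mu> \<tau> K le \<and> LST \<mu> \<tau> K le"

definition substr_rel :: "'u rel \<Rightarrow> 'u vocab \<Rightarrow> 'u str set \<Rightarrow> 'u str rel" where
  "substr_rel \<mu> \<tau> K = {(M, N). M \<in> K \<and> N \<in> K \<and> substr \<mu> \<tau> M N}"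

definition universal_mu_AEC :: "'u rel \<Rightarrow> 'u vocab \<Rightarrow> 'u str set \<Rightarrow> 'u str rel \<Rightarrow> bool" where
  "universal_mu_AEC \<mu> \<tau> K le \<longleftrightarrow>
     vocabulary \<mu> \<tau> \<and> (\<forall>M \<in> K. str_of \<mu> \<tau> M) \<and> iso_closed \<mu> \<tau> K \<and>
     (\<forall>M N. N \<in> K \<and> str_of \<mu> \<tau> M \<and> substr \<mu> \<tau> M N \<longrightarrow> M \<in> K) \<and>
     (\<forall>I r M. directed_system \<mu> K (substr_rel \<mu> \<tau> K) I r M \<longrightarrow> union_str \<mu> \<tau> I M \<in> K) \<and>
     le = substr_rel \<mu> \<tau> K"

definition cl :: "'u str rel \<Rightarrow> 'u str \<Rightarrow> 'u set \<Rightarrow> 'u set" where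
  "cl le N A = \<Inter> {univ M | M. (M, N) \<in> le \<and> A \<subseteq> univ M}"

definition admits_intersections :: "'u str set \<Rightarrow> 'u str rel \<Rightarrow> bool" where
  "admits_intersections K le \<longleftrightarrow>
     (\<forall>N \<in> K. \<forall>A \<subseteq> univ N. \<exists>M. (M, N) \<in> le \<and> univ M = cl le N A)"

definition pseudo_universal_mu_AEC ::
  "'u rel \<Rightarrow> 'u vocab \<Rightarrow> 'u str set \<Rightarrow> 'u str rel \<Rightarrow> bool" where
  "pseudo_universal_mu_AEC \<mu> \<tau> K le \<longleftrightarrow> mu_AEC \<mu> \<tau> K le \<and> admits_intersections K le \<and>
     (\<forall>M \<in> K. \<forall>N \<in> K. \<forall>f g. \<forall>A \<subseteq> univ M.
        K_embedding \<mu> \<tau> le M f N \<and> K_embedding \<mu> \<tau> le M g N \<and> (\<forall>a \<in> A. f a = g a) \<longrightarrow>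
        (\<forall>a \<in> cl le M A. f a = g a))"

end

theory Submission
  imports Defs
begin

text \<open>
  The proof goes round the cycle (1) \<Rightarrow> (2) \<Rightarrow> (3) \<Rightarrow> (4) \<Rightarrow> (1).

  (1) \<Rightarrow> (2). Fix a small set \<open>S\<close> of presentable objects generating the category, and let the points of
  an object \<open>X\<close> be the arrows from members of \<open>S\<close> to \<open>X\<close>. A tuple \<open>x\<close> of fewer than \<open>\<mu>\<close> points of \<open>X\<close> is a
  cocone on a discrete diagram, hence factors uniquely as \<open>x = h \<circ> p\<close> through exactly one component
  \<open>(P, p)\<close>, the type of \<open>x\<close>, of a multicolimit. Choosing a point \<open>e t\<close> of every type \<open>t\<close> gives an operation
  \<open>x \<mapsto> h \<circ> e (P, p)\<close>, natural in \<open>X\<close>. With all these operations, and with the members of \<open>S\<close> as unary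
  predicates, the points of \<open>X\<close> form a structure \<open>E X\<close>; \<open>E\<close> is fully faithful into embeddings because
  arrows are monomorphisms and members of \<open>S\<close> are presentable. A structure is isomorphic to some \<open>E X\<close>
  iff each of its short tuples generates a copy of some \<open>E P\<close>, for it is then the union of a
  \<open>\<mu>\<close>-directed system of such copies, and \<open>X\<close> is the colimit of the corresponding \<open>P\<close>. This is a
  universal condition.

  (2) \<Rightarrow> (3) \<Rightarrow> (4). Embeddings preserve and reflect quantifier-free formulas, and a short tuple of a
  \<open>\<mu>\<close>-directed union lies in a member of the system. Closures are generated substructures, and the
  set where two embeddings agree is a substructure.

  (4) \<Rightarrow> (1). A \<open>\<mu>\<close>-directed colimit is a union up to isomorphism, so objects generated by fewer than \<open>\<mu>\<close>
  elements are presentable, and every object is the directed union of such. The components of the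
  multicolimit of a diagram are the cocones whose vertex is generated by the images of the diagram:
  pseudo-universality makes arrows out of them unique. All of this is transported along the given
  equivalence.
\<close>

section \<open>Small sets\<close>

text \<open>Presentability is preservation of directed colimits by a hom-functor into sets. As all
  arrows in sight are monomorphisms, it comes down to one condition, \<open>factoring\<close>: an
  arrow into a \<mu>-directed colimit factors through a stage. Two factorisations are compared at a
  later stage, where a leg of the colimit cocone can be cancelled. In this form presentability is
  transported along fully faithful, essentially surjective functors.

  Two obstacles shape the step from (1) to (2). Points must be elements of \<open>'u\<close>, so the
  arrows, whose type is arbitrary, are first recoded in \<open>'u\<close>; the bound on the class of
  objects serves this. And the axioms must form a set, although they have to say that a short tuple
  generates a copy of some \<open>E P\<close>. The axiom for an arity is the disjunction of these
  descriptions over the types of that arity.\<close>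

locale regular_universe =
  fixes \<mu> :: "'u rel"
  assumes inacc: "inaccessible_universe TYPE('u)"
    and reg: "regular_cardinal \<mu>"
begin

lemma Cinfinite_univ: "Cinfinite |UNIV :: 'u set|"
proof -
  have "natLeq \<le>o |UNIV :: 'u set|"
    using inacc unfolding inaccessible_universe_def by (blast intro: ordLess_imp_ordLeq)
  then show ?thesis
    using natLeq_ordLeq_cinfinite card_of_Card_order
    by (meson Cinfinite_cong cinfinite_mono natLeq_cinfinite)
qed

lemma regular_univ: "regularCard |UNIV :: 'u set|"
  using inacc unfolding inaccessible_universe_def by blast

lemma Cinfinite_mu: "Cinfinite \<mu>" and regular_mu: "regularCard \<mu>"
    and mu_less: "\<mu> <o |UNIV :: 'u set|" and Card_order_mu: "Card_order \<mu>"
    and Well_order_mu: "Well_order \<mu>"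
  using reg unfolding regular_cardinal_def by (auto intro: card_order_on_well_order_on)

lemma small_leq: "|A| \<le>o |B| \<Longrightarrow> small TYPE('u) B \<Longrightarrow> small TYPE('u) A"
  unfolding small_def by (rule ordLeq_ordLess_trans)

lemma small_subset: "small TYPE('u) B \<Longrightarrow> A \<subseteq> B \<Longrightarrow> small TYPE('u) A"
  by (rule small_leq[OF card_of_mono1])

lemma small_image: "small TYPE('u) A \<Longrightarrow> small TYPE('u) (f ` A)"
  by (rule small_leq[OF card_of_image])

lemma small_inj: "inj_on f A \<Longrightarrow> f ` A \<subseteq> B \<Longrightarrow> small TYPE('u) B \<Longrightarrow> small TYPE('u) A"
  by (rule small_leq[OF iffD1[OF card_of_ordLeq]]) blast+

lemma small_finite: "finite A \<Longrightarrow> small TYPE('u) A"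
  unfolding small_def using Cinfinite_univ
  by (intro finite_ordLess_infinite card_of_Well_order) (auto simp: cinfinite_def Field_card_of)

lemma small_UN: "small TYPE('u) I \<Longrightarrow> (\<And>i. i \<in> I \<Longrightarrow> small TYPE('u) (A i)) \<Longrightarrow> small TYPE('u) (\<Union>i\<in>I. A i)"
  unfolding small_def by (rule regularCard_UNION_bound[OF Cinfinite_univ regular_univ])

lemma small_Un: "small TYPE('u) A \<Longrightarrow> small TYPE('u) B \<Longrightarrow> small TYPE('u) (A \<union> B)"
  using small_UN[of UNIV "\<lambda>b. if b then A else B"] small_finite[of "UNIV :: bool set"]
  by (simp add: UNIV_bool Un_commute)

lemma small_Sigma: "small TYPE('u) A \<Longrightarrow> (\<And>x. x \<in> A \<Longrightarrow> small TYPE('u) (B x)) \<Longrightarrow> small TYPE('u) (Sigma A B)"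
  using small_UN[of A "\<lambda>x. Pair x ` B x"] small_image
  by (force intro: small_subset)

lemma small_code: "small TYPE('u) A \<Longrightarrow> \<exists>c :: 'a \<Rightarrow> 'u. inj_on c A"
  unfolding small_def by (drule ordLess_imp_ordLeq, drule iffD2[OF card_of_ordLeq]) blast

lemma small_copy: "small TYPE('u) A \<Longrightarrow> \<exists>(B :: 'u set) c. bij_betw c A B \<and> small TYPE('u) B"
  using small_code small_image unfolding bij_betw_def by metis

text \<open>The strong limit hypothesis speaks of subsets of \<open>'u\<close> only, so
  \<open>A\<close> is first coded into \<open>'u\<close>.\<close>

lemma small_Pow: "small TYPE('u) A \<Longrightarrow> small TYPE('u) (Pow A)"
proof -
  assume A: "small TYPE('u) A"
  then obtain c :: "'a \<Rightarrow> 'u" where c: "inj_on c A" using small_code by blast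
  have "small TYPE('u) (Pow (c ` A))"
    using inacc small_image[OF A] unfolding inaccessible_universe_def by blast
  moreover have "inj_on ((`) c) (Pow A)" using c by (rule inj_on_image_Pow)
  ultimately show ?thesis by (rule small_inj[rotated 2]) auto
qed

text \<open>An extensional function is determined by its graph, a subset of
  \<open>Sigma A B\<close>.\<close>

lemma small_PiE: "small TYPE('u) A \<Longrightarrow> (\<And>x. x \<in> A \<Longrightarrow> small TYPE('u) (B x)) \<Longrightarrow> small TYPE('u) (Pi\<^sub>E A B)"
proof (rule small_inj)
  show "inj_on (\<lambda>f. {(x, f x) |x. x \<in> A}) (Pi\<^sub>E A B)"
    by (rule inj_onI, rule PiE_ext) blast+
  show "(\<lambda>f. {(x, f x) |x. x \<in> A}) ` Pi\<^sub>E A B \<subseteq> Pow (Sigma A B)" by auto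
qed (blast intro: small_Pow small_Sigma)

section \<open>Sets of size below \<mu>\<close>

lemma less_mu_small: "|A| <o \<mu> \<Longrightarrow> small TYPE('u) A"
  unfolding small_def using mu_less ordLess_transitive by blast

lemma small_Field_mu: "small TYPE('u) (Field \<mu>)"
  unfolding small_def using mu_less Card_order_mu
  by (meson card_of_Field_ordIso ordIso_ordLess_trans)

lemma card_underS_less: "\<alpha> \<in> Field \<mu> \<Longrightarrow> |underS \<mu> \<alpha>| <o \<mu>"
  using card_of_underS[OF Card_order_mu] .

lemma small_underS: "\<alpha> \<in> Field \<mu> \<Longrightarrow> small TYPE('u) (underS \<mu> \<alpha>)"
  using card_underS_less less_mu_small by blast

lemma less_mu_UN: "|I| <o \<mu> \<Longrightarrow> (\<And>i. i \<in> I \<Longrightarrow> |A i| <o \<mu>) \<Longrightarrow> |\<Union>i\<in>I. A i| <o \<mu>"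
  by (rule regularCard_UNION_bound[OF Cinfinite_mu regular_mu])

lemma less_mu_image: "|A| <o \<mu> \<Longrightarrow> |f ` A| <o \<mu>"
  using card_of_image ordLeq_ordLess_trans by blast

lemma less_mu_finite: "finite A \<Longrightarrow> |A| <o \<mu>"
  using Cinfinite_mu
  by (intro finite_ordLess_infinite card_of_Well_order Well_order_mu) (auto simp: cinfinite_def Field_card_of)

text \<open>A cardinal below \<mu> is order isomorphic to a proper initial segment of the well-order
  \<mu>. This turns a short subset into the range of a short tuple.\<close>

lemma less_mu_enum:
  assumes "|A| <o \<mu>"
  shows "\<exists>\<alpha>\<in>Field \<mu>. \<exists>f. bij_betw f (underS \<mu> \<alpha>) A"
proof -
  obtain \<alpha> where a: "\<alpha> \<in> Field \<mu>" and *: "|A| =o Restr \<mu> (underS \<mu> \<alpha>)"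
    using assms ordLess_iff_ordIso_Restr[OF Well_order_mu card_of_Well_order] by blast
  have "Restr \<mu> (underS \<mu> \<alpha>) =o |A|" using * by (rule ordIso_symmetric)
  then obtain f where "iso (Restr \<mu> (underS \<mu> \<alpha>)) |A| f" unfolding ordIso_def by blast
  then have "bij_betw f (Field (Restr \<mu> (underS \<mu> \<alpha>))) A" by (simp add: iso_def Field_card_of)
  moreover have "Field (Restr \<mu> (underS \<mu> \<alpha>)) = underS \<mu> \<alpha>"
    using Well_order_mu
    by (intro Refl_Field_Restr2)
      (auto simp: well_order_on_def linear_order_on_def partial_order_on_def preorder_on_def
        underS_def Field_def)
  ultimately show ?thesis using a by auto
qed

text \<open>The inclusion order on the subsets of size below \<mu> is directed because, by
  regularity, fewer than \<mu> of them have a union of size below \<mu>. The subsets are renamed by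
  elements \<open>i\<close> of \<open>'u\<close>, the type of indices in
  \<open>directed_poset\<close>, and \<open>dec\<close> recovers them. Both directed presentations
  built later, of an object by generated subobjects and of a model by structures of points, are
  indexed in this way.\<close>

lemma subset_poset:
  assumes B: "small TYPE('u) B"
  obtains I r and dec :: "'u \<Rightarrow> 'b set" where "directed_poset \<mu> I r"
    "bij_betw dec I {A. A \<subseteq> B \<and> |A| <o \<mu>}"
    "\<And>i j. (i, j) \<in> r \<longleftrightarrow> i \<in> I \<and> j \<in> I \<and> dec i \<subseteq> dec j"
proof -
  let ?P = "{A. A \<subseteq> B \<and> |A| <o \<mu>}"
  have P: "small TYPE('u) ?P" by (rule small_subset[OF small_Pow[OF B]]) auto
  then obtain I :: "'u set" and c where c: "bij_betw c ?P I" and I: "small TYPE('u) I"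
    using small_copy by blast
  define dec where "dec = inv_into ?P c"
  have dec: "bij_betw dec I ?P" unfolding dec_def using c by (rule bij_betw_inv_into)
  define r where "r = {(i, j). i \<in> I \<and> j \<in> I \<and> dec i \<subseteq> dec j}"
  have inj: "inj_on dec I" using dec bij_betw_def by blast
  have "partial_order_on I r"
    unfolding partial_order_on_def preorder_on_def r_def
    by (auto simp: refl_on_def trans_def antisym_def dest: inj_onD[OF inj])
  moreover have "\<exists>b\<in>I. \<forall>a\<in>X. (a, b) \<in> r" if X: "X \<subseteq> I" "|X| <o \<mu>" for X
  proof -
    have "dec a \<in> ?P" if "a \<in> X" for a using that X dec bij_betwE by blast
    then have "(\<Union>a\<in>X. dec a) \<in> ?P" using less_mu_UN[OF X(2), of dec] by auto
    then obtain b where "b \<in> I" "dec b = (\<Union>a\<in>X. dec a)"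
      using bij_betw_imp_surj_on[OF dec] by (metis (no_types, lifting) imageE)
    then show ?thesis using X unfolding r_def by blast
  qed
  ultimately have "directed_poset \<mu> I r" using I unfolding directed_poset_def by simp
  then show ?thesis by (rule that[OF _ dec]) (simp add: r_def)
qed

section \<open>Upper bounds in \<mu>-directed posets\<close>

lemma directed_nonempty: "directed_poset \<mu> I r \<Longrightarrow> I \<noteq> {}"
  unfolding directed_poset_def using less_mu_finite[of "{}"] by auto

lemma directed_bound:
  assumes "directed_poset \<mu> I r" "X \<subseteq> I" "|X| <o \<mu>"
  shows "\<exists>b\<in>I. \<forall>a\<in>X. (a, b) \<in> r"
  using assms unfolding directed_poset_def by simp

lemma directed_upper2:
  assumes "directed_poset \<mu> I r" "i \<in> I" "j \<in> I"
  shows "\<exists>k\<in>I. (i, k) \<in> r \<and> (j, k) \<in> r"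
proof -
  have "|{i, j}| <o \<mu>" by (rule less_mu_finite) simp
  from directed_bound[OF assms(1) _ this] have "\<exists>b\<in>I. \<forall>a\<in>{i, j}. (a, b) \<in> r"
    using assms(2,3) by simp
  then show ?thesis by simp
qed

lemma directed_upper:
  assumes "directed_poset \<mu> I r" "|X| <o \<mu>" "\<And>x. x \<in> X \<Longrightarrow> f x \<in> I"
  shows "\<exists>k\<in>I. \<forall>x\<in>X. (f x, k) \<in> r"
proof -
  have "|f ` X| <o \<mu>" using assms(2) by (rule less_mu_image)
  from directed_bound[OF assms(1) _ this] have "\<exists>b\<in>I. \<forall>a\<in>f ` X. (a, b) \<in> r"
    using assms(3) by (simp add: image_subset_iff)
  then show ?thesis by simp
qed

lemma directed_poset_facts:
  assumes "directed_poset \<mu> I r"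
  shows "small TYPE('u) I" "(i, j) \<in> r \<Longrightarrow> i \<in> I" "(i, j) \<in> r \<Longrightarrow> j \<in> I" "i \<in> I \<Longrightarrow> (i, i) \<in> r"
    "(i, j) \<in> r \<Longrightarrow> (j, k) \<in> r \<Longrightarrow> (i, k) \<in> r"
proof -
  have r: "small TYPE('u) I" "refl_on I r" "trans r" "r \<subseteq> I \<times> I"
    using assms unfolding directed_poset_def partial_order_on_def preorder_on_def by blast+
  show "small TYPE('u) I" "(i, j) \<in> r \<Longrightarrow> i \<in> I" "(i, j) \<in> r \<Longrightarrow> j \<in> I" "i \<in> I \<Longrightarrow> (i, i) \<in> r"
    using r by (auto dest: refl_onD)
  show "(i, j) \<in> r \<Longrightarrow> (j, k) \<in> r \<Longrightarrow> (i, k) \<in> r" using r(3) by (rule transD)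
qed

end

section \<open>Categories and weak equivalences\<close>

lemma Hom_iff: "f \<in> Hom C A B \<longleftrightarrow> f \<in> Ar C \<and> Src C f = A \<and> Tgt C f = B"
  by (simp add: Hom_def)

lemma
  assumes "category C"
  shows Src_Ob: "f \<in> Ar C \<Longrightarrow> Src C f \<in> Ob C"
    and Tgt_Ob: "f \<in> Ar C \<Longrightarrow> Tgt C f \<in> Ob C"
    and Idt_Ar: "A \<in> Ob C \<Longrightarrow> Idt C A \<in> Ar C"
    and Src_Idt: "A \<in> Ob C \<Longrightarrow> Src C (Idt C A) = A"
    and Tgt_Idt: "A \<in> Ob C \<Longrightarrow> Tgt C (Idt C A) = A"
    and Cmp_Idt: "f \<in> Ar C \<Longrightarrow> Src C f = A \<Longrightarrow> Cmp C f (Idt C A) = f"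
    and Idt_Cmp: "f \<in> Ar C \<Longrightarrow> Tgt C f = A \<Longrightarrow> Cmp C (Idt C A) f = f"
  using assms by (auto simp: category_def Hom_iff)

lemma
  assumes "category C" "f \<in> Ar C" "g \<in> Ar C" "Tgt C f = Src C g"
  shows Cmp_Ar: "Cmp C g f \<in> Ar C"
    and Src_Cmp: "Src C (Cmp C g f) = Src C f"
    and Tgt_Cmp: "Tgt C (Cmp C g f) = Tgt C g"
proof -
  have "\<forall>A \<in> Ob C. \<forall>B \<in> Ob C. \<forall>D \<in> Ob C. \<forall>f \<in> Hom C A B. \<forall>g \<in> Hom C B D. Cmp C g f \<in> Hom C A D"
    using assms(1) by (simp add: category_def)
  moreover have "f \<in> Hom C (Src C f) (Tgt C f)" "g \<in> Hom C (Tgt C f) (Tgt C g)"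
    using assms by (simp_all add: Hom_iff)
  ultimately have "Cmp C g f \<in> Hom C (Src C f) (Tgt C g)"
    using assms Src_Ob Tgt_Ob by metis
  then show "Cmp C g f \<in> Ar C" "Src C (Cmp C g f) = Src C f" "Tgt C (Cmp C g f) = Tgt C g"
    by (simp_all add: Hom_iff)
qed

lemma Cmp_assoc:
  assumes "category C" "f \<in> Ar C" "g \<in> Ar C" "h \<in> Ar C" "Tgt C f = Src C g" "Tgt C g = Src C h"
  shows "Cmp C (Cmp C h g) f = Cmp C h (Cmp C g f)"
proof -
  have "\<forall>f \<in> Ar C. \<forall>g \<in> Ar C. \<forall>h \<in> Ar C. Tgt C f = Src C g \<longrightarrow> Tgt C g = Src C h \<longrightarrow>
        Cmp C h (Cmp C g f) = Cmp C (Cmp C h g) f"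
    using assms(1) by (simp add: category_def)
  then show ?thesis using assms by metis
qed

lemmas cat_simps = Src_Ob Tgt_Ob Idt_Ar Src_Idt Tgt_Idt Cmp_Idt Idt_Cmp Cmp_Ar Src_Cmp Tgt_Cmp Cmp_assoc

lemma Cmp_Hom: "category C \<Longrightarrow> f \<in> Hom C A B \<Longrightarrow> g \<in> Hom C B D \<Longrightarrow> Cmp C g f \<in> Hom C A D"
  by (simp add: Hom_iff cat_simps)

lemma Idt_Hom: "category C \<Longrightarrow> A \<in> Ob C \<Longrightarrow> Idt C A \<in> Hom C A A"
  by (simp add: Hom_iff cat_simps)

lemma Hom_Ob1: "category C \<Longrightarrow> f \<in> Hom C A B \<Longrightarrow> A \<in> Ob C"
  and Hom_Ob2: "category C \<Longrightarrow> f \<in> Hom C A B \<Longrightarrow> B \<in> Ob C"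
  by (auto simp add: Hom_iff cat_simps)

lemma Hom_assoc:
  "category C \<Longrightarrow> f \<in> Hom C A B \<Longrightarrow> g \<in> Hom C B D \<Longrightarrow> h \<in> Hom C D E \<Longrightarrow>
    Cmp C (Cmp C h g) f = Cmp C h (Cmp C g f)"
  by (simp add: Hom_iff cat_simps)

lemma Hom_Idt_right: "category C \<Longrightarrow> f \<in> Hom C A B \<Longrightarrow> Cmp C f (Idt C A) = f"
  and Hom_Idt_left: "category C \<Longrightarrow> f \<in> Hom C A B \<Longrightarrow> Cmp C (Idt C B) f = f"
  by (simp_all add: Hom_iff cat_simps)

lemma mono_cancel:
  assumes "category C" "\<forall>f\<in>Ar C. mono_arrow C f" "g \<in> Hom C A B" "h \<in> Hom C A B" "f \<in> Hom C B D"
    "Cmp C f g = Cmp C f h"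
  shows "g = h"
proof -
  have f: "f \<in> Ar C" "Src C f = B" using assms(5) by (simp_all add: Hom_iff)
  then have "mono_arrow C f" using assms(2) by blast
  then show ?thesis using assms(3,4,6) f(2) Hom_Ob1[OF assms(1,3)] by (simp add: mono_arrow_def)
qed

lemma FO_Ob: "is_functor C D F \<Longrightarrow> A \<in> Ob C \<Longrightarrow> FO F A \<in> Ob D"
  by (simp add: is_functor_def)

lemma FA_Hom: "is_functor C D F \<Longrightarrow> f \<in> Hom C A B \<Longrightarrow> FA F f \<in> Hom D (FO F A) (FO F B)"
  by (auto simp: is_functor_def Hom_iff)

lemma FA_Idt: "is_functor C D F \<Longrightarrow> A \<in> Ob C \<Longrightarrow> FA F (Idt C A) = Idt D (FO F A)"
  by (simp add: is_functor_def)

lemma FA_Cmp: "is_functor C D F \<Longrightarrow> f \<in> Hom C A B \<Longrightarrow> g \<in> Hom C B E \<Longrightarrow>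
    FA F (Cmp C g f) = Cmp D (FA F g) (FA F f)"
  by (auto simp: is_functor_def Hom_iff)

lemma comp_fctr_simps[simp]:
  "FO (comp_fctr G F) A = FO G (FO F A)" "FA (comp_fctr G F) f = FA G (FA F f)"
  by (simp_all add: comp_fctr_def)

lemma id_fctr_simps[simp]: "FO id_fctr A = A" "FA id_fctr f = f"
  by (simp_all add: id_fctr_def)

lemma comp_functor: "is_functor C D F \<Longrightarrow> is_functor D E G \<Longrightarrow> is_functor C E (comp_fctr G F)"
  unfolding is_functor_def Hom_iff by simp

section \<open>Inverse pairs and weak equivalences\<close>

definition inverse_arrows :: "('o, 'm) cat \<Rightarrow> 'o \<Rightarrow> 'o \<Rightarrow> 'm \<Rightarrow> 'm \<Rightarrow> bool" where
  "inverse_arrows C A B u v \<longleftrightarrow> u \<in> Hom C A B \<and> v \<in> Hom C B A \<and> Cmp C v u = Idt C A \<and> Cmp C u v = Idt C B"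

lemma iso_arrow_inverse:
  "iso_arrow C u \<and> u \<in> Hom C A B \<longleftrightarrow> (\<exists>v. inverse_arrows C A B u v)"
  by (auto simp: iso_arrow_def inverse_arrows_def Hom_iff)

lemma inverse_arrows_sym: "inverse_arrows C A B u v \<Longrightarrow> inverse_arrows C B A v u"
  by (auto simp: inverse_arrows_def)

lemma inverse_arrows_Idt: "category C \<Longrightarrow> A \<in> Ob C \<Longrightarrow> inverse_arrows C A A (Idt C A) (Idt C A)"
  by (simp add: inverse_arrows_def Idt_Hom Hom_iff cat_simps)

lemma inverse_arrows_cancel:
  assumes "category C" "inverse_arrows C A B u v"
  shows "f \<in> Hom C D A \<Longrightarrow> Cmp C v (Cmp C u f) = f"
    and "g \<in> Hom C A D \<Longrightarrow> Cmp C (Cmp C g v) u = g"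
proof -
  have uv: "u \<in> Hom C A B" "v \<in> Hom C B A" "Cmp C v u = Idt C A"
    using assms(2) by (auto simp: inverse_arrows_def)
  show "f \<in> Hom C D A \<Longrightarrow> Cmp C v (Cmp C u f) = f"
    using Hom_assoc[OF assms(1) _ uv(1,2), of f D] Hom_Idt_left[OF assms(1)] uv(3) by metis
  show "g \<in> Hom C A D \<Longrightarrow> Cmp C (Cmp C g v) u = g"
    using Hom_assoc[OF assms(1) uv(1,2), of g D] Hom_Idt_right[OF assms(1)] uv(3) by metis
qed

lemma inverse_arrows_trans:
  assumes C: "category C" and "inverse_arrows C A B u v" "inverse_arrows C B D u' v'"
  shows "inverse_arrows C A D (Cmp C u' u) (Cmp C v v')"
proof -
  have h: "u \<in> Hom C A B" "v \<in> Hom C B A" "u' \<in> Hom C B D" "v' \<in> Hom C D B"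
    using assms by (auto simp: inverse_arrows_def)
  have "Cmp C (Cmp C v v') (Cmp C u' u) = Cmp C v (Cmp C v' (Cmp C u' u))"
    using Hom_assoc[OF C Cmp_Hom[OF C h(1,3)] h(4,2)] .
  also have "\<dots> = Idt C A" using inverse_arrows_cancel(1)[OF C assms(3) h(1)] assms(2)
    by (simp add: inverse_arrows_def)
  finally have 1: "Cmp C (Cmp C v v') (Cmp C u' u) = Idt C A" .
  have "Cmp C (Cmp C u' u) (Cmp C v v') = Cmp C u' (Cmp C u (Cmp C v v'))"
    using Hom_assoc[OF C Cmp_Hom[OF C h(4,2)] h(1,3)] .
  also have "\<dots> = Idt C D"
    using inverse_arrows_cancel(1)[OF C inverse_arrows_sym[OF assms(2)] h(4)] assms(3)
    by (simp add: inverse_arrows_def)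
  finally show ?thesis using 1 h Cmp_Hom[OF C] by (auto simp: inverse_arrows_def)
qed

lemma functor_inverse_arrows:
  "is_functor C D F \<Longrightarrow> category C \<Longrightarrow> inverse_arrows C A B u v \<Longrightarrow> inverse_arrows D (FO F A) (FO F B) (FA F u) (FA F v)"
  unfolding inverse_arrows_def
  by (metis FA_Cmp FA_Hom FA_Idt Hom_Ob1)

text \<open>Full, faithful and essentially surjective. A single functor is easier to build, compose
  and transport along than the two functors and two natural isomorphisms of
  \<open>equivalent\<close>.\<close>

definition weak_equivalence :: "('o, 'm) cat \<Rightarrow> ('p, 'n) cat \<Rightarrow> ('o, 'm, 'p, 'n) fctr \<Rightarrow> bool" where
  "weak_equivalence C D F \<longleftrightarrow> is_functor C D F \<and>
     (\<forall>A\<in>Ob C. \<forall>B\<in>Ob C. \<forall>g\<in>Hom D (FO F A) (FO F B). \<exists>f\<in>Hom C A B. FA F f = g) \<and>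
     (\<forall>A B. \<forall>f\<in>Hom C A B. \<forall>g\<in>Hom C A B. FA F f = FA F g \<longrightarrow> f = g) \<and>
     (\<forall>Y\<in>Ob D. \<exists>X\<in>Ob C. \<exists>u v. inverse_arrows D Y (FO F X) u v)"

lemma
  assumes "weak_equivalence C D F"
  shows weq_functor: "is_functor C D F"
    and weq_full: "A \<in> Ob C \<Longrightarrow> B \<in> Ob C \<Longrightarrow> k \<in> Hom D (FO F A) (FO F B) \<Longrightarrow> \<exists>f\<in>Hom C A B. FA F f = k"
    and weq_faithful: "f \<in> Hom C A B \<Longrightarrow> g \<in> Hom C A B \<Longrightarrow> FA F f = FA F g \<Longrightarrow> f = g"
    and weq_surj: "Y \<in> Ob D \<Longrightarrow> \<exists>X\<in>Ob C. \<exists>u v. inverse_arrows D Y (FO F X) u v"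
  using assms by (auto simp: weak_equivalence_def)

text \<open>Both composites become identities under \<open>F\<close>, and \<open>F\<close> is
  faithful.\<close>

lemma weq_reflects_inverse:
  assumes F: "weak_equivalence C D F" and C: "category C"
    and h: "u \<in> Hom C A B" "v \<in> Hom C B A" "inverse_arrows D (FO F A) (FO F B) (FA F u) (FA F v)"
  shows "inverse_arrows C A B u v"
proof -
  note f = weq_functor[OF F]
  have "FA F (Cmp C v u) = FA F (Idt C A)" "FA F (Cmp C u v) = FA F (Idt C B)"
    using h(3) FA_Cmp[OF f h(1,2)] FA_Cmp[OF f h(2,1)]
      FA_Idt[OF f Hom_Ob1[OF C h(1)]] FA_Idt[OF f Hom_Ob1[OF C h(2)]]
    by (simp_all add: inverse_arrows_def)
  then show ?thesis
    using weq_faithful[OF F Cmp_Hom[OF C h(1,2)] Idt_Hom[OF C Hom_Ob1[OF C h(1)]]]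
      weq_faithful[OF F Cmp_Hom[OF C h(2,1)] Idt_Hom[OF C Hom_Ob1[OF C h(2)]]] h(1,2)
    by (simp add: inverse_arrows_def)
qed

lemma weak_equivalence_comp:
  assumes F: "weak_equivalence C D F" and G: "weak_equivalence D E G"
    and C: "category C" and D: "category D" and E: "category E"
  shows "weak_equivalence C E (comp_fctr G F)"
proof -
  note f = weq_functor[OF F] and g = weq_functor[OF G]
  have "\<exists>k\<in>Hom C A B. FA G (FA F k) = h"
    if "A \<in> Ob C" "B \<in> Ob C" "h \<in> Hom E (FO G (FO F A)) (FO G (FO F B))" for A B h
    using weq_full[OF G _ _ that(3)] weq_full[OF F that(1,2)] FO_Ob[OF f] that(1,2) by metis
  moreover have "k = h" if "k \<in> Hom C A B" "h \<in> Hom C A B" "FA G (FA F k) = FA G (FA F h)" for A B k h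
    using weq_faithful[OF F that(1,2)] weq_faithful[OF G FA_Hom[OF f that(1)] FA_Hom[OF f that(2)]] that(3)
    by blast
  moreover have "\<exists>X\<in>Ob C. \<exists>u v. inverse_arrows E Y (FO G (FO F X)) u v" if Y: "Y \<in> Ob E" for Y
  proof -
    obtain Z u v where Z: "Z \<in> Ob D" "inverse_arrows E Y (FO G Z) u v" using weq_surj[OF G Y] by blast
    obtain X u' v' where X: "X \<in> Ob C" "inverse_arrows D Z (FO F X) u' v'" using weq_surj[OF F Z(1)] by blast
    show ?thesis
      using X(1) inverse_arrows_trans[OF E Z(2) functor_inverse_arrows[OF g D X(2)]] by blast
  qed
  ultimately show ?thesis
    using comp_functor[OF f g] by (simp add: weak_equivalence_def)
qed

text \<open>Naturality of the unit and of the counit makes \<open>F\<close> and \<open>G\<close>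
  faithful. Fullness of \<open>F\<close> then follows by comparing arrows after
  \<open>G\<close>.\<close>

lemma equivalent_imp_weak_equivalence:
  assumes eq: "equivalent C D" and C: "category C" and D: "category D"
  shows "\<exists>F. weak_equivalence C D F"
proof -
  obtain F G \<eta> \<epsilon> where F: "is_functor C D F" and G: "is_functor D C G"
    and n: "natural_iso C C id_fctr (comp_fctr G F) \<eta>"
    and e: "natural_iso D D (comp_fctr F G) id_fctr \<epsilon>"
    using eq unfolding equivalent_def by blast
  have "\<exists>v. inverse_arrows C A (FO G (FO F A)) (\<eta> A) v" if "A \<in> Ob C" for A
    using n that by (simp add: natural_iso_def flip: iso_arrow_inverse)
  then obtain \<eta>' where \<eta>: "inverse_arrows C A (FO G (FO F A)) (\<eta> A) (\<eta>' A)" if "A \<in> Ob C" for A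
    by metis
  have "\<exists>v. inverse_arrows D (FO F (FO G A)) A (\<epsilon> A) v" if "A \<in> Ob D" for A
    using e that by (simp add: natural_iso_def flip: iso_arrow_inverse)
  then obtain \<epsilon>' where \<epsilon>: "inverse_arrows D (FO F (FO G A)) A (\<epsilon> A) (\<epsilon>' A)" if "A \<in> Ob D" for A
    by metis
  have nat\<eta>: "Cmp C (\<eta> B) f = Cmp C (FA G (FA F f)) (\<eta> A)" if "f \<in> Hom C A B" for f A B
    using n that by (auto simp: natural_iso_def Hom_iff)
  have nat\<epsilon>: "Cmp D (\<epsilon> B) (FA F (FA G f)) = Cmp D f (\<epsilon> A)" if "f \<in> Hom D A B" for f A B
    using e that by (auto simp: natural_iso_def Hom_iff)
  have faithF: "f = g" if f: "f \<in> Hom C A B" "g \<in> Hom C A B" "FA F f = FA F g" for f g A B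
  proof -
    have "Cmp C (\<eta> B) f = Cmp C (\<eta> B) g" using nat\<eta>[OF f(1)] nat\<eta>[OF f(2)] f(3) by simp
    then show ?thesis using inverse_arrows_cancel(1)[OF C \<eta>[OF Hom_Ob2[OF C f(1)]]] f by metis
  qed
  have faithG: "f = g" if f: "f \<in> Hom D A B" "g \<in> Hom D A B" "FA G f = FA G g" for f g A B
  proof -
    have "Cmp D f (\<epsilon> A) = Cmp D g (\<epsilon> A)" using nat\<epsilon>[OF f(1)] nat\<epsilon>[OF f(2)] f(3) by simp
    then show ?thesis
      using inverse_arrows_cancel(2)[OF D inverse_arrows_sym[OF \<epsilon>[OF Hom_Ob1[OF D f(1)]]]] f by metis
  qed
  have full: "\<exists>f\<in>Hom C A B. FA F f = g" if A: "A \<in> Ob C" "B \<in> Ob C" and g: "g \<in> Hom D (FO F A) (FO F B)"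
    for A B g
  proof -
    have hs: "\<eta> A \<in> Hom C A (FO G (FO F A))" "\<eta>' B \<in> Hom C (FO G (FO F B)) B"
      using \<eta>[OF A(1)] \<eta>[OF A(2)] by (auto simp: inverse_arrows_def)
    have Gg: "FA G g \<in> Hom C (FO G (FO F A)) (FO G (FO F B))" using FA_Hom[OF G g] .
    \<comment> \<open>Naturality of the unit at \<open>f\<close> forces this preimage of
      \<open>g\<close>.\<close>
    define f where "f = Cmp C (\<eta>' B) (Cmp C (FA G g) (\<eta> A))"
    have f: "f \<in> Hom C A B" unfolding f_def using hs Gg Cmp_Hom[OF C] by blast
    have "Cmp C (\<eta> B) f = Cmp C (FA G g) (\<eta> A)" unfolding f_def
      using inverse_arrows_cancel(1)[OF C inverse_arrows_sym[OF \<eta>[OF A(2)]] Cmp_Hom[OF C hs(1) Gg]] .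
    then have "Cmp C (FA G (FA F f)) (\<eta> A) = Cmp C (FA G g) (\<eta> A)" using nat\<eta>[OF f] by simp
    then have "FA G (FA F f) = FA G g"
      using inverse_arrows_cancel(2)[OF C inverse_arrows_sym[OF \<eta>[OF A(1)]]] Gg
        FA_Hom[OF G FA_Hom[OF F f]] by metis
    then show ?thesis using faithG[OF FA_Hom[OF F f] g] f by blast
  qed
  have "\<exists>X\<in>Ob C. \<exists>u v. inverse_arrows D Y (FO F X) u v" if Y: "Y \<in> Ob D" for Y
    using FO_Ob[OF G Y] inverse_arrows_sym[OF \<epsilon>[OF Y]] by blast
  then show ?thesis unfolding weak_equivalence_def using F full faithF by blast
qed

text \<open>A quasi-inverse is chosen: \<open>g Y\<close> is an object with \<open>F (g Y)\<close>
  isomorphic to \<open>Y\<close>, and an arrow is sent to the preimage under \<open>F\<close> of its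
  conjugate by the chosen isomorphisms. The functor laws and the naturality of the unit hold because
  they hold after \<open>F\<close>; the counit consists of the chosen isomorphisms
  themselves.\<close>

lemma weak_equivalence_imp_equivalent:
  assumes F: "weak_equivalence C D F" and C: "category C" and D: "category D"
  shows "equivalent C D"
proof -
  note f = weq_functor[OF F]
  obtain g u v where gu: "\<And>Y. Y \<in> Ob D \<Longrightarrow> g Y \<in> Ob C"
    "\<And>Y. Y \<in> Ob D \<Longrightarrow> inverse_arrows D Y (FO F (g Y)) (u Y) (v Y)"
    using weq_surj[OF F] by metis
  have u: "u Y \<in> Hom D Y (FO F (g Y))" and v: "v Y \<in> Hom D (FO F (g Y)) Y" if "Y \<in> Ob D" for Y
    using gu(2)[OF that] by (auto simp: inverse_arrows_def)
  have conj: "Cmp D (Cmp D (u (Tgt D k)) k) (v (Src D k)) \<in> Hom D (FO F (g (Src D k))) (FO F (g (Tgt D k)))"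
    if "k \<in> Ar D" for k
    using that u[OF Tgt_Ob[OF D]] v[OF Src_Ob[OF D]] D by (simp add: Hom_iff cat_simps)
  have "\<exists>h\<in>Hom C (g (Src D k)) (g (Tgt D k)). FA F h = Cmp D (Cmp D (u (Tgt D k)) k) (v (Src D k))"
    if "k \<in> Ar D" for k
    using weq_full[OF F gu(1)[OF Src_Ob[OF D that]] gu(1)[OF Tgt_Ob[OF D that]] conj[OF that]] .
  then obtain ga where ga: "\<And>k. k \<in> Ar D \<Longrightarrow> ga k \<in> Hom C (g (Src D k)) (g (Tgt D k))"
    "\<And>k. k \<in> Ar D \<Longrightarrow> FA F (ga k) = Cmp D (Cmp D (u (Tgt D k)) k) (v (Src D k))" by metis
  define G where "G = \<lparr>FO = g, FA = ga\<rparr>"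
  have G: "is_functor D C G" unfolding is_functor_def
  proof (intro conjI ballI impI)
    fix A assume A: "A \<in> Ob D"
    show "FO G A \<in> Ob C" using gu(1)[OF A] by (simp add: G_def)
    have "FA F (ga (Idt D A)) = FA F (Idt C (g A))"
      using ga(2)[OF Idt_Ar[OF D A]] gu(2)[OF A] u[OF A] FA_Idt[OF f gu(1)[OF A]] A D
      by (simp add: cat_simps inverse_arrows_def Hom_iff)
    then show "FA G (Idt D A) = Idt C (FO G A)"
      using weq_faithful[OF F _ Idt_Hom[OF C gu(1)[OF A]]] ga(1)[OF Idt_Ar[OF D A]] A D
      by (simp add: G_def cat_simps)
  next
    fix k assume k: "k \<in> Ar D"
    show "FA G k \<in> Hom C (FO G (Src D k)) (FO G (Tgt D k))" using ga(1)[OF k] by (simp add: G_def)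
  next
    fix k l assume k: "k \<in> Ar D" and l: "l \<in> Ar D" and kl: "Tgt D k = Src D l"
    have o: "Src D k \<in> Ob D" "Src D l \<in> Ob D" "Tgt D l \<in> Ob D" using k l D by (simp_all add: cat_simps)
    note H = u[OF o(2)] v[OF o(2)] u[OF o(3)] v[OF o(1)]
    have lk: "Cmp D l k \<in> Ar D" "Src D (Cmp D l k) = Src D k" "Tgt D (Cmp D l k) = Tgt D l"
      using k l kl D by (simp_all add: cat_simps)
    have gg: "Cmp C (ga l) (ga k) \<in> Hom C (g (Src D k)) (g (Tgt D l))"
      using ga(1)[OF k] ga(1)[OF l] kl Cmp_Hom[OF C] by metis
    \<comment> \<open>The inverse pair in the middle of two composed conjugates cancels.\<close>
    have can: "Cmp D (v (Src D l)) (Cmp D (u (Src D l)) (Cmp D k (v (Src D k)))) = Cmp D k (v (Src D k))"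
      by (rule inverse_arrows_cancel(1)[OF D gu(2)[OF o(2)]]) (use H k kl D in \<open>auto simp: Hom_iff cat_simps\<close>)
    have "FA F (Cmp C (ga l) (ga k)) = Cmp D (FA F (ga l)) (FA F (ga k))"
      using FA_Cmp[OF f ga(1)[OF k]] ga(1)[OF l] kl by metis
    also have "\<dots> = Cmp D (Cmp D (u (Tgt D l)) l) (Cmp D (v (Src D l)) (Cmp D (u (Src D l)) (Cmp D k (v (Src D k)))))"
      using H k l kl D by (simp add: ga(2)[OF k] ga(2)[OF l] Hom_iff cat_simps)
    also have "\<dots> = FA F (ga (Cmp D l k))" unfolding can
      using H k l kl D by (simp add: ga(2)[OF lk(1)] lk Hom_iff cat_simps)
    finally show "FA G (Cmp D l k) = Cmp C (FA G l) (FA G k)"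
      using weq_faithful[OF F gg, of "ga (Cmp D l k)"] ga(1)[OF lk(1)] lk by (simp add: G_def)
  qed
  have "\<exists>h\<in>Hom C A (g (FO F A)). FA F h = u (FO F A)" if "A \<in> Ob C" for A
    using weq_full[OF F that gu(1)[OF FO_Ob[OF f that]] u[OF FO_Ob[OF f that]]] .
  then obtain \<eta> where \<eta>: "\<And>A. A \<in> Ob C \<Longrightarrow> \<eta> A \<in> Hom C A (g (FO F A))"
    "\<And>A. A \<in> Ob C \<Longrightarrow> FA F (\<eta> A) = u (FO F A)" by metis
  have iso: "iso_arrow C (\<eta> A)" if A: "A \<in> Ob C" for A
  proof -
    have A': "FO F A \<in> Ob D" using FO_Ob[OF f A] .
    obtain h where "h \<in> Hom C (g (FO F A)) A" "FA F h = v (FO F A)"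
      using weq_full[OF F gu(1)[OF A'] A v[OF A']] by blast
    then have "inverse_arrows C A (g (FO F A)) (\<eta> A) h"
      using weq_reflects_inverse[OF F C \<eta>(1)[OF A]] gu(2)[OF A'] \<eta>(2)[OF A] by simp
    then show ?thesis using iso_arrow_inverse by metis
  qed
  have nat1: "natural_iso C C id_fctr (comp_fctr G F) \<eta>"
    unfolding natural_iso_def
  proof (intro conjI ballI)
    fix A assume A: "A \<in> Ob C"
    show "\<eta> A \<in> Hom C (FO id_fctr A) (FO (comp_fctr G F) A)" using \<eta>(1)[OF A] by (simp add: G_def)
    show "iso_arrow C (\<eta> A)" by (rule iso[OF A])
  next
    fix k assume k: "k \<in> Ar C"
    have o: "Src C k \<in> Ob C" "Tgt C k \<in> Ob C" using k C by (simp_all add: cat_simps)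
    have kH: "k \<in> Hom C (Src C k) (Tgt C k)" using k by (simp add: Hom_iff)
    have Fk: "FA F k \<in> Ar D" "Src D (FA F k) = FO F (Src C k)" "Tgt D (FA F k) = FO F (Tgt C k)"
      using FA_Hom[OF f kH] by (auto simp: Hom_iff)
    have 1: "Cmp C (\<eta> (Tgt C k)) k \<in> Hom C (Src C k) (g (FO F (Tgt C k)))"
      using Cmp_Hom[OF C kH \<eta>(1)[OF o(2)]] .
    have gk: "ga (FA F k) \<in> Hom C (g (FO F (Src C k))) (g (FO F (Tgt C k)))"
      using ga(1)[OF Fk(1)] Fk by simp
    have 2: "Cmp C (ga (FA F k)) (\<eta> (Src C k)) \<in> Hom C (Src C k) (g (FO F (Tgt C k)))"
      using Cmp_Hom[OF C \<eta>(1)[OF o(1)] gk] .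
    have "FA F (Cmp C (ga (FA F k)) (\<eta> (Src C k))) = Cmp D (FA F (ga (FA F k))) (u (FO F (Src C k)))"
      using FA_Cmp[OF f \<eta>(1)[OF o(1)] gk] \<eta>(2)[OF o(1)] by simp
    also have "\<dots> = Cmp D (u (FO F (Tgt C k))) (FA F k)"
      using inverse_arrows_cancel(2)[OF D gu(2)[OF FO_Ob[OF f o(1)]],
          of "Cmp D (u (FO F (Tgt C k))) (FA F k)" "FO F (g (FO F (Tgt C k)))"]
        Cmp_Hom[OF D FA_Hom[OF f kH] u[OF FO_Ob[OF f o(2)]]]
      by (simp add: ga(2)[OF Fk(1)] Fk)
    also have "\<dots> = FA F (Cmp C (\<eta> (Tgt C k)) k)"
      using FA_Cmp[OF f kH \<eta>(1)[OF o(2)]] \<eta>(2)[OF o(2)] by simp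
    finally show "Cmp C (\<eta> (Tgt C k)) (FA id_fctr k) = Cmp C (FA (comp_fctr G F) k) (\<eta> (Src C k))"
      using weq_faithful[OF F 1 2] by (simp add: G_def)
  qed
  have nat2: "natural_iso D D (comp_fctr F G) id_fctr v"
    unfolding natural_iso_def
  proof (intro conjI ballI)
    fix A assume A: "A \<in> Ob D"
    show "v A \<in> Hom D (FO (comp_fctr F G) A) (FO id_fctr A)" using v[OF A] by (simp add: G_def)
    show "iso_arrow D (v A)" using inverse_arrows_sym[OF gu(2)[OF A]] iso_arrow_inverse by metis
  next
    fix k assume k: "k \<in> Ar D"
    have o: "Src D k \<in> Ob D" "Tgt D k \<in> Ob D" using k D by (simp_all add: cat_simps)
    have "Cmp D (v (Tgt D k)) (FA F (ga k)) = Cmp D (v (Tgt D k)) (Cmp D (u (Tgt D k)) (Cmp D k (v (Src D k))))"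
      using u[OF o(2)] v[OF o(1)] k D by (simp add: ga(2)[OF k] Hom_iff cat_simps)
    also have "\<dots> = Cmp D k (v (Src D k))"
      by (rule inverse_arrows_cancel(1)[OF D gu(2)[OF o(2)]]) (use v[OF o(1)] k D in \<open>auto simp: Hom_iff cat_simps\<close>)
    finally show "Cmp D (v (Tgt D k)) (FA (comp_fctr F G) k) = Cmp D (FA id_fctr k) (v (Src D k))"
      by (simp add: G_def)
  qed
  show ?thesis unfolding equivalent_def using f G nat1 nat2 by blast
qed

section \<open>Cocones\<close>

text \<open>The objects of \<open>cocone_cat\<close>, and below its arrows, without the tuples that
  carry source and target.\<close>

definition cocone :: "('o, 'm) cat \<Rightarrow> ('i, 'k) cat \<Rightarrow> ('i, 'k, 'o, 'm) fctr \<Rightarrow> 'o \<Rightarrow> ('i \<Rightarrow> 'm) \<Rightarrow> bool" where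
  "cocone C J D X c \<longleftrightarrow> X \<in> Ob C \<and> c \<in> (\<Pi>\<^sub>E j\<in>Ob J. Hom C (FO D j) X) \<and>
     (\<forall>u\<in>Ar J. Cmp C (c (Tgt J u)) (FA D u) = c (Src J u))"

definition cocone_map ::
  "('o, 'm) cat \<Rightarrow> ('i, 'k) cat \<Rightarrow> 'o \<Rightarrow> ('i \<Rightarrow> 'm) \<Rightarrow> 'o \<Rightarrow> ('i \<Rightarrow> 'm) \<Rightarrow> 'm \<Rightarrow> bool" where
  "cocone_map C J X c Y d h \<longleftrightarrow> h \<in> Hom C X Y \<and> (\<forall>j\<in>Ob J. Cmp C h (c j) = d j)"

lemma cocone_cat_Ob: "(X, c) \<in> Ob (cocone_cat C J D) \<longleftrightarrow> cocone C J D X c"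
  by (simp add: cocone_cat_def cocone_def Let_def)

lemma cocone_cat_Hom:
  "f \<in> Hom (cocone_cat C J D) (X, c) (Y, d) \<longleftrightarrow>
     (\<exists>h. f = ((X, c), h, (Y, d)) \<and> cocone C J D X c \<and> cocone C J D Y d \<and> cocone_map C J X c Y d h)"
  unfolding Hom_iff by (auto simp: cocone_cat_def cocone_def Let_def cocone_map_def)

lemma ball_cocone_cat:
  "(\<forall>M\<in>Ob (cocone_cat C J D). Q M) \<longleftrightarrow> (\<forall>Y d. cocone C J D Y d \<longrightarrow> Q (Y, d))"
  unfolding Ball_def split_paired_All cocone_cat_Ob by (rule refl)

lemma is_colimit_iff:
  "is_colimit C J D X c \<longleftrightarrow> cocone C J D X c \<and>
     (\<forall>Y d. cocone C J D Y d \<longrightarrow> (\<exists>!h. cocone_map C J X c Y d h))"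
proof -
  have "(\<exists>!f. f \<in> Hom (cocone_cat C J D) (X, c) (Y, d)) \<longleftrightarrow> (\<exists>!h. cocone_map C J X c Y d h)"
    if "cocone C J D X c" "cocone C J D Y d" for Y d
    using that unfolding cocone_cat_Hom by blast
  then show ?thesis
    unfolding is_colimit_def initial_def ball_cocone_cat cocone_cat_Ob by (simp cong: conj_cong imp_cong)
qed

lemma cocone_arrow: "cocone C J D X c \<Longrightarrow> j \<in> Ob J \<Longrightarrow> c j \<in> Hom C (FO D j) X"
  by (auto simp: cocone_def)

lemma cocone_Ob: "cocone C J D X c \<Longrightarrow> X \<in> Ob C"
  by (simp add: cocone_def)

lemma cocone_commute: "cocone C J D X c \<Longrightarrow> u \<in> Ar J \<Longrightarrow> Cmp C (c (Tgt J u)) (FA D u) = c (Src J u)"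
  by (simp add: cocone_def)

lemma cocone_map_comp:
  assumes "category C" "cocone C J D X c" "cocone_map C J X c Y d h" "cocone_map C J Y d Z e k"
  shows "cocone_map C J X c Z e (Cmp C k h)"
  unfolding cocone_map_def
proof (intro conjI ballI)
  have hk: "h \<in> Hom C X Y" "k \<in> Hom C Y Z" using assms by (auto simp: cocone_map_def)
  show "Cmp C k h \<in> Hom C X Z" using Cmp_Hom[OF assms(1) hk] .
  show "Cmp C (Cmp C k h) (c j) = e j" if j: "j \<in> Ob J" for j
    using Hom_assoc[OF assms(1) cocone_arrow[OF assms(2) j] hk] assms(3,4) j
    by (simp add: cocone_map_def)
qed

lemma cocone_map_Idt: "category C \<Longrightarrow> cocone C J D X c \<Longrightarrow> cocone_map C J X c X c (Idt C X)"
  unfolding cocone_map_def by (simp add: Idt_Hom cocone_Ob Hom_Idt_left[OF _ cocone_arrow])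

lemma cocone_map_unique:
  "is_colimit C J D X c \<Longrightarrow> cocone C J D Y d \<Longrightarrow> cocone_map C J X c Y d h \<Longrightarrow> cocone_map C J X c Y d k \<Longrightarrow> h = k"
  unfolding is_colimit_iff by blast

lemma cocone_map_exists:
  "is_colimit C J D X c \<Longrightarrow> cocone C J D Y d \<Longrightarrow> \<exists>h. cocone_map C J X c Y d h"
  unfolding is_colimit_iff by blast

lemma cocone_comp:
  assumes C: "category C" and J: "category J" and D: "is_functor J C D"
    and c: "cocone C J D X c" and u: "u \<in> Hom C X Y"
  shows "cocone C J D Y (\<lambda>j\<in>Ob J. Cmp C u (c j))"
  unfolding cocone_def
proof (intro conjI ballI)
  show "Y \<in> Ob C" using Hom_Ob2[OF C u] .
  show "(\<lambda>j\<in>Ob J. Cmp C u (c j)) \<in> (\<Pi>\<^sub>E j\<in>Ob J. Hom C (FO D j) Y)"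
    using Cmp_Hom[OF C cocone_arrow[OF c] u] by auto
  fix k assume k: "k \<in> Ar J"
  have o: "Src J k \<in> Ob J" "Tgt J k \<in> Ob J" using Src_Ob[OF J k] Tgt_Ob[OF J k] .
  have Dk: "FA D k \<in> Hom C (FO D (Src J k)) (FO D (Tgt J k))" using FA_Hom[OF D] k by (auto simp: Hom_iff)
  show "Cmp C ((\<lambda>j\<in>Ob J. Cmp C u (c j)) (Tgt J k)) (FA D k) = (\<lambda>j\<in>Ob J. Cmp C u (c j)) (Src J k)"
    using o Hom_assoc[OF C Dk cocone_arrow[OF c o(2)] u] cocone_commute[OF c k] by simp
qed

section \<open>Multicolimits as families of cocones\<close>

lemma multicolimit_iff:
  "has_multicolimit U C J D \<longleftrightarrow> (\<exists>W. small U W \<and> (\<forall>(X, c)\<in>W. cocone C J D X c) \<and>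
     (\<forall>Y d. cocone C J D Y d \<longrightarrow>
       (\<exists>!w. w \<in> W \<and> (\<exists>h. cocone_map C J (fst w) (snd w) Y d h)) \<and>
       (\<forall>(X, c)\<in>W. \<forall>h k. cocone_map C J X c Y d h \<longrightarrow> cocone_map C J X c Y d k \<longrightarrow> h = k)))"
  (is "_ \<longleftrightarrow> (\<exists>W. ?P W)")
proof -
  have "multiinitial U (cocone_cat C J D) W \<longleftrightarrow> ?P W" for W
  proof (cases "\<forall>(X, c)\<in>W. cocone C J D X c")
    case True
    then have W: "cocone C J D (fst w) (snd w)" if "w \<in> W" for w using that by auto
    have sub: "W \<subseteq> Ob (cocone_cat C J D)" using True by (auto simp: cocone_cat_Ob)
    have Homs: "Hom (cocone_cat C J D) w (Y, d) = (\<lambda>h. (w, h, (Y, d))) ` {h. cocone_map C J (fst w) (snd w) Y d h}"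
      if "cocone C J D Y d" "w \<in> W" for w Y d
    proof -
      have "Hom (cocone_cat C J D) (fst w, snd w) (Y, d) =
          (\<lambda>h. ((fst w, snd w), h, (Y, d))) ` {h. cocone_map C J (fst w) (snd w) Y d h}"
        using W[OF that(2)] that(1) by (simp only: set_eq_iff cocone_cat_Hom image_iff) blast
      then show ?thesis by simp
    qed
    have ex: "(\<exists>f. f \<in> Hom (cocone_cat C J D) w (Y, d)) \<longleftrightarrow> (\<exists>h. cocone_map C J (fst w) (snd w) Y d h)"
      if "cocone C J D Y d" "w \<in> W" for w Y d
      unfolding Homs[OF that] by blast
    have uni: "(\<forall>f\<in>Hom (cocone_cat C J D) w (Y, d). \<forall>g\<in>Hom (cocone_cat C J D) w (Y, d). f = g) \<longleftrightarrow>
       (\<forall>h k. cocone_map C J (fst w) (snd w) Y d h \<longrightarrow> cocone_map C J (fst w) (snd w) Y d k \<longrightarrow> h = k)"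
      if "cocone C J D Y d" "w \<in> W" for w Y d
      unfolding Homs[OF that] by blast
    have 1: "(\<exists>!w. w \<in> W \<and> (\<exists>f. f \<in> Hom (cocone_cat C J D) w (Y, d))) \<longleftrightarrow>
        (\<exists>!w. w \<in> W \<and> (\<exists>h. cocone_map C J (fst w) (snd w) Y d h))" if "cocone C J D Y d" for Y d
      using ex[OF that] by metis
    have 2: "(\<forall>w\<in>W. \<forall>f\<in>Hom (cocone_cat C J D) w (Y, d). \<forall>g\<in>Hom (cocone_cat C J D) w (Y, d). f = g) \<longleftrightarrow>
      (\<forall>(X, c)\<in>W. \<forall>h k. cocone_map C J X c Y d h \<longrightarrow> cocone_map C J X c Y d k \<longrightarrow> h = k)"
      if "cocone C J D Y d" for Y d
      using uni[OF that] by (simp add: case_prod_beta)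
    show ?thesis unfolding multiinitial_def ball_cocone_cat using sub True 1 2
      by (simp cong: conj_cong imp_cong)
  next
    case False
    then show ?thesis by (auto simp: multiinitial_def cocone_cat_Ob)
  qed
  then show ?thesis unfolding has_multicolimit_def by (rule ex_cong1)
qed

text \<open>It suffices to have a small family from which every cocone is reached, uniquely from
  each member, and in which members reaching a common cocone reach each other. Having an arrow is
  then an equivalence relation on \<open>W\<close>: if \<open>w\<close> reaches \<open>w'\<close>,
  both reach \<open>w'\<close>, so by \<open>conn\<close> also \<open>w'\<close> reaches
  \<open>w\<close>. One representative of each class gives a multiinitial family.\<close>

lemma multicolimitI:
  assumes C: "category C" and small: "\<And>A B. small U A \<Longrightarrow> B \<subseteq> A \<Longrightarrow> small U (B :: ('o \<times> ('i \<Rightarrow> 'm)) set)"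
    and W: "small U W" "\<And>X c. (X, c) \<in> W \<Longrightarrow> cocone C J D X c"
    and ex: "\<And>Y d. cocone C J D Y d \<Longrightarrow> \<exists>(X, c)\<in>W. \<exists>h. cocone_map C J X c Y d h"
    and uni: "\<And>X c Y d h k. (X, c) \<in> W \<Longrightarrow> cocone C J D Y d \<Longrightarrow>
        cocone_map C J X c Y d h \<Longrightarrow> cocone_map C J X c Y d k \<Longrightarrow> h = k"
    and conn: "\<And>X c X' c' Y d h k. (X, c) \<in> W \<Longrightarrow> (X', c') \<in> W \<Longrightarrow> cocone C J D Y d \<Longrightarrow>
        cocone_map C J X c Y d h \<Longrightarrow> cocone_map C J X' c' Y d k \<Longrightarrow> \<exists>l. cocone_map C J X c X' c' l"
  shows "has_multicolimit U C J (D :: ('i, 'k, 'o, 'm) fctr)"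
proof -
  define to where "to w q \<longleftrightarrow> (\<exists>h. cocone_map C J (fst w) (snd w) (fst q) (snd q) h)" for w q
  have coc: "cocone C J D (fst w) (snd w)" if "w \<in> W" for w using W(2)[of "fst w" "snd w"] that by simp
  have to_trans: "to w q \<Longrightarrow> to q r \<Longrightarrow> to w r" if "w \<in> W" for w q r
    unfolding to_def using cocone_map_comp[OF C coc[OF that]] by blast
  have to_refl: "to w w" if "w \<in> W" for w
    unfolding to_def using cocone_map_Idt[OF C coc[OF that]] by blast
  have common: "to w w'" if "w \<in> W" "w' \<in> W" "to w (Y, d)" "to w' (Y, d)" "cocone C J D Y d" for w w' Y d
    using conn[of "fst w" "snd w" "fst w'" "snd w'" Y d] that unfolding to_def by auto
  have to_sym: "to w' w" if "w \<in> W" "w' \<in> W" "to w w'" for w w'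
    using common[OF that(2,1), of "fst w'" "snd w'"] to_refl[OF that(2)] that coc[OF that(2)] by simp
  define rep where "rep w = (SOME w'. w' \<in> W \<and> to w' w)" for w
  have rep: "rep w \<in> W \<and> to (rep w) w" if "w \<in> W" for w
    unfolding rep_def by (rule someI[of _ w]) (use that to_refl in blast)
  have rep_eq: "rep w = rep w'" if "w \<in> W" "w' \<in> W" "to w w'" for w w'
  proof -
    have "(x \<in> W \<and> to x w) = (x \<in> W \<and> to x w')" for x
      using to_trans that to_sym[OF that] by blast
    then show ?thesis unfolding rep_def by simp
  qed
  define R where "R = rep ` W"
  have RW: "R \<subseteq> W" unfolding R_def using rep by blast
  have "small U R" using small[OF W(1) RW] .
  moreover have "\<forall>(X, c)\<in>R. cocone C J D X c" using RW W(2) by blast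
  moreover have "\<exists>!w. w \<in> R \<and> (\<exists>h. cocone_map C J (fst w) (snd w) Y d h)" if Y: "cocone C J D Y d" for Y d
  proof -
    obtain X c where Xc: "(X, c) \<in> W" "to (X, c) (Y, d)" using ex[OF Y] unfolding to_def by auto
    have "rep (X, c) \<in> R" "to (rep (X, c)) (Y, d)"
      using Xc rep[OF Xc(1)] to_trans[of "rep (X, c)"] unfolding R_def by blast+
    moreover have "w = rep (X, c)" if w: "w \<in> R" "to w (Y, d)" for w
    proof -
      obtain w0 where w0: "w0 \<in> W" "w = rep w0" using w unfolding R_def by blast
      have wW: "w \<in> W" using w RW by blast
      have "to w w0" using rep[OF w0(1)] w0 by simp
      then have "to w0 w" using to_sym[OF wW w0(1)] by blast
      then have "to w0 (Y, d)" using to_trans[OF w0(1)] w(2) by blast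
      then have "to w0 (X, c)" using common[OF w0(1) Xc(1) _ Xc(2) Y] by blast
      then show ?thesis using rep_eq[OF w0(1) Xc(1)] w0 by simp
    qed
    ultimately show ?thesis unfolding to_def fst_conv snd_conv by blast
  qed
  moreover have "\<forall>(X, c)\<in>R. \<forall>h k. cocone_map C J X c Y d h \<longrightarrow> cocone_map C J X c Y d k \<longrightarrow> h = k"
    if "cocone C J D Y d" for Y d
    using uni[OF subsetD[OF RW] that] by blast
  ultimately show ?thesis unfolding multicolimit_iff by (intro exI[of _ R]) simp
qed

section \<open>Transfer along weak equivalences\<close>

lemma functor_cocone:
  assumes f: "is_functor C D F" and J: "category J" and E: "is_functor J C E"
    and c: "cocone C J E X c"
  shows "cocone D J (comp_fctr F E) (FO F X) (\<lambda>j\<in>Ob J. FA F (c j))"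
  unfolding cocone_def
proof (intro conjI ballI)
  show "FO F X \<in> Ob D" using FO_Ob[OF f cocone_Ob[OF c]] .
  show "(\<lambda>j\<in>Ob J. FA F (c j)) \<in> (\<Pi>\<^sub>E j\<in>Ob J. Hom D (FO (comp_fctr F E) j) (FO F X))"
    using FA_Hom[OF f cocone_arrow[OF c]] by auto
  fix k assume k: "k \<in> Ar J"
  have o: "Src J k \<in> Ob J" "Tgt J k \<in> Ob J" using Src_Ob[OF J k] Tgt_Ob[OF J k] .
  have Ek: "FA E k \<in> Hom C (FO E (Src J k)) (FO E (Tgt J k))" using FA_Hom[OF E] k by (auto simp: Hom_iff)
  show "Cmp D ((\<lambda>j\<in>Ob J. FA F (c j)) (Tgt J k)) (FA (comp_fctr F E) k) = (\<lambda>j\<in>Ob J. FA F (c j)) (Src J k)"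
    using o FA_Cmp[OF f Ek cocone_arrow[OF c o(2)]] cocone_commute[OF c k] by simp
qed

lemmas weq_cocone = functor_cocone[OF weq_functor]

lemma weq_cocone_map:
  assumes F: "weak_equivalence C D F" and C: "category C" and c: "cocone C J E X c" and d: "cocone C J E Y d"
    and h: "h \<in> Hom C X Y"
  shows "cocone_map D J (FO F X) (\<lambda>j\<in>Ob J. FA F (c j)) (FO F Y) (\<lambda>j\<in>Ob J. FA F (d j)) (FA F h)
     \<longleftrightarrow> cocone_map C J X c Y d h" (is "?L \<longleftrightarrow> ?R")
proof -
  note f = weq_functor[OF F]
  have "Cmp D (FA F h) (FA F (c j)) = FA F (d j) \<longleftrightarrow> Cmp C h (c j) = d j" if j: "j \<in> Ob J" for j
    using FA_Cmp[OF f cocone_arrow[OF c j] h] weq_faithful[OF F Cmp_Hom[OF C cocone_arrow[OF c j] h] cocone_arrow[OF d j]]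
    by auto
  then show ?thesis using h FA_Hom[OF f h] by (simp add: cocone_map_def)
qed

lemma weq_cocone_map_lift:
  assumes F: "weak_equivalence C D F" and C: "category C" and c: "cocone C J E X c" and d: "cocone C J E Y d"
    and k: "cocone_map D J (FO F X) (\<lambda>j\<in>Ob J. FA F (c j)) (FO F Y) (\<lambda>j\<in>Ob J. FA F (d j)) k"
  shows "\<exists>h. cocone_map C J X c Y d h \<and> FA F h = k"
proof -
  have "k \<in> Hom D (FO F X) (FO F Y)" using k by (simp add: cocone_map_def)
  then obtain h where h: "h \<in> Hom C X Y" "FA F h = k"
    using weq_full[OF F cocone_Ob[OF c] cocone_Ob[OF d]] by blast
  then show ?thesis using weq_cocone_map[OF F C c d h(1)] k by auto
qed

text \<open>The vertex \<open>Y\<close> need not be a value of \<open>F\<close>. It is replaced by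
  an isomorphic \<open>F X\<close>, and fullness then lifts the legs; the isomorphism and its
  inverse are maps of cocones.\<close>

lemma weq_cocone_lift:
  assumes F: "weak_equivalence C D F" and C: "category C" and D: "category D" and J: "category J"
    and E: "is_functor J C E" and d: "cocone D J (comp_fctr F E) Y d"
  shows "\<exists>X c u v. cocone C J E X c \<and> inverse_arrows D Y (FO F X) u v \<and>
     cocone_map D J Y d (FO F X) (\<lambda>j\<in>Ob J. FA F (c j)) u \<and>
     cocone_map D J (FO F X) (\<lambda>j\<in>Ob J. FA F (c j)) Y d v"
proof -
  note f = weq_functor[OF F]
  obtain X u v where X: "X \<in> Ob C" and uv: "inverse_arrows D Y (FO F X) u v"
    using weq_surj[OF F cocone_Ob[OF d]] by blast
  have H: "u \<in> Hom D Y (FO F X)" "v \<in> Hom D (FO F X) Y" using uv by (auto simp: inverse_arrows_def)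
  have dj: "d j \<in> Hom D (FO F (FO E j)) Y" if "j \<in> Ob J" for j using cocone_arrow[OF d that] by simp
  have "\<exists>k\<in>Hom C (FO E j) X. FA F k = Cmp D u (d j)" if j: "j \<in> Ob J" for j
    using weq_full[OF F FO_Ob[OF E j] X Cmp_Hom[OF D dj[OF j] H(1)]] .
  then obtain c0 where c0: "\<And>j. j \<in> Ob J \<Longrightarrow> c0 j \<in> Hom C (FO E j) X"
    "\<And>j. j \<in> Ob J \<Longrightarrow> FA F (c0 j) = Cmp D u (d j)" by metis
  define c where "c = restrict c0 (Ob J)"
  have c: "cocone C J E X c" unfolding cocone_def
  proof (intro conjI ballI)
    show "c \<in> (\<Pi>\<^sub>E j\<in>Ob J. Hom C (FO E j) X)" using c0(1) unfolding c_def by auto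
    fix k assume k: "k \<in> Ar J"
    have o: "Src J k \<in> Ob J" "Tgt J k \<in> Ob J" using Src_Ob[OF J k] Tgt_Ob[OF J k] .
    have Ek: "FA E k \<in> Hom C (FO E (Src J k)) (FO E (Tgt J k))" using FA_Hom[OF E] k by (auto simp: Hom_iff)
    have "FA F (Cmp C (c0 (Tgt J k)) (FA E k)) = Cmp D (Cmp D u (d (Tgt J k))) (FA F (FA E k))"
      using FA_Cmp[OF f Ek c0(1)[OF o(2)]] c0(2)[OF o(2)] by simp
    also have "\<dots> = FA F (c0 (Src J k))"
      using Hom_assoc[OF D FA_Hom[OF f Ek] dj[OF o(2)] H(1)] cocone_commute[OF d k] c0(2)[OF o(1)] by simp
    finally show "Cmp C (c (Tgt J k)) (FA E k) = c (Src J k)"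
      using weq_faithful[OF F Cmp_Hom[OF C Ek c0(1)[OF o(2)]] c0(1)[OF o(1)]] o by (simp add: c_def)
  qed (rule X)
  have "cocone_map D J Y d (FO F X) (\<lambda>j\<in>Ob J. FA F (c j)) u"
    using H c0(2) by (simp add: cocone_map_def c_def)
  moreover have "cocone_map D J (FO F X) (\<lambda>j\<in>Ob J. FA F (c j)) Y d v"
    using H c0(2) inverse_arrows_cancel(1)[OF D uv dj] by (simp add: cocone_map_def c_def)
  ultimately show ?thesis using c uv by blast
qed

lemma weq_creates_colimit:
  assumes F: "weak_equivalence C D F" and C: "category C" and D: "category D" and J: "category J"
    and E: "is_functor J C E" and col: "is_colimit D J (comp_fctr F E) Y d"
  shows "\<exists>X c. is_colimit C J E X c"
proof -
  note f = weq_functor[OF F]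
  have d: "cocone D J (comp_fctr F E) Y d" using col by (simp add: is_colimit_iff)
  obtain X c u v where c: "cocone C J E X c" and uv: "inverse_arrows D Y (FO F X) u v"
    and u: "cocone_map D J Y d (FO F X) (\<lambda>j\<in>Ob J. FA F (c j)) u"
    and v: "cocone_map D J (FO F X) (\<lambda>j\<in>Ob J. FA F (c j)) Y d v"
    using weq_cocone_lift[OF F C D J E d] by blast
  have "\<exists>!h. cocone_map C J X c Z e h" if e: "cocone C J E Z e" for Z e
  proof (rule ex_ex1I)
    have Fc: "cocone D J (comp_fctr F E) (FO F X) (\<lambda>j\<in>Ob J. FA F (c j))" by (rule weq_cocone[OF F J E c])
    have Fe: "cocone D J (comp_fctr F E) (FO F Z) (\<lambda>j\<in>Ob J. FA F (e j))" by (rule weq_cocone[OF F J E e])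
    obtain k where "cocone_map D J Y d (FO F Z) (\<lambda>j\<in>Ob J. FA F (e j)) k"
      using cocone_map_exists[OF col Fe] by blast
    from cocone_map_comp[OF D Fc v this] weq_cocone_map_lift[OF F C c e]
    show "\<exists>h. cocone_map C J X c Z e h" by blast
    fix h h' assume h: "cocone_map C J X c Z e h" "cocone_map C J X c Z e h'"
    then have H: "h \<in> Hom C X Z" "h' \<in> Hom C X Z" by (auto simp: cocone_map_def)
    have "Cmp D (FA F h) u = Cmp D (FA F h') u"
      using cocone_map_unique[OF col Fe] cocone_map_comp[OF D d u] weq_cocone_map[OF F C c e H(1)]
        weq_cocone_map[OF F C c e H(2)] h by blast
    then have "FA F h = FA F h'"
      using inverse_arrows_cancel(2)[OF D inverse_arrows_sym[OF uv]] FA_Hom[OF f H(1)] FA_Hom[OF f H(2)] by metis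
    then show "h = h'" by (rule weq_faithful[OF F H])
  qed
  then have "is_colimit C J E X c" using c by (simp add: is_colimit_iff)
  then show ?thesis by blast
qed

text \<open>A competing cocone in \<open>D\<close> is first lifted up to isomorphism to
  \<open>C\<close>, where the universal property of \<open>X\<close> applies.\<close>

lemma weq_preserves_colimit:
  assumes F: "weak_equivalence C D F" and C: "category C" and D: "category D" and J: "category J"
    and E: "is_functor J C E" and col: "is_colimit C J E X c"
  shows "is_colimit D J (comp_fctr F E) (FO F X) (\<lambda>j\<in>Ob J. FA F (c j))"
proof -
  note f = weq_functor[OF F]
  have c: "cocone C J E X c" using col by (simp add: is_colimit_iff)
  have Fc: "cocone D J (comp_fctr F E) (FO F X) (\<lambda>j\<in>Ob J. FA F (c j))" by (rule weq_cocone[OF F J E c])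
  have "\<exists>!h. cocone_map D J (FO F X) (\<lambda>j\<in>Ob J. FA F (c j)) Y d h" if d: "cocone D J (comp_fctr F E) Y d" for Y d
  proof (rule ex_ex1I)
    obtain Z e u v where e: "cocone C J E Z e" and uv: "inverse_arrows D Y (FO F Z) u v"
      and u: "cocone_map D J Y d (FO F Z) (\<lambda>j\<in>Ob J. FA F (e j)) u"
      and v: "cocone_map D J (FO F Z) (\<lambda>j\<in>Ob J. FA F (e j)) Y d v"
      using weq_cocone_lift[OF F C D J E d] by blast
    obtain k where k: "cocone_map C J X c Z e k" using cocone_map_exists[OF col e] by blast
    then have "k \<in> Hom C X Z" by (simp add: cocone_map_def)
    then show "\<exists>h. cocone_map D J (FO F X) (\<lambda>j\<in>Ob J. FA F (c j)) Y d h"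
      using cocone_map_comp[OF D Fc _ v] weq_cocone_map[OF F C c e] k by blast
    fix h h' assume h: "cocone_map D J (FO F X) (\<lambda>j\<in>Ob J. FA F (c j)) Y d h"
      "cocone_map D J (FO F X) (\<lambda>j\<in>Ob J. FA F (c j)) Y d h'"
    obtain l l' where l: "cocone_map C J X c Z e l" "FA F l = Cmp D u h"
       "cocone_map C J X c Z e l'" "FA F l' = Cmp D u h'"
      using weq_cocone_map_lift[OF F C c e] cocone_map_comp[OF D Fc h(1) u] cocone_map_comp[OF D Fc h(2) u] by blast
    then have "Cmp D u h = Cmp D u h'" using cocone_map_unique[OF col e] by metis
    moreover have "h \<in> Hom D (FO F X) Y" "h' \<in> Hom D (FO F X) Y" using h by (auto simp: cocone_map_def)
    ultimately show "h = h'" using inverse_arrows_cancel(1)[OF D uv] by metis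
  qed
  then show ?thesis using Fc by (simp add: is_colimit_iff)
qed

text \<open>Each component is lifted to \<open>C\<close> up to isomorphism. Lifted components that
  reach a common cocone come from the same \<open>w\<close>, by uniqueness of the component in
  \<open>D\<close>, so the connecting map asked for by \<open>multicolimitI\<close> is an
  identity.\<close>

lemma weq_multicolimit:
  assumes F: "weak_equivalence C D F" and C: "category C" and D: "category D" and J: "category J"
    and small: "\<And>A B. small U A \<Longrightarrow> B \<subseteq> A \<Longrightarrow> small U (B :: ('o \<times> ('i \<Rightarrow> 'm)) set)"
      "\<And>A (g :: ('p \<times> ('i \<Rightarrow> 'n)) \<Rightarrow> ('o \<times> ('i \<Rightarrow> 'm))). small U A \<Longrightarrow> small U (g ` A)"
    and E: "is_functor J C (E :: ('i, 'k, 'o, 'm) fctr)"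
    and mc: "has_multicolimit U (D :: ('p, 'n) cat) J (comp_fctr F E)"
  shows "has_multicolimit U C J E"
proof -
  note f = weq_functor[OF F]
  obtain W where W0: "small U W \<and> (\<forall>(X, c)\<in>W. cocone D J (comp_fctr F E) X c) \<and>
     (\<forall>Y d. cocone D J (comp_fctr F E) Y d \<longrightarrow>
       (\<exists>!w. w \<in> W \<and> (\<exists>h. cocone_map D J (fst w) (snd w) Y d h)) \<and>
       (\<forall>(X, c)\<in>W. \<forall>h k. cocone_map D J X c Y d h \<longrightarrow> cocone_map D J X c Y d k \<longrightarrow> h = k))"
    using mc unfolding multicolimit_iff by (rule exE)
  have W: "small U W" "\<And>X c. (X, c) \<in> W \<Longrightarrow> cocone D J (comp_fctr F E) X c"
    using W0 by auto
  have ex: "\<exists>!w. w \<in> W \<and> (\<exists>h. cocone_map D J (fst w) (snd w) Y d h)"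
    if "cocone D J (comp_fctr F E) Y d" for Y d
    using W0 that by simp
  have uni: "h = k" if "cocone D J (comp_fctr F E) Y d" "(X, c) \<in> W"
      "cocone_map D J X c Y d h" "cocone_map D J X c Y d k" for Y d X c h k
  proof -
    have "\<forall>(X, c)\<in>W. \<forall>h k. cocone_map D J X c Y d h \<longrightarrow> cocone_map D J X c Y d k \<longrightarrow> h = k"
      using W0 that(1) by simp
    then show ?thesis using that(2-4) by blast
  qed
  have "\<exists>q u v. cocone C J E (fst q) (snd q) \<and> inverse_arrows D (fst w) (FO F (fst q)) u v \<and>
     cocone_map D J (fst w) (snd w) (FO F (fst q)) (\<lambda>j\<in>Ob J. FA F (snd q j)) u \<and>
     cocone_map D J (FO F (fst q)) (\<lambda>j\<in>Ob J. FA F (snd q j)) (fst w) (snd w) v" if "w \<in> W" for w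
    using weq_cocone_lift[OF F C D J E W(2)[of "fst w" "snd w"]] that by simp
  then obtain q u v where q: "\<And>w. w \<in> W \<Longrightarrow> cocone C J E (fst (q w)) (snd (q w))"
    and uv: "\<And>w. w \<in> W \<Longrightarrow> inverse_arrows D (fst w) (FO F (fst (q w))) (u w) (v w)"
    and u: "\<And>w. w \<in> W \<Longrightarrow> cocone_map D J (fst w) (snd w) (FO F (fst (q w))) (\<lambda>j\<in>Ob J. FA F (snd (q w) j)) (u w)"
    and v: "\<And>w. w \<in> W \<Longrightarrow> cocone_map D J (FO F (fst (q w))) (\<lambda>j\<in>Ob J. FA F (snd (q w) j)) (fst w) (snd w) (v w)"
    by metis
  note Fc = weq_cocone[OF F J E]
  have down: "cocone_map D J (fst w) (snd w) (FO F Y) (\<lambda>j\<in>Ob J. FA F (d j)) (Cmp D (FA F h) (u w))"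
    if "w \<in> W" "cocone C J E Y d" "cocone_map C J (fst (q w)) (snd (q w)) Y d h" for w Y d h
  proof -
    have "h \<in> Hom C (fst (q w)) Y" using that by (simp add: cocone_map_def)
    then have "cocone_map D J (FO F (fst (q w))) (\<lambda>j\<in>Ob J. FA F (snd (q w) j)) (FO F Y) (\<lambda>j\<in>Ob J. FA F (d j)) (FA F h)"
      using weq_cocone_map[OF F C q[OF that(1)] that(2)] that(3) by blast
    then show ?thesis using cocone_map_comp[OF D W(2)[of "fst w" "snd w"] u[OF that(1)]] that(1) by simp
  qed
  show ?thesis
  proof (rule multicolimitI[OF C small(1) small(2)[OF W(1), of q]])
    fix X c assume "(X, c) \<in> q ` W"
    then show "cocone C J E X c" using q by (metis fst_conv imageE snd_conv)
  next
    fix Y d assume d: "cocone C J E Y d"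
    obtain w h where w: "w \<in> W" "cocone_map D J (fst w) (snd w) (FO F Y) (\<lambda>j\<in>Ob J. FA F (d j)) h"
      using ex[OF Fc[OF d]] by blast
    obtain k where "cocone_map C J (fst (q w)) (snd (q w)) Y d k"
      using weq_cocone_map_lift[OF F C q[OF w(1)] d] cocone_map_comp[OF D Fc[OF q[OF w(1)]] v[OF w(1)] w(2)] by blast
    then show "\<exists>(X, c)\<in>q ` W. \<exists>h. cocone_map C J X c Y d h" using w(1) by (auto simp: case_prod_beta)
  next
    fix X c Y d h k assume "(X, c) \<in> q ` W" and d: "cocone C J E Y d" and hk: "cocone_map C J X c Y d h"
      "cocone_map C J X c Y d k"
    then obtain w where w: "w \<in> W" "(X, c) = q w" by blast
    then have X: "X = fst (q w)" "c = snd (q w)" by (metis fst_conv, metis snd_conv)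
    have H: "h \<in> Hom C (fst (q w)) Y" "k \<in> Hom C (fst (q w)) Y" using hk X by (auto simp: cocone_map_def)
    have "Cmp D (FA F h) (u w) = Cmp D (FA F k) (u w)"
      using uni[OF Fc[OF d], of "fst w" "snd w"] down[OF w(1) d] hk X w(1) by simp
    then have "FA F h = FA F k"
      using inverse_arrows_cancel(2)[OF D inverse_arrows_sym[OF uv[OF w(1)]]] FA_Hom[OF f H(1)] FA_Hom[OF f H(2)] by metis
    then show "h = k" using weq_faithful[OF F H] by blast
  next
    fix X c X' c' Y d h k assume "(X, c) \<in> q ` W" "(X', c') \<in> q ` W" and d: "cocone C J E Y d"
      and hk: "cocone_map C J X c Y d h" "cocone_map C J X' c' Y d k"
    then obtain w w' where w: "w \<in> W" "(X, c) = q w" "w' \<in> W" "(X', c') = q w'" by blast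
    then have X: "X = fst (q w)" "c = snd (q w)" "X' = fst (q w')" "c' = snd (q w')"
      by (metis fst_conv, metis snd_conv, metis fst_conv, metis snd_conv)
    have "w = w'" using ex[OF Fc[OF d]] down[OF w(1) d] down[OF w(3) d] hk X w(1,3) by blast
    then show "\<exists>l. cocone_map C J X c X' c' l" using cocone_map_Idt[OF C q[OF w(1)]] X by auto
  qed
qed

text \<open>Conjugating by isomorphisms from \<open>E j\<close> to \<open>F (L j)\<close> gives a
  diagram of values of \<open>F\<close>, which lifts by full faithfulness. The objects
  \<open>L j\<close> are prescribed so that they can be taken from a given family of generators;
  with \<open>F\<close> the identity this replaces the objects of a diagram by isomorphic
  ones.\<close>

lemma weq_lift_diagram:
  assumes F: "weak_equivalence C D F" and C: "category C" and D: "category D" and J: "category J"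
    and E: "is_functor J D E" and col: "is_colimit D J E (FO F X) c" and X: "X \<in> Ob C"
    and L: "\<And>j. j \<in> Ob J \<Longrightarrow> L j \<in> Ob C" "\<And>j. j \<in> Ob J \<Longrightarrow> \<exists>u v. inverse_arrows D (FO E j) (FO F (L j)) u v"
  shows "\<exists>E' c'. is_functor J C E' \<and> FO E' = L \<and> is_colimit C J E' X c'"
proof -
  note f = weq_functor[OF F]
  obtain u v where uv: "\<And>j. j \<in> Ob J \<Longrightarrow> inverse_arrows D (FO E j) (FO F (L j)) (u j) (v j)"
    using L(2) by metis
  have u: "u j \<in> Hom D (FO E j) (FO F (L j))" and v: "v j \<in> Hom D (FO F (L j)) (FO E j)" if "j \<in> Ob J" for j
    using uv[OF that] by (auto simp: inverse_arrows_def)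
  have cc: "cocone D J E (FO F X) c" using col by (simp add: is_colimit_iff)
  have Ek: "FA E k \<in> Hom D (FO E (Src J k)) (FO E (Tgt J k))" if "k \<in> Ar J" for k
    using FA_Hom[OF E] that by (auto simp: Hom_iff)
  have o: "Src J k \<in> Ob J" "Tgt J k \<in> Ob J" if "k \<in> Ar J" for k using Src_Ob[OF J that] Tgt_Ob[OF J that] .
  have "\<exists>h\<in>Hom C (L (Src J k)) (L (Tgt J k)). FA F h = Cmp D (Cmp D (u (Tgt J k)) (FA E k)) (v (Src J k))"
    if k: "k \<in> Ar J" for k
    using weq_full[OF F L(1)[OF o(1)[OF k]] L(1)[OF o(2)[OF k]]
      Cmp_Hom[OF D v[OF o(1)[OF k]] Cmp_Hom[OF D Ek[OF k] u[OF o(2)[OF k]]]]] .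
  then obtain a where a: "\<And>k. k \<in> Ar J \<Longrightarrow> a k \<in> Hom C (L (Src J k)) (L (Tgt J k))"
    "\<And>k. k \<in> Ar J \<Longrightarrow> FA F (a k) = Cmp D (Cmp D (u (Tgt J k)) (FA E k)) (v (Src J k))" by metis
  define E' where "E' = \<lparr>FO = L, FA = a\<rparr>"
  have E': "is_functor J C E'" unfolding is_functor_def
  proof (intro conjI ballI impI)
    fix j assume j: "j \<in> Ob J"
    show "FO E' j \<in> Ob C" using L(1)[OF j] by (simp add: E'_def)
    have s: "Src J (Idt J j) = j" "Tgt J (Idt J j) = j" "Idt J j \<in> Ar J" using j J by (simp_all add: cat_simps)
    have "FA F (a (Idt J j)) = FA F (Idt C (L j))"
      using a(2)[OF s(3)] s FA_Idt[OF E j] uv[OF j] Hom_Idt_right[OF D u[OF j]] FA_Idt[OF f L(1)[OF j]]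
      by (simp add: inverse_arrows_def)
    then show "FA E' (Idt J j) = Idt C (FO E' j)"
      using weq_faithful[OF F _ Idt_Hom[OF C L(1)[OF j]]] a(1)[OF s(3)] s by (simp add: E'_def)
  next
    fix k assume "k \<in> Ar J" then show "FA E' k \<in> Hom C (FO E' (Src J k)) (FO E' (Tgt J k))"
      using a(1) by (simp add: E'_def)
  next
    fix k l assume k: "k \<in> Ar J" and l: "l \<in> Ar J" and kl: "Tgt J k = Src J l"
    have s: "Cmp J l k \<in> Ar J" "Src J (Cmp J l k) = Src J k" "Tgt J (Cmp J l k) = Tgt J l"
      using k l kl J by (simp_all add: cat_simps)
    note H = u[OF o(1)[OF k]] v[OF o(1)[OF k]] u[OF o(1)[OF l]] v[OF o(1)[OF l]] u[OF o(2)[OF l]] Ek[OF k] Ek[OF l]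
    have can: "Cmp D (v (Src J l)) (Cmp D (u (Src J l)) (Cmp D (FA E k) (v (Src J k)))) = Cmp D (FA E k) (v (Src J k))"
      by (rule inverse_arrows_cancel(1)[OF D uv[OF o(1)[OF l]]]) (use H kl D in \<open>auto simp: Hom_iff cat_simps\<close>)
    have ll: "a l \<in> Hom C (L (Tgt J k)) (L (Tgt J l))" using a(1)[OF l] kl by simp
    have "FA F (Cmp C (a l) (a k)) = Cmp D (FA F (a l)) (FA F (a k))"
      using FA_Cmp[OF f a(1)[OF k] ll] .
    also have "\<dots> = Cmp D (Cmp D (u (Tgt J l)) (FA E l)) (Cmp D (v (Src J l)) (Cmp D (u (Src J l)) (Cmp D (FA E k) (v (Src J k)))))"
      using H kl D by (simp add: a(2)[OF k] a(2)[OF l] Hom_iff cat_simps)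
    also have "\<dots> = FA F (a (Cmp J l k))" unfolding can
      using H kl D E k l by (simp add: a(2)[OF s(1)] s Hom_iff cat_simps is_functor_def)
    finally have "Cmp C (a l) (a k) = a (Cmp J l k)"
      using weq_faithful[OF F Cmp_Hom[OF C a(1)[OF k] ll]] a(1)[OF s(1)] s by simp
    then show "FA E' (Cmp J l k) = Cmp C (FA E' l) (FA E' k)" by (simp add: E'_def)
  qed
  have "\<exists>h\<in>Hom C (L j) X. FA F h = Cmp D (c j) (v j)" if j: "j \<in> Ob J" for j
    using weq_full[OF F L(1)[OF j] X Cmp_Hom[OF D v[OF j] cocone_arrow[OF cc j]]] .
  then obtain c0 where c0: "\<And>j. j \<in> Ob J \<Longrightarrow> c0 j \<in> Hom C (L j) X" "\<And>j. j \<in> Ob J \<Longrightarrow> FA F (c0 j) = Cmp D (c j) (v j)"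
    by metis
  define c' where "c' = restrict c0 (Ob J)"
  have c': "cocone C J E' X c'" unfolding cocone_def
  proof (intro conjI ballI)
    show "c' \<in> (\<Pi>\<^sub>E j\<in>Ob J. Hom C (FO E' j) X)" using c0(1) by (auto simp: c'_def E'_def)
    fix k assume k: "k \<in> Ar J"
    note H = v[OF o(1)[OF k]] v[OF o(2)[OF k]] u[OF o(2)[OF k]] Ek[OF k] cocone_arrow[OF cc o(2)[OF k]]
      cocone_arrow[OF cc o(1)[OF k]]
    have can: "Cmp D (v (Tgt J k)) (Cmp D (u (Tgt J k)) (Cmp D (FA E k) (v (Src J k)))) = Cmp D (FA E k) (v (Src J k))"
      by (rule inverse_arrows_cancel(1)[OF D uv[OF o(2)[OF k]]]) (use H D in \<open>auto simp: Hom_iff cat_simps\<close>)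
    have "FA F (Cmp C (c0 (Tgt J k)) (a k)) = Cmp D (c (Tgt J k)) (Cmp D (v (Tgt J k)) (Cmp D (u (Tgt J k)) (Cmp D (FA E k) (v (Src J k)))))"
      using FA_Cmp[OF f a(1)[OF k] c0(1)[OF o(2)[OF k]]] H D
      by (simp add: a(2)[OF k] c0(2)[OF o(2)[OF k]] Hom_iff cat_simps)
    also have "\<dots> = Cmp D (Cmp D (c (Tgt J k)) (FA E k)) (v (Src J k))" unfolding can
      using H D by (simp add: Hom_iff cat_simps)
    also have "\<dots> = FA F (c0 (Src J k))" using cocone_commute[OF cc k] c0(2)[OF o(1)[OF k]] by simp
    finally have "Cmp C (c0 (Tgt J k)) (a k) = c0 (Src J k)"
      using weq_faithful[OF F Cmp_Hom[OF C a(1)[OF k] c0(1)[OF o(2)[OF k]]] c0(1)[OF o(1)[OF k]]] by blast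
    then show "Cmp C (c' (Tgt J k)) (FA E' k) = c' (Src J k)" using o[OF k] by (simp add: c'_def E'_def)
  qed (rule X)
  have "\<exists>!h. cocone_map C J X c' Y d h" if d: "cocone C J E' Y d" for Y d
  proof -
    have dj: "d j \<in> Hom C (L j) Y" if "j \<in> Ob J" for j using cocone_arrow[OF d that] by (simp add: E'_def)
    have d': "cocone D J E (FO F Y) (\<lambda>j\<in>Ob J. Cmp D (FA F (d j)) (u j))" unfolding cocone_def
    proof (intro conjI ballI)
      show "FO F Y \<in> Ob D" using FO_Ob[OF f cocone_Ob[OF d]] .
      show "(\<lambda>j\<in>Ob J. Cmp D (FA F (d j)) (u j)) \<in> (\<Pi>\<^sub>E j\<in>Ob J. Hom D (FO E j) (FO F Y))"
        using Cmp_Hom[OF D u FA_Hom[OF f dj]] by auto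
      fix k assume k: "k \<in> Ar J"
      note H = v[OF o(1)[OF k]] u[OF o(1)[OF k]] u[OF o(2)[OF k]] Ek[OF k] FA_Hom[OF f dj[OF o(2)[OF k]]]
      have e: "FA F (d (Src J k)) = Cmp D (FA F (d (Tgt J k))) (FA F (a k))"
        using FA_Cmp[OF f a(1)[OF k] dj[OF o(2)[OF k]]] cocone_commute[OF d k] by (simp add: E'_def)
      have can: "Cmp D (v (Src J k)) (u (Src J k)) = Idt D (FO E (Src J k))"
        using uv[OF o(1)[OF k]] by (simp add: inverse_arrows_def)
      have "Cmp D (FA F (d (Src J k))) (u (Src J k)) =
         Cmp D (FA F (d (Tgt J k))) (Cmp D (u (Tgt J k)) (Cmp D (FA E k) (Cmp D (v (Src J k)) (u (Src J k)))))"
        using H D by (simp add: e a(2)[OF k] Hom_iff cat_simps)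
      also have "\<dots> = Cmp D (Cmp D (FA F (d (Tgt J k))) (u (Tgt J k))) (FA E k)"
        unfolding can using H D by (simp add: Hom_iff cat_simps)
      finally show "Cmp D ((\<lambda>j\<in>Ob J. Cmp D (FA F (d j)) (u j)) (Tgt J k)) (FA E k) =
         (\<lambda>j\<in>Ob J. Cmp D (FA F (d j)) (u j)) (Src J k)" using o[OF k] by simp
    qed
    have key: "cocone_map C J X c' Y d h \<longleftrightarrow> cocone_map D J (FO F X) c (FO F Y) (\<lambda>j\<in>Ob J. Cmp D (FA F (d j)) (u j)) (FA F h)"
      if h: "h \<in> Hom C X Y" for h
    proof -
      have "Cmp C h (c' j) = d j \<longleftrightarrow> Cmp D (FA F h) (c j) = Cmp D (FA F (d j)) (u j)" if j: "j \<in> Ob J" for j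
      proof -
        note cj = cocone_arrow[OF cc j]
        have e: "FA F (Cmp C h (c0 j)) = Cmp D (Cmp D (FA F h) (c j)) (v j)"
          using FA_Cmp[OF f c0(1)[OF j] h] c0(2)[OF j] Hom_assoc[OF D v[OF j] cj FA_Hom[OF f h]] by simp
        have 1: "Cmp D (FA F (Cmp C h (c0 j))) (u j) = Cmp D (FA F h) (c j)"
          unfolding e using inverse_arrows_cancel(2)[OF D uv[OF j] Cmp_Hom[OF D cj FA_Hom[OF f h]]] .
        have H: "Cmp C h (c0 j) \<in> Hom C (L j) Y" using Cmp_Hom[OF C c0(1)[OF j] h] .
        have "Cmp C h (c0 j) = d j" if "Cmp D (FA F (Cmp C h (c0 j))) (u j) = Cmp D (FA F (d j)) (u j)"
          using that inverse_arrows_cancel(2)[OF D inverse_arrows_sym[OF uv[OF j]]] FA_Hom[OF f H]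
            FA_Hom[OF f dj[OF j]] weq_faithful[OF F H dj[OF j]] by metis
        then show ?thesis using 1 j by (auto simp: c'_def)
      qed
      then show ?thesis using h FA_Hom[OF f h] by (simp add: cocone_map_def)
    qed
    show ?thesis
    proof (rule ex_ex1I)
      obtain k where k: "cocone_map D J (FO F X) c (FO F Y) (\<lambda>j\<in>Ob J. Cmp D (FA F (d j)) (u j)) k"
        using cocone_map_exists[OF col d'] by blast
      then have "k \<in> Hom D (FO F X) (FO F Y)" by (simp add: cocone_map_def)
      then obtain h where "h \<in> Hom C X Y" "FA F h = k" using weq_full[OF F X cocone_Ob[OF d]] by blast
      then show "\<exists>h. cocone_map C J X c' Y d h" using key k by blast
      fix h h' assume h: "cocone_map C J X c' Y d h" "cocone_map C J X c' Y d h'"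
      then have H: "h \<in> Hom C X Y" "h' \<in> Hom C X Y" by (auto simp: cocone_map_def)
      have "FA F h = FA F h'" using cocone_map_unique[OF col d'] key[OF H(1)] key[OF H(2)] h by blast
      then show "h = h'" by (rule weq_faithful[OF F H])
    qed
  qed
  then have "is_colimit C J E' X c'" using c' by (simp add: is_colimit_iff)
  moreover have "FO E' = L" by (simp add: E'_def)
  ultimately show ?thesis using E' by blast
qed

lemma weak_equivalence_id: "category C \<Longrightarrow> weak_equivalence C C id_fctr"
  unfolding weak_equivalence_def is_functor_def
  using inverse_arrows_Idt by (fastforce simp: Hom_iff)

section \<open>Concrete categories and presentable objects\<close>

lemma concrete_cat_simps[simp]:
  "Ob (concrete_cat K U mor) = K"
  "Idt (concrete_cat K U mor) A = (A, \<lambda>x\<in>U A. x, A)"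
  "Cmp (concrete_cat K U mor) (B, g, D) (A, f, B') = (A, compose (U A) g f, D)"
  "Src (concrete_cat K U mor) (A, f, B) = A"
  "Tgt (concrete_cat K U mor) (A, f, B) = B"
  "(A, f, B) \<in> Ar (concrete_cat K U mor) \<longleftrightarrow> A \<in> K \<and> B \<in> K \<and> f \<in> extensional (U A) \<and> mor A f B"
  by (simp_all add: concrete_cat_def)

lemma concrete_Hom:
  "x \<in> Hom (concrete_cat K U mor) A B \<longleftrightarrow> (\<exists>f. x = (A, f, B) \<and> A \<in> K \<and> B \<in> K \<and> f \<in> extensional (U A) \<and> mor A f B)"
  by (cases x) (auto simp: Hom_iff)

lemma category_concrete:
  assumes id: "\<And>A. A \<in> K \<Longrightarrow> mor A (\<lambda>x\<in>U A. x) A"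
    and comp: "\<And>A B D f g. A \<in> K \<Longrightarrow> B \<in> K \<Longrightarrow> D \<in> K \<Longrightarrow> mor A f B \<Longrightarrow> mor B g D \<Longrightarrow> mor A (compose (U A) g f) D"
    and fn: "\<And>A B f. A \<in> K \<Longrightarrow> B \<in> K \<Longrightarrow> mor A f B \<Longrightarrow> f \<in> U A \<rightarrow> U B"
  shows "category (concrete_cat K U mor)"
  unfolding category_def
proof (intro conjI ballI impI)
  fix x assume x: "x \<in> Ar (concrete_cat K U mor)"
  obtain A f B where [simp]: "x = (A, f, B)" by (cases x)
  have f: "A \<in> K" "B \<in> K" "f \<in> extensional (U A)" "f \<in> U A \<rightarrow> U B" using x fn by auto
  show "Src (concrete_cat K U mor) x \<in> Ob (concrete_cat K U mor)"
    "Tgt (concrete_cat K U mor) x \<in> Ob (concrete_cat K U mor)" using f by simp_all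
  show "Cmp (concrete_cat K U mor) x (Idt (concrete_cat K U mor) (Src (concrete_cat K U mor) x)) = x"
    "Cmp (concrete_cat K U mor) (Idt (concrete_cat K U mor) (Tgt (concrete_cat K U mor) x)) x = x"
    using f by (auto simp: compose_def extensional_def fun_eq_iff Pi_iff)
next
  fix A assume "A \<in> Ob (concrete_cat K U mor)"
  then show "Idt (concrete_cat K U mor) A \<in> Hom (concrete_cat K U mor) A A"
    using id by (simp add: concrete_Hom)
next
  fix A B D x y assume "x \<in> Hom (concrete_cat K U mor) A B" "y \<in> Hom (concrete_cat K U mor) B D"
  then show "Cmp (concrete_cat K U mor) y x \<in> Hom (concrete_cat K U mor) A D"
    using comp by (auto simp: concrete_Hom)
next
  fix x y z assume xyz: "x \<in> Ar (concrete_cat K U mor)" "y \<in> Ar (concrete_cat K U mor)"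
    "z \<in> Ar (concrete_cat K U mor)" and e: "Tgt (concrete_cat K U mor) x = Src (concrete_cat K U mor) y"
    "Tgt (concrete_cat K U mor) y = Src (concrete_cat K U mor) z"
  obtain A f B B' g D D' h E where [simp]: "x = (A, f, B)" "y = (B', g, D)" "z = (D', h, E)"
    by (cases x, cases y, cases z)
  have [simp]: "B' = B" "D' = D" using e by simp_all
  have "f \<in> U A \<rightarrow> U B" using xyz fn by auto
  then show "Cmp (concrete_cat K U mor) z (Cmp (concrete_cat K U mor) y x) =
    Cmp (concrete_cat K U mor) (Cmp (concrete_cat K U mor) z y) x"
    by (auto simp: compose_def fun_eq_iff Pi_iff)
qed

lemma poset_cat_simps[simp]:
  "Ob (poset_cat I r) = I" "Ar (poset_cat I r) = r" "Src (poset_cat I r) p = fst p"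
  "Tgt (poset_cat I r) p = snd p" "Idt (poset_cat I r) i = (i, i)"
  "Cmp (poset_cat I r) (j, k) (i, j') = (i, k)"
  by (simp_all add: poset_cat_def)

text \<open>The surjectivity half of the statement that Hom(A, -) preserves \<mu>-directed colimits.
  The injectivity half follows when the legs of colimit cocones are monomorphisms.\<close>

definition factoring :: "'u rel \<Rightarrow> ('o, 'm) cat \<Rightarrow> 'o \<Rightarrow> bool" where
  "factoring \<mu> C A \<longleftrightarrow> A \<in> Ob C \<and> (\<forall>I r E X c. directed_poset \<mu> I r \<longrightarrow> is_functor (poset_cat I r) C E \<longrightarrow>
     is_colimit C (poset_cat I r) E X c \<longrightarrow>
     (\<forall>f\<in>Hom C A X. \<exists>i\<in>I. \<exists>g\<in>Hom C A (FO E i). f = Cmp C (c i) g))"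

section \<open>Presentable objects and factoring\<close>

context regular_universe
begin

lemma category_poset:
  assumes "directed_poset \<mu> I r" shows "category (poset_cat I r)"
proof -
  note f = directed_poset_facts[OF assms]
  have "Cmp (poset_cat I r) y x \<in> Hom (poset_cat I r) A D"
    if "x \<in> Hom (poset_cat I r) A B" "y \<in> Hom (poset_cat I r) B D" for x y A B D
    using that f(5) by (cases x, cases y) (auto simp: Hom_iff)
  then show ?thesis unfolding category_def
    using f(2,3) f(4) by (simp add: Hom_iff split_paired_all)
qed

lemma category_set_cat: "category (set_cat TYPE('u))"
  unfolding set_cat_def by (rule category_concrete) (auto simp: compose_def)

lemma set_cat_Hom:
  "x \<in> Hom (set_cat TYPE('u)) X Y \<longleftrightarrow> (\<exists>f. x = (X, f, Y) \<and> small TYPE('u) X \<and> small TYPE('u) Y \<and> f \<in> X \<rightarrow>\<^sub>E Y)"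
  unfolding set_cat_def concrete_Hom by (auto simp: PiE_def)

lemma set_cat_Cmp: "Cmp (set_cat TYPE('u)) (B, g, D) (A, f, B') = (A, compose A g f, D)"
  by (simp add: set_cat_def)

lemma hom_fctr_functor:
  assumes C: "category (C :: ('o, 'm) cat)" and ls: "locally_small TYPE('u) C" and A: "A \<in> Ob C"
  shows "is_functor C (set_cat TYPE('u))
     (hom_fctr C A :: ('o, 'm, ('m + 'u) set, ('m + 'u) set \<times> (('m + 'u) \<Rightarrow> ('m + 'u)) \<times> ('m + 'u) set) fctr)"
proof -
  let ?H = "hom_fctr C A :: ('o, 'm, ('m + 'u) set, ('m + 'u) set \<times> (('m + 'u) \<Rightarrow> ('m + 'u)) \<times> ('m + 'u) set) fctr"
  let ?S = "set_cat TYPE('u) :: (('m + 'u) set, ('m + 'u) set \<times> (('m + 'u) \<Rightarrow> ('m + 'u)) \<times> ('m + 'u) set) cat"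
  have sm: "small TYPE('u) (Inl ` Hom C A X :: ('m + 'u) set)" if "X \<in> Ob C" for X
    using ls A that unfolding locally_small_def by (intro small_image) blast
  show ?thesis unfolding is_functor_def
  proof (intro conjI ballI impI)
    fix X assume X: "X \<in> Ob C"
    show "FO ?H X \<in> Ob ?S"
      using sm[OF X] by (simp add: hom_fctr_def set_cat_def)
    show "FA ?H (Idt C X) = Idt ?S (FO ?H X)"
      using C X by (auto simp: hom_fctr_def set_cat_def Src_Idt Tgt_Idt Hom_Idt_left fun_eq_iff)
  next
    fix f assume f: "f \<in> Ar C"
    have "f \<in> Hom C (Src C f) (Tgt C f)" using f by (simp add: Hom_iff)
    then show "FA ?H f \<in> Hom ?S (FO ?H (Src C f)) (FO ?H (Tgt C f))"
      using sm[OF Src_Ob[OF C f]] sm[OF Tgt_Ob[OF C f]] Cmp_Hom[OF C]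
      by (auto simp: hom_fctr_def set_cat_Hom)
  next
    fix f g assume f: "f \<in> Ar C" and g: "g \<in> Ar C" and e: "Tgt C f = Src C g"
    show "FA ?H (Cmp C g f) = Cmp ?S (FA ?H g) (FA ?H f)"
      using f g e C
      by (auto simp: hom_fctr_def set_cat_Cmp cat_simps compose_def fun_eq_iff Hom_iff)
  qed
qed

text \<open>The legs of a colimit of sets are jointly surjective: two functions that differ only at
  an \<open>f\<close> outside all their images would be two maps between the same cocones.\<close>

lemma presentable_imp_factoring:
  assumes C: "category C" and ls: "locally_small TYPE('u) C" and P: "presentable \<mu> C (A :: 'o)"
  shows "factoring \<mu> (C :: ('o, 'm) cat) A"
  unfolding factoring_def
proof (intro conjI allI impI ballI)
  show A: "A \<in> Ob C" using P by (simp add: presentable_def)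
  let ?H = "hom_fctr C A :: ('o, 'm, ('m + 'u) set, ('m + 'u) set \<times> (('m + 'u) \<Rightarrow> ('m + 'u)) \<times> ('m + 'u) set) fctr"
  let ?S = "set_cat TYPE('u) :: (('m + 'u) set, ('m + 'u) set \<times> (('m + 'u) \<Rightarrow> ('m + 'u)) \<times> ('m + 'u) set) cat"
  fix I r E X c f
  assume dir: "directed_poset \<mu> I r" and E: "is_functor (poset_cat I r) C E"
    and col: "is_colimit C (poset_cat I r) E X c" and f: "f \<in> Hom C A X"
  have cc: "cocone C (poset_cat I r) E X c" using col by (simp add: is_colimit_iff)
  have col': "is_colimit ?S (poset_cat I r) (comp_fctr ?H E) (FO ?H X) (\<lambda>i\<in>I. FA ?H (c i))"
    using P dir E col unfolding presentable_def preserves_directed_colimits_def by blast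
  have X: "X \<in> Ob C" using cocone_Ob[OF cc] .
  note H = hom_fctr_functor[OF C ls A]
  show "\<exists>i\<in>I. \<exists>g\<in>Hom C A (FO E i). f = Cmp C (c i) g"
  proof (rule ccontr)
    assume no: "\<not> ?thesis"
    have "infinite (UNIV :: 'u set)" using Cinfinite_univ by (simp add: cinfinite_def Field_card_of)
    then obtain b where ab: "(undefined :: 'u) \<noteq> b" using finite.emptyI
      by (metis (full_types) UNIV_eq_I finite.insertI finite_subset insert_iff subsetI)
    let ?a = "undefined :: 'u"
    \<comment> \<open>A two-element test set; its elements are taken from the copy of
      \<open>'u\<close>, which is known to be infinite.\<close>
    let ?Y = "{Inr ?a, Inr b} :: ('m + 'u) set"
    let ?P = "(FO ?H X, \<lambda>x\<in>FO ?H X. Inr ?a :: 'm + 'u, ?Y)"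
    let ?Q = "(FO ?H X, \<lambda>x\<in>FO ?H X. if x = Inl f then Inr b else Inr ?a :: 'm + 'u, ?Y)"
    have FX: "FO ?H X = Inl ` Hom C A X" by (simp add: hom_fctr_def)
    have smX: "small TYPE('u) (FO ?H X)" using FO_Ob[OF H X] by (simp add: set_cat_def)
    have smY: "small TYPE('u) ?Y" by (rule small_finite) simp
    have PH: "?P \<in> Hom ?S (FO ?H X) ?Y" and QH: "?Q \<in> Hom ?S (FO ?H X) ?Y"
      using smX smY by (auto simp: set_cat_Hom)
    have coc: "cocone ?S (poset_cat I r) (comp_fctr ?H E) (FO ?H X) (\<lambda>i\<in>I. FA ?H (c i))"
      using col' by (simp add: is_colimit_iff)
    have d: "cocone ?S (poset_cat I r) (comp_fctr ?H E) ?Y (\<lambda>j\<in>Ob (poset_cat I r). Cmp ?S ?P ((\<lambda>i\<in>I. FA ?H (c i)) j))"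
      by (rule cocone_comp[OF category_set_cat category_poset[OF dir] comp_functor[OF E H] coc PH])
    have "cocone_map ?S (poset_cat I r) (FO ?H X) (\<lambda>i\<in>I. FA ?H (c i)) ?Y (\<lambda>j\<in>Ob (poset_cat I r). Cmp ?S ?P ((\<lambda>i\<in>I. FA ?H (c i)) j)) ?P"
      using PH by (simp add: cocone_map_def)
    moreover have "cocone_map ?S (poset_cat I r) (FO ?H X) (\<lambda>i\<in>I. FA ?H (c i)) ?Y (\<lambda>j\<in>Ob (poset_cat I r). Cmp ?S ?P ((\<lambda>i\<in>I. FA ?H (c i)) j)) ?Q"
      unfolding cocone_map_def
    proof (intro conjI ballI)
      fix i assume "i \<in> Ob (poset_cat I r)"
      then have i: "i \<in> I" by simp
      have ci: "c i \<in> Hom C (FO E i) X" using cocone_arrow[OF cc] i by simp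
      then have s: "Src C (c i) = FO E i" "Tgt C (c i) = X" by (simp_all add: Hom_iff)
      have "\<forall>g\<in>Hom C A (FO E i). Cmp C (c i) g \<noteq> f" using no i by blast
      then show "Cmp ?S ?Q ((\<lambda>i\<in>I. FA ?H (c i)) i) = (\<lambda>j\<in>Ob (poset_cat I r). Cmp ?S ?P ((\<lambda>i\<in>I. FA ?H (c i)) j)) i"
        using i s Cmp_Hom[OF C _ ci]
        by (auto simp: hom_fctr_def set_cat_Cmp compose_def fun_eq_iff)
    qed (rule QH)
    ultimately have "?P = ?Q" by (rule cocone_map_unique[OF col' d])
    then have "fst (snd ?P) (Inl f) = fst (snd ?Q) (Inl f)" by (simp only:)
    then show False using f ab by (simp add: FX)
  qed
qed

text \<open>A cocone \<delta> on the hom-sets must induce the map sending \<open>f = c i g\<close>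
  to the value of \<delta> at the stage \<open>i\<close> on \<open>g\<close>. A factorisation exists
  by hypothesis; monomorphisms make the value independent of it.\<close>

lemma factoring_imp_presentable:
  assumes C: "category C" and ls: "locally_small TYPE('u) C" and mono: "\<forall>f\<in>Ar C. mono_arrow C f"
    and P: "factoring \<mu> (C :: ('o, 'm) cat) A"
  shows "presentable \<mu> C (A :: 'o)"
  unfolding presentable_def preserves_directed_colimits_def
proof (intro conjI allI impI; (elim conjE)?)
  show A: "A \<in> Ob C" using P by (simp add: factoring_def)
  let ?H = "hom_fctr C A :: ('o, 'm, ('m + 'u) set, ('m + 'u) set \<times> (('m + 'u) \<Rightarrow> ('m + 'u)) \<times> ('m + 'u) set) fctr"
  let ?S = "set_cat TYPE('u) :: (('m + 'u) set, ('m + 'u) set \<times> (('m + 'u) \<Rightarrow> ('m + 'u)) \<times> ('m + 'u) set) cat"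
  fix I r E X c
  assume dir: "directed_poset \<mu> I r" and E: "is_functor (poset_cat I r) C E"
    and col: "is_colimit C (poset_cat I r) E X c"
  note J = category_poset[OF dir]
  have cc: "cocone C (poset_cat I r) E X c" using col by (simp add: is_colimit_iff)
  have X: "X \<in> Ob C" using cocone_Ob[OF cc] .
  note H = hom_fctr_functor[OF C ls A]
  have ci: "c i \<in> Hom C (FO E i) X" if "i \<in> I" for i using cocone_arrow[OF cc] that by simp
  have s: "Src C (c i) = FO E i" "Tgt C (c i) = X" if "i \<in> I" for i using ci[OF that] by (simp_all add: Hom_iff)
  have fac: "\<exists>i\<in>I. \<exists>g\<in>Hom C A (FO E i). f = Cmp C (c i) g" if "f \<in> Hom C A X" for f
    using P dir E col that unfolding factoring_def by blast
  have coc: "cocone ?S (poset_cat I r) (comp_fctr ?H E) (FO ?H X) (\<lambda>i\<in>I. FA ?H (c i))"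
    using functor_cocone[OF H J E cc] by simp
  have "\<exists>!h. cocone_map ?S (poset_cat I r) (FO ?H X) (\<lambda>i\<in>I. FA ?H (c i)) Y d h"
    if d: "cocone ?S (poset_cat I r) (comp_fctr ?H E) Y d" for Y d
  proof -
    have "\<exists>\<delta>. d i = (Inl ` Hom C A (FO E i), \<delta>, Y) \<and> \<delta> \<in> Inl ` Hom C A (FO E i) \<rightarrow>\<^sub>E Y" if i: "i \<in> I" for i
      using cocone_arrow[OF d, of i] i by (auto simp: set_cat_Hom hom_fctr_def)
    then obtain \<delta> where \<delta>: "\<And>i. i \<in> I \<Longrightarrow> d i = (Inl ` Hom C A (FO E i), \<delta> i, Y)"
      "\<And>i. i \<in> I \<Longrightarrow> \<delta> i \<in> Inl ` Hom C A (FO E i) \<rightarrow>\<^sub>E Y" by metis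
    have up: "\<delta> i (Inl g) = \<delta> k (Inl (Cmp C (FA E (i, k)) g))"
      if ik: "(i, k) \<in> r" and g: "g \<in> Hom C A (FO E i)" for i k g
    proof -
      have Ik: "i \<in> I" "k \<in> I" using directed_poset_facts[OF dir] ik by blast+
      have Eik: "FA E (i, k) \<in> Hom C (FO E i) (FO E k)"
        using FA_Hom[OF E, of "(i, k)" i k] ik by (simp add: Hom_iff)
      then have s: "Src C (FA E (i, k)) = FO E i" "Tgt C (FA E (i, k)) = FO E k" by (simp_all add: Hom_iff)
      have "Cmp ?S (d k) (FA ?H (FA E (i, k))) = d i" using cocone_commute[OF d, of "(i, k)"] ik by simp
      then have "compose (Inl ` Hom C A (FO E i)) (\<delta> k) (\<lambda>x\<in>Inl ` Hom C A (FO E i). Inl (Cmp C (FA E (i, k)) (projl x))) = \<delta> i"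
        using \<delta>(1)[OF Ik(1)] \<delta>(1)[OF Ik(2)] s by (simp add: hom_fctr_def set_cat_Cmp)
      from fun_cong[OF this, of "Inl g"] show ?thesis using g by (simp add: compose_def)
    qed
    \<comment> \<open>Two factorisations of one arrow are pushed to a common later stage
      \<open>k\<close>, where the monomorphism \<open>c k\<close> can be cancelled.\<close>
    have wd: "\<delta> i (Inl g) = \<delta> j (Inl g')" if i: "i \<in> I" "g \<in> Hom C A (FO E i)" "j \<in> I" "g' \<in> Hom C A (FO E j)"
      and e: "Cmp C (c i) g = Cmp C (c j) g'" for i j g g'
    proof -
      obtain k where k: "k \<in> I" "(i, k) \<in> r" "(j, k) \<in> r" using directed_upper2[OF dir i(1,3)] by blast
      have Ei: "FA E (i, k) \<in> Hom C (FO E i) (FO E k)" and Ej: "FA E (j, k) \<in> Hom C (FO E j) (FO E k)"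
        using FA_Hom[OF E, of "(i, k)" i k] FA_Hom[OF E, of "(j, k)" j k] k by (simp_all add: Hom_iff)
      have "Cmp C (c k) (Cmp C (FA E (i, k)) g) = Cmp C (c i) g"
        using Hom_assoc[OF C i(2) Ei ci[OF k(1)]] cocone_commute[OF cc, of "(i, k)"] k by simp
      moreover have "Cmp C (c k) (Cmp C (FA E (j, k)) g') = Cmp C (c j) g'"
        using Hom_assoc[OF C i(4) Ej ci[OF k(1)]] cocone_commute[OF cc, of "(j, k)"] k by simp
      ultimately have "Cmp C (FA E (i, k)) g = Cmp C (FA E (j, k)) g'"
        using mono_cancel[OF C mono Cmp_Hom[OF C i(2) Ei] Cmp_Hom[OF C i(4) Ej] ci[OF k(1)]] e by simp
      then show ?thesis using up[OF k(2) i(2)] up[OF k(3) i(4)] by simp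
    qed
    define \<phi> where "\<phi> f = (SOME y. \<exists>i\<in>I. \<exists>g\<in>Hom C A (FO E i). f = Cmp C (c i) g \<and> y = \<delta> i (Inl g))" for f
    have \<phi>: "\<phi> (Cmp C (c i) g) = \<delta> i (Inl g)" if i: "i \<in> I" "g \<in> Hom C A (FO E i)" for i g
    proof -
      have "\<exists>y. \<exists>i'\<in>I. \<exists>g'\<in>Hom C A (FO E i'). Cmp C (c i) g = Cmp C (c i') g' \<and> y = \<delta> i' (Inl g')"
        using i by auto
      from someI_ex[OF this] have "\<exists>i'\<in>I. \<exists>g'\<in>Hom C A (FO E i'). Cmp C (c i) g = Cmp C (c i') g' \<and>
          \<phi> (Cmp C (c i) g) = \<delta> i' (Inl g')"
        by (simp only: \<phi>_def)
      then obtain i' g' where "i' \<in> I" "g' \<in> Hom C A (FO E i')" "Cmp C (c i) g = Cmp C (c i') g'"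
          "\<phi> (Cmp C (c i) g) = \<delta> i' (Inl g')" by (elim bexE conjE)
      then show ?thesis using wd[OF i] by simp
    qed
    have FX: "FO ?H X = Inl ` Hom C A X" by (simp add: hom_fctr_def)
    have smX: "small TYPE('u) (FO ?H X)" using FO_Ob[OF H X] by (simp add: set_cat_def)
    have smY: "small TYPE('u) Y" using cocone_Ob[OF d] by (simp add: set_cat_def)
    have \<phi>Y: "\<phi> (projl x) \<in> Y" if x: "x \<in> FO ?H X" for x
    proof -
      obtain f where f: "x = Inl f" "f \<in> Hom C A X" using x unfolding FX by (rule imageE)
      obtain i g where g: "i \<in> I" "g \<in> Hom C A (FO E i)" "f = Cmp C (c i) g" using fac[OF f(2)] by blast
      then show ?thesis using \<phi>[OF g(1,2)] PiE_mem[OF \<delta>(2)[OF g(1)], of "Inl g"] f by simp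
    qed
    show ?thesis
    proof (rule ex_ex1I)
      have "(FO ?H X, \<lambda>x\<in>FO ?H X. \<phi> (projl x), Y) \<in> Hom ?S (FO ?H X) Y"
        using smX smY \<phi>Y by (auto simp: set_cat_Hom)
      moreover have "Cmp ?S (FO ?H X, \<lambda>x\<in>FO ?H X. \<phi> (projl x), Y) ((\<lambda>i\<in>I. FA ?H (c i)) i) = d i" if i: "i \<in> I" for i
      proof -
        have "compose (Inl ` Hom C A (FO E i)) (\<lambda>x\<in>Inl ` Hom C A X. \<phi> (projl x))
           (\<lambda>x\<in>Inl ` Hom C A (FO E i). Inl (Cmp C (c i) (projl x))) = \<delta> i"
        proof
          fix x :: "'m + 'u"
          show "compose (Inl ` Hom C A (FO E i)) (\<lambda>x\<in>Inl ` Hom C A X. \<phi> (projl x))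
            (\<lambda>x\<in>Inl ` Hom C A (FO E i). Inl (Cmp C (c i) (projl x))) x = \<delta> i x"
          proof (cases "x \<in> Inl ` Hom C A (FO E i)")
            case True
            then obtain g where g: "x = Inl g" "g \<in> Hom C A (FO E i)" by blast
            then show ?thesis using \<phi>[OF i g(2)] Cmp_Hom[OF C g(2) ci[OF i]] by (simp add: compose_def)
          next
            case False
            then show ?thesis using \<delta>(2)[OF i] by (simp add: compose_def PiE_def extensional_def)
          qed
        qed
        then show ?thesis using i s[OF i] \<delta>(1)[OF i] by (simp add: hom_fctr_def set_cat_Cmp)
      qed
      ultimately show "\<exists>h. cocone_map ?S (poset_cat I r) (FO ?H X) (\<lambda>i\<in>I. FA ?H (c i)) Y d h"
        unfolding cocone_map_def by auto
      fix h k assume h: "cocone_map ?S (poset_cat I r) (FO ?H X) (\<lambda>i\<in>I. FA ?H (c i)) Y d h"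
        "cocone_map ?S (poset_cat I r) (FO ?H X) (\<lambda>i\<in>I. FA ?H (c i)) Y d k"
      obtain h' k' where hk: "h = (FO ?H X, h', Y)" "h' \<in> FO ?H X \<rightarrow>\<^sub>E Y" "k = (FO ?H X, k', Y)" "k' \<in> FO ?H X \<rightarrow>\<^sub>E Y"
        using h by (auto simp: cocone_map_def set_cat_Hom)
      have "h' x = k' x" if x: "x \<in> FO ?H X" for x
      proof -
        obtain f where f: "x = Inl f" "f \<in> Hom C A X" using x unfolding FX by (rule imageE)
        obtain i g where g: "i \<in> I" "g \<in> Hom C A (FO E i)" "f = Cmp C (c i) g" using fac[OF f(2)] by blast
        have "Cmp ?S h (FA ?H (c i)) = Cmp ?S k (FA ?H (c i))" using h g(1) by (simp add: cocone_map_def)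
        then have "compose (Inl ` Hom C A (FO E i) :: ('m + 'u) set) h' (\<lambda>x\<in>Inl ` Hom C A (FO E i). Inl (Cmp C (c i) (projl x))) =
           compose (Inl ` Hom C A (FO E i)) k' (\<lambda>x\<in>Inl ` Hom C A (FO E i). Inl (Cmp C (c i) (projl x)))"
          using hk s[OF g(1)] by (simp add: hom_fctr_def set_cat_Cmp)
        from fun_cong[OF this, of "Inl g"] show ?thesis using g f by (simp add: compose_def)
      qed
      then have "h' = k'" using hk(2,4) by (rule PiE_ext[rotated 2])
      then show "h = k" using hk by simp
    qed
  qed
  then show "is_colimit ?S (poset_cat I r) (comp_fctr ?H E) (FO ?H X) (\<lambda>i\<in>I. FA ?H (c i))"
    using coc by (simp add: is_colimit_iff)
qed

section \<open>Transfer of presentability and multipresentability\<close>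

lemma weq_mono:
  assumes F: "weak_equivalence C D F" and C: "category C" and mono: "\<forall>f\<in>Ar D. mono_arrow D f" and D: "category D"
  shows "\<forall>f\<in>Ar C. mono_arrow C f"
proof
  note f = weq_functor[OF F]
  fix m assume m: "m \<in> Ar C"
  then have mH: "m \<in> Hom C (Src C m) (Tgt C m)" by (simp add: Hom_iff)
  show "mono_arrow C m" unfolding mono_arrow_def
  proof (intro conjI ballI impI)
    fix A g h assume g: "g \<in> Hom C A (Src C m)" and h: "h \<in> Hom C A (Src C m)" and e: "Cmp C m g = Cmp C m h"
    have "Cmp D (FA F m) (FA F g) = Cmp D (FA F m) (FA F h)"
      using FA_Cmp[OF f g mH] FA_Cmp[OF f h mH] e by simp
    then have "FA F g = FA F h"
      by (rule mono_cancel[OF D mono FA_Hom[OF f g] FA_Hom[OF f h] FA_Hom[OF f mH]])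
    then show "g = h" by (rule weq_faithful[OF F g h])
  qed (rule m)
qed

text \<open>\<open>F\<close> preserves the colimit, so the image of \<open>h\<close>, precomposed
  with the isomorphism from \<open>A\<close>, factors in \<open>D\<close>; fullness pulls the factor
  back and faithfulness the equation.\<close>

lemma weq_factoring:
  assumes F: "weak_equivalence C D F" and C: "category C" and D: "category D"
    and A: "factoring \<mu> D A" and A': "A' \<in> Ob C" and uv: "inverse_arrows D A (FO F A') u v"
  shows "factoring \<mu> C A'"
  unfolding factoring_def
proof (intro conjI allI impI ballI)
  note f = weq_functor[OF F]
  fix I r E X c h
  assume dir: "directed_poset \<mu> I r" and E: "is_functor (poset_cat I r) C E"
    and col: "is_colimit C (poset_cat I r) E X c" and h: "h \<in> Hom C A' X"
  have u: "u \<in> Hom D A (FO F A')" and v: "v \<in> Hom D (FO F A') A" using uv by (auto simp: inverse_arrows_def)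
  have cc: "cocone C (poset_cat I r) E X c" using col by (simp add: is_colimit_iff)
  note J = category_poset[OF dir]
  have hu: "Cmp D (FA F h) u \<in> Hom D A (FO F X)" using Cmp_Hom[OF D u FA_Hom[OF f h]] .
  have col': "is_colimit D (poset_cat I r) (comp_fctr F E) (FO F X) (\<lambda>i\<in>I. FA F (c i))"
    using weq_preserves_colimit[OF F C D J E col] by simp
  have "\<exists>i\<in>I. \<exists>g\<in>Hom D A (FO (comp_fctr F E) i). Cmp D (FA F h) u = Cmp D ((\<lambda>i\<in>I. FA F (c i)) i) g"
    using A dir comp_functor[OF E f] col' hu unfolding factoring_def by blast
  then obtain i g where i: "i \<in> I" and g: "g \<in> Hom D A (FO F (FO E i))"
    and e: "Cmp D (FA F h) u = Cmp D (FA F (c i)) g" by auto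
  have Ei: "FO E i \<in> Ob C" using FO_Ob[OF E] i by simp
  have ci: "c i \<in> Hom C (FO E i) X" using cocone_arrow[OF cc] i by simp
  obtain k where k: "k \<in> Hom C A' (FO E i)" "FA F k = Cmp D g v"
    using weq_full[OF F A' Ei Cmp_Hom[OF D v g]] by blast
  have "FA F (Cmp C (c i) k) = Cmp D (Cmp D (FA F (c i)) g) v"
    using FA_Cmp[OF f k(1) ci] k(2) Hom_assoc[OF D v g FA_Hom[OF f ci]] by simp
  also have "\<dots> = FA F h" unfolding e[symmetric]
    using inverse_arrows_cancel(2)[OF D inverse_arrows_sym[OF uv] FA_Hom[OF f h]] .
  finally have "h = Cmp C (c i) k" using weq_faithful[OF F h Cmp_Hom[OF C k(1) ci]] by simp
  then show "\<exists>i\<in>I. \<exists>g\<in>Hom C A' (FO E i). h = Cmp C (c i) g" using i k(1) by blast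
qed (rule A')

text \<open>Presentations by objects isomorphic to members of \<open>S\<close> are enough, since
  \<open>weq_lift_diagram\<close> along the identity functor replaces the stages by members of
  \<open>S\<close>.\<close>

lemma accessibleI:
  assumes C: "category C" and ls: "locally_small TYPE('u) C" and mono: "\<forall>f\<in>Ar C. mono_arrow C f"
    and dc: "has_directed_colimits \<mu> C"
    and S: "small TYPE('u) S" "\<And>A. A \<in> S \<Longrightarrow> factoring \<mu> C A"
    and pres: "\<And>X. X \<in> Ob C \<Longrightarrow> \<exists>I r D c. directed_poset \<mu> I r \<and> is_functor (poset_cat I r) C D \<and>
        (\<forall>i\<in>I. \<exists>A\<in>S. \<exists>u v. inverse_arrows C (FO D i) A u v) \<and> is_colimit C (poset_cat I r) D X c"
  shows "accessible \<mu> C"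
  unfolding accessible_def
proof (intro conjI exI[of _ S] ballI)
  fix A assume "A \<in> S" then show "presentable \<mu> C A" by (rule factoring_imp_presentable[OF C ls mono S(2)])
next
  fix X assume X: "X \<in> Ob C"
  obtain I r D c where D: "directed_poset \<mu> I r" "is_functor (poset_cat I r) C D"
    "\<forall>i\<in>I. \<exists>A\<in>S. \<exists>u v. inverse_arrows C (FO D i) A u v" "is_colimit C (poset_cat I r) D X c"
    using pres[OF X] by (elim exE conjE)
  obtain L where L: "\<And>i. i \<in> I \<Longrightarrow> L i \<in> S" "\<And>i. i \<in> I \<Longrightarrow> \<exists>u v. inverse_arrows C (FO D i) (L i) u v"
    using D(3) by metis
  have "\<exists>E' c'. is_functor (poset_cat I r) C E' \<and> FO E' = L \<and> is_colimit C (poset_cat I r) E' X c'"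
    by (rule weq_lift_diagram[OF weak_equivalence_id[OF C] C C category_poset[OF D(1)] D(2)])
      (use D(4) X L S(2) in \<open>auto simp: factoring_def\<close>)
  then show "\<exists>I r D c. directed_poset \<mu> I r \<and> is_functor (poset_cat I r) C D \<and>
     (\<forall>i\<in>I. FO D i \<in> S) \<and> is_colimit C (poset_cat I r) D X c"
    using D(1) L(1) by metis
qed (rule dc, rule S(1))

theorem weq_locally_multipresentable:
  assumes F: "weak_equivalence C D F" and C: "category C" and D: "category D"
    and ls: "locally_small TYPE('u) C" "locally_small TYPE('u) D"
    and mono: "\<forall>f\<in>Ar D. mono_arrow D f" and lmp: "locally_multipresentable \<mu> D"
  shows "locally_multipresentable \<mu> C"
  unfolding locally_multipresentable_def
proof (intro conjI allI impI; (elim conjE)?)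
  have acc: "accessible \<mu> D" using lmp by (simp add: locally_multipresentable_def)
  then have dcD: "has_directed_colimits \<mu> D" by (simp add: accessible_def)
  obtain S where S: "small TYPE('u) S" "\<forall>A\<in>S. presentable \<mu> D A"
     "\<forall>X\<in>Ob D. \<exists>I r E c. directed_poset \<mu> I r \<and> is_functor (poset_cat I r) D E \<and>
           (\<forall>i\<in>I. FO E i \<in> S) \<and> is_colimit D (poset_cat I r) E X c"
    using acc unfolding accessible_def by (elim conjE exE)
  have SOb: "A \<in> Ob D" if "A \<in> S" for A using S(2) that by (auto simp: presentable_def)
  obtain l u v where l: "\<And>A. A \<in> S \<Longrightarrow> l A \<in> Ob C" "\<And>A. A \<in> S \<Longrightarrow> inverse_arrows D A (FO F (l A)) (u A) (v A)"
    using weq_surj[OF F SOb] by metis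
  show "accessible \<mu> C"
  proof (rule accessibleI[OF C ls(1) weq_mono[OF F C mono D]])
    show "has_directed_colimits \<mu> C" unfolding has_directed_colimits_def
    proof (intro allI impI; elim conjE)
      fix I r E assume dir: "directed_poset \<mu> I r" and E: "is_functor (poset_cat I r) C E"
      obtain Y d where "is_colimit D (poset_cat I r) (comp_fctr F E) Y d"
        using dcD dir comp_functor[OF E weq_functor[OF F]] unfolding has_directed_colimits_def by blast
      then show "\<exists>X c. is_colimit C (poset_cat I r) E X c"
        by (rule weq_creates_colimit[OF F C D category_poset[OF dir] E])
    qed
    show "small TYPE('u) (l ` S)" by (rule small_image[OF S(1)])
    fix A assume "A \<in> l ` S"
    then obtain B where B: "B \<in> S" "A = l B" by blast
    then show "factoring \<mu> C A"
      using weq_factoring[OF F C D presentable_imp_factoring[OF D ls(2)] l(1)[OF B(1)] l(2)[OF B(1)]] S(2) by blast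
  next
    fix X assume X: "X \<in> Ob C"
    obtain I r E c where E: "directed_poset \<mu> I r" "is_functor (poset_cat I r) D E"
         "\<forall>i\<in>I. FO E i \<in> S" "is_colimit D (poset_cat I r) E (FO F X) c"
      using bspec[OF S(3) FO_Ob[OF weq_functor[OF F] X]] by (elim exE conjE)
    \<comment> \<open>The presentation of \<open>F X\<close> by generators of \<open>D\<close> is
      pulled back to one of \<open>X\<close> by their chosen preimages.\<close>
    have "\<exists>E' c'. is_functor (poset_cat I r) C E' \<and> FO E' = (\<lambda>i. l (FO E i)) \<and> is_colimit C (poset_cat I r) E' X c'"
      by (rule weq_lift_diagram[OF F C D category_poset[OF E(1)] E(2,4) X]) (use E(3) l in \<open>simp, metis poset_cat_simps(1)\<close>)
    then obtain E' c' where E': "is_functor (poset_cat I r) C E'" "FO E' = (\<lambda>i. l (FO E i))"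
      "is_colimit C (poset_cat I r) E' X c'" by blast
    have "\<exists>A\<in>l ` S. \<exists>u v. inverse_arrows C (FO E' i) A u v" if "i \<in> I" for i
      using E'(2) E(3) that inverse_arrows_Idt[OF C l(1)[of "FO E i"]]
      by (intro bexI[of _ "FO E' i"]) auto
    then show "\<exists>I r D c. directed_poset \<mu> I r \<and> is_functor (poset_cat I r) C D \<and>
        (\<forall>i\<in>I. \<exists>A\<in>l ` S. \<exists>u v. inverse_arrows C (FO D i) A u v) \<and> is_colimit C (poset_cat I r) D X c"
      using E(1) E'(1,3) by blast
  qed
  fix J :: "('u, 'u) cat" and E assume J: "small_category TYPE('u) J" and E: "is_functor J C E"
  have Jc: "category J" using J by (simp add: small_category_def)
  have "has_multicolimit TYPE('u) D J (comp_fctr F E)"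
    using lmp J comp_functor[OF E weq_functor[OF F]] by (simp add: locally_multipresentable_def)
  then show "has_multicolimit TYPE('u) C J E"
    by (rule weq_multicolimit[OF F C D Jc _ _ E, rotated -1]) (fact small_subset, fact small_image)
qed

end

section \<open>Structures and embeddings\<close>

lemma tuples_compose: "t \<in> tuples \<mu> \<alpha> A \<Longrightarrow> f \<in> A \<rightarrow> B \<Longrightarrow> compose (underS \<mu> \<alpha>) f t \<in> tuples \<mu> \<alpha> B"
  by (auto simp: tuples_def compose_def)

lemma tuples_mono: "A \<subseteq> B \<Longrightarrow> t \<in> tuples \<mu> \<alpha> A \<Longrightarrow> t \<in> tuples \<mu> \<alpha> B"
  by (auto simp: tuples_def)

lemma compose_tuple_cong:
  "t \<in> tuples \<mu> \<alpha> A \<Longrightarrow> (\<And>x. x \<in> A \<Longrightarrow> f x = g x) \<Longrightarrow> compose (underS \<mu> \<alpha>) f t = compose (underS \<mu> \<alpha>) g t"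
  by (fastforce simp: tuples_def compose_def fun_eq_iff)

lemma compose_tuple_id:
  "t \<in> tuples \<mu> \<alpha> A \<Longrightarrow> (\<And>x. x \<in> A \<Longrightarrow> f x = x) \<Longrightarrow> compose (underS \<mu> \<alpha>) f t = t"
  by (auto simp: tuples_def compose_def fun_eq_iff PiE_def extensional_def Pi_iff)

lemma compose_tuple_compose:
  "compose (underS \<mu> \<alpha>) g (compose (underS \<mu> \<alpha>) f t) = compose (underS \<mu> \<alpha>) (\<lambda>x. g (f x)) t"
  by (auto simp: compose_def fun_eq_iff)

lemma small_tuples:
  "regular_universe \<mu> \<Longrightarrow> \<alpha> \<in> Field \<mu> \<Longrightarrow> small TYPE('u) A \<Longrightarrow> small TYPE('u) (tuples (\<mu> :: 'u rel) \<alpha> A)"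
  unfolding tuples_def by (rule regular_universe.small_PiE, assumption, rule regular_universe.small_underS)

locale vocab_universe = regular_universe \<mu> for \<mu> :: "'u rel" +
  fixes \<tau> :: "'u vocab"
  assumes voc: "vocabulary \<mu> \<tau>"
begin

abbreviation "str \<equiv> str_of \<mu> \<tau>"
abbreviation "emb \<equiv> embedding \<mu> \<tau>"
abbreviation "siso \<equiv> str_iso \<mu> \<tau>"
abbreviation "sub \<equiv> substr \<mu> \<tau>"
abbreviation "ftuples s A \<equiv> tuples \<mu> (far \<tau> s) A"
abbreviation "rtuples s A \<equiv> tuples \<mu> (rar \<tau> s) A"
abbreviation "fcmp s f t \<equiv> compose (underS \<mu> (far \<tau> s)) f t"
abbreviation "rcmp s f t \<equiv> compose (underS \<mu> (rar \<tau> s)) f t"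

lemma far_Field: "s \<in> Fsym \<tau> \<Longrightarrow> far \<tau> s \<in> Field \<mu>" and rar_Field: "s \<in> Rsym \<tau> \<Longrightarrow> rar \<tau> s \<in> Field \<mu>"
  using voc by (auto simp: vocabulary_def)

lemma str_small: "str M \<Longrightarrow> small TYPE('u) (univ M)"
  by (simp add: str_of_def)

lemma fns_closed: "str M \<Longrightarrow> s \<in> Fsym \<tau> \<Longrightarrow> t \<in> ftuples s (univ M) \<Longrightarrow> fns M s t \<in> univ M"
  unfolding str_of_def PiE_def Pi_def by auto

lemma rels_tuples: "str M \<Longrightarrow> s \<in> Rsym \<tau> \<Longrightarrow> t \<in> rels M s \<Longrightarrow> t \<in> rtuples s (univ M)"
  by (auto simp: str_of_def)

lemma str_eqI:
  assumes M: "str M" and N: "str N" and U: "univ M = univ N"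
    and F: "\<And>s t. s \<in> Fsym \<tau> \<Longrightarrow> t \<in> ftuples s (univ M) \<Longrightarrow> fns M s t = fns N s t"
    and R: "\<And>s. s \<in> Rsym \<tau> \<Longrightarrow> rels M s = rels N s"
  shows "M = N"
proof -
  have f: "fns M \<in> (\<Pi>\<^sub>E s\<in>Fsym \<tau>. ftuples s (univ M) \<rightarrow>\<^sub>E univ M)" "fns N \<in> (\<Pi>\<^sub>E s\<in>Fsym \<tau>. ftuples s (univ M) \<rightarrow>\<^sub>E univ M)"
    using M N U by (simp_all add: str_of_def)
  have "fns M = fns N"
  proof (rule PiE_ext[OF f])
    fix s assume s: "s \<in> Fsym \<tau>"
    show "fns M s = fns N s"
      by (rule PiE_ext[OF PiE_mem[OF f(1) s] PiE_mem[OF f(2) s]]) (rule F[OF s])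
  qed
  moreover have "rels M = rels N"
  proof
    fix s show "rels M s = rels N s" using R[of s] M N by (cases "s \<in> Rsym \<tau>") (auto simp: str_of_def)
  qed
  ultimately show ?thesis using U by simp
qed

lemma
  assumes "emb M f N"
  shows emb_fn: "f \<in> univ M \<rightarrow> univ N" and emb_inj: "inj_on f (univ M)"
    and emb_fns: "s \<in> Fsym \<tau> \<Longrightarrow> t \<in> ftuples s (univ M) \<Longrightarrow> f (fns M s t) = fns N s (fcmp s f t)"
    and emb_rels: "s \<in> Rsym \<tau> \<Longrightarrow> t \<in> rtuples s (univ M) \<Longrightarrow> t \<in> rels M s \<longleftrightarrow> rcmp s f t \<in> rels N s"
  using assms by (simp_all add: embedding_def)

lemma emb_cong:
  assumes "str M" "\<And>x. x \<in> univ M \<Longrightarrow> f x = g x" "emb M f N"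
  shows "emb M g N"
  unfolding embedding_def
proof (intro conjI ballI)
  show "g \<in> univ M \<rightarrow> univ N" using emb_fn[OF assms(3)] assms(2) by (simp add: Pi_iff)
  show "inj_on g (univ M)" using emb_inj[OF assms(3)] inj_on_cong[of "univ M" f g] assms(2) by blast
  fix s t assume "s \<in> Fsym \<tau>" "t \<in> ftuples s (univ M)"
  then show "g (fns M s t) = fns N s (fcmp s g t)"
    using emb_fns[OF assms(3)] assms(2) fns_closed[OF assms(1)] compose_tuple_cong[of t \<mu> "far \<tau> s" "univ M" f g] by simp
next
  fix s t assume "s \<in> Rsym \<tau>" "t \<in> rtuples s (univ M)"
  then show "t \<in> rels M s \<longleftrightarrow> rcmp s g t \<in> rels N s"
    using emb_rels[OF assms(3)] assms(2) compose_tuple_cong[of t \<mu> "rar \<tau> s" "univ M" f g] by simp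
qed

lemma emb_id: "str M \<Longrightarrow> (\<And>x. x \<in> univ M \<Longrightarrow> f x = x) \<Longrightarrow> emb M f M"
  unfolding embedding_def
  by (simp add: Pi_iff inj_on_def fns_closed compose_tuple_id)

lemma emb_comp:
  assumes "str M" "emb M f N" "emb N g P" "\<And>x. x \<in> univ M \<Longrightarrow> h x = g (f x)"
  shows "emb M h P"
proof (rule emb_cong[OF assms(1)])
  show "g (f x) = h x" if "x \<in> univ M" for x using assms(4)[OF that] by simp
  show "emb M (\<lambda>x. g (f x)) P" unfolding embedding_def
  proof (intro conjI ballI)
    show "(\<lambda>x. g (f x)) \<in> univ M \<rightarrow> univ P" using emb_fn[OF assms(2)] emb_fn[OF assms(3)] by auto
    show "inj_on (\<lambda>x. g (f x)) (univ M)"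
      using emb_inj[OF assms(2)] emb_inj[OF assms(3)] emb_fn[OF assms(2)] by (simp add: inj_on_def Pi_iff)
    fix s t assume s: "s \<in> Fsym \<tau>" and t: "t \<in> ftuples s (univ M)"
    show "g (f (fns M s t)) = fns P s (fcmp s (\<lambda>x. g (f x)) t)"
      using emb_fns[OF assms(2) s t] emb_fns[OF assms(3) s tuples_compose[OF t emb_fn[OF assms(2)]]]
      by (simp add: compose_tuple_compose)
  next
    fix s t assume s: "s \<in> Rsym \<tau>" and t: "t \<in> rtuples s (univ M)"
    show "t \<in> rels M s \<longleftrightarrow> rcmp s (\<lambda>x. g (f x)) t \<in> rels P s"
      using emb_rels[OF assms(2) s t] emb_rels[OF assms(3) s tuples_compose[OF t emb_fn[OF assms(2)]]]
      by (simp add: compose_tuple_compose)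
  qed
qed

lemma sub_emb: "str M \<Longrightarrow> sub M N \<Longrightarrow> (\<And>x. x \<in> univ M \<Longrightarrow> f x = x) \<Longrightarrow> emb M f N"
proof -
  assume M: "str M" and s: "sub M N" and f: "\<And>x. x \<in> univ M \<Longrightarrow> f x = x"
  have "f (fns M s t) = fns N s t" if "s \<in> Fsym \<tau>" "t \<in> ftuples s (univ M)" for s t
    using s that f[OF fns_closed[OF M that]] by (simp add: substr_def)
  then show ?thesis using s f
    unfolding embedding_def substr_def
    by (auto simp: Pi_iff inj_on_def compose_tuple_id)
qed

lemma sub_refl: "str M \<Longrightarrow> sub M M"
  by (auto simp: substr_def str_of_def)

lemma tuples_Int: "A \<subseteq> B \<Longrightarrow> tuples \<mu> \<alpha> B \<inter> tuples \<mu> \<alpha> A = tuples \<mu> \<alpha> A"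
  using tuples_mono[of A B] by blast

lemma sub_trans: "sub M N \<Longrightarrow> sub N P \<Longrightarrow> sub M P"
  unfolding substr_def
  by (auto simp: tuples_mono)

lemma sub_univ: "sub M N \<Longrightarrow> univ M \<subseteq> univ N"
  by (simp add: substr_def)

lemma sub_antisym:
  assumes "str M" "str N" "sub M N" "sub N M"
  shows "M = N"
proof (rule str_eqI[OF assms(1,2)])
  show U: "univ M = univ N" using sub_univ[OF assms(3)] sub_univ[OF assms(4)] by blast
  show "fns M s t = fns N s t" if "s \<in> Fsym \<tau>" "t \<in> ftuples s (univ M)" for s t
    using assms(3) that by (simp add: substr_def)
  show "rels M s = rels N s" if s: "s \<in> Rsym \<tau>" for s
    using assms(3,4) s U unfolding substr_def by auto
qed

lemma sub_subset:
  assumes "sub M N" "sub M' N" "univ M \<subseteq> univ M'"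
  shows "sub M M'"
  unfolding substr_def
proof (intro conjI ballI)
  show "fns M s t = fns M' s t" if "s \<in> Fsym \<tau>" "t \<in> ftuples s (univ M)" for s t
    using assms that tuples_mono[OF assms(3) that(2)] by (simp add: substr_def)
  show "rels M s = rels M' s \<inter> rtuples s (univ M)" if "s \<in> Rsym \<tau>" for s
    using assms that tuples_Int[OF assms(3), of "rar \<tau> s"] by (auto simp: substr_def)
qed (rule assms(3))

lemma sub_eq: "str M \<Longrightarrow> str M' \<Longrightarrow> sub M N \<Longrightarrow> sub M' N \<Longrightarrow> univ M = univ M' \<Longrightarrow> M = M'"
  using sub_antisym sub_subset by blast

section \<open>Induced substructures and isomorphic copies\<close>

definition restr :: "'u str \<Rightarrow> 'u set \<Rightarrow> 'u str" where
  "restr N B = \<lparr>univ = B, fns = (\<lambda>s\<in>Fsym \<tau>. \<lambda>t\<in>ftuples s B. fns N s t),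
     rels = (\<lambda>s. if s \<in> Rsym \<tau> then rels N s \<inter> rtuples s B else {})\<rparr>"

lemma
  assumes N: "str N" and B: "B \<subseteq> univ N" and cl: "\<And>s t. s \<in> Fsym \<tau> \<Longrightarrow> t \<in> ftuples s B \<Longrightarrow> fns N s t \<in> B"
  shows restr_str: "str (restr N B)" and restr_sub: "sub (restr N B) N" and restr_univ: "univ (restr N B) = B"
  using small_subset[OF str_small[OF N] B] B cl
  by (auto simp: str_of_def restr_def substr_def)

definition img :: "('u \<Rightarrow> 'u) \<Rightarrow> 'u str \<Rightarrow> 'u str" where
  "img f M = \<lparr>univ = f ` univ M,
     fns = (\<lambda>s\<in>Fsym \<tau>. \<lambda>t\<in>ftuples s (f ` univ M). f (fns M s (fcmp s (inv_into (univ M) f) t))),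
     rels = (\<lambda>s. rcmp s f ` rels M s)\<rparr>"

lemma img_univ[simp]: "univ (img f M) = f ` univ M"
  by (simp add: img_def)

lemma img_str_iso:
  assumes M: "str M" and inj: "inj_on f (univ M)"
  shows "str (img f M)" "siso M f (img f M)"
proof -
  let ?g = "inv_into (univ M) f"
  have g: "?g \<in> f ` univ M \<rightarrow> univ M" by (auto intro: inv_into_into)
  have gf: "?g (f x) = x" if "x \<in> univ M" for x using inj that by simp
  have fM: "f \<in> univ M \<rightarrow> f ` univ M" by blast
  have cl: "f (fns M s (fcmp s ?g t)) \<in> f ` univ M" if "s \<in> Fsym \<tau>" "t \<in> ftuples s (f ` univ M)" for s t
    using fns_closed[OF M that(1) tuples_compose[OF that(2) g]] by blast
  show S: "str (img f M)" unfolding str_of_def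
  proof (intro conjI ballI allI impI)
    show "small TYPE('u) (univ (img f M))" using small_image[OF str_small[OF M]] by simp
    show "fns (img f M) \<in> (\<Pi>\<^sub>E s\<in>Fsym \<tau>. ftuples s (univ (img f M)) \<rightarrow>\<^sub>E univ (img f M))"
      using cl by (auto simp: img_def)
    show "rels (img f M) s \<subseteq> rtuples s (univ (img f M))" if "s \<in> Rsym \<tau>" for s
      using tuples_compose[OF rels_tuples[OF M that] fM] by (auto simp: img_def)
    show "rels (img f M) s = {}" if "s \<notin> Rsym \<tau>" for s using M that by (simp add: img_def str_of_def)
  qed
  show "siso M f (img f M)" unfolding str_iso_def embedding_def
  proof (intro conjI ballI)
    fix s t assume s: "s \<in> Fsym \<tau>" and t: "t \<in> ftuples s (univ M)"
    have "fcmp s ?g (fcmp s f t) = t" unfolding compose_tuple_compose using gf by (rule compose_tuple_id[OF t])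
    then show "f (fns M s t) = fns (img f M) s (fcmp s f t)"
      using s tuples_compose[OF t fM] by (simp add: img_def)
  next
    fix s t assume s: "s \<in> Rsym \<tau>" and t: "t \<in> rtuples s (univ M)"
    have "t' = t" if "t' \<in> rels M s" "rcmp s f t = rcmp s f t'" for t'
    proof -
      have "rcmp s ?g (rcmp s f t) = rcmp s ?g (rcmp s f t')" using that by simp
      moreover have "rcmp s ?g (rcmp s f t) = t" unfolding compose_tuple_compose using gf by (rule compose_tuple_id[OF t])
      moreover have "rcmp s ?g (rcmp s f t') = t'" unfolding compose_tuple_compose
        using gf by (rule compose_tuple_id[OF rels_tuples[OF M s that(1)]])
      ultimately show ?thesis by simp
    qed
    then show "t \<in> rels M s \<longleftrightarrow> rcmp s f t \<in> rels (img f M) s" by (auto simp: img_def)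
  qed (use inj in auto)
qed

lemma iso_emb: "siso M f N \<Longrightarrow> emb M f N" and iso_univ: "siso M f N \<Longrightarrow> f ` univ M = univ N"
  by (simp_all add: str_iso_def)

lemma iso_comp:
  assumes "str M" "siso M f N" "siso N g P" "\<And>x. x \<in> univ M \<Longrightarrow> h x = g (f x)"
  shows "siso M h P"
proof -
  have "h ` univ M = g ` (f ` univ M)" using assms(4) by (force simp: image_iff)
  then show ?thesis
    using emb_comp[OF assms(1) iso_emb[OF assms(2)] iso_emb[OF assms(3)] assms(4)]
      iso_univ[OF assms(2)] iso_univ[OF assms(3)] by (simp add: str_iso_def)
qed

lemma iso_inv:
  assumes M: "str M" and f: "siso M f N"
  shows "siso N (inv_into (univ M) f) M"
proof -
  let ?g = "inv_into (univ M) f"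
  note e = iso_emb[OF f] and u = iso_univ[OF f]
  have inj: "inj_on f (univ M)" by (rule emb_inj[OF e])
  have g: "?g \<in> univ N \<rightarrow> univ M" using u by (auto intro: inv_into_into)
  have fg: "f (?g y) = y" if "y \<in> univ N" for y using u that by (simp add: f_inv_into_f)
  have gf: "?g (f x) = x" if "x \<in> univ M" for x using inj that by simp
  have "emb N ?g M" unfolding embedding_def
  proof (intro conjI ballI)
    show "inj_on ?g (univ N)" using fg by (rule inj_on_inverseI)
    fix s t assume s: "s \<in> Fsym \<tau>" and t: "t \<in> ftuples s (univ N)"
    have "f (fns M s (fcmp s ?g t)) = fns N s (fcmp s f (fcmp s ?g t))"
      using emb_fns[OF e s tuples_compose[OF t g]] .
    also have "fcmp s f (fcmp s ?g t) = t" unfolding compose_tuple_compose using fg by (rule compose_tuple_id[OF t])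
    finally show "?g (fns N s t) = fns M s (fcmp s ?g t)"
      using gf[OF fns_closed[OF M s tuples_compose[OF t g]]] by metis
  next
    fix s t assume s: "s \<in> Rsym \<tau>" and t: "t \<in> rtuples s (univ N)"
    have "rcmp s f (rcmp s ?g t) = t" unfolding compose_tuple_compose using fg by (rule compose_tuple_id[OF t])
    then show "t \<in> rels N s \<longleftrightarrow> rcmp s ?g t \<in> rels M s"
      using emb_rels[OF e s tuples_compose[OF t g]] by simp
  qed (rule g)
  moreover have "?g ` univ N = univ M"
  proof
    show "?g ` univ N \<subseteq> univ M" using g by blast
    show "univ M \<subseteq> ?g ` univ N" using gf u by (metis imageI subsetI)
  qed
  ultimately show ?thesis by (simp add: str_iso_def)
qed

lemma emb_img:
  assumes M: "str M" and e: "emb M f N"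
  shows "sub (img f M) N"
proof -
  have inj: "inj_on f (univ M)" by (rule emb_inj[OF e])
  let ?g = "inv_into (univ M) f"
  have g: "?g \<in> f ` univ M \<rightarrow> univ M" by (auto intro: inv_into_into)
  have fg: "f (?g y) = y" if "y \<in> f ` univ M" for y using that by (simp add: f_inv_into_f)
  show ?thesis unfolding substr_def
  proof (intro conjI ballI)
    show "univ (img f M) \<subseteq> univ N" using emb_fn[OF e] by auto
    fix s t assume s: "s \<in> Fsym \<tau>" and t: "t \<in> ftuples s (univ (img f M))"
    then have t': "t \<in> ftuples s (f ` univ M)" by simp
    have "fcmp s f (fcmp s ?g t) = t" unfolding compose_tuple_compose using fg by (rule compose_tuple_id[OF t'])
    then show "fns (img f M) s t = fns N s t"
      using emb_fns[OF e s tuples_compose[OF t' g]] s t' by (simp add: img_def)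
  next
    fix s assume s: "s \<in> Rsym \<tau>"
    show "rels (img f M) s = rels N s \<inter> rtuples s (univ (img f M))"
    proof
      show "rels (img f M) s \<subseteq> rels N s \<inter> rtuples s (univ (img f M))"
      proof
        fix t assume "t \<in> rels (img f M) s"
        then obtain t' where t': "t' \<in> rels M s" "t = rcmp s f t'" by (auto simp: img_def)
        have T: "t' \<in> rtuples s (univ M)" by (rule rels_tuples[OF M s t'(1)])
        show "t \<in> rels N s \<inter> rtuples s (univ (img f M))"
          using emb_rels[OF e s T] t' tuples_compose[OF T, of f "f ` univ M"] by auto
      qed
      show "rels N s \<inter> rtuples s (univ (img f M)) \<subseteq> rels (img f M) s"
      proof
        fix t assume t: "t \<in> rels N s \<inter> rtuples s (univ (img f M))"
        then have t': "t \<in> rtuples s (f ` univ M)" by simp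
        have eq: "rcmp s f (rcmp s ?g t) = t" unfolding compose_tuple_compose using fg by (rule compose_tuple_id[OF t'])
        have "rcmp s ?g t \<in> rels M s" using emb_rels[OF e s tuples_compose[OF t' g]] eq t by simp
        then show "t \<in> rels (img f M) s" using eq by (force simp: img_def)
      qed
    qed
  qed
qed

text \<open>Both structures are substructures of \<open>N\<close> with the same universe, and a
  substructure is determined by its universe because interpretations are fixed outside their
  domains.\<close>

lemma iso_img_eq:
  assumes "str M" "str N" "siso M f N"
  shows "img f M = N"
proof (rule sub_eq[OF _ assms(2) _ sub_refl[OF assms(2)]])
  note e = iso_emb[OF assms(3)]
  show "str (img f M)" by (rule img_str_iso(1)[OF assms(1) emb_inj[OF e]])
  show "sub (img f M) N" by (rule emb_img[OF assms(1) e])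
  show "univ (img f M) = univ N" using iso_univ[OF assms(3)] by simp
qed

lemma img_id: "str M \<Longrightarrow> (\<And>x. x \<in> univ M \<Longrightarrow> f x = x) \<Longrightarrow> img f M = M"
  by (rule iso_img_eq) (auto simp: str_iso_def intro: emb_id)

lemma img_img:
  assumes M: "str M" and "inj_on f (univ M)" "inj_on g (f ` univ M)" "\<And>x. x \<in> univ M \<Longrightarrow> h x = g (f x)"
  shows "img g (img f M) = img h M"
proof -
  have i: "str (img f M)" "siso M f (img f M)" using img_str_iso[OF M assms(2)] .
  have j: "str (img g (img f M))" "siso (img f M) g (img g (img f M))" using img_str_iso[OF i(1)] assms(3) by simp_all
  show ?thesis using iso_img_eq[OF M j(1) iso_comp[OF M i(2) j(2) assms(4)]] by simp
qed

lemma sub_img: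
  assumes "str M" "sub M N" "str N" "inj_on f (univ N)"
  shows "sub (img f M) (img f N)"
proof (rule emb_img[OF assms(1)])
  show "emb M f (img f N)"
    by (rule emb_comp[OF assms(1) sub_emb[OF assms(1,2)] iso_emb[OF img_str_iso(2)[OF assms(3,4)]]]) (rule refl)+
qed

section \<open>Quantifier-free formulas\<close>

lemma val_embedding:
  assumes M: "str M" and e: "emb M f N" and \<rho>: "\<And>x. x \<in> V \<Longrightarrow> \<rho> x \<in> univ M \<and> \<rho>' x = f (\<rho> x)"
  shows "wf_trm \<mu> \<tau> V a \<Longrightarrow> val \<mu> \<tau> M \<rho> a \<in> univ M \<and> val \<mu> \<tau> N \<rho>' a = f (val \<mu> \<tau> M \<rho> a)"
proof (induction a)
  case (Var x)
  then show ?case using \<rho> by simp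
next
  case (Fn s ts)
  have s: "s \<in> Fsym \<tau>" using Fn.prems by simp
  let ?t = "restrict (\<lambda>i. val \<mu> \<tau> M \<rho> (ts i)) (underS \<mu> (far \<tau> s))"
  have t: "?t \<in> ftuples s (univ M)" using Fn by (auto simp: tuples_def)
  have "restrict (\<lambda>i. val \<mu> \<tau> N \<rho>' (ts i)) (underS \<mu> (far \<tau> s)) = fcmp s f ?t"
    using Fn by (auto simp: compose_def fun_eq_iff)
  then show ?case using fns_closed[OF M s t] emb_fns[OF e s t] by simp
qed

text \<open>Injectivity takes care of equations, reflection of relations takes care of atoms, and
  the connectives follow. The assignments are compared on \<open>V\<close> only, since tuples are
  fixed off their arity.\<close>

lemma sat_embedding:
  assumes M: "str M" and e: "emb M f N" and \<rho>: "\<And>x. x \<in> V \<Longrightarrow> \<rho> x \<in> univ M \<and> \<rho>' x = f (\<rho> x)"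
  shows "wf_qff \<mu> \<tau> V \<phi> \<Longrightarrow> sat \<mu> \<tau> M \<rho> \<phi> \<longleftrightarrow> sat \<mu> \<tau> N \<rho>' \<phi>"
proof (induction \<phi>)
  case (Eq a b)
  then show ?case using val_embedding[OF M e \<rho>] emb_inj[OF e] by (auto simp: inj_on_def)
next
  case (Rl s ts)
  have s: "s \<in> Rsym \<tau>" using Rl by simp
  let ?t = "\<lambda>i\<in>underS \<mu> (rar \<tau> s). val \<mu> \<tau> M \<rho> (ts i)"
  have v: "val \<mu> \<tau> M \<rho> (ts i) \<in> univ M \<and> val \<mu> \<tau> N \<rho>' (ts i) = f (val \<mu> \<tau> M \<rho> (ts i))" if "i \<in> underS \<mu> (rar \<tau> s)" for i
    using Rl that by (intro val_embedding[OF M e \<rho>]) auto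
  have t: "?t \<in> rtuples s (univ M)" using v by (auto simp: tuples_def)
  have "(\<lambda>i\<in>underS \<mu> (rar \<tau> s). val \<mu> \<tau> N \<rho>' (ts i)) = rcmp s f ?t"
    using v by (auto simp: compose_def fun_eq_iff)
  then show ?case using emb_rels[OF e s t] by simp
qed auto

section \<open>Directed unions\<close>

definition substr_system :: "'u set \<Rightarrow> 'u rel \<Rightarrow> ('u \<Rightarrow> 'u str) \<Rightarrow> bool" where
  "substr_system I r M \<longleftrightarrow> directed_poset \<mu> I r \<and> (\<forall>i\<in>I. str (M i)) \<and> (\<forall>i j. (i, j) \<in> r \<longrightarrow> sub (M i) (M j))"

context
  fixes I r and M :: "'u \<Rightarrow> 'u str"
  assumes sys: "substr_system I r M"
begin

private lemma dir: "directed_poset \<mu> I r" and strM: "i \<in> I \<Longrightarrow> str (M i)"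
    and subM: "(i, j) \<in> r \<Longrightarrow> sub (M i) (M j)"
  using sys by (auto simp: substr_system_def)

lemma union_univ: "univ (union_str \<mu> \<tau> I M) = (\<Union>i\<in>I. univ (M i))"
  by (simp add: union_str_def Let_def)

text \<open>Here arities below \<mu> meet \<mu>-directedness: the fewer than \<mu> stages that
  contain the entries have an upper bound.\<close>

lemma tuple_in_union:
  assumes "t \<in> tuples \<mu> \<alpha> (\<Union>i\<in>I. univ (M i))" "\<alpha> \<in> Field \<mu>"
  shows "\<exists>i\<in>I. t \<in> tuples \<mu> \<alpha> (univ (M i))"
proof -
  have "\<forall>x\<in>underS \<mu> \<alpha>. \<exists>i\<in>I. t x \<in> univ (M i)" using assms(1) by (auto simp: tuples_def)
  then obtain f where f: "\<And>x. x \<in> underS \<mu> \<alpha> \<Longrightarrow> f x \<in> I" "\<And>x. x \<in> underS \<mu> \<alpha> \<Longrightarrow> t x \<in> univ (M (f x))" by metis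
  obtain k where k: "k \<in> I" "\<forall>x\<in>underS \<mu> \<alpha>. (f x, k) \<in> r"
    using directed_upper[OF dir card_underS_less[OF assms(2)], of f] f(1) by blast
  have "t x \<in> univ (M k)" if "x \<in> underS \<mu> \<alpha>" for x
    using sub_univ[OF subM] k(2) f(2) that by blast
  then show ?thesis using k(1) assms(1) by (auto simp: tuples_def PiE_def)
qed

lemma union_fns:
  assumes "i \<in> I" "s \<in> Fsym \<tau>" "t \<in> ftuples s (univ (M i))"
  shows "fns (union_str \<mu> \<tau> I M) s t = fns (M i) s t"
proof -
  have t: "t \<in> ftuples s (\<Union>i\<in>I. univ (M i))"
    using assms(1) by (intro tuples_mono[OF _ assms(3)]) blast
  have "(THE y. \<exists>j\<in>I. t \<in> ftuples s (univ (M j)) \<and> y = fns (M j) s t) = fns (M i) s t"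
  proof (rule the_equality)
    show "\<exists>j\<in>I. t \<in> ftuples s (univ (M j)) \<and> fns (M i) s t = fns (M j) s t"
      using assms(1,3) by (intro bexI[of _ i]) auto
    fix y assume "\<exists>j\<in>I. t \<in> ftuples s (univ (M j)) \<and> y = fns (M j) s t"
    then obtain j where j: "j \<in> I" "t \<in> ftuples s (univ (M j))" "y = fns (M j) s t" by blast
    obtain k where k: "k \<in> I" "(i, k) \<in> r" "(j, k) \<in> r" using directed_upper2[OF dir assms(1) j(1)] by blast
    have "fns (M i) s t = fns (M k) s t" using subM[OF k(2)] assms by (simp add: substr_def)
    moreover have "fns (M j) s t = fns (M k) s t" using subM[OF k(3)] assms j by (simp add: substr_def)
    ultimately show "y = fns (M i) s t" using j by simp
  qed
  then show ?thesis using assms(2) t by (simp add: union_str_def Let_def)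
qed

lemma union_sub: "i \<in> I \<Longrightarrow> sub (M i) (union_str \<mu> \<tau> I M)"
  unfolding substr_def
proof (intro conjI ballI)
  assume i: "i \<in> I"
  show "univ (M i) \<subseteq> univ (union_str \<mu> \<tau> I M)" using i by (auto simp: union_univ)
  show "fns (M i) s t = fns (union_str \<mu> \<tau> I M) s t" if "s \<in> Fsym \<tau>" "t \<in> ftuples s (univ (M i))" for s t
    using union_fns[OF i that] by simp
  fix s assume s: "s \<in> Rsym \<tau>"
  have "t \<in> rels (M i) s" if j: "j \<in> I" "t \<in> rels (M j) s" "t \<in> rtuples s (univ (M i))" for j t
  proof -
    obtain k where k: "k \<in> I" "(i, k) \<in> r" "(j, k) \<in> r" using directed_upper2[OF dir i j(1)] by blast
    have "t \<in> rels (M k) s" using subM[OF k(3)] j s by (auto simp: substr_def)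
    then show ?thesis using subM[OF k(2)] j s by (auto simp: substr_def)
  qed
  then show "rels (M i) s = rels (union_str \<mu> \<tau> I M) s \<inter> rtuples s (univ (M i))"
    using i rels_tuples[OF strM[OF i] s] by (auto simp: union_str_def Let_def)
qed

lemma union_str_str: "str (union_str \<mu> \<tau> I M)"
  unfolding str_of_def
proof (intro conjI ballI allI impI)
  let ?X = "union_str \<mu> \<tau> I M"
  show "small TYPE('u) (univ ?X)" unfolding union_univ
    by (rule small_UN[OF directed_poset_facts(1)[OF dir] str_small[OF strM]])
  have cl: "fns ?X s t \<in> univ ?X" if s: "s \<in> Fsym \<tau>" and t: "t \<in> ftuples s (univ ?X)" for s t
  proof -
    obtain i where i: "i \<in> I" "t \<in> ftuples s (univ (M i))"
      using tuple_in_union[OF _ far_Field[OF s]] t unfolding union_univ by blast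
    show ?thesis using union_fns[OF i(1) s i(2)] fns_closed[OF strM[OF i(1)] s i(2)] i(1) unfolding union_univ by auto
  qed
  \<comment> \<open>The extensional form of the interpretation, for which membership in the product
    is just closure of the universe.\<close>
  define g where "g = (\<lambda>s\<in>Fsym \<tau>. \<lambda>t\<in>ftuples s (univ ?X). fns ?X s t)"
  have "fns ?X = g" unfolding g_def
    by (auto simp: union_str_def Let_def fun_eq_iff)
  moreover have "g \<in> (\<Pi>\<^sub>E s\<in>Fsym \<tau>. ftuples s (univ ?X) \<rightarrow>\<^sub>E univ ?X)" unfolding g_def
    using cl by auto
  ultimately show "fns ?X \<in> (\<Pi>\<^sub>E s\<in>Fsym \<tau>. ftuples s (univ ?X) \<rightarrow>\<^sub>E univ ?X)" by simp
  show "rels ?X s \<subseteq> rtuples s (univ ?X)" if s: "s \<in> Rsym \<tau>" for s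
  proof
    fix t assume "t \<in> rels ?X s"
    then obtain i where i: "i \<in> I" "t \<in> rels (M i) s" by (auto simp: union_str_def Let_def)
    show "t \<in> rtuples s (univ ?X)"
      by (rule tuples_mono[OF _ rels_tuples[OF strM[OF i(1)] s i(2)]]) (use i(1) union_univ in auto)
  qed
  show "rels ?X s = {}" if "s \<notin> Rsym \<tau>" for s
    using strM that by (auto simp: union_str_def Let_def str_of_def)
qed

lemma union_least:
  assumes "\<And>i. i \<in> I \<Longrightarrow> sub (M i) N"
  shows "sub (union_str \<mu> \<tau> I M) N"
  unfolding substr_def
proof (intro conjI ballI)
  let ?X = "union_str \<mu> \<tau> I M"
  show "univ ?X \<subseteq> univ N" using sub_univ[OF assms] unfolding union_univ by blast
  fix s t assume s: "s \<in> Fsym \<tau>" and t: "t \<in> ftuples s (univ ?X)"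
  obtain i where i: "i \<in> I" "t \<in> ftuples s (univ (M i))"
    using tuple_in_union[OF _ far_Field[OF s]] t unfolding union_univ by blast
  then show "fns ?X s t = fns N s t"
    using union_fns[OF i(1) s i(2)] assms[OF i(1)] s by (simp add: substr_def)
next
  let ?X = "union_str \<mu> \<tau> I M"
  fix s assume s: "s \<in> Rsym \<tau>"
  have "t \<in> rels ?X s" if t: "t \<in> rels N s" "t \<in> rtuples s (univ ?X)" for t
  proof -
    obtain i where i: "i \<in> I" "t \<in> rtuples s (univ (M i))"
      using tuple_in_union[OF _ rar_Field[OF s]] t unfolding union_univ by blast
    then have "t \<in> rels (M i) s" using assms[OF i(1)] s t by (simp add: substr_def)
    then show ?thesis using i by (auto simp: union_str_def Let_def)
  qed
  moreover have "t \<in> rels N s" if "t \<in> rels ?X s" for t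
    using that assms s by (auto simp: union_str_def Let_def substr_def)
  moreover have "t \<in> rtuples s (univ ?X)" if "t \<in> rels ?X s" for t
    using that union_str_str s by (auto simp: str_of_def)
  ultimately show "rels ?X s = rels N s \<inter> rtuples s (univ ?X)" by blast
qed

end

end

section \<open>Universal theories axiomatise universal classes\<close>

lemma concrete_cat_cong:
  assumes "\<And>A f B. A \<in> K \<Longrightarrow> B \<in> K \<Longrightarrow> mor A f B \<longleftrightarrow> mor' A f B"
  shows "concrete_cat K U mor = concrete_cat K U mor'"
  using assms by (auto simp: concrete_cat_def)

context vocab_universe
begin

text \<open>An assignment in \<open>M\<close> is pushed forward along \<open>f\<close>. Stated for
  embeddings, this gives closure under substructures and under isomorphism at once.\<close>

lemma holds_emb:
  assumes M: "str M" and e: "emb M f N" and u: "universal_sentence \<mu> \<tau> \<sigma>" and h: "holds \<mu> \<tau> N \<sigma>"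
  shows "holds \<mu> \<tau> M \<sigma>"
proof (cases \<sigma>)
  case (Forall \<alpha> \<phi>)
  show ?thesis unfolding Forall holds.simps
  proof
    fix \<rho> assume \<rho>: "\<rho> \<in> tuples \<mu> \<alpha> (univ M)"
    have "sat \<mu> \<tau> M \<rho> \<phi> \<longleftrightarrow> sat \<mu> \<tau> N (compose (underS \<mu> \<alpha>) f \<rho>) \<phi>"
      by (rule sat_embedding[OF M e, of "underS \<mu> \<alpha>"])
        (use \<rho> u Forall in \<open>auto simp: tuples_def compose_def\<close>)
    then show "sat \<mu> \<tau> M \<rho> \<phi>" using h tuples_compose[OF \<rho> emb_fn[OF e]] Forall by simp
  qed
qed

lemma models_universal:
  assumes T: "universal_theory \<mu> \<tau> T"
  shows "universal_mu_AEC \<mu> \<tau> (models \<mu> \<tau> T) (substr_rel \<mu> \<tau> (models \<mu> \<tau> T))"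
  unfolding universal_mu_AEC_def
proof (intro conjI allI impI ballI; (elim conjE)?)
  have u: "universal_sentence \<mu> \<tau> \<sigma>" if "\<sigma> \<in> T" for \<sigma> using T that by (simp add: universal_theory_def)
  show "vocabulary \<mu> \<tau>" by (rule voc)
  show "str M" if "M \<in> models \<mu> \<tau> T" for M using that by (simp add: models_def)
  show "iso_closed \<mu> \<tau> (models \<mu> \<tau> T)" unfolding iso_closed_def
  proof (intro allI impI; elim conjE)
    fix M N f assume M: "M \<in> models \<mu> \<tau> T" and N: "str N" and f: "siso M f N"
    have "str M" using M by (simp add: models_def)
    from iso_emb[OF iso_inv[OF this f]] show "N \<in> models \<mu> \<tau> T"
      using holds_emb[OF N _ u] N M by (simp add: models_def)
  qed
  show "M \<in> models \<mu> \<tau> T" if N: "N \<in> models \<mu> \<tau> T" and M: "str M" and s: "sub M N" for M N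
    using holds_emb[OF M sub_emb[OF M s, of "\<lambda>x. x"] u] N M by (simp add: models_def)
  show "substr_rel \<mu> \<tau> (models \<mu> \<tau> T) = substr_rel \<mu> \<tau> (models \<mu> \<tau> T)" ..
  fix I r M assume "directed_system \<mu> (models \<mu> \<tau> T) (substr_rel \<mu> \<tau> (models \<mu> \<tau> T)) I r M"
  then have dir: "directed_poset \<mu> I r" and M: "\<And>i. i \<in> I \<Longrightarrow> M i \<in> models \<mu> \<tau> T"
    and s: "\<And>i j. (i, j) \<in> r \<Longrightarrow> sub (M i) (M j)"
    by (auto simp: directed_system_def substr_rel_def)
  have strM: "\<And>i. i \<in> I \<Longrightarrow> str (M i)" using M by (simp add: models_def)
  let ?X = "union_str \<mu> \<tau> I M"
  have sys: "substr_system I r M" using dir strM s by (auto simp: substr_system_def)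
  have X: "str ?X" by (rule union_str_str[OF sys])
  have "holds \<mu> \<tau> ?X \<sigma>" if \<sigma>: "\<sigma> \<in> T" for \<sigma>
  proof (cases \<sigma>)
    case (Forall \<alpha> \<phi>)
    have \<alpha>: "\<alpha> \<in> Field \<mu>" "wf_qff \<mu> \<tau> (underS \<mu> \<alpha>) \<phi>" using u[OF \<sigma>] Forall by simp_all
    show ?thesis unfolding Forall holds.simps
    proof
      fix \<rho> assume "\<rho> \<in> tuples \<mu> \<alpha> (univ ?X)"
      then obtain i where i: "i \<in> I" "\<rho> \<in> tuples \<mu> \<alpha> (univ (M i))"
        using tuple_in_union[OF sys _ \<alpha>(1)] unfolding union_univ[OF sys] by blast
      have "sat \<mu> \<tau> (M i) \<rho> \<phi> \<longleftrightarrow> sat \<mu> \<tau> ?X \<rho> \<phi>"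
        by (rule sat_embedding[OF strM[OF i(1)] sub_emb[OF strM[OF i(1)] union_sub[OF sys i(1)], of "\<lambda>x. x"] _ \<alpha>(2)])
          (use i(2) in \<open>auto simp: tuples_def\<close>)
      moreover have "holds \<mu> \<tau> (M i) \<sigma>" using M[OF i(1)] \<sigma> by (simp add: models_def)
      ultimately show "sat \<mu> \<tau> ?X \<rho> \<phi>" using i(2) Forall by simp
    qed
  qed
  then show "?X \<in> models \<mu> \<tau> T" using X by (simp add: models_def)
qed

end

locale universal_class = vocab_universe \<mu> \<tau> for \<mu> :: "'u rel" and \<tau> +
  fixes K :: "'u str set"
  assumes uni: "universal_mu_AEC \<mu> \<tau> K (substr_rel \<mu> \<tau> K)"
begin

abbreviation "le \<equiv> substr_rel \<mu> \<tau> K"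

lemma K_str: "M \<in> K \<Longrightarrow> str M"
  and K_iso: "M \<in> K \<Longrightarrow> str N \<Longrightarrow> siso M f N \<Longrightarrow> N \<in> K"
  and K_sub: "N \<in> K \<Longrightarrow> str M \<Longrightarrow> sub M N \<Longrightarrow> M \<in> K"
  and K_union: "directed_system \<mu> K le I r M' \<Longrightarrow> union_str \<mu> \<tau> I M' \<in> K"
  using uni unfolding universal_mu_AEC_def iso_closed_def by blast+

lemma le_iff: "(M, N) \<in> le \<longleftrightarrow> M \<in> K \<and> N \<in> K \<and> sub M N"
  by (simp add: substr_rel_def)

lemma K_img: "M \<in> K \<Longrightarrow> inj_on f (univ M) \<Longrightarrow> img f M \<in> K"
  using K_iso img_str_iso[OF K_str] by blast

text \<open>The image of an embedding is an isomorphic copy of \<open>M\<close> and so belongs to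
  \<open>K\<close>; it is a substructure of \<open>N\<close>, which is all that the order
  asks.\<close>

lemma K_embedding_iff:
  assumes M: "M \<in> K" and N: "N \<in> K"
  shows "K_embedding \<mu> \<tau> le M f N \<longleftrightarrow> emb M f N"
proof
  assume "K_embedding \<mu> \<tau> le M f N"
  then obtain M' where M': "str M'" "siso M f M'" "sub M' N" by (auto simp: K_embedding_def le_iff)
  show "emb M f N"
    by (rule emb_comp[OF K_str[OF M] iso_emb[OF M'(2)] sub_emb[OF M'(1,3), of "\<lambda>x. x"]]) auto
next
  assume e: "emb M f N"
  show "K_embedding \<mu> \<tau> le M f N" unfolding K_embedding_def le_iff
    using img_str_iso[OF K_str[OF M] emb_inj[OF e]] K_img[OF M emb_inj[OF e]] emb_img[OF K_str[OF M] e] N by blast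
qed

lemma class_cat_eq: "class_cat \<mu> \<tau> K le = concrete_cat K univ (embedding \<mu> \<tau>)"
  unfolding class_cat_def by (rule concrete_cat_cong) (rule K_embedding_iff)

lemma restr_K:
  assumes "N \<in> K" "B \<subseteq> univ N" "\<And>s t. s \<in> Fsym \<tau> \<Longrightarrow> t \<in> ftuples s B \<Longrightarrow> fns N s t \<in> B"
  shows "(restr N B, N) \<in> le"
  using restr_str[OF K_str[OF assms(1)] assms(2,3)] restr_sub[OF K_str[OF assms(1)] assms(2,3)]
    K_sub[OF assms(1)] assms(1) unfolding le_iff by blast

end

section \<open>The size of generated substructures\<close>

context vocab_universe
begin

text \<open>The tuple condition is split into extensionality and membership of each entry, so that
  induction provides a hypothesis for every entry.\<close>

inductive_set gen :: "'u str \<Rightarrow> 'u set \<Rightarrow> 'u set" for M A where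
  gen_base: "a \<in> A \<Longrightarrow> a \<in> gen M A"
| gen_step: "s \<in> Fsym \<tau> \<Longrightarrow> t \<in> extensional (underS \<mu> (far \<tau> s)) \<Longrightarrow>
    (\<And>i. i \<in> underS \<mu> (far \<tau> s) \<Longrightarrow> t i \<in> gen M A) \<Longrightarrow> fns M s t \<in> gen M A"

lemma gen_closed: "s \<in> Fsym \<tau> \<Longrightarrow> t \<in> ftuples s (gen M A) \<Longrightarrow> fns M s t \<in> gen M A"
  by (rule gen_step) (auto simp: tuples_def PiE_def)

lemma gen_least:
  assumes "A \<subseteq> B" "\<And>s t. s \<in> Fsym \<tau> \<Longrightarrow> t \<in> ftuples s B \<Longrightarrow> fns M s t \<in> B"
  shows "gen M A \<subseteq> B"
proof
  fix x assume "x \<in> gen M A"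
  then show "x \<in> B" by induction (use assms in \<open>auto simp: tuples_def PiE_def Pi_def\<close>)
qed

lemma gen_subset: "str M \<Longrightarrow> A \<subseteq> univ M \<Longrightarrow> gen M A \<subseteq> univ M"
  by (rule gen_least) (auto intro: fns_closed)

lemma gen_mono: "A \<subseteq> B \<Longrightarrow> gen M A \<subseteq> gen M B"
  by (rule gen_least) (auto intro: gen_base gen_closed)

text \<open>An operation has fewer than \<mu> arguments, each with a support of size below \<mu>; by
  regularity the union of these supports is again of size below \<mu>.\<close>

lemma gen_small_support: "gen M A \<subseteq> (\<Union>A0\<in>{A0. A0 \<subseteq> A \<and> |A0| <o \<mu>}. gen M A0)"
proof (rule gen_least)
  show "A \<subseteq> (\<Union>A0\<in>{A0. A0 \<subseteq> A \<and> |A0| <o \<mu>}. gen M A0)"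
  proof
    fix a assume "a \<in> A"
    then show "a \<in> (\<Union>A0\<in>{A0. A0 \<subseteq> A \<and> |A0| <o \<mu>}. gen M A0)"
      using less_mu_finite[of "{a}"] gen_base[of a "{a}" M] by (intro UN_I[of "{a}"]) auto
  qed
  fix s t assume s: "s \<in> Fsym \<tau>" and t: "t \<in> ftuples s (\<Union>A0\<in>{A0. A0 \<subseteq> A \<and> |A0| <o \<mu>}. gen M A0)"
  then have "\<forall>i\<in>underS \<mu> (far \<tau> s). \<exists>A0. A0 \<subseteq> A \<and> |A0| <o \<mu> \<and> t i \<in> gen M A0"
    by (auto simp: tuples_def)
  then obtain B where B: "\<And>i. i \<in> underS \<mu> (far \<tau> s) \<Longrightarrow> B i \<subseteq> A \<and> |B i| <o \<mu> \<and> t i \<in> gen M (B i)" by metis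
  let ?C = "\<Union>i\<in>underS \<mu> (far \<tau> s). B i"
  have "|?C| <o \<mu>" using B by (intro less_mu_UN card_underS_less far_Field s) blast
  moreover have "?C \<subseteq> A" using B by blast
  moreover have "fns M s t \<in> gen M ?C"
  proof (rule gen_step[OF s])
    show "t \<in> extensional (underS \<mu> (far \<tau> s))" using t by (simp add: tuples_def PiE_def)
    show "t i \<in> gen M ?C" if "i \<in> underS \<mu> (far \<tau> s)" for i
      using B[OF that] gen_mono[of "B i" ?C M] that by blast
  qed
  ultimately show "fns M s t \<in> (\<Union>A0\<in>{A0. A0 \<subseteq> A \<and> |A0| <o \<mu>}. gen M A0)"
    by (intro UN_I[of ?C]) auto
qed

text \<open>
  Elements of the generated substructure receive codes in a set closed under an injective coding of
  tuples; a code determines its element.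
\<close>

inductive coded for e :: "'u + 'u \<times> ('u \<Rightarrow> 'u) \<Rightarrow> 'u" and M A B where
  coded_base: "a \<in> A \<Longrightarrow> coded e M A B (e (Inl a)) a"
| coded_step: "s \<in> Fsym \<tau> \<Longrightarrow> t \<in> ftuples s B \<Longrightarrow> y \<in> extensional (underS \<mu> (far \<tau> s)) \<Longrightarrow>
    (\<And>i. i \<in> underS \<mu> (far \<tau> s) \<Longrightarrow> coded e M A B (t i) (y i)) \<Longrightarrow>
    coded e M A B (e (Inr (s, t))) (fns M s y)"

text \<open>Injectivity of \<open>e\<close> makes a code determine its element, and closure of
  \<open>B\<close> under \<open>e\<close> provides a code in \<open>B\<close> for every generated
  element. So \<open>B\<close> maps onto the generated set, and no transfinite iteration of closure
  steps has to be counted.\<close>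

lemma card_gen:
  assumes e: "inj_on e (A <+> (SIGMA s:Fsym \<tau>. ftuples s B))" "e ` (A <+> (SIGMA s:Fsym \<tau>. ftuples s B)) \<subseteq> B"
  shows "|gen M A| \<le>o |B|"
proof -
  have B: "b \<in> B" if "coded e M A B b x" for b x
    using that by cases (use e(2) in auto)
  have fn: "x = x'" if "coded e M A B b x" "coded e M A B b x'" for b x x'
    using that
  proof (induction arbitrary: x' rule: coded.induct)
    case (coded_base a)
    from coded_base(2) show ?case
    proof cases
      case coded_base
      then show ?thesis using e(1) \<open>a \<in> A\<close> by (auto dest!: inj_onD)
    next
      case (coded_step s t y)
      then have "Inl a = (Inr (s, t) :: 'u + 'u \<times> ('u \<Rightarrow> 'u))" using \<open>a \<in> A\<close> by (intro inj_onD[OF e(1)]) auto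
      then show ?thesis by simp
    qed
  next
    case (coded_step s t y)
    note st = coded_step.hyps(1,2) and y = coded_step.hyps(3) and IH = coded_step.IH
    from coded_step.prems show ?case
    proof cases
      case coded_base
      then have "Inl x' = (Inr (s, t) :: 'u + 'u \<times> ('u \<Rightarrow> 'u))" using st by (intro inj_onD[OF e(1)]) auto
      then show ?thesis by simp
    next
      case (coded_step s' t' y')
      then have "Inr (s, t) = (Inr (s', t') :: 'u + 'u \<times> ('u \<Rightarrow> 'u))"
        using st by (intro inj_onD[OF e(1)]) auto
      then have eq: "s' = s" "t' = t" by auto
      have "y i = y' i" for i
        using coded_step(5,6) eq y IH[of i "y' i"]
        by (cases "i \<in> underS \<mu> (far \<tau> s)") (auto simp: extensional_def)
      then have "y = y'" by blast
      then show ?thesis using coded_step(2) eq by simp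
    qed
  qed
  have "\<exists>b. coded e M A B b x" if "x \<in> gen M A" for x
    using that
  proof induction
    case (gen_base a)
    then show ?case using coded_base by blast
  next
    case (gen_step s t)
    then obtain b where b: "\<And>i. i \<in> underS \<mu> (far \<tau> s) \<Longrightarrow> coded e M A B (b i) (t i)" by metis
    have "coded e M A B (e (Inr (s, restrict b (underS \<mu> (far \<tau> s))))) (fns M s t)"
      by (rule coded_step[OF gen_step(1) _ gen_step(2)]) (use b B in \<open>auto simp: tuples_def\<close>)
    then show ?case by blast
  qed
  then have "gen M A \<subseteq> (\<lambda>b. THE x. coded e M A B b x) ` B"
    using B fn by (smt (verit, best) image_eqI subsetI the_equality)
  then show ?thesis by (rule ordLeq_transitive[OF card_of_mono1 card_of_image])
qed

text \<open>With \<open>X\<close> collecting the symbols and the ordinals below \<mu>, the cardinal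
  is 2 to the power |X|. Its powers with exponent below \<mu> do not exceed it, since for infinite
  \<open>X\<close> of size at least \<mu> the product of such an exponent with \<open>X\<close> is
  no larger than \<open>X\<close>.\<close>

lemma LST_cardinal:
  obtains B :: "'u set" where "small TYPE('u) B" "infinite B" "|(Fsym \<tau> <+> Rsym \<tau>) <+> Field \<mu>| \<le>o |B|"
    "|B| =o card_pow_less \<mu> B"
proof -
  let ?X = "(Fsym \<tau> <+> Rsym \<tau>) <+> Field \<mu>"
  have "small TYPE('u) (Fsym \<tau>)" "small TYPE('u) (Rsym \<tau>)" using voc by (auto simp: vocabulary_def)
  then have X: "small TYPE('u) ?X"
    unfolding Plus_def by (intro small_Un small_image small_Field_mu) auto
  obtain B :: "'u set" and c where c: "bij_betw c (Pow ?X) B" and B: "small TYPE('u) B"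
    using small_copy[OF small_Pow[OF X]] by blast
  have cB: "|Pow ?X| =o |B|" using c by (rule card_of_ordIsoI)
  have infF: "infinite (Field \<mu>)" using Cinfinite_mu by (simp add: cinfinite_def)
  have infX: "infinite ?X" using infF by simp
  have XB: "|?X| \<le>o |B|" by (rule ordLess_imp_ordLeq[OF ordLess_ordIso_trans[OF card_of_Pow cB]])
  have infB: "infinite B" using infX XB card_of_ordLeq_infinite by blast
  have FB: "|Field \<mu>| \<le>o |B|" by (rule ordLeq_transitive[OF card_of_Plus2 XB])
  have tB: "|tuples \<mu> \<alpha> B| \<le>o |B|" if \<alpha>: "\<alpha> \<in> Field \<mu>" for \<alpha>
  proof -
    define d where "d = inv_into (Pow ?X) c"
    have d: "inj_on d B" "\<And>b. b \<in> B \<Longrightarrow> d b \<subseteq> ?X"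
      using bij_betw_inv_into[OF c] unfolding d_def bij_betw_def by blast+
    \<comment> \<open>A tuple of subsets of \<open>X\<close> is a single subset of the product of
      its length with \<open>X\<close>.\<close>
    have "inj_on (\<lambda>t. SIGMA i:underS \<mu> \<alpha>. d (t i)) (tuples \<mu> \<alpha> B)"
    proof (rule inj_onI)
      fix t t' assume t: "t \<in> tuples \<mu> \<alpha> B" "t' \<in> tuples \<mu> \<alpha> B"
        and eq: "(SIGMA i:underS \<mu> \<alpha>. d (t i)) = (SIGMA i:underS \<mu> \<alpha>. d (t' i))"
      have "t i = t' i" if i: "i \<in> underS \<mu> \<alpha>" for i
      proof (rule inj_onD[OF d(1)])
        show "d (t i) = d (t' i)" using eq i by auto
        show "t i \<in> B" "t' i \<in> B" using t i by (auto simp: tuples_def)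
      qed
      then show "t = t'" using t unfolding tuples_def by (intro PiE_ext[of t _ _ t']) auto
    qed
    moreover have "(\<lambda>t. SIGMA i:underS \<mu> \<alpha>. d (t i)) ` tuples \<mu> \<alpha> B \<subseteq> Pow (underS \<mu> \<alpha> \<times> ?X)"
      using d(2) by (fastforce simp: tuples_def)
    ultimately have 1: "|tuples \<mu> \<alpha> B| \<le>o |Pow (underS \<mu> \<alpha> \<times> ?X)|" by (meson card_of_ordLeq)
    have "|underS \<mu> \<alpha>| \<le>o |?X|"
    proof -
      have "underS \<mu> \<alpha> \<subseteq> Field \<mu>" by (auto simp: underS_def Field_def)
      then show ?thesis by (rule ordLeq_transitive[OF card_of_mono1 card_of_Plus2])
    qed
    then have "|underS \<mu> \<alpha> \<times> ?X| \<le>o |?X|"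
      using infX by (intro card_of_Sigma_ordLeq_infinite) (auto intro: ordLeq_refl card_of_Card_order)
    then obtain g where g: "inj_on g (underS \<mu> \<alpha> \<times> ?X)" "g ` (underS \<mu> \<alpha> \<times> ?X) \<subseteq> ?X" by (meson card_of_ordLeq)
    have "|Pow (underS \<mu> \<alpha> \<times> ?X)| \<le>o |Pow ?X|"
      using card_of_ordLeq[of "Pow (underS \<mu> \<alpha> \<times> ?X)" "Pow ?X"] inj_on_image_Pow[OF g(1)] image_Pow_mono[OF g(2)] by blast
    then show ?thesis using ordLeq_transitive[OF 1] ordLeq_ordIso_trans[OF _ cB] by blast
  qed
  \<comment> \<open>Sequences of length one already give |B| many.\<close>
  have "|B| \<le>o card_pow_less \<mu> B"
  proof -
    obtain \<alpha> f where \<alpha>: "\<alpha> \<in> Field \<mu>" and f: "bij_betw f (underS \<mu> \<alpha>) {True}"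
      using less_mu_enum[OF less_mu_finite[of "{True}"]] by auto
    then obtain i where i: "i \<in> underS \<mu> \<alpha>" by (auto simp: bij_betw_def)
    have "inj_on (\<lambda>b. (\<alpha>, \<lambda>i\<in>underS \<mu> \<alpha>. b)) B"
      by (rule inj_onI) (use i in \<open>auto simp: fun_eq_iff split: if_splits\<close>)
    moreover have "(\<lambda>b. (\<alpha>, \<lambda>i\<in>underS \<mu> \<alpha>. b)) ` B \<subseteq> (SIGMA \<alpha>:Field \<mu>. tuples \<mu> \<alpha> B)"
      using \<alpha> by (auto simp: tuples_def)
    ultimately show ?thesis unfolding card_pow_less_def by (meson card_of_ordLeq)
  qed
  moreover have "card_pow_less \<mu> B \<le>o |B|" unfolding card_pow_less_def
    by (rule card_of_Sigma_ordLeq_infinite[OF infB FB]) (use tB in blast)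
  ultimately have "|B| =o card_pow_less \<mu> B" by (simp add: ordIso_iff_ordLeq)
  then show ?thesis using that[OF B infB XB] by blast
qed

text \<open>A set of size below \<mu> generates at most |B| elements by \<open>card_gen\<close>. The
  general case is a union of these over the short subsets of \<open>A\<close>, each the range of a
  short tuple, hence at most |A| to the power <\<mu> in number.\<close>

lemma gen_bound:
  assumes B: "infinite B" "|(Fsym \<tau> <+> Rsym \<tau>) <+> Field \<mu>| \<le>o |B|" "|B| =o card_pow_less \<mu> B"
  shows "|gen M A| \<le>o card_pow_less \<mu> A +c |B|"
proof -
  have FB: "|Field \<mu>| \<le>o |B|" by (rule ordLeq_transitive[OF card_of_Plus2 B(2)])
  have FsB: "|Fsym \<tau>| \<le>o |B|"
    by (rule ordLeq_transitive[OF card_of_Plus1 ordLeq_transitive[OF card_of_Plus1 B(2)]])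
  have tB: "|tuples \<mu> \<alpha> B| \<le>o |B|" if \<alpha>: "\<alpha> \<in> Field \<mu>" for \<alpha>
  proof -
    have "|tuples \<mu> \<alpha> B| \<le>o card_pow_less \<mu> B" unfolding card_pow_less_def
      by (rule iffD1[OF card_of_ordLeq]) (use \<alpha> in \<open>auto intro!: exI[of _ "Pair \<alpha>"] simp: inj_on_def\<close>)
    then show ?thesis using ordLeq_ordIso_trans[OF _ ordIso_symmetric[OF B(3)]] by blast
  qed
  have 0: "|gen M A0| \<le>o |B|" if A0: "|A0| <o \<mu>" for A0
  proof -
    have "|A0| \<le>o |Field \<mu>|"
      by (rule ordLeq_ordIso_trans[OF ordLess_imp_ordLeq[OF A0] ordIso_symmetric[OF card_of_Field_ordIso[OF Card_order_mu]]])
    then have A0B: "|A0| \<le>o |B|" using FB by (rule ordLeq_transitive)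
    have "|SIGMA s:Fsym \<tau>. ftuples s B| \<le>o |B|"
      by (rule card_of_Sigma_ordLeq_infinite[OF B(1) FsB]) (use tB far_Field in blast)
    then have "|A0 <+> (SIGMA s:Fsym \<tau>. ftuples s B)| \<le>o |B|"
      using A0B B(1) by (intro card_of_Plus_ordLeq_infinite_Field) (auto simp: Field_card_of card_of_card_order_on)
    then obtain e where "inj_on e (A0 <+> (SIGMA s:Fsym \<tau>. ftuples s B))"
       "e ` (A0 <+> (SIGMA s:Fsym \<tau>. ftuples s B)) \<subseteq> B" by (meson card_of_ordLeq)
    then show ?thesis by (rule card_gen)
  qed
  let ?P = "{A0. A0 \<subseteq> A \<and> |A0| <o \<mu>}"
  let ?S = "SIGMA \<alpha>:Field \<mu>. tuples \<mu> \<alpha> A"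
  let ?Z = "?S <+> B"
  have "?P \<subseteq> (\<lambda>(\<alpha>, t). t ` underS \<mu> \<alpha>) ` ?S"
  proof
    fix A0 assume A0: "A0 \<in> ?P"
    then obtain \<alpha> f where f: "\<alpha> \<in> Field \<mu>" "bij_betw f (underS \<mu> \<alpha>) A0" using less_mu_enum[of A0] by blast
    then have im: "f ` underS \<mu> \<alpha> = A0" by (simp add: bij_betw_def)
    have "restrict f (underS \<mu> \<alpha>) \<in> tuples \<mu> \<alpha> A" using im A0 by (auto simp: tuples_def)
    moreover have "restrict f (underS \<mu> \<alpha>) ` underS \<mu> \<alpha> = A0" using im by (simp cong: image_cong)
    ultimately show "A0 \<in> (\<lambda>(\<alpha>, t). t ` underS \<mu> \<alpha>) ` ?S"
      using f(1) by (intro image_eqI[of _ _ "(\<alpha>, restrict f (underS \<mu> \<alpha>))"]) simp_all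
  qed
  then have "|?P| \<le>o |?S|" by (rule ordLeq_transitive[OF card_of_mono1 card_of_image])
  then have 1: "|?P| \<le>o |?Z|" by (rule ordLeq_transitive[OF _ card_of_Plus1])
  have "|\<Union>A0\<in>?P. gen M A0| \<le>o |?Z|"
    by (rule card_of_UNION_ordLeq_infinite[OF _ 1]) (use B(1) ordLeq_transitive[OF 0 card_of_Plus2] in auto)
  moreover have "|gen M A| \<le>o |\<Union>A0\<in>?P. gen M A0|" by (rule card_of_mono1[OF gen_small_support])
  ultimately have "|gen M A| \<le>o |?Z|" by (rule ordLeq_transitive[rotated])
  then show ?thesis by (simp add: csum_def card_pow_less_def Field_card_of)
qed

end

section \<open>Universal classes are pseudo-universal\<close>

context universal_class
begin

lemma abstract_class_le: "abstract_class \<mu> \<tau> K le"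
  unfolding abstract_class_def
proof (intro conjI allI impI ballI; (elim conjE)?)
  show "vocabulary \<mu> \<tau>" by (rule voc)
  show "str M" if "M \<in> K" for M by (rule K_str[OF that])
  show "iso_closed \<mu> \<tau> K" using uni by (simp add: universal_mu_AEC_def)
  show "partial_order_on K le"
    unfolding partial_order_on_def preorder_on_def refl_on_def trans_def antisym_def
    using sub_refl[OF K_str] sub_trans sub_antisym[OF K_str K_str] by (auto simp: le_iff)
  show "sub M N" if "(M, N) \<in> le" for M N using that by (simp add: le_iff)
  fix M N M' N' f
  assume le: "(M, N) \<in> le" and M': "str M'" and N': "str N'" and f: "siso N f N'" "siso M f M'"
  have M: "M \<in> K" and N: "N \<in> K" and s: "sub M N" using le by (auto simp: le_iff)
  have e: "img f M = M'" "img f N = N'" by (rule iso_img_eq[OF K_str[OF M] M' f(2)], rule iso_img_eq[OF K_str[OF N] N' f(1)])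
  have "sub M' N'" using sub_img[OF K_str[OF M] s K_str[OF N] emb_inj[OF iso_emb[OF f(1)]]] unfolding e .
  then show "(M', N') \<in> le" unfolding le_iff using K_iso[OF M M' f(2)] K_iso[OF N N' f(1)] by blast
qed

lemma chain_le: "chain_axioms \<mu> \<tau> K le"
  unfolding chain_axioms_def
proof (intro allI impI)
  fix I r M assume sys: "directed_system \<mu> K le I r M"
  then have dir: "directed_poset \<mu> I r" and M: "\<And>i. i \<in> I \<Longrightarrow> M i \<in> K"
    and s: "\<And>i j. (i, j) \<in> r \<Longrightarrow> sub (M i) (M j)"
    by (auto simp: directed_system_def le_iff)
  have ss: "substr_system I r M" using dir K_str[OF M] s by (auto simp: substr_system_def)
  show "union_str \<mu> \<tau> I M \<in> K \<and> (\<forall>i\<in>I. (M i, union_str \<mu> \<tau> I M) \<in> le) \<and>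
        (\<forall>N\<in>K. (\<forall>i\<in>I. (M i, N) \<in> le) \<longrightarrow> (union_str \<mu> \<tau> I M, N) \<in> le)"
    using K_union[OF sys] M union_sub[OF ss] union_least[OF ss] by (simp add: le_iff)
qed

lemma LST_le: "LST \<mu> \<tau> K le"
proof -
  obtain B :: "'u set" where B: "small TYPE('u) B" "infinite B" "|(Fsym \<tau> <+> Rsym \<tau>) <+> Field \<mu>| \<le>o |B|"
    "|B| =o card_pow_less \<mu> B" by (rule LST_cardinal)
  show ?thesis unfolding LST_def
  proof (intro exI[of _ "|B|"] conjI ballI allI impI)
    show "Card_order |B|" by (rule card_of_Card_order)
    show "|B| <o |UNIV :: 'u set|" using B(1) by (simp add: small_def)
    show "|B| =o card_pow_less \<mu> (Field |B| )" using B(4) by (simp add: Field_card_of)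
    show "|Fsym \<tau> <+> Rsym \<tau>| +c \<mu> \<le>o |B|" using B(3) by (simp add: csum_def Field_card_of)
    fix M A assume M: "M \<in> K" and A: "A \<subseteq> univ M"
    have sub: "gen M A \<subseteq> univ M" by (rule gen_subset[OF K_str[OF M] A])
    have "(restr M (gen M A), M) \<in> le" by (rule restr_K[OF M sub gen_closed])
    moreover have "univ (restr M (gen M A)) = gen M A" by (simp add: restr_def)
    moreover have "A \<subseteq> gen M A" using gen_base by blast
    ultimately show "\<exists>M0. (M0, M) \<in> le \<and> A \<subseteq> univ M0 \<and> |univ M0| \<le>o card_pow_less \<mu> A +c |B|"
      using gen_bound[OF B(2-4), of M A] by metis
  qed
qed

theorem pseudo_universal: "pseudo_universal_mu_AEC \<mu> \<tau> K le"
  unfolding pseudo_universal_mu_AEC_def mu_AEC_def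
proof (intro conjI allI impI ballI; (elim conjE)?)
  show "abstract_class \<mu> \<tau> K le" by (rule abstract_class_le)
  show "coherence \<mu> \<tau> K le" by (simp add: coherence_def le_iff)
  show "chain_axioms \<mu> \<tau> K le" by (rule chain_le)
  show "LST \<mu> \<tau> K le" by (rule LST_le)
  show "admits_intersections K le" unfolding admits_intersections_def
  proof (intro ballI allI impI)
    fix N A assume N: "N \<in> K" and A: "A \<subseteq> univ N"
    have sub: "cl le N A \<subseteq> univ N" unfolding cl_def using N A sub_refl[OF K_str[OF N]] by (auto simp: le_iff)
    have "fns N s t \<in> cl le N A" if s: "s \<in> Fsym \<tau>" and t: "t \<in> ftuples s (cl le N A)" for s t
      unfolding cl_def
    proof (rule InterI)
      fix X assume "X \<in> {univ M |M. (M, N) \<in> le \<and> A \<subseteq> univ M}"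
      then obtain M where M: "X = univ M" "(M, N) \<in> le" "A \<subseteq> univ M" by blast
      then have MK: "M \<in> K" "sub M N" by (auto simp: le_iff)
      have "cl le N A \<subseteq> univ M" unfolding cl_def using M by blast
      then have t': "t \<in> ftuples s (univ M)" by (rule tuples_mono[OF _ t])
      then show "fns N s t \<in> X" using fns_closed[OF K_str[OF MK(1)] s t'] MK(2) s M(1) by (simp add: substr_def)
    qed
    from restr_K[OF N sub this] show "\<exists>M. (M, N) \<in> le \<and> univ M = cl le N A" by (auto simp: restr_def)
  qed
  fix M N f g A a
  assume M: "M \<in> K" and N: "N \<in> K" and A: "A \<subseteq> univ M" and f: "K_embedding \<mu> \<tau> le M f N" and g: "K_embedding \<mu> \<tau> le M g N"
    and ag: "\<forall>a\<in>A. f a = g a" and a: "a \<in> cl le M A"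
  have fe: "emb M f N" and ge: "emb M g N" using f g K_embedding_iff[OF M N] by blast+
  let ?E = "{x \<in> univ M. f x = g x}"
  have "fns M s t \<in> ?E" if s: "s \<in> Fsym \<tau>" and t: "t \<in> ftuples s ?E" for s t
  proof -
    have t': "t \<in> ftuples s (univ M)" by (rule tuples_mono[OF _ t]) blast
    have "fcmp s f t = fcmp s g t" using t by (rule compose_tuple_cong) blast
    then show ?thesis using emb_fns[OF fe s t'] emb_fns[OF ge s t'] fns_closed[OF K_str[OF M] s t'] by simp
  qed
  then have "(restr M ?E, M) \<in> le" by (intro restr_K[OF M]) auto
  moreover have "A \<subseteq> univ (restr M ?E)" using A ag by (auto simp: restr_def)
  ultimately have "a \<in> univ (restr M ?E)" using a unfolding cl_def by blast
  then show "f a = g a" by (simp add: restr_def)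
qed

end

section \<open>Pseudo-universal classes are locally multipresentable\<close>

lemma (in regular_universe) card_pow_less_mono:
  assumes "|A| \<le>o |B|" shows "card_pow_less \<mu> A \<le>o card_pow_less \<mu> B"
proof -
  obtain f where f: "inj_on f A" "f ` A \<subseteq> B" using assms by (meson card_of_ordLeq)
  let ?g = "\<lambda>(\<alpha>, t). (\<alpha>, compose (underS \<mu> \<alpha>) f t)"
  have "inj_on ?g (SIGMA \<alpha>:Field \<mu>. tuples \<mu> \<alpha> A)"
  proof (rule inj_onI)
    fix p p' assume p: "p \<in> (SIGMA \<alpha>:Field \<mu>. tuples \<mu> \<alpha> A)" "p' \<in> (SIGMA \<alpha>:Field \<mu>. tuples \<mu> \<alpha> A)" and e: "?g p = ?g p'"
    obtain \<alpha> t t' where pp: "p = (\<alpha>, t)" "p' = (\<alpha>, t')" using e by (cases p, cases p') auto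
    have "t i = t' i" if i: "i \<in> underS \<mu> \<alpha>" for i
    proof (rule inj_onD[OF f(1)])
      show "f (t i) = f (t' i)" using e i pp by (auto simp: compose_def dest: fun_cong[of _ _ i])
      show "t i \<in> A" "t' i \<in> A" using p pp i by (auto simp: tuples_def)
    qed
    then have "t = t'" using p pp unfolding tuples_def by (intro PiE_ext[of t _ _ t']) auto
    then show "p = p'" using pp by simp
  qed
  moreover have "?g ` (SIGMA \<alpha>:Field \<mu>. tuples \<mu> \<alpha> A) \<subseteq> (SIGMA \<alpha>:Field \<mu>. tuples \<mu> \<alpha> B)"
    using f(2) by (auto intro!: tuples_compose)
  ultimately show ?thesis unfolding card_pow_less_def by (meson card_of_ordLeq)
qed

lemma cocone_posetI:
  assumes "X \<in> Ob C" "\<And>i. i \<in> I \<Longrightarrow> c i \<in> Hom C (FO D i) X" "c \<in> extensional I"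
    "\<And>i j. (i, j) \<in> r \<Longrightarrow> Cmp C (c j) (FA D (i, j)) = c i"
  shows "cocone C (poset_cat I r) D X c"
  using assms by (auto simp: cocone_def PiE_def)

locale pseudo_class = vocab_universe \<mu> \<tau> for \<mu> :: "'u rel" and \<tau> +
  fixes K :: "'u str set" and le :: "'u str rel"
  assumes pu: "pseudo_universal_mu_AEC \<mu> \<tau> K le"
begin

abbreviation "Kemb \<equiv> K_embedding \<mu> \<tau> le"

lemma ac: "abstract_class \<mu> \<tau> K le" and coh: "coherence \<mu> \<tau> K le" and chain: "chain_axioms \<mu> \<tau> K le"
    and lst: "LST \<mu> \<tau> K le" and inter: "admits_intersections K le"
  using pu by (auto simp: pseudo_universal_mu_AEC_def mu_AEC_def)

lemma K_str: "M \<in> K \<Longrightarrow> str M"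
  using ac by (simp add: abstract_class_def)

lemma K_iso: "M \<in> K \<Longrightarrow> str N \<Longrightarrow> siso M f N \<Longrightarrow> N \<in> K"
  using ac unfolding abstract_class_def iso_closed_def by blast

lemma le_po: "partial_order_on K le"
  using ac by (simp add: abstract_class_def)

lemma le_K1: "(M, N) \<in> le \<Longrightarrow> M \<in> K" and le_K2: "(M, N) \<in> le \<Longrightarrow> N \<in> K"
  using le_po unfolding partial_order_on_def preorder_on_def refl_on_def by auto

lemma le_refl: "M \<in> K \<Longrightarrow> (M, M) \<in> le"
  using le_po unfolding partial_order_on_def preorder_on_def refl_on_def by auto

lemma le_trans: "(M, N) \<in> le \<Longrightarrow> (N, P) \<in> le \<Longrightarrow> (M, P) \<in> le"
  using le_po unfolding partial_order_on_def preorder_on_def by (auto dest: transD)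

lemma le_sub: "(M, N) \<in> le \<Longrightarrow> sub M N"
  using ac by (simp add: abstract_class_def)

lemma le_univ: "(M, N) \<in> le \<Longrightarrow> univ M \<subseteq> univ N"
  using le_sub sub_univ by blast

lemma K_img: "M \<in> K \<Longrightarrow> inj_on f (univ M) \<Longrightarrow> img f M \<in> K"
  using K_iso img_str_iso[OF K_str] by blast

lemma le_img:
  assumes le: "(M, N) \<in> le" and inj: "inj_on f (univ N)"
  shows "(img f M, img f N) \<in> le"
proof -
  have M: "str M" and N: "str N" using K_str le_K1[OF le] le_K2[OF le] by blast+
  have "inj_on f (univ M)" using inj le_univ[OF le] by (rule inj_on_subset)
  note i = img_str_iso[OF M this] and j = img_str_iso[OF N inj]
  have "\<forall>M N M' N' f. (M, N) \<in> le \<and> str M' \<and> str N' \<and> siso N f N' \<and> siso M f M' \<longrightarrow> (M', N') \<in> le"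
    using ac unfolding abstract_class_def by (elim conjE)
  then show ?thesis using le i j by blast
qed

text \<open>Coherence in the form used throughout: below a common \<open>N\<close> the order is
  inclusion of universes.\<close>

lemma le_coherent: "(M, N) \<in> le \<Longrightarrow> (P, N) \<in> le \<Longrightarrow> univ M \<subseteq> univ P \<Longrightarrow> (M, P) \<in> le"
  using coh sub_subset[OF le_sub le_sub] le_K1 le_K2 unfolding coherence_def by blast

lemma le_eq: "(M, N) \<in> le \<Longrightarrow> (P, N) \<in> le \<Longrightarrow> univ M = univ P \<Longrightarrow> M = P"
  using sub_eq[OF K_str K_str le_sub le_sub] le_K1 by blast

text \<open>The intermediate structure in the definition of a K-embedding can only be the copy
  \<open>img f M\<close>.\<close>

lemma Kemb_iff:
  assumes M: "M \<in> K"
  shows "Kemb M f N \<longleftrightarrow> inj_on f (univ M) \<and> (img f M, N) \<in> le"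
proof
  assume "Kemb M f N"
  then obtain M' where M': "str M'" "siso M f M'" "(M', N) \<in> le" by (auto simp: K_embedding_def)
  then show "inj_on f (univ M) \<and> (img f M, N) \<in> le"
    using iso_img_eq[OF K_str[OF M] M'(1,2)] emb_inj[OF iso_emb[OF M'(2)]] by simp
next
  assume "inj_on f (univ M) \<and> (img f M, N) \<in> le"
  then show "Kemb M f N" unfolding K_embedding_def using img_str_iso[OF K_str[OF M], of f] by blast
qed

lemma Kemb_inj: "M \<in> K \<Longrightarrow> Kemb M f N \<Longrightarrow> inj_on f (univ M)"
  and Kemb_le: "M \<in> K \<Longrightarrow> Kemb M f N \<Longrightarrow> (img f M, N) \<in> le"
  by (simp_all add: Kemb_iff)

lemma Kemb_fn: "M \<in> K \<Longrightarrow> Kemb M f N \<Longrightarrow> f \<in> univ M \<rightarrow> univ N"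
  using le_univ[OF Kemb_le, of M f N] by auto

lemma Kemb_cong: "M \<in> K \<Longrightarrow> (\<And>x. x \<in> univ M \<Longrightarrow> f x = g x) \<Longrightarrow> Kemb M f N \<Longrightarrow> Kemb M g N"
  unfolding Kemb_iff using img_img[OF K_str, of M f "\<lambda>x. x" g] img_id[OF img_str_iso(1)[OF K_str], of M f "\<lambda>x. x"]
  by (metis (no_types, lifting) inj_on_cong inj_on_id2)

lemma le_Kemb: "(M, N) \<in> le \<Longrightarrow> (\<And>x. x \<in> univ M \<Longrightarrow> f x = x) \<Longrightarrow> Kemb M f N"
  by (rule Kemb_cong[of _ "\<lambda>x. x"])
    (auto simp: Kemb_iff le_K1 img_id[OF K_str[OF le_K1]])

lemma Kemb_img: "M \<in> K \<Longrightarrow> inj_on f (univ M) \<Longrightarrow> Kemb M f (img f M)"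
  by (simp add: Kemb_iff le_refl K_img)

lemma Kemb_comp:
  assumes M: "M \<in> K" and N: "N \<in> K" and f: "Kemb M f N" and g: "Kemb N g P" and h: "\<And>x. x \<in> univ M \<Longrightarrow> h x = g (f x)"
  shows "Kemb M h P"
proof -
  have fi: "inj_on f (univ M)" "(img f M, N) \<in> le" and gi: "inj_on g (univ N)" "(img g N, P) \<in> le"
    using f g Kemb_iff M N by blast+
  have gf: "inj_on g (f ` univ M)" using inj_on_subset[OF gi(1)] Kemb_fn[OF M f] by blast
  have "img g (img f M) = img h M" by (rule img_img[OF K_str[OF M] fi(1) gf h])
  then have "(img h M, P) \<in> le" using le_trans[OF le_img[OF fi(2) gi(1)] gi(2)] by simp
  moreover have "inj_on h (univ M)" using comp_inj_on[OF fi(1) gf] inj_on_cong[of "univ M" h "g \<circ> f"] h by simp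
  ultimately show ?thesis by (simp add: Kemb_iff[OF M])
qed

text \<open>Both images lie below \<open>N\<close>, so coherence puts the image of \<open>M\<close>
  below that of \<open>P\<close>; the inverse of \<open>g\<close> carries this relation back to
  \<open>P\<close>.\<close>

lemma Kemb_factor:
  assumes M: "M \<in> K" and P: "P \<in> K" and f: "Kemb M f N" and g: "Kemb P g N" and sub: "f ` univ M \<subseteq> g ` univ P"
  shows "\<exists>h. Kemb M h P \<and> (\<forall>x\<in>univ M. g (h x) = f x)"
proof -
  let ?g = "inv_into (univ P) g"
  have fi: "inj_on f (univ M)" "(img f M, N) \<in> le" and gi: "inj_on g (univ P)" "(img g P, N) \<in> le"
    using f g Kemb_iff M P by blast+
  have ginv: "inj_on ?g (g ` univ P)" by (rule inj_on_inv_into) simp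
  have "(img f M, img g P) \<in> le" by (rule le_coherent[OF fi(2) gi(2)]) (use sub in simp)
  then have "(img ?g (img f M), img ?g (img g P)) \<in> le" by (rule le_img) (use ginv in simp)
  moreover have "img ?g (img g P) = P"
  proof -
    have "img ?g (img g P) = img (\<lambda>x. x) P" by (rule img_img[OF K_str[OF P] gi(1) ginv]) (use gi(1) in simp)
    then show ?thesis using img_id[OF K_str[OF P], of "\<lambda>x. x"] by simp
  qed
  moreover have "img ?g (img f M) = img (\<lambda>x. ?g (f x)) M"
    by (rule img_img[OF K_str[OF M] fi(1) inj_on_subset[OF ginv sub]]) simp
  moreover have "inj_on (\<lambda>x. ?g (f x)) (univ M)"
    using comp_inj_on[OF fi(1) inj_on_subset[OF ginv sub]] by (simp add: comp_def)
  ultimately have "Kemb M (\<lambda>x. ?g (f x)) P" by (simp add: Kemb_iff[OF M])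
  moreover have "\<forall>x\<in>univ M. g (?g (f x)) = f x" using sub by (auto simp: f_inv_into_f)
  ultimately show ?thesis by (intro exI[of _ "\<lambda>x. ?g (f x)"]) simp
qed

subsection \<open>The category\<close>

abbreviation "CC \<equiv> class_cat \<mu> \<tau> K le"

definition arr :: "'u str \<Rightarrow> ('u \<Rightarrow> 'u) \<Rightarrow> 'u str \<Rightarrow> 'u str \<times> ('u \<Rightarrow> 'u) \<times> 'u str" where
  "arr M f N = (M, restrict f (univ M), N)"

definition fn :: "'u str \<times> ('u \<Rightarrow> 'u) \<times> 'u str \<Rightarrow> 'u \<Rightarrow> 'u" where
  "fn x = fst (snd x)"

lemma CC_Ob: "Ob CC = K"
  by (simp add: class_cat_def)

lemma CC_Hom: "x \<in> Hom CC M N \<longleftrightarrow> M \<in> K \<and> N \<in> K \<and> fst x = M \<and> snd (snd x) = N \<and> fn x \<in> extensional (univ M) \<and> Kemb M (fn x) N"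
  unfolding class_cat_def concrete_Hom by (cases x) (auto simp: fn_def)

lemma Hom_K1: "x \<in> Hom CC M N \<Longrightarrow> M \<in> K" and Hom_K2: "x \<in> Hom CC M N \<Longrightarrow> N \<in> K"
  and Hom_Kemb: "x \<in> Hom CC M N \<Longrightarrow> Kemb M (fn x) N"
  by (simp_all add: CC_Hom)

lemma Hom_inj: "x \<in> Hom CC M N \<Longrightarrow> a \<in> univ M \<Longrightarrow> b \<in> univ M \<Longrightarrow> fn x a = fn x b \<Longrightarrow> a = b"
  using Kemb_inj[OF Hom_K1[of x M N] Hom_Kemb[of x M N]] by (auto dest: inj_onD)

lemma Hom_fn: "x \<in> Hom CC M N \<Longrightarrow> a \<in> univ M \<Longrightarrow> fn x a \<in> univ N"
  using Kemb_fn[OF Hom_K1[of x M N] Hom_Kemb[of x M N]] by blast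

lemma arr_Hom: "M \<in> K \<Longrightarrow> N \<in> K \<Longrightarrow> Kemb M f N \<Longrightarrow> arr M f N \<in> Hom CC M N"
  unfolding CC_Hom by (auto simp: arr_def fn_def intro: Kemb_cong[of M f])

lemma fn_arr: "a \<in> univ M \<Longrightarrow> fn (arr M f N) a = f a"
  by (simp add: fn_def arr_def)

lemma Hom_eqI: "x \<in> Hom CC M N \<Longrightarrow> y \<in> Hom CC M N \<Longrightarrow> (\<And>a. a \<in> univ M \<Longrightarrow> fn x a = fn y a) \<Longrightarrow> x = y"
  unfolding CC_Hom fn_def by (cases x, cases y) (auto intro: extensionalityI)

lemma fn_Cmp: "x \<in> Hom CC M N \<Longrightarrow> y \<in> Hom CC N P \<Longrightarrow> a \<in> univ M \<Longrightarrow> fn (Cmp CC y x) a = fn y (fn x a)"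
  unfolding CC_Hom by (cases x, cases y) (auto simp: class_cat_def fn_def compose_def)

lemma fn_Idt: "a \<in> univ M \<Longrightarrow> fn (Idt CC M) a = a"
  by (simp add: class_cat_def fn_def)

lemma category_CC: "category CC"
  unfolding class_cat_def
proof (rule category_concrete)
  show "Kemb M (\<lambda>x\<in>univ M. x) M" if "M \<in> K" for M by (rule le_Kemb[OF le_refl[OF that]]) simp
  show "Kemb A (compose (univ A) g f) D" if "A \<in> K" "B \<in> K" "Kemb A f B" "Kemb B g D" for A B D f g
    by (rule Kemb_comp[OF that]) (simp add: compose_def)
  show "f \<in> univ A \<rightarrow> univ B" if "A \<in> K" "Kemb A f B" for A B f by (rule Kemb_fn[OF that])
qed

lemma mono_CC: "\<forall>f\<in>Ar CC. mono_arrow CC f"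
proof
  fix f assume f: "f \<in> Ar CC"
  then have fH: "f \<in> Hom CC (Src CC f) (Tgt CC f)" by (simp add: Hom_iff)
  show "mono_arrow CC f" unfolding mono_arrow_def
  proof (intro conjI ballI impI)
    fix A g h assume g: "g \<in> Hom CC A (Src CC f)" and h: "h \<in> Hom CC A (Src CC f)" and e: "Cmp CC f g = Cmp CC f h"
    show "g = h"
    proof (rule Hom_eqI[OF g h])
      fix a assume a: "a \<in> univ A"
      show "fn g a = fn h a"
        by (rule Hom_inj[OF fH Hom_fn[OF g a] Hom_fn[OF h a]])
          (use fn_Cmp[OF g fH a] fn_Cmp[OF h fH a] e in simp)
    qed
  qed (rule f)
qed

lemma small_Hom_CC: "small TYPE('u) (Hom CC M N)"
proof (cases "M \<in> K \<and> N \<in> K")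
  case True
  have "Hom CC M N \<subseteq> (\<lambda>f. (M, f, N)) ` (univ M \<rightarrow>\<^sub>E univ N)"
    using Kemb_fn by (auto simp: CC_Hom fn_def PiE_def image_iff) 
  moreover have "small TYPE('u) (univ M \<rightarrow>\<^sub>E univ N)"
    using True K_str str_small by (intro small_PiE) auto
  ultimately show ?thesis using small_subset small_image by blast
next
  case False
  then have "Hom CC M N = {}" by (auto simp: CC_Hom)
  then show ?thesis using small_finite[of "{} :: ('u str \<times> ('u \<Rightarrow> 'u) \<times> 'u str) set"] by simp
qed

lemma locally_small_CC: "locally_small TYPE('u) CC"
  unfolding locally_small_def using small_Hom_CC by blast

text \<open>Allows an object to be replaced by a copy inside a prescribed set, which is what makes
  the families of generators and of cocones small.\<close>

lemma img_inverse_arrows: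
  assumes M: "M \<in> K" and f: "inj_on f (univ M)"
  shows "inverse_arrows CC M (img f M) (arr M f (img f M)) (arr (img f M) (inv_into (univ M) f) M)"
proof -
  let ?g = "inv_into (univ M) f"
  have P: "img f M \<in> K" by (rule K_img[OF M f])
  have "img ?g (img f M) = M"
    using img_img[OF K_str[OF M] f inj_on_inv_into[of "f ` univ M" f "univ M"], of "\<lambda>x. x"]
      img_id[OF K_str[OF M], of "\<lambda>x. x"] f by simp
  moreover have "inj_on ?g (univ (img f M))" using inj_on_inv_into[of "f ` univ M" f "univ M"] by simp
  ultimately have g: "Kemb (img f M) ?g M" using Kemb_img[OF P, of ?g] by simp
  have u: "arr M f (img f M) \<in> Hom CC M (img f M)" by (rule arr_Hom[OF M P Kemb_img[OF M f]])
  have v: "arr (img f M) ?g M \<in> Hom CC (img f M) M" by (rule arr_Hom[OF P M g])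
  show ?thesis unfolding inverse_arrows_def
  proof (intro conjI)
    show "Cmp CC (arr (img f M) ?g M) (arr M f (img f M)) = Idt CC M"
    proof (rule Hom_eqI[OF Cmp_Hom[OF category_CC u v] Idt_Hom[OF category_CC]])
      show "M \<in> Ob CC" using M by (simp add: CC_Ob)
      fix a assume a: "a \<in> univ M"
      show "fn (Cmp CC (arr (img f M) ?g M) (arr M f (img f M))) a = fn (Idt CC M) a"
        using fn_Cmp[OF u v a] a f by (simp add: fn_arr fn_Idt)
    qed
    show "Cmp CC (arr M f (img f M)) (arr (img f M) ?g M) = Idt CC (img f M)"
    proof (rule Hom_eqI[OF Cmp_Hom[OF category_CC v u] Idt_Hom[OF category_CC]])
      show "img f M \<in> Ob CC" using P by (simp add: CC_Ob)
      fix a assume a: "a \<in> univ (img f M)"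
      show "fn (Cmp CC (arr M f (img f M)) (arr (img f M) ?g M)) a = fn (Idt CC (img f M)) a"
        using fn_Cmp[OF v u a] a by (auto simp: fn_arr fn_Idt f_inv_into_f inv_into_into)
    qed
  qed (rule u, rule v)
qed

subsection \<open>Directed colimits\<close>

context
  fixes I r E
  assumes dir: "directed_poset \<mu> I r" and E: "is_functor (poset_cat I r) CC E"
begin

private lemma EK: "i \<in> I \<Longrightarrow> FO E i \<in> K"
  using FO_Ob[OF E] by (simp add: CC_Ob)

private lemma EH: "(i, j) \<in> r \<Longrightarrow> FA E (i, j) \<in> Hom CC (FO E i) (FO E j)"
  using FA_Hom[OF E, of "(i, j)" i j] by (simp add: Hom_iff)

private lemma EC: "(i, j) \<in> r \<Longrightarrow> (j, k) \<in> r \<Longrightarrow> a \<in> univ (FO E i) \<Longrightarrow> fn (FA E (i, k)) a = fn (FA E (j, k)) (fn (FA E (i, j)) a)"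
  using fn_Cmp[OF EH EH, of i j k a] FA_Cmp[OF E, of "(i, j)" i j "(j, k)" k] by (simp add: Hom_iff)

private lemma cocone_fn:
  assumes "cocone CC (poset_cat I r) E X c" "(i, j) \<in> r" "a \<in> univ (FO E i)"
  shows "fn (c i) a = fn (c j) (fn (FA E (i, j)) a)"
proof -
  have j: "j \<in> I" using directed_poset_facts[OF dir] assms(2) by blast
  have "Cmp CC (c j) (FA E (i, j)) = c i" using cocone_commute[OF assms(1), of "(i, j)"] assms(2) by simp
  then show ?thesis using fn_Cmp[OF EH[OF assms(2)] cocone_arrow[OF assms(1), of j] assms(3)] j by simp
qed

text \<open>Joint surjectivity forces \<open>h (c i a) = d i a\<close> for every other cocone
  \<open>d\<close>. This is well defined and injective, and it is a K-embedding because its image is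
  the union of the directed system of the images of the \<open>d i\<close>, which lies below
  \<open>Y\<close> by the chain axioms.\<close>

lemma jointly_surjective_colimit:
  assumes c: "cocone CC (poset_cat I r) E X c" and surj: "univ X \<subseteq> (\<Union>i\<in>I. fn (c i) ` univ (FO E i))"
  shows "is_colimit CC (poset_cat I r) E X c"
  unfolding is_colimit_iff
proof (intro conjI allI impI)
  show "cocone CC (poset_cat I r) E X c" by (rule c)
  fix Y d assume d: "cocone CC (poset_cat I r) E Y d"
  have X: "X \<in> K" and Y: "Y \<in> K" using cocone_Ob[OF c] cocone_Ob[OF d] by (simp_all add: CC_Ob)
  have cH: "c i \<in> Hom CC (FO E i) X" and dH: "d i \<in> Hom CC (FO E i) Y" if "i \<in> I" for i
    using cocone_arrow[OF c] cocone_arrow[OF d] that by simp_all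
  \<comment> \<open>Legs are injective, so either cocone identifies two elements exactly when they
    agree at a common later stage.\<close>
  have eq: "fn (c i) a = fn (c j) b \<longleftrightarrow> fn (d i) a = fn (d j) b"
    if ij: "i \<in> I" "j \<in> I" and a: "a \<in> univ (FO E i)" and b: "b \<in> univ (FO E j)" for i j a b
  proof -
    obtain k where k: "k \<in> I" "(i, k) \<in> r" "(j, k) \<in> r" using directed_upper2[OF dir ij] by blast
    let ?a = "fn (FA E (i, k)) a" and ?b = "fn (FA E (j, k)) b"
    have ab: "?a \<in> univ (FO E k)" "?b \<in> univ (FO E k)" using Hom_fn[OF EH] k a b by blast+
    have "fn (c i) a = fn (c j) b \<longleftrightarrow> ?a = ?b"
      using cocone_fn[OF c k(2) a] cocone_fn[OF c k(3) b] Hom_inj[OF cH[OF k(1)] ab] by auto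
    moreover have "fn (d i) a = fn (d j) b \<longleftrightarrow> ?a = ?b"
      using cocone_fn[OF d k(2) a] cocone_fn[OF d k(3) b] Hom_inj[OF dH[OF k(1)] ab] by auto
    ultimately show ?thesis by simp
  qed
  have "\<forall>x\<in>univ X. \<exists>i a. i \<in> I \<and> a \<in> univ (FO E i) \<and> x = fn (c i) a" using surj by blast
  then obtain ix av where ia: "\<And>x. x \<in> univ X \<Longrightarrow> ix x \<in> I" "\<And>x. x \<in> univ X \<Longrightarrow> av x \<in> univ (FO E (ix x))"
    "\<And>x. x \<in> univ X \<Longrightarrow> x = fn (c (ix x)) (av x)" by metis
  define h where "h x = fn (d (ix x)) (av x)" for x
  have h: "h (fn (c i) a) = fn (d i) a" if i: "i \<in> I" and a: "a \<in> univ (FO E i)" for i a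
  proof -
    have x: "fn (c i) a \<in> univ X" by (rule Hom_fn[OF cH[OF i] a])
    show ?thesis unfolding h_def using eq[OF i ia(1)[OF x] a ia(2)[OF x]] ia(3)[OF x] by simp
  qed
  have hinj: "inj_on h (univ X)"
  proof (rule inj_onI)
    fix x y assume xy: "x \<in> univ X" "y \<in> univ X" "h x = h y"
    then show "x = y" using eq[OF ia(1)[OF xy(1)] ia(1)[OF xy(2)] ia(2)[OF xy(1)] ia(2)[OF xy(2)]] ia(3) xy
      unfolding h_def by metis
  qed
  have hX: "img h X \<in> K" by (rule K_img[OF X hinj])
  define N where "N i = img (fn (d i)) (FO E i)" for i
  have NY: "(N i, Y) \<in> le" if "i \<in> I" for i unfolding N_def using Kemb_le[OF EK[OF that] Hom_Kemb[OF dH[OF that]]] .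
  have Nu: "univ (N i) = fn (d i) ` univ (FO E i)" for i by (simp add: N_def)
  have Nr: "(N i, N j) \<in> le" if ij: "(i, j) \<in> r" for i j
  proof (rule le_coherent[OF NY NY])
    show "i \<in> I" "j \<in> I" using directed_poset_facts[OF dir] ij by blast+
    show "univ (N i) \<subseteq> univ (N j)" using cocone_fn[OF d ij] Hom_fn[OF EH[OF ij]] by (auto simp: Nu)
  qed
  have "directed_system \<mu> K le I r N"
    using dir Nr le_K1[OF NY] by (auto simp: directed_system_def)
  then have ch: "\<forall>P\<in>K. (\<forall>i\<in>I. (N i, P) \<in> le) \<longrightarrow> (union_str \<mu> \<tau> I N, P) \<in> le"
    using chain by (simp add: chain_axioms_def)
  have "(N i, img h X) \<in> le" if i: "i \<in> I" for i
  proof -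
    have "(img h (img (fn (c i)) (FO E i)), img h X) \<in> le"
      by (rule le_img[OF Kemb_le[OF EK[OF i] Hom_Kemb[OF cH[OF i]]] hinj])
    moreover have "inj_on h (fn (c i) ` univ (FO E i))"
      by (rule inj_on_subset[OF hinj]) (use Hom_fn[OF cH[OF i]] in auto)
    then have "img h (img (fn (c i)) (FO E i)) = N i" unfolding N_def
      by (rule img_img[OF K_str[OF EK[OF i]] Kemb_inj[OF EK[OF i] Hom_Kemb[OF cH[OF i]]]])
        (use h[OF i] in simp)
    ultimately show ?thesis by simp
  qed
  then have 1: "(union_str \<mu> \<tau> I N, img h X) \<in> le" using ch hX by blast
  have 2: "(union_str \<mu> \<tau> I N, Y) \<in> le" using ch Y NY by blast
  have "univ (img h X) \<subseteq> univ (union_str \<mu> \<tau> I N)"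
  proof
    fix y assume "y \<in> univ (img h X)"
    then obtain x where x: "x \<in> univ X" "y = h x" by auto
    then show "y \<in> univ (union_str \<mu> \<tau> I N)" using ia(1,2)[OF x(1)] by (auto simp: union_str_def Let_def Nu h_def)
  qed
  \<comment> \<open>Both lie below \<open>img h X\<close> and have the same universe; being below
    \<open>Y\<close> passes from the union to the image of \<open>h\<close>.\<close>
  then have "union_str \<mu> \<tau> I N = img h X" using le_eq[OF 1 le_refl[OF hX]] le_univ[OF 1] by blast
  then have hE: "Kemb X h Y" using 2 hinj by (simp add: Kemb_iff[OF X])
  show "\<exists>!k. cocone_map CC (poset_cat I r) X c Y d k"
  proof (rule ex_ex1I)
    have hH: "arr X h Y \<in> Hom CC X Y" by (rule arr_Hom[OF X Y hE])
    have "Cmp CC (arr X h Y) (c i) = d i" if i: "i \<in> I" for i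
      by (rule Hom_eqI[OF Cmp_Hom[OF category_CC cH[OF i] hH] dH[OF i]])
        (simp add: fn_Cmp[OF cH[OF i] hH] fn_arr Hom_fn[OF cH[OF i]] h[OF i])
    then show "\<exists>k. cocone_map CC (poset_cat I r) X c Y d k"
      using hH by (intro exI[of _ "arr X h Y"]) (simp add: cocone_map_def)
    fix k k' assume k: "cocone_map CC (poset_cat I r) X c Y d k" "cocone_map CC (poset_cat I r) X c Y d k'"
    then have H: "k \<in> Hom CC X Y" "k' \<in> Hom CC X Y" by (auto simp: cocone_map_def)
    show "k = k'"
    proof (rule Hom_eqI[OF H])
      fix x assume x: "x \<in> univ X"
      have "Cmp CC k (c (ix x)) = Cmp CC k' (c (ix x))" using k ia(1)[OF x] by (simp add: cocone_map_def)
      then show "fn k x = fn k' x"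
        using fn_Cmp[OF cH[OF ia(1)[OF x]] H(1) ia(2)[OF x]] fn_Cmp[OF cH[OF ia(1)[OF x]] H(2) ia(2)[OF x]] ia(3)[OF x] by simp
    qed
  qed
qed

text \<open>The disjoint union modulo eventual equality, with the classes coded by elements of
  \<open>'u\<close> so that they can form a universe. After this renaming the transition maps are
  inclusions, and the chain axioms supply the union.\<close>

lemma directed_colimit_exists:
  "\<exists>X c. cocone CC (poset_cat I r) E X c \<and> univ X \<subseteq> (\<Union>i\<in>I. fn (c i) ` univ (FO E i))"
proof -
  note po = directed_poset_facts[OF dir]
  define Z where "Z = (SIGMA i:I. univ (FO E i))"
  define sim where "sim p q \<longleftrightarrow> (\<exists>k. (fst p, k) \<in> r \<and> (fst q, k) \<in> r \<and>
     fn (FA E (fst p, k)) (snd p) = fn (FA E (fst q, k)) (snd q))" for p q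
  have sim_refl: "sim p p" if "p \<in> Z" for p
    unfolding sim_def using that po(4) by (intro exI[of _ "fst p"]) (auto simp: Z_def)
  have sim_sym: "sim p q \<Longrightarrow> sim q p" for p q unfolding sim_def by metis
  have sim_trans: "sim p s" if p: "p \<in> Z" "q \<in> Z" "s \<in> Z" and pq: "sim p q" and qs: "sim q s" for p q s
  proof -
    obtain k where k: "(fst p, k) \<in> r" "(fst q, k) \<in> r" "fn (FA E (fst p, k)) (snd p) = fn (FA E (fst q, k)) (snd q)"
      using pq unfolding sim_def by blast
    obtain m where m: "(fst q, m) \<in> r" "(fst s, m) \<in> r" "fn (FA E (fst q, m)) (snd q) = fn (FA E (fst s, m)) (snd s)"
      using qs unfolding sim_def by blast
    obtain n where n: "(k, n) \<in> r" "(m, n) \<in> r" using directed_upper2[OF dir po(3)[OF k(1)] po(3)[OF m(1)]] by blast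
    have z: "snd p \<in> univ (FO E (fst p))" "snd q \<in> univ (FO E (fst q))" "snd s \<in> univ (FO E (fst s))"
      using p by (auto simp: Z_def)
    have "fn (FA E (fst p, n)) (snd p) = fn (FA E (fst s, n)) (snd s)"
      using EC[OF k(1) n(1) z(1)] EC[OF k(2) n(1) z(2)] EC[OF m(1) n(2) z(2)] EC[OF m(2) n(2) z(3)] k(3) m(3) by simp
    then show ?thesis unfolding sim_def using po(5)[OF k(1) n(1)] po(5)[OF m(2) n(2)] by blast
  qed
  define q where "q p = {p' \<in> Z. sim p p'}" for p
  have q_eq: "q p = q p' \<longleftrightarrow> sim p p'" if p: "p \<in> Z" "p' \<in> Z" for p p'
  proof
    assume "q p = q p'"
    then show "sim p p'" using sim_refl[OF p(2)] p unfolding q_def by blast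
  next
    assume s: "sim p p'"
    show "q p = q p'" unfolding q_def using sim_trans[OF p(2,1) _ sim_sym[OF s]] sim_trans[OF p _ s] by blast
  qed
  have "small TYPE('u) Z" unfolding Z_def using po(1) str_small[OF K_str[OF EK]] by (rule small_Sigma)
  \<comment> \<open>One code for all classes at once, so that the renamed stages overlap exactly
    where the colimit identifies elements.\<close>
  then obtain cc :: "('u \<times> 'u) set \<Rightarrow> 'u" where cc: "inj_on cc (q ` Z)" using small_code small_image by blast
  define \<gamma> where "\<gamma> i a = cc (q (i, a))" for i a
  have \<gamma>_eq: "\<gamma> i a = \<gamma> j b \<longleftrightarrow> sim (i, a) (j, b)" if "(i, a) \<in> Z" "(j, b) \<in> Z" for i a j b
    unfolding \<gamma>_def using q_eq[OF that] inj_on_eq_iff[OF cc] that by blast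
  have \<gamma>_inj: "inj_on (\<gamma> i) (univ (FO E i))" if i: "i \<in> I" for i
  proof (rule inj_onI)
    fix a b assume ab: "a \<in> univ (FO E i)" "b \<in> univ (FO E i)" "\<gamma> i a = \<gamma> i b"
    then obtain k where k: "(i, k) \<in> r" "fn (FA E (i, k)) a = fn (FA E (i, k)) b"
      using \<gamma>_eq[of i a i b] i unfolding sim_def by (auto simp: Z_def)
    then show "a = b" using Hom_inj[OF EH[OF k(1)] ab(1,2)] by blast
  qed
  have \<gamma>_up: "\<gamma> j (fn (FA E (i, j)) a) = \<gamma> i a" if ij: "(i, j) \<in> r" and a: "a \<in> univ (FO E i)" for i j a
  proof -
    have I: "i \<in> I" "j \<in> I" using po ij by blast+
    have b: "fn (FA E (i, j)) a \<in> univ (FO E j)" by (rule Hom_fn[OF EH[OF ij] a])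
    have jj: "(j, j) \<in> r" by (rule po(4)[OF I(2)])
    have "sim (j, fn (FA E (i, j)) a) (i, a)"
      unfolding sim_def using ij jj EC[OF ij jj a] by auto
    then show ?thesis using \<gamma>_eq[of j _ i a] I a b by (simp add: Z_def)
  qed
  define M where "M i = img (\<gamma> i) (FO E i)" for i
  have MK: "M i \<in> K" if "i \<in> I" for i unfolding M_def by (rule K_img[OF EK[OF that] \<gamma>_inj[OF that]])
  have Mle: "(M i, M j) \<in> le" if ij: "(i, j) \<in> r" for i j
  proof -
    have I: "i \<in> I" "j \<in> I" using po ij by blast+
    have "(img (\<gamma> j) (img (fn (FA E (i, j))) (FO E i)), M j) \<in> le" unfolding M_def
      by (rule le_img[OF Kemb_le[OF EK[OF I(1)] Hom_Kemb[OF EH[OF ij]]] \<gamma>_inj[OF I(2)]])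
    moreover have "inj_on (\<gamma> j) (fn (FA E (i, j)) ` univ (FO E i))"
      by (rule inj_on_subset[OF \<gamma>_inj[OF I(2)]]) (use Hom_fn[OF EH[OF ij]] in auto)
    then have "img (\<gamma> j) (img (fn (FA E (i, j))) (FO E i)) = M i" unfolding M_def
      by (rule img_img[OF K_str[OF EK[OF I(1)]] Kemb_inj[OF EK[OF I(1)] Hom_Kemb[OF EH[OF ij]]]])
        (use \<gamma>_up[OF ij] in simp)
    ultimately show ?thesis by simp
  qed
  define X where "X = union_str \<mu> \<tau> I M"
  have "directed_system \<mu> K le I r M" using dir MK Mle by (auto simp: directed_system_def)
  then have X: "X \<in> K" and MX: "\<And>i. i \<in> I \<Longrightarrow> (M i, X) \<in> le"
    using chain unfolding chain_axioms_def X_def by blast+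
  have \<gamma>E: "Kemb (FO E i) (\<gamma> i) X" if i: "i \<in> I" for i
    using MX[OF i] \<gamma>_inj[OF i] by (simp add: Kemb_iff[OF EK[OF i]] M_def)
  define c where "c = (\<lambda>i\<in>I. arr (FO E i) (\<gamma> i) X)"
  have cH: "c i \<in> Hom CC (FO E i) X" if i: "i \<in> I" for i
    using arr_Hom[OF EK[OF i] X \<gamma>E[OF i]] i by (simp add: c_def)
  have "Cmp CC (c j) (FA E (i, j)) = c i" if ij: "(i, j) \<in> r" for i j
  proof -
    have I: "i \<in> I" "j \<in> I" using po ij by blast+
    show ?thesis
    proof (rule Hom_eqI[OF Cmp_Hom[OF category_CC EH[OF ij] cH[OF I(2)]] cH[OF I(1)]])
      fix a assume a: "a \<in> univ (FO E i)"
      show "fn (Cmp CC (c j) (FA E (i, j))) a = fn (c i) a"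
        using fn_Cmp[OF EH[OF ij] cH[OF I(2)] a] \<gamma>_up[OF ij a] I a Hom_fn[OF EH[OF ij] a] by (simp add: c_def fn_arr)
    qed
  qed
  then have "cocone CC (poset_cat I r) E X c"
    by (rule cocone_posetI[rotated 3]) (use X cH in \<open>auto simp: CC_Ob c_def extensional_def\<close>)
  moreover have "univ X \<subseteq> (\<Union>i\<in>I. fn (c i) ` univ (FO E i))"
    by (auto simp: X_def union_str_def Let_def M_def c_def fn_arr image_iff)
  ultimately show ?thesis by blast
qed

text \<open>Compare with the colimit constructed above: the composite from \<open>X\<close> to it
  and back is the identity, so each element of \<open>X\<close> comes from an element of the
  constructed colimit and hence from a stage.\<close>

lemma colimit_jointly_surjective:
  assumes col: "is_colimit CC (poset_cat I r) E X c"
  shows "univ X \<subseteq> (\<Union>i\<in>I. fn (c i) ` univ (FO E i))"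
proof
  fix x assume x: "x \<in> univ X"
  have c: "cocone CC (poset_cat I r) E X c" using col by (simp add: is_colimit_iff)
  obtain X' c' where c': "cocone CC (poset_cat I r) E X' c'" "univ X' \<subseteq> (\<Union>i\<in>I. fn (c' i) ` univ (FO E i))"
    using directed_colimit_exists by blast
  obtain h where h: "cocone_map CC (poset_cat I r) X' c' X c h"
    using cocone_map_exists[OF jointly_surjective_colimit[OF c'] c] by blast
  obtain k where k: "cocone_map CC (poset_cat I r) X c X' c' k"
    using cocone_map_exists[OF col c'(1)] by blast
  have H: "h \<in> Hom CC X' X" "k \<in> Hom CC X X'" using h k by (auto simp: cocone_map_def)
  have "Cmp CC h k = Idt CC X"
    using cocone_map_unique[OF col c cocone_map_comp[OF category_CC c k h] cocone_map_Idt[OF category_CC c]] .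
  then have e: "fn h (fn k x) = x" using fn_Cmp[OF H(2,1) x] fn_Idt[OF x] by simp
  have "fn k x \<in> univ X'" by (rule Hom_fn[OF H(2) x])
  then obtain i a where i: "i \<in> I" "a \<in> univ (FO E i)" "fn k x = fn (c' i) a" using c'(2) by blast
  have c'i: "c' i \<in> Hom CC (FO E i) X'" using cocone_arrow[OF c'(1)] i(1) by simp
  have "Cmp CC h (c' i) = c i" using h i(1) by (simp add: cocone_map_def)
  then have "x = fn (c i) a" using fn_Cmp[OF c'i H(1) i(2)] e i(3) by simp
  then show "x \<in> (\<Union>i\<in>I. fn (c i) ` univ (FO E i))" using i by blast
qed

end

lemma directed_colimits_CC: "has_directed_colimits \<mu> CC"
  unfolding has_directed_colimits_def
  using directed_colimit_exists jointly_surjective_colimit by blast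

subsection \<open>Generated objects\<close>

text \<open>Closure of \<open>A\<close> taken inside \<open>M\<close> itself. Unlike a closure in an
  ambient structure, this is intrinsic to \<open>M\<close> and invariant under isomorphism.\<close>

definition generated :: "'u str \<Rightarrow> 'u set \<Rightarrow> bool" where
  "generated M A \<longleftrightarrow> M \<in> K \<and> A \<subseteq> univ M \<and> (\<forall>P. (P, M) \<in> le \<longrightarrow> A \<subseteq> univ P \<longrightarrow> univ M \<subseteq> univ P)"

text \<open>The closure of \<open>A\<close> in \<open>N\<close> also generates in the intrinsic
  sense, since what is below it is below \<open>N\<close>.\<close>

lemma generated_exists:
  assumes N: "N \<in> K" and A: "A \<subseteq> univ N"
  obtains M where "(M, N) \<in> le" "generated M A" "\<And>P. (P, N) \<in> le \<Longrightarrow> A \<subseteq> univ P \<Longrightarrow> univ M \<subseteq> univ P"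
proof -
  obtain M where M: "(M, N) \<in> le" "univ M = cl le N A"
    using inter N A unfolding admits_intersections_def by blast
  have min: "univ M \<subseteq> univ P" if "(P, N) \<in> le" "A \<subseteq> univ P" for P unfolding M(2) cl_def using that by blast
  have AM: "A \<subseteq> univ M" unfolding M(2) cl_def by blast
  have "generated M A" unfolding generated_def using le_K1[OF M(1)] AM min le_trans[OF _ M(1)] by blast
  then show ?thesis using that[OF M(1)] min by blast
qed

lemma generated_cl:
  assumes "generated M A" shows "cl le M A = univ M"
proof
  have M: "M \<in> K" "A \<subseteq> univ M" using assms by (auto simp: generated_def)
  show "cl le M A \<subseteq> univ M" unfolding cl_def using le_refl[OF M(1)] M(2) by blast
  show "univ M \<subseteq> cl le M A" unfolding cl_def using assms by (auto simp: generated_def)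
qed

text \<open>The agreement clause of pseudo-universality enters here: the closure of \<open>A\<close>
  in \<open>M\<close> is all of \<open>M\<close>.\<close>

lemma generated_unique:
  assumes g: "generated M A" and x: "x \<in> Hom CC M N" and y: "y \<in> Hom CC M N" and eq: "\<And>a. a \<in> A \<Longrightarrow> fn x a = fn y a"
  shows "x = y"
proof (rule Hom_eqI[OF x y])
  fix a assume a: "a \<in> univ M"
  have MA: "M \<in> K" "A \<subseteq> univ M" using g by (auto simp: generated_def)
  have "\<forall>M \<in> K. \<forall>N \<in> K. \<forall>f g. \<forall>A \<subseteq> univ M. Kemb M f N \<and> Kemb M g N \<and> (\<forall>a \<in> A. f a = g a) \<longrightarrow> (\<forall>a \<in> cl le M A. f a = g a)"
    using pu by (simp add: pseudo_universal_mu_AEC_def)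
  then have "\<forall>a\<in>cl le M A. fn x a = fn y a"
    using MA Hom_K2[OF x] Hom_Kemb[OF x] Hom_Kemb[OF y] eq by blast
  then show "fn x a = fn y a" using a unfolding generated_cl[OF g] by blast
qed

lemma generated_image_subset:
  assumes g: "generated M A" and f: "Kemb M f N" and P: "(P, N) \<in> le" and AP: "f ` A \<subseteq> univ P"
  shows "f ` univ M \<subseteq> univ P"
proof -
  have M: "M \<in> K" "A \<subseteq> univ M" using g by (auto simp: generated_def)
  have N: "N \<in> K" by (rule le_K2[OF P])
  have fA: "f ` A \<subseteq> univ N" using Kemb_fn[OF M(1) f] M(2) by blast
  obtain M0 where M0: "(M0, N) \<in> le" "generated M0 (f ` A)"
    and min: "\<And>P. (P, N) \<in> le \<Longrightarrow> f ` A \<subseteq> univ P \<Longrightarrow> univ M0 \<subseteq> univ P"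
    by (rule generated_exists[OF N fA], rule that)
  have sub: "univ M0 \<subseteq> f ` univ M" using min[OF Kemb_le[OF M(1) f]] M(2) by auto
  have M0K: "M0 \<in> K" by (rule le_K1[OF M0(1)])
  have "\<exists>h. Kemb M0 h M \<and> (\<forall>x\<in>univ M0. f (h x) = x)"
    using Kemb_factor[OF M0K M(1) le_Kemb[OF M0(1), of "\<lambda>x. x"] f] sub by simp
  then obtain h where h: "Kemb M0 h M" "\<forall>x\<in>univ M0. f (h x) = x" by blast
  have "A \<subseteq> univ (img h M0)"
  proof
    fix a assume a: "a \<in> A"
    have fa: "f a \<in> univ M0" using M0(2) a by (auto simp: generated_def)
    have "f (h (f a)) = f a" using h(2) fa by blast
    then have "h (f a) = a"
      using inj_onD[OF Kemb_inj[OF M(1) f]] Kemb_fn[OF M0K h(1)] fa a M(2) by blast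
    then show "a \<in> univ (img h M0)" using fa by (metis imageI img_univ)
  qed
  then have "univ M \<subseteq> h ` univ M0" using g Kemb_le[OF M0K h(1)] unfolding generated_def by (metis img_univ)
  then have "f ` univ M \<subseteq> univ M0" using h(2) by auto
  then show ?thesis using min[OF P AP] by blast
qed

text \<open>For an arrow out of a generated object, factoring through \<open>y\<close> has to be
  checked on generators only.\<close>

lemma generated_factor:
  assumes g: "generated M A" and x: "x \<in> Hom CC M N" and y: "y \<in> Hom CC P N" and sub: "fn x ` A \<subseteq> fn y ` univ P"
  shows "\<exists>z\<in>Hom CC M P. Cmp CC y z = x"
proof -
  have M: "M \<in> K" and P: "P \<in> K" using Hom_K1[OF x] Hom_K1[OF y] .
  have "fn x ` univ M \<subseteq> univ (img (fn y) P)"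
    using generated_image_subset[OF g Hom_Kemb[OF x] Kemb_le[OF P Hom_Kemb[OF y]]] sub by simp
  then have "fn x ` univ M \<subseteq> fn y ` univ P" by simp
  then obtain h where h: "Kemb M h P" "\<forall>a\<in>univ M. fn y (h a) = fn x a"
    using Kemb_factor[OF M P Hom_Kemb[OF x] Hom_Kemb[OF y]] by blast
  have z: "arr M h P \<in> Hom CC M P" by (rule arr_Hom[OF M P h(1)])
  have "Cmp CC y (arr M h P) = x"
    by (rule Hom_eqI[OF Cmp_Hom[OF category_CC z y] x]) (simp add: fn_Cmp[OF z y] fn_arr h(2))
  then show ?thesis using z by blast
qed

lemma generated_img:
  assumes g: "generated M A" and f: "inj_on f (univ M)"
  shows "generated (img f M) (f ` A)"
proof -
  have M: "M \<in> K" "A \<subseteq> univ M" using g by (auto simp: generated_def)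
  show ?thesis unfolding generated_def
    using K_img[OF M(1) f] M(2) generated_image_subset[OF g Kemb_img[OF M(1) f]] by auto
qed

text \<open>A generated object equals any strong substructure that contains its generators, in
  particular the one given by the LST axiom, whose size is bounded in terms of \<open>|A|\<close>
  alone. The bound is realised by a set in \<open>'u\<close>, into which copies can be
  moved.\<close>

lemma generated_bound:
  assumes A0: "small TYPE('u) (A0 :: 'u set)"
  obtains L :: "'u set" where "small TYPE('u) L" "\<And>M A. generated M A \<Longrightarrow> |A| \<le>o |A0| \<Longrightarrow> |univ M| \<le>o |L|"
proof -
  obtain lam :: "'u rel" where lam: "Card_order lam" "lam <o |UNIV :: 'u set|"
    and ls: "\<forall>M\<in>K. \<forall>A\<subseteq>univ M. \<exists>M0. (M0, M) \<in> le \<and> A \<subseteq> univ M0 \<and> |univ M0| \<le>o card_pow_less \<mu> A +c lam"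
    using lst unfolding LST_def by blast
  let ?Z = "(SIGMA \<alpha>:Field \<mu>. tuples \<mu> \<alpha> A0) <+> Field lam"
  have "small TYPE('u) (Field lam)" unfolding small_def
    using lam card_of_Field_ordIso ordIso_ordLess_trans by blast
  moreover have "small TYPE('u) (SIGMA \<alpha>:Field \<mu>. tuples \<mu> \<alpha> A0)"
    by (rule small_Sigma[OF small_Field_mu small_tuples[OF regular_universe_axioms _ A0]])
  ultimately have "small TYPE('u) ?Z" unfolding Plus_def by (intro small_Un small_image)
  then obtain L :: "'u set" and c where L: "bij_betw c ?Z L" "small TYPE('u) L" using small_copy by blast
  have "|univ M| \<le>o |L|" if g: "generated M A" and A: "|A| \<le>o |A0|" for M A
  proof -
    have M: "M \<in> K" "A \<subseteq> univ M" using g by (auto simp: generated_def)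
    obtain M0 where M0: "(M0, M) \<in> le" "A \<subseteq> univ M0" "|univ M0| \<le>o card_pow_less \<mu> A +c lam"
      using ls M by blast
    have "univ M \<subseteq> univ M0" using g M0(1,2) by (simp add: generated_def)
    then have 1: "|univ M| \<le>o card_pow_less \<mu> A +c lam" by (rule ordLeq_transitive[OF card_of_mono1 M0(3)])
    have "card_pow_less \<mu> A +c lam \<le>o card_pow_less \<mu> A0 +c lam"
      by (rule csum_mono1[OF card_pow_less_mono[OF A]])
    then have "|univ M| \<le>o card_pow_less \<mu> A0 +c lam" by (rule ordLeq_transitive[OF 1])
    moreover have "card_pow_less \<mu> A0 +c lam = |?Z|" by (simp add: csum_def card_pow_less_def Field_card_of)
    ultimately show ?thesis using card_of_ordIsoI[OF L(1)] ordLeq_ordIso_trans by metis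
  qed
  then show ?thesis using that[OF L(2)] by blast
qed

text \<open>A structure is coded by its universe, its functions and the set of pairs of a relation
  symbol and a tuple satisfying it; off the vocabulary the relations are fixed.\<close>

lemma small_structures:
  assumes L: "small TYPE('u) (L :: 'u set)"
  shows "small TYPE('u) {M. str M \<and> univ M \<subseteq> L}"
proof -
  let ?T = "SIGMA U:Pow L. (\<Pi>\<^sub>E s\<in>Fsym \<tau>. ftuples s U \<rightarrow>\<^sub>E U) \<times> Pow (SIGMA s:Rsym \<tau>. rtuples s L)"
  let ?f = "\<lambda>M. (univ M, fns M, SIGMA s:Rsym \<tau>. rels M s)"
  have F: "small TYPE('u) (Fsym \<tau>)" and R: "small TYPE('u) (Rsym \<tau>)" using voc by (auto simp: vocabulary_def)
  note tup = small_tuples[OF regular_universe_axioms]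
  have "small TYPE('u) ?T"
  proof (rule small_Sigma[OF small_Pow[OF L]])
    fix U assume "U \<in> Pow L"
    then have U: "small TYPE('u) U" using small_subset[OF L] by blast
    have "small TYPE('u) (\<Pi>\<^sub>E s\<in>Fsym \<tau>. ftuples s U \<rightarrow>\<^sub>E U)"
      by (rule small_PiE[OF F small_PiE[OF tup[OF far_Field U] U]])
    moreover have "small TYPE('u) (Pow (SIGMA s:Rsym \<tau>. rtuples s L))"
      by (rule small_Pow[OF small_Sigma[OF R tup[OF rar_Field L]]])
    ultimately show "small TYPE('u) ((\<Pi>\<^sub>E s\<in>Fsym \<tau>. ftuples s U \<rightarrow>\<^sub>E U) \<times> Pow (SIGMA s:Rsym \<tau>. rtuples s L))"
      by (rule small_Sigma)
  qed
  moreover have "inj_on ?f {M. str M \<and> univ M \<subseteq> L}"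
  proof (rule inj_onI)
    fix M N assume M: "M \<in> {M. str M \<and> univ M \<subseteq> L}" and N: "N \<in> {M. str M \<and> univ M \<subseteq> L}" and e: "?f M = ?f N"
    have "rels M s = rels N s" if "s \<in> Rsym \<tau>" for s
    proof -
      have "(SIGMA s:Rsym \<tau>. rels M s) `` {s} = (SIGMA s:Rsym \<tau>. rels N s) `` {s}" using e by simp
      then show ?thesis using that by auto
    qed
    then show "M = N" using M N e by (intro str_eqI) auto
  qed
  moreover have "?f ` {M. str M \<and> univ M \<subseteq> L} \<subseteq> ?T"
  proof
    fix p assume "p \<in> ?f ` {M. str M \<and> univ M \<subseteq> L}"
    then obtain M where M: "str M" "univ M \<subseteq> L" "p = ?f M" by blast
    have "(SIGMA s:Rsym \<tau>. rels M s) \<subseteq> (SIGMA s:Rsym \<tau>. rtuples s L)"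
      using rels_tuples[OF M(1)] tuples_mono[OF M(2)] by blast
    then show "p \<in> ?T" using M by (simp add: str_of_def)
  qed
  ultimately show ?thesis by (intro small_inj[of ?f])
qed

text \<open>Each of the fewer than \<mu> generators lands in the image of a stage, so all land in a
  single one, and \<open>generated_factor\<close> applies.\<close>

lemma generated_factoring:
  assumes g: "generated M A" and A: "|A| <o \<mu>"
  shows "factoring \<mu> CC M"
  unfolding factoring_def
proof (intro conjI allI impI ballI)
  show "M \<in> Ob CC" using g by (simp add: generated_def CC_Ob)
  fix I r E X c x
  assume dir: "directed_poset \<mu> I r" and E: "is_functor (poset_cat I r) CC E"
    and col: "is_colimit CC (poset_cat I r) E X c" and x: "x \<in> Hom CC M X"
  have c: "cocone CC (poset_cat I r) E X c" using col by (simp add: is_colimit_iff)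
  have cH: "c i \<in> Hom CC (FO E i) X" if "i \<in> I" for i using cocone_arrow[OF c] that by simp
  have "\<forall>a\<in>A. \<exists>i b. i \<in> I \<and> b \<in> univ (FO E i) \<and> fn x a = fn (c i) b"
    using colimit_jointly_surjective[OF dir E col] Hom_fn[OF x] g unfolding generated_def by blast
  then obtain i b where ib: "\<And>a. a \<in> A \<Longrightarrow> i a \<in> I" "\<And>a. a \<in> A \<Longrightarrow> b a \<in> univ (FO E (i a))" "\<And>a. a \<in> A \<Longrightarrow> fn x a = fn (c (i a)) (b a)"
    by metis
  obtain k where k: "k \<in> I" "\<forall>a\<in>A. (i a, k) \<in> r" using directed_upper[OF dir A, of i] ib(1) by blast
  have "fn x a \<in> fn (c k) ` univ (FO E k)" if a: "a \<in> A" for a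
  proof -
    have r: "(i a, k) \<in> r" using k a by blast
    have EH: "FA E (i a, k) \<in> Hom CC (FO E (i a)) (FO E k)"
      using FA_Hom[OF E, of "(i a, k)" "i a" k] r by (simp add: Hom_iff)
    have "Cmp CC (c k) (FA E (i a, k)) = c (i a)" using cocone_commute[OF c, of "(i a, k)"] r by simp
    then have "fn x a = fn (c k) (fn (FA E (i a, k)) (b a))"
      using fn_Cmp[OF EH cH[OF k(1)] ib(2)[OF a]] ib(3)[OF a] by simp
    then show ?thesis using Hom_fn[OF EH ib(2)[OF a]] by blast
  qed
  then obtain z where "z \<in> Hom CC M (FO E k)" "Cmp CC (c k) z = x"
    using generated_factor[OF g x cH[OF k(1)]] by blast
  then show "\<exists>i\<in>I. \<exists>g\<in>Hom CC M (FO E i). x = Cmp CC (c i) g" using k(1) by blast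
qed

text \<open>The stages are the closures in \<open>X\<close> of its subsets of size below \<mu>,
  connected by inclusions; the singletons among these subsets make the stages cover
  \<open>X\<close>.\<close>

lemma generated_presentation:
  assumes X: "X \<in> K"
  shows "\<exists>I r D c. directed_poset \<mu> I r \<and> is_functor (poset_cat I r) CC D \<and>
    (\<forall>i\<in>I. \<exists>A. |A| <o \<mu> \<and> generated (FO D i) A) \<and> is_colimit CC (poset_cat I r) D X c"
proof -
  obtain I r dec where dir: "directed_poset \<mu> I r" and dec: "bij_betw dec I {A. A \<subseteq> univ X \<and> |A| <o \<mu>}"
    and r: "\<And>i j. (i, j) \<in> r \<longleftrightarrow> i \<in> I \<and> j \<in> I \<and> dec i \<subseteq> dec j"
    by (rule subset_poset[OF str_small[OF K_str[OF X]]], rule that)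
  note po = directed_poset_facts[OF dir]
  have decI: "dec i \<subseteq> univ X" "|dec i| <o \<mu>" if "i \<in> I" for i using bij_betwE[OF dec] that by auto
  have "\<exists>M. (M, X) \<in> le \<and> generated M (dec i) \<and> (\<forall>P. (P, X) \<in> le \<longrightarrow> dec i \<subseteq> univ P \<longrightarrow> univ M \<subseteq> univ P)" if "i \<in> I" for i
    by (rule generated_exists[OF X decI(1)[OF that]]) blast
  then obtain M where M: "\<And>i. i \<in> I \<Longrightarrow> (M i, X) \<in> le" "\<And>i. i \<in> I \<Longrightarrow> generated (M i) (dec i)"
    "\<And>i P. i \<in> I \<Longrightarrow> (P, X) \<in> le \<Longrightarrow> dec i \<subseteq> univ P \<Longrightarrow> univ (M i) \<subseteq> univ P" by metis
  have MK: "M i \<in> K" if "i \<in> I" for i by (rule le_K1[OF M(1)[OF that]])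
  have Mr: "(M i, M j) \<in> le" if ij: "(i, j) \<in> r" for i j
  proof -
    have I: "i \<in> I" "j \<in> I" "dec i \<subseteq> dec j" using r ij by blast+
    have "dec j \<subseteq> univ (M j)" using M(2)[OF I(2)] by (simp add: generated_def)
    then have "univ (M i) \<subseteq> univ (M j)" using M(3)[OF I(1) M(1)[OF I(2)]] I(3) by blast
    then show ?thesis by (rule le_coherent[OF M(1)[OF I(1)] M(1)[OF I(2)]])
  qed
  define D where "D = \<lparr>FO = M, FA = (\<lambda>(i, j). arr (M i) (\<lambda>x. x) (M j))\<rparr>"
  have D: "is_functor (poset_cat I r) CC D" unfolding is_functor_def
  proof (intro conjI ballI impI)
    fix i assume "i \<in> Ob (poset_cat I r)"
    then have i: "i \<in> I" by simp
    show "FO D i \<in> Ob CC" using MK[OF i] by (simp add: D_def CC_Ob)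
    have a: "arr (M i) (\<lambda>x. x) (M i) \<in> Hom CC (M i) (M i)"
      by (rule arr_Hom[OF MK[OF i] MK[OF i] le_Kemb[OF le_refl[OF MK[OF i]]]]) simp
    have "arr (M i) (\<lambda>x. x) (M i) = Idt CC (M i)"
      by (rule Hom_eqI[OF a Idt_Hom[OF category_CC]]) (use MK[OF i] in \<open>simp_all add: CC_Ob fn_arr fn_Idt\<close>)
    then show "FA D (Idt (poset_cat I r) i) = Idt CC (FO D i)" by (simp add: D_def)
  next
    fix p assume "p \<in> Ar (poset_cat I r)"
    then obtain i j where p: "p = (i, j)" "(i, j) \<in> r" by (cases p) auto
    have "arr (M i) (\<lambda>x. x) (M j) \<in> Hom CC (M i) (M j)"
      by (rule arr_Hom[OF le_K1[OF Mr] le_K2[OF Mr] le_Kemb[OF Mr]]) (use p in auto)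
    then show "FA D p \<in> Hom CC (FO D (Src (poset_cat I r) p)) (FO D (Tgt (poset_cat I r) p))"
      using p by (simp add: D_def)
  next
    fix p q assume "p \<in> Ar (poset_cat I r)" "q \<in> Ar (poset_cat I r)" "Tgt (poset_cat I r) p = Src (poset_cat I r) q"
    then obtain i j k where p: "p = (i, j)" "q = (j, k)" "(i, j) \<in> r" "(j, k) \<in> r" by (cases p, cases q) auto
    have a: "arr (M i) (\<lambda>x. x) (M j) \<in> Hom CC (M i) (M j)" if "(i, j) \<in> r" for i j
      by (rule arr_Hom[OF le_K1[OF Mr[OF that]] le_K2[OF Mr[OF that]] le_Kemb[OF Mr[OF that]]]) simp
    have "arr (M i) (\<lambda>x. x) (M k) = Cmp CC (arr (M j) (\<lambda>x. x) (M k)) (arr (M i) (\<lambda>x. x) (M j))"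
      by (rule Hom_eqI[OF a[OF po(5)[OF p(3,4)]] Cmp_Hom[OF category_CC a[OF p(3)] a[OF p(4)]]])
        (use le_univ[OF Mr[OF p(3)]] in \<open>auto simp: fn_Cmp[OF a[OF p(3)] a[OF p(4)]] fn_arr\<close>)
    then show "FA D (Cmp (poset_cat I r) q p) = Cmp CC (FA D q) (FA D p)" using p by (simp add: D_def)
  qed
  define c where "c = (\<lambda>i\<in>I. arr (M i) (\<lambda>x. x) X)"
  have aX: "arr (M i) (\<lambda>x. x) X \<in> Hom CC (M i) X" if "i \<in> I" for i
    by (rule arr_Hom[OF MK[OF that] X le_Kemb[OF M(1)[OF that]]]) simp
  have "Cmp CC (c j) (FA D (i, j)) = c i" if ij: "(i, j) \<in> r" for i j
  proof -
    have I: "i \<in> I" "j \<in> I" using po ij by blast+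
    have a: "arr (M i) (\<lambda>x. x) (M j) \<in> Hom CC (M i) (M j)"
      by (rule arr_Hom[OF le_K1[OF Mr[OF ij]] le_K2[OF Mr[OF ij]] le_Kemb[OF Mr[OF ij]]]) simp
    have "Cmp CC (arr (M j) (\<lambda>x. x) X) (arr (M i) (\<lambda>x. x) (M j)) = arr (M i) (\<lambda>x. x) X"
      by (rule Hom_eqI[OF Cmp_Hom[OF category_CC a aX[OF I(2)]] aX[OF I(1)]])
        (use le_univ[OF Mr[OF ij]] in \<open>auto simp: fn_Cmp[OF a aX[OF I(2)]] fn_arr\<close>)
    then show ?thesis using I by (simp add: c_def D_def)
  qed
  then have coc: "cocone CC (poset_cat I r) D X c"
    by (rule cocone_posetI[rotated 3]) (use X aX in \<open>auto simp: CC_Ob c_def D_def extensional_def\<close>)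
  have "univ X \<subseteq> (\<Union>i\<in>I. fn (c i) ` univ (FO D i))"
  proof
    fix x assume x: "x \<in> univ X"
    have "{x} \<in> {A. A \<subseteq> univ X \<and> |A| <o \<mu>}" using x less_mu_finite[of "{x}"] by simp
    then obtain i where i: "i \<in> I" "dec i = {x}" using bij_betw_imp_surj_on[OF dec] by (metis (no_types, lifting) imageE)
    have "x \<in> univ (M i)" using M(2)[OF i(1)] i(2) by (simp add: generated_def)
    then show "x \<in> (\<Union>i\<in>I. fn (c i) ` univ (FO D i))"
      using i(1) by (intro UN_I[of i] image_eqI[of _ _ x]) (simp_all add: c_def D_def fn_arr)
  qed
  then have col: "is_colimit CC (poset_cat I r) D X c" by (rule jointly_surjective_colimit[OF dir D coc])
  have "\<exists>A. |A| <o \<mu> \<and> generated (FO D i) A" if i: "i \<in> I" for i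
    using decI(2)[OF i] M(2)[OF i] by (auto simp: D_def)
  then show ?thesis using dir D col by blast
qed

lemma accessible_CC: "accessible \<mu> CC"
proof -
  obtain L :: "'u set" where L: "small TYPE('u) L" and bd: "\<And>M A. generated M A \<Longrightarrow> |A| \<le>o |Field \<mu>| \<Longrightarrow> |univ M| \<le>o |L|"
    by (rule generated_bound[OF small_Field_mu], rule that)
  \<comment> \<open>\<open>L\<close> is large enough to contain a copy of every object generated by
    fewer than \<mu> elements.\<close>
  define S where "S = {M \<in> K. univ M \<subseteq> L \<and> (\<exists>A. |A| <o \<mu> \<and> generated M A)}"
  show ?thesis
  proof (rule accessibleI[OF category_CC locally_small_CC mono_CC directed_colimits_CC, of S])
    show "small TYPE('u) S"
      by (rule small_subset[OF small_structures[OF L]]) (auto simp: S_def K_str)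
    show "factoring \<mu> CC M" if "M \<in> S" for M using that generated_factoring by (auto simp: S_def)
    fix X assume "X \<in> Ob CC"
    then have X: "X \<in> K" by (simp add: CC_Ob)
    obtain I r D c where D: "directed_poset \<mu> I r" "is_functor (poset_cat I r) CC D"
      "\<forall>i\<in>I. \<exists>A. |A| <o \<mu> \<and> generated (FO D i) A" "is_colimit CC (poset_cat I r) D X c"
      using generated_presentation[OF X] by (elim exE conjE)
    have "\<exists>N\<in>S. \<exists>u v. inverse_arrows CC (FO D i) N u v" if i: "i \<in> I" for i
    proof -
      obtain A where A: "|A| <o \<mu>" "generated (FO D i) A" using D(3) i by blast
      have "|A| \<le>o |Field \<mu>|"
        by (rule ordLeq_ordIso_trans[OF ordLess_imp_ordLeq[OF A(1)] ordIso_symmetric[OF card_of_Field_ordIso[OF Card_order_mu]]])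
      then have "|univ (FO D i)| \<le>o |L|" by (rule bd[OF A(2)])
      then obtain f where f: "inj_on f (univ (FO D i))" "f ` univ (FO D i) \<subseteq> L" by (meson card_of_ordLeq)
      have K: "FO D i \<in> K" using A(2) by (simp add: generated_def)
      have "img f (FO D i) \<in> S" unfolding S_def
        using K_img[OF K f(1)] f(2) generated_img[OF A(2) f(1)] less_mu_image[OF A(1)] by auto
      then show ?thesis using img_inverse_arrows[OF K f(1)] by blast
    qed
    then show "\<exists>I r D c. directed_poset \<mu> I r \<and> is_functor (poset_cat I r) CC D \<and>
        (\<forall>i\<in>I. \<exists>A\<in>S. \<exists>u v. inverse_arrows CC (FO D i) A u v) \<and> is_colimit CC (poset_cat I r) D X c"
      using D(1,2,4) by blast
  qed
qed

subsection \<open>Multicolimits\<close>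

text \<open>Every cocone restricts to one whose vertex is generated by the images of the diagram.
  The size of such a vertex is bounded by the diagram alone, so up to isomorphism these cocones form
  a small family, to which \<open>multicolimitI\<close> applies.\<close>

lemma multicolimits_CC:
  fixes J :: "('u, 'u) cat"
  assumes J: "small_category TYPE('u) J" and D: "is_functor J CC D"
  shows "has_multicolimit TYPE('u) CC J D"
proof -
  have Jc: "category J" and Js: "small TYPE('u) (Ob J)" using J by (auto simp: small_category_def)
  have DK: "FO D j \<in> K" if "j \<in> Ob J" for j using FO_Ob[OF D that] by (simp add: CC_Ob)
  have DH: "FA D u \<in> Hom CC (FO D (Src J u)) (FO D (Tgt J u))" if "u \<in> Ar J" for u
    using FA_Hom[OF D] that by (auto simp: Hom_iff)
  \<comment> \<open>The elements reached by the legs. Their number is bounded by that of the pairs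
    of an index and an element there, uniformly in the cocone.\<close>
  define A where "A c = (\<Union>j\<in>Ob J. fn (c j) ` univ (FO D j))" for c :: "'u \<Rightarrow> 'u str \<times> ('u \<Rightarrow> 'u) \<times> 'u str"
  let ?Z = "SIGMA j:Ob J. univ (FO D j)"
  have "small TYPE('u) ?Z" by (rule small_Sigma[OF Js str_small[OF K_str[OF DK]]])
  then obtain A0 :: "'u set" and cd where A0: "bij_betw cd ?Z A0" "small TYPE('u) A0" using small_copy by blast
  have Acard: "|A c| \<le>o |A0|" for c
  proof -
    have "A c \<subseteq> (\<lambda>(j, a). fn (c j) a) ` ?Z" by (auto simp: A_def)
    then have "|A c| \<le>o |?Z|" by (rule ordLeq_transitive[OF card_of_mono1 card_of_image])
    then show ?thesis using card_of_ordIsoI[OF A0(1)] ordLeq_ordIso_trans by blast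
  qed
  obtain L :: "'u set" where L: "small TYPE('u) L" and bd: "\<And>M A. generated M A \<Longrightarrow> |A| \<le>o |A0| \<Longrightarrow> |univ M| \<le>o |L|"
    by (rule generated_bound[OF A0(2)], rule that)
  define W where "W = {(X, c). cocone CC J D X c \<and> generated X (A c) \<and> univ X \<subseteq> L}"
  have map_fn: "fn h (fn (c j) a) = fn (d j) a"
    if h: "cocone_map CC J X c Y d h" and c: "cocone CC J D X c" and j: "j \<in> Ob J" and a: "a \<in> univ (FO D j)" for X c Y d h j a
  proof -
    have "h \<in> Hom CC X Y" "Cmp CC h (c j) = d j" using h j by (auto simp: cocone_map_def)
    then show ?thesis using fn_Cmp[OF cocone_arrow[OF c j] _ a] by metis
  qed
  have mapA: "fn h ` A c = A d" if h: "cocone_map CC J X c Y d h" and c: "cocone CC J D X c" for X c Y d h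
    using map_fn[OF h c] unfolding A_def image_UN image_image by (intro SUP_cong refl image_cong) auto
  show ?thesis
  proof (rule multicolimitI[OF category_CC, where W = W])
    show "small TYPE('u) P" if "small TYPE('u) Q" "P \<subseteq> Q" for P Q :: "('u str \<times> ('u \<Rightarrow> 'u str \<times> ('u \<Rightarrow> 'u) \<times> 'u str)) set"
      by (rule small_subset[OF that])
  next
    have "W \<subseteq> (SIGMA X:{M. str M \<and> univ M \<subseteq> L}. \<Pi>\<^sub>E j\<in>Ob J. Hom CC (FO D j) X)"
      by (auto simp: W_def cocone_def generated_def K_str)
    moreover have "small TYPE('u) (SIGMA X:{M. str M \<and> univ M \<subseteq> L}. \<Pi>\<^sub>E j\<in>Ob J. Hom CC (FO D j) X)"
      by (rule small_Sigma[OF small_structures[OF L] small_PiE[OF Js small_Hom_CC]])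
    ultimately show "small TYPE('u) W" by (rule small_subset[rotated])
    show "cocone CC J D X c" if "(X, c) \<in> W" for X c using that by (simp add: W_def)
  next
    fix Y d assume d: "cocone CC J D Y d"
    have dH: "d j \<in> Hom CC (FO D j) Y" if "j \<in> Ob J" for j by (rule cocone_arrow[OF d that])
    have Y: "Y \<in> K" using cocone_Ob[OF d] by (simp add: CC_Ob)
    have AY: "A d \<subseteq> univ Y" using Hom_fn[OF dH] by (auto simp: A_def)
    \<comment> \<open>The closure of the images inside \<open>Y\<close>, then moved into
      \<open>L\<close> by \<open>f\<close>.\<close>
    obtain M where M: "(M, Y) \<in> le" "generated M (A d)" by (rule generated_exists[OF Y AY], rule that)
    have MK: "M \<in> K" by (rule le_K1[OF M(1)])
    have "|univ M| \<le>o |L|" by (rule bd[OF M(2) Acard])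
    then obtain f where f: "inj_on f (univ M)" "f ` univ M \<subseteq> L" by (meson card_of_ordLeq)
    let ?X = "img f M" and ?g = "inv_into (univ M) f"
    have XK: "?X \<in> K" by (rule K_img[OF MK f(1)])
    have iX: "arr M (\<lambda>x. x) Y \<in> Hom CC M Y" by (rule arr_Hom[OF MK Y le_Kemb[OF M(1)]]) simp
    have dM: "fn (d j) a \<in> univ M" if "j \<in> Ob J" "a \<in> univ (FO D j)" for j a
      using M(2) that unfolding generated_def A_def by blast
    have "\<exists>h. Kemb (FO D j) h M \<and> (\<forall>a\<in>univ (FO D j). h a = fn (d j) a)" if j: "j \<in> Ob J" for j
      using Kemb_factor[OF DK[OF j] MK Hom_Kemb[OF dH[OF j]] le_Kemb[OF M(1), of "\<lambda>x. x"]] dM[OF j] by auto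
    then have dE: "Kemb (FO D j) (fn (d j)) M" if j: "j \<in> Ob J" for j
      using Kemb_cong[OF DK[OF j]] j by blast
    define c where "c = (\<lambda>j\<in>Ob J. arr (FO D j) (\<lambda>a. f (fn (d j) a)) ?X)"
    have cH: "c j \<in> Hom CC (FO D j) ?X" if j: "j \<in> Ob J" for j
      using arr_Hom[OF DK[OF j] XK Kemb_comp[OF DK[OF j] MK dE[OF j] Kemb_img[OF MK f(1)]]] j by (simp add: c_def)
    have cf: "fn (c j) a = f (fn (d j) a)" if "j \<in> Ob J" "a \<in> univ (FO D j)" for j a
      using that by (simp add: c_def fn_arr)
    have c: "cocone CC J D ?X c" unfolding cocone_def
    proof (intro conjI ballI)
      show "?X \<in> Ob CC" using XK by (simp add: CC_Ob)
      show "c \<in> (\<Pi>\<^sub>E j\<in>Ob J. Hom CC (FO D j) ?X)" using cH by (auto simp: c_def)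
      fix u assume u: "u \<in> Ar J"
      have o: "Src J u \<in> Ob J" "Tgt J u \<in> Ob J" using Src_Ob[OF Jc u] Tgt_Ob[OF Jc u] .
      show "Cmp CC (c (Tgt J u)) (FA D u) = c (Src J u)"
      proof (rule Hom_eqI[OF Cmp_Hom[OF category_CC DH[OF u] cH[OF o(2)]] cH[OF o(1)]])
        fix a assume a: "a \<in> univ (FO D (Src J u))"
        have "fn (d (Tgt J u)) (fn (FA D u) a) = fn (d (Src J u)) a"
          using fn_Cmp[OF DH[OF u] dH[OF o(2)] a] cocone_commute[OF d u] by simp
        then show "fn (Cmp CC (c (Tgt J u)) (FA D u)) a = fn (c (Src J u)) a"
          using fn_Cmp[OF DH[OF u] cH[OF o(2)] a] cf[OF o(2) Hom_fn[OF DH[OF u] a]] cf[OF o(1) a] by simp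
      qed
    qed
    have "A c = f ` A d"
      unfolding A_def image_UN image_image using cf by (intro SUP_cong refl image_cong) auto
    then have "generated ?X (A c)" using generated_img[OF M(2) f(1)] by simp
    then have "(?X, c) \<in> W" using c f(2) by (simp add: W_def)
    moreover have "\<exists>h. cocone_map CC J ?X c Y d h"
    proof -
      have v: "arr ?X ?g M \<in> Hom CC ?X M" using img_inverse_arrows[OF MK f(1)] by (simp add: inverse_arrows_def)
      let ?h = "Cmp CC (arr M (\<lambda>x. x) Y) (arr ?X ?g M)"
      have h: "?h \<in> Hom CC ?X Y" by (rule Cmp_Hom[OF category_CC v iX])
      have "Cmp CC ?h (c j) = d j" if j: "j \<in> Ob J" for j
      proof (rule Hom_eqI[OF Cmp_Hom[OF category_CC cH[OF j] h] dH[OF j]])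
        fix a assume a: "a \<in> univ (FO D j)"
        have x: "f (fn (d j) a) \<in> univ ?X" using dM[OF j a] by simp
        show "fn (Cmp CC ?h (c j)) a = fn (d j) a"
          using fn_Cmp[OF cH[OF j] h a] cf[OF j a] fn_Cmp[OF v iX x] fn_arr[OF x, of ?g M] dM[OF j a] f(1)
          by (simp add: fn_arr)
      qed
      then show ?thesis using h by (intro exI[of _ ?h]) (simp add: cocone_map_def)
    qed
    ultimately show "\<exists>(X, c)\<in>W. \<exists>h. cocone_map CC J X c Y d h" by blast
  next
    fix X c Y d h k
    assume w: "(X, c) \<in> W" and d: "cocone CC J D Y d" and h: "cocone_map CC J X c Y d h" and k: "cocone_map CC J X c Y d k"
    have c: "cocone CC J D X c" "generated X (A c)" using w by (auto simp: W_def)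
    show "h = k"
    proof (rule generated_unique[OF c(2)])
      show "h \<in> Hom CC X Y" "k \<in> Hom CC X Y" using h k by (auto simp: cocone_map_def)
      fix a assume "a \<in> A c"
      then obtain j b where "j \<in> Ob J" "b \<in> univ (FO D j)" "a = fn (c j) b" by (auto simp: A_def)
      then show "fn h a = fn k a" using map_fn[OF h c(1)] map_fn[OF k c(1)] by simp
    qed
  next
    fix X c X' c' Y d h k
    assume w: "(X, c) \<in> W" "(X', c') \<in> W" and d: "cocone CC J D Y d"
      and h: "cocone_map CC J X c Y d h" and k: "cocone_map CC J X' c' Y d k"
    have c: "cocone CC J D X c" "generated X (A c)" "cocone CC J D X' c'" "generated X' (A c')" using w by (auto simp: W_def)
    have H: "h \<in> Hom CC X Y" "k \<in> Hom CC X' Y" using h k by (auto simp: cocone_map_def)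
    \<comment> \<open>Maps of cocones carry generators to generators, so both sets of generators
      have the image \<open>A d\<close>. The factor \<open>l\<close> obtained from this respects the
      legs, as is seen by cancelling \<open>k\<close>.\<close>
    have "fn h ` A c \<subseteq> fn k ` univ X'"
      using mapA[OF h c(1)] mapA[OF k c(3)] c(4) unfolding generated_def by blast
    then obtain l where l: "l \<in> Hom CC X X'" "Cmp CC k l = h" using generated_factor[OF c(2) H] by blast
    have "Cmp CC l (c j) = c' j" if j: "j \<in> Ob J" for j
    proof (rule mono_cancel[OF category_CC mono_CC Cmp_Hom[OF category_CC cocone_arrow[OF c(1) j] l(1)] cocone_arrow[OF c(3) j] H(2)])
      show "Cmp CC k (Cmp CC l (c j)) = Cmp CC k (c' j)"
        using Hom_assoc[OF category_CC cocone_arrow[OF c(1) j] l(1) H(2)] l(2) h k j by (simp add: cocone_map_def)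
    qed
    then show "\<exists>l. cocone_map CC J X c X' c' l" using l(1) by (intro exI[of _ l]) (simp add: cocone_map_def)
  qed
qed

theorem class_cat_locally_multipresentable: "locally_multipresentable \<mu> CC"
  unfolding locally_multipresentable_def using accessible_CC multicolimits_CC by blast

end

section \<open>Tuples of points and their universal types\<close>

text \<open>
  A point of an object is an arrow into it from one of the chosen presentable objects. A tuple of
  points of \<open>X\<close> is a cocone on a discrete diagram, so it factors through exactly one component
  \<open>(P, p)\<close> of the multicolimit of that diagram: the type of the tuple.
\<close>

definition points :: "('o, 'm) cat \<Rightarrow> 'o set \<Rightarrow> 'o \<Rightarrow> 'm set" where
  "points C S X = {f \<in> Ar C. Src C f \<in> S \<and> Tgt C f = X}"

text \<open>\<open>Ty \<alpha>\<close> stands for the components of the multicolimits of all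
  families of members of \<open>S\<close> of length \<alpha>; only their universal property for
  tuples of points is kept. Arrows are of type \<open>'u\<close>, so that points can be elements of
  a structure.\<close>

locale presented_category = regular_universe \<mu> for \<mu> :: "'u rel" +
  fixes C :: "('o, 'u) cat" and S :: "'o set" and Ty :: "'u \<Rightarrow> ('o \<times> ('u \<Rightarrow> 'u)) set"
  assumes cat: "category C" and ls: "locally_small TYPE('u) C" and mono: "\<forall>f\<in>Ar C. mono_arrow C f"
    and dc: "has_directed_colimits \<mu> C"
    and S_small: "small TYPE('u) S" and S_fac: "A \<in> S \<Longrightarrow> factoring \<mu> C A"
    and pres: "X \<in> Ob C \<Longrightarrow> \<exists>I r D c. directed_poset \<mu> I r \<and> is_functor (poset_cat I r) C D \<and>
        (\<forall>i\<in>I. FO D i \<in> S) \<and> is_colimit C (poset_cat I r) D X c"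
    and Ty_small: "\<alpha> \<in> Field \<mu> \<Longrightarrow> small TYPE('u) (Ty \<alpha>)"
    and Ty_tuple: "\<alpha> \<in> Field \<mu> \<Longrightarrow> t \<in> Ty \<alpha> \<Longrightarrow> fst t \<in> Ob C \<and> snd t \<in> tuples \<mu> \<alpha> (points C S (fst t))"
    and Ty_ex1: "\<alpha> \<in> Field \<mu> \<Longrightarrow> X \<in> Ob C \<Longrightarrow> x \<in> tuples \<mu> \<alpha> (points C S X) \<Longrightarrow>
        \<exists>!t. t \<in> Ty \<alpha> \<and> (\<exists>h\<in>Hom C (fst t) X. \<forall>i\<in>underS \<mu> \<alpha>. Cmp C h (snd t i) = x i)"
    and Ty_unique: "\<alpha> \<in> Field \<mu> \<Longrightarrow> t \<in> Ty \<alpha> \<Longrightarrow> h \<in> Hom C (fst t) X \<Longrightarrow> k \<in> Hom C (fst t) X \<Longrightarrow>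
        (\<forall>i\<in>underS \<mu> \<alpha>. Cmp C h (snd t i) = Cmp C k (snd t i)) \<Longrightarrow> h = k"

definition discrete_cat :: "'i set \<Rightarrow> ('i, 'i) cat" where
  "discrete_cat I = \<lparr>Ob = I, Ar = I, Src = (\<lambda>i. i), Tgt = (\<lambda>i. i), Idt = (\<lambda>i. i), Cmp = (\<lambda>g f. f)\<rparr>"

definition discrete_diagram :: "('o, 'm) cat \<Rightarrow> ('i \<Rightarrow> 'o) \<Rightarrow> ('i, 'i, 'o, 'm) fctr" where
  "discrete_diagram C A = \<lparr>FO = A, FA = (\<lambda>i. Idt C (A i))\<rparr>"

lemma category_discrete: "category (discrete_cat I)"
  by (auto simp: category_def discrete_cat_def Hom_iff)

lemma discrete_functor:
  "category C \<Longrightarrow> (\<And>i. i \<in> I \<Longrightarrow> A i \<in> Ob C) \<Longrightarrow> is_functor (discrete_cat I) C (discrete_diagram C A)"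
  by (auto simp: is_functor_def discrete_cat_def discrete_diagram_def Hom_iff cat_simps)

lemma discrete_cocone:
  assumes "category C"
  shows "cocone C (discrete_cat I) (discrete_diagram C A) X c \<longleftrightarrow> X \<in> Ob C \<and> c \<in> (\<Pi>\<^sub>E i\<in>I. Hom C (A i) X)"
  using Hom_Idt_right[OF assms] by (fastforce simp: cocone_def discrete_cat_def discrete_diagram_def)

lemma discrete_cocone_map:
  "cocone_map C (discrete_cat I) X c Y d h \<longleftrightarrow> h \<in> Hom C X Y \<and> (\<forall>i\<in>I. Cmp C h (c i) = d i)"
  by (simp add: cocone_map_def discrete_cat_def)

lemma points_Hom: "b \<in> points C S X \<longleftrightarrow> Src C b \<in> S \<and> b \<in> Hom C (Src C b) X"
  by (auto simp: points_def Hom_iff)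

lemma points_HomI: "b \<in> Hom C A X \<Longrightarrow> A \<in> S \<Longrightarrow> b \<in> points C S X"
  by (auto simp: points_def Hom_iff)

lemma points_Cmp: "category C \<Longrightarrow> f \<in> Hom C X Y \<Longrightarrow> b \<in> points C S X \<Longrightarrow> Cmp C f b \<in> points C S Y"
  by (simp add: points_def Hom_iff cat_simps)

text \<open>A family of generators of length \<alpha> is a discrete diagram and the types are
  collected over all such families. The family belonging to a tuple is recovered as the sources of
  its entries, so collecting does not disturb uniqueness.\<close>

lemma (in regular_universe) locally_multipresentable_presented:
  fixes C :: "('o, 'u) cat"
  assumes cat: "category C" and ls: "locally_small TYPE('u) C" and mono: "\<forall>f\<in>Ar C. mono_arrow C f"
    and lmp: "locally_multipresentable \<mu> C"
  shows "\<exists>S Ty. presented_category \<mu> C S Ty"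
proof -
  have acc: "accessible \<mu> C" using lmp by (simp add: locally_multipresentable_def)
  then have dc: "has_directed_colimits \<mu> C" by (simp add: accessible_def)
  obtain S where S: "small TYPE('u) S" "\<forall>A\<in>S. presentable \<mu> C A"
     "\<forall>X\<in>Ob C. \<exists>I r E c. directed_poset \<mu> I r \<and> is_functor (poset_cat I r) C E \<and>
           (\<forall>i\<in>I. FO E i \<in> S) \<and> is_colimit C (poset_cat I r) E X c"
    using acc unfolding accessible_def by (elim conjE exE)
  have SOb: "A \<in> Ob C" if "A \<in> S" for A using S(2) that by (auto simp: presentable_def)
  define ok where "ok \<alpha> A W \<longleftrightarrow> small TYPE('u) W \<and> (\<forall>(X, c)\<in>W. cocone C (discrete_cat (underS \<mu> \<alpha>)) (discrete_diagram C A) X c) \<and>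
     (\<forall>Y d. cocone C (discrete_cat (underS \<mu> \<alpha>)) (discrete_diagram C A) Y d \<longrightarrow>
       (\<exists>!w. w \<in> W \<and> (\<exists>h. cocone_map C (discrete_cat (underS \<mu> \<alpha>)) (fst w) (snd w) Y d h)) \<and>
       (\<forall>(X, c)\<in>W. \<forall>h k. cocone_map C (discrete_cat (underS \<mu> \<alpha>)) X c Y d h \<longrightarrow>
          cocone_map C (discrete_cat (underS \<mu> \<alpha>)) X c Y d k \<longrightarrow> h = k))" for \<alpha> A W
  have "\<exists>W. ok \<alpha> A W" if \<alpha>: "\<alpha> \<in> Field \<mu>" and A: "A \<in> (underS \<mu> \<alpha> \<rightarrow>\<^sub>E S)" for \<alpha> A
  proof -
    have "small_category TYPE('u) (discrete_cat (underS \<mu> \<alpha>))"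
      using small_underS[OF \<alpha>] category_discrete by (auto simp: small_category_def discrete_cat_def)
    moreover have "is_functor (discrete_cat (underS \<mu> \<alpha>)) C (discrete_diagram C A)"
      by (rule discrete_functor[OF cat]) (use A SOb in \<open>auto simp: tuples_def\<close>)
    ultimately have "has_multicolimit TYPE('u) C (discrete_cat (underS \<mu> \<alpha>)) (discrete_diagram C A)"
      using lmp by (simp add: locally_multipresentable_def)
    then show ?thesis unfolding multicolimit_iff ok_def .
  qed
  then obtain W where W: "\<And>\<alpha> A. \<alpha> \<in> Field \<mu> \<Longrightarrow> A \<in> (underS \<mu> \<alpha> \<rightarrow>\<^sub>E S) \<Longrightarrow> ok \<alpha> A (W \<alpha> A)" by metis
  define Ty where "Ty \<alpha> = (\<Union>A\<in>(underS \<mu> \<alpha> \<rightarrow>\<^sub>E S). W \<alpha> A)" for \<alpha>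
  have Wc: "fst w \<in> Ob C \<and> snd w \<in> (\<Pi>\<^sub>E i\<in>underS \<mu> \<alpha>. Hom C (A i) (fst w))"
    if "\<alpha> \<in> Field \<mu>" "A \<in> (underS \<mu> \<alpha> \<rightarrow>\<^sub>E S)" "w \<in> W \<alpha> A" for \<alpha> A w
    using W[OF that(1,2)] that(3) unfolding ok_def discrete_cocone[OF cat] by (auto simp: case_prod_beta)
  have Wex: "\<exists>!w. w \<in> W \<alpha> A \<and> (\<exists>h\<in>Hom C (fst w) Y. \<forall>i\<in>underS \<mu> \<alpha>. Cmp C h (snd w i) = d i)"
    if "\<alpha> \<in> Field \<mu>" "A \<in> (underS \<mu> \<alpha> \<rightarrow>\<^sub>E S)" "Y \<in> Ob C" "d \<in> (\<Pi>\<^sub>E i\<in>underS \<mu> \<alpha>. Hom C (A i) Y)" for \<alpha> A Y d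
    using W[OF that(1,2)] that(3,4) unfolding ok_def discrete_cocone[OF cat] discrete_cocone_map Bex_def by simp
  have Wun: "h = k" if \<alpha>: "\<alpha> \<in> Field \<mu>" and A: "A \<in> (underS \<mu> \<alpha> \<rightarrow>\<^sub>E S)" and w: "w \<in> W \<alpha> A" and
    h: "h \<in> Hom C (fst w) Y" and k: "k \<in> Hom C (fst w) Y" and e: "\<forall>i\<in>underS \<mu> \<alpha>. Cmp C h (snd w i) = Cmp C k (snd w i)"
    for \<alpha> A w Y h k
  proof -
    let ?d = "\<lambda>i\<in>underS \<mu> \<alpha>. Cmp C h (snd w i)"
    have d: "Y \<in> Ob C" "?d \<in> (\<Pi>\<^sub>E i\<in>underS \<mu> \<alpha>. Hom C (A i) Y)"
      using Hom_Ob2[OF cat h] Wc[OF \<alpha> A w] Cmp_Hom[OF cat _ h] by auto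
    have "\<forall>(X, c)\<in>W \<alpha> A. \<forall>h k. cocone_map C (discrete_cat (underS \<mu> \<alpha>)) X c Y ?d h \<longrightarrow>
          cocone_map C (discrete_cat (underS \<mu> \<alpha>)) X c Y ?d k \<longrightarrow> h = k"
      using W[OF \<alpha> A] d unfolding ok_def discrete_cocone[OF cat] by blast
    then have "cocone_map C (discrete_cat (underS \<mu> \<alpha>)) (fst w) (snd w) Y ?d h \<longrightarrow>
          cocone_map C (discrete_cat (underS \<mu> \<alpha>)) (fst w) (snd w) Y ?d k \<longrightarrow> h = k"
      using w by (simp add: case_prod_beta)
    then show ?thesis using h k e by (simp add: discrete_cocone_map)
  qed
  have "presented_category \<mu> C S Ty"
  proof
    show "category C" "locally_small TYPE('u) C" "\<forall>f\<in>Ar C. mono_arrow C f" "has_directed_colimits \<mu> C" "small TYPE('u) S"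
      by (fact cat ls mono dc S(1))+
    show "factoring \<mu> C A" if "A \<in> S" for A using presentable_imp_factoring[OF cat ls] S(2) that by blast
    show "\<exists>I r D c. directed_poset \<mu> I r \<and> is_functor (poset_cat I r) C D \<and>
        (\<forall>i\<in>I. FO D i \<in> S) \<and> is_colimit C (poset_cat I r) D X c" if "X \<in> Ob C" for X
      using bspec[OF S(3) that] .
  next
    fix \<alpha> assume \<alpha>: "\<alpha> \<in> Field \<mu>"
    show "small TYPE('u) (Ty \<alpha>)" unfolding Ty_def
      using small_PiE[OF small_underS[OF \<alpha>] S(1)]
      by (rule small_UN) (use W[OF \<alpha>] in \<open>simp add: ok_def\<close>)
    show "fst t \<in> Ob C \<and> snd t \<in> tuples \<mu> \<alpha> (points C S (fst t))" if t: "t \<in> Ty \<alpha>" for t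
    proof -
      obtain A where A: "A \<in> (underS \<mu> \<alpha> \<rightarrow>\<^sub>E S)" "t \<in> W \<alpha> A" using t unfolding Ty_def by blast
      have "snd t i \<in> points C S (fst t)" if "i \<in> underS \<mu> \<alpha>" for i
        using points_HomI[of "snd t i" C "A i" "fst t" S] Wc[OF \<alpha> A] A(1) that by (auto simp: tuples_def)
      then show ?thesis using Wc[OF \<alpha> A] by (auto simp: tuples_def PiE_def)
    qed
    show "h = k" if t: "t \<in> Ty \<alpha>" "h \<in> Hom C (fst t) X" "k \<in> Hom C (fst t) X"
        "\<forall>i\<in>underS \<mu> \<alpha>. Cmp C h (snd t i) = Cmp C k (snd t i)" for t h k X
    proof -
      obtain A where A: "A \<in> (underS \<mu> \<alpha> \<rightarrow>\<^sub>E S)" "t \<in> W \<alpha> A" using t unfolding Ty_def by blast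
      show ?thesis by (rule Wun[OF \<alpha> A t(2,3,4)])
    qed
    fix X x assume X: "X \<in> Ob C" and x: "x \<in> tuples \<mu> \<alpha> (points C S X)"
    define A where "A = (\<lambda>i\<in>underS \<mu> \<alpha>. Src C (x i))"
    have A: "A \<in> (underS \<mu> \<alpha> \<rightarrow>\<^sub>E S)" using x by (auto simp: A_def tuples_def points_def)
    have xd: "x \<in> (\<Pi>\<^sub>E i\<in>underS \<mu> \<alpha>. Hom C (A i) X)"
      using x by (auto simp: A_def tuples_def points_def Hom_iff PiE_def)
    \<comment> \<open>Composition does not change sources, so a type mapping onto \<open>x\<close>
      belongs to the family of the sources of \<open>x\<close>.\<close>
    have same: "t \<in> W \<alpha> A" if t: "t \<in> Ty \<alpha>" and h: "h \<in> Hom C (fst t) X" "\<forall>i\<in>underS \<mu> \<alpha>. Cmp C h (snd t i) = x i" for t h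
    proof -
      obtain A' where A': "A' \<in> (underS \<mu> \<alpha> \<rightarrow>\<^sub>E S)" "t \<in> W \<alpha> A'" using t unfolding Ty_def by blast
      have "A' i = A i" if i: "i \<in> underS \<mu> \<alpha>" for i
      proof -
        have ti: "snd t i \<in> Hom C (A' i) (fst t)" using Wc[OF \<alpha> A'] i by auto
        have "Cmp C h (snd t i) \<in> Hom C (A' i) X" by (rule Cmp_Hom[OF cat ti h(1)])
        then show ?thesis using h(2) i by (auto simp: A_def Hom_iff)
      qed
      then have "A' = A" using A A'(1) by (intro PiE_ext[of A' _ _ A]) auto
      then show ?thesis using A'(2) by simp
    qed
    obtain w where w: "w \<in> W \<alpha> A" "\<exists>h\<in>Hom C (fst w) X. \<forall>i\<in>underS \<mu> \<alpha>. Cmp C h (snd w i) = x i"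
      and wu: "\<And>w'. w' \<in> W \<alpha> A \<Longrightarrow> \<exists>h\<in>Hom C (fst w') X. \<forall>i\<in>underS \<mu> \<alpha>. Cmp C h (snd w' i) = x i \<Longrightarrow> w' = w"
      using Wex[OF \<alpha> A X xd] by blast
    show "\<exists>!t. t \<in> Ty \<alpha> \<and> (\<exists>h\<in>Hom C (fst t) X. \<forall>i\<in>underS \<mu> \<alpha>. Cmp C h (snd t i) = x i)"
    proof (rule ex1I[of _ w])
      show "w \<in> Ty \<alpha> \<and> (\<exists>h\<in>Hom C (fst w) X. \<forall>i\<in>underS \<mu> \<alpha>. Cmp C h (snd w i) = x i)" using w A by (auto simp: Ty_def)
      show "t = w" if "t \<in> Ty \<alpha> \<and> (\<exists>h\<in>Hom C (fst t) X. \<forall>i\<in>underS \<mu> \<alpha>. Cmp C h (snd t i) = x i)" for t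
        using that same wu by blast
    qed
  qed
  then show ?thesis by blast
qed

section \<open>The structure of points\<close>

context presented_category
begin

abbreviation "U \<equiv> points C S"

text \<open>A directed poset has an element, as a bound of the empty set, and the corresponding leg
  of a presentation is a point. This supplies default values for operations.\<close>

lemma U_nonempty: "X \<in> Ob C \<Longrightarrow> U X \<noteq> {}"
proof -
  assume X: "X \<in> Ob C"
  obtain I r D c where D: "directed_poset \<mu> I r" "\<forall>i\<in>I. FO D i \<in> S" "is_colimit C (poset_cat I r) D X c"
    using pres[OF X] by (elim exE conjE)
  obtain i where i: "i \<in> I" using directed_nonempty[OF D(1)] by blast
  have "cocone C (poset_cat I r) D X c" using D(3) by (simp add: is_colimit_iff)
  from cocone_arrow[OF this, of i] have "c i \<in> U X" using points_HomI[of "c i" C "FO D i" X S] D(2) i by simp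
  then show ?thesis by blast
qed

lemma S_Ob: "A \<in> S \<Longrightarrow> A \<in> Ob C"
  using S_fac by (auto simp: factoring_def)

lemma U_small: "X \<in> Ob C \<Longrightarrow> small TYPE('u) (U X)"
proof -
  assume X: "X \<in> Ob C"
  have "small TYPE('u) (\<Union>A\<in>S. Hom C A X)"
    using S_small by (rule small_UN) (use ls S_Ob X in \<open>auto simp: locally_small_def\<close>)
  then show ?thesis by (rule small_subset) (auto simp: points_def Hom_iff)
qed

definition ty :: "'u \<Rightarrow> 'o \<Rightarrow> ('u \<Rightarrow> 'u) \<Rightarrow> 'o \<times> ('u \<Rightarrow> 'u)" where
  "ty \<alpha> X x = (THE t. t \<in> Ty \<alpha> \<and> (\<exists>h\<in>Hom C (fst t) X. \<forall>i\<in>underS \<mu> \<alpha>. Cmp C h (snd t i) = x i))"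

definition hm :: "'u \<Rightarrow> 'o \<Rightarrow> ('u \<Rightarrow> 'u) \<Rightarrow> 'u" where
  "hm \<alpha> X x = (SOME h. h \<in> Hom C (fst (ty \<alpha> X x)) X \<and> (\<forall>i\<in>underS \<mu> \<alpha>. Cmp C h (snd (ty \<alpha> X x) i) = x i))"

lemma
  assumes "\<alpha> \<in> Field \<mu>" "X \<in> Ob C" "x \<in> tuples \<mu> \<alpha> (U X)"
  shows ty_Ty: "ty \<alpha> X x \<in> Ty \<alpha>" and hm_Hom: "hm \<alpha> X x \<in> Hom C (fst (ty \<alpha> X x)) X"
    and hm_tuple: "i \<in> underS \<mu> \<alpha> \<Longrightarrow> Cmp C (hm \<alpha> X x) (snd (ty \<alpha> X x) i) = x i"
proof -
  have 1: "ty \<alpha> X x \<in> Ty \<alpha> \<and> (\<exists>h\<in>Hom C (fst (ty \<alpha> X x)) X. \<forall>i\<in>underS \<mu> \<alpha>. Cmp C h (snd (ty \<alpha> X x) i) = x i)"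
    unfolding ty_def by (rule theI'[OF Ty_ex1[OF assms]])
  then show "ty \<alpha> X x \<in> Ty \<alpha>" by simp
  have "\<exists>h. h \<in> Hom C (fst (ty \<alpha> X x)) X \<and> (\<forall>i\<in>underS \<mu> \<alpha>. Cmp C h (snd (ty \<alpha> X x) i) = x i)" using 1 by blast
  then have "hm \<alpha> X x \<in> Hom C (fst (ty \<alpha> X x)) X \<and> (\<forall>i\<in>underS \<mu> \<alpha>. Cmp C (hm \<alpha> X x) (snd (ty \<alpha> X x) i) = x i)"
    unfolding hm_def by (rule someI_ex)
  then show "hm \<alpha> X x \<in> Hom C (fst (ty \<alpha> X x)) X" "i \<in> underS \<mu> \<alpha> \<Longrightarrow> Cmp C (hm \<alpha> X x) (snd (ty \<alpha> X x) i) = x i"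
    by auto
qed

text \<open>Any factorisation through a member of \<open>Ty \<alpha>\<close> identifies the type.
  Applied to \<open>f\<close> after the factorisation of \<open>x\<close>, it shows that a tuple and
  its image have the same type, whence naturality of the operations.\<close>

lemma ty_hm_eq:
  assumes \<alpha>: "\<alpha> \<in> Field \<mu>" and t: "t \<in> Ty \<alpha>" and h: "h \<in> Hom C (fst t) X" and x: "x \<in> tuples \<mu> \<alpha> (U X)"
    and e: "\<And>i. i \<in> underS \<mu> \<alpha> \<Longrightarrow> Cmp C h (snd t i) = x i"
  shows "ty \<alpha> X x = t" "hm \<alpha> X x = h"
proof -
  have X: "X \<in> Ob C" by (rule Hom_Ob2[OF cat h])
  show ty: "ty \<alpha> X x = t" unfolding ty_def
    by (rule the1_equality[OF Ty_ex1[OF \<alpha> X x]]) (use t h e in blast)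
  show "hm \<alpha> X x = h"
    by (rule Ty_unique[OF \<alpha> t _ h]) (use hm_Hom[OF \<alpha> X x] hm_tuple[OF \<alpha> X x] e ty in auto)
qed

definition Ops :: "('u \<times> ('o \<times> ('u \<Rightarrow> 'u) \<Rightarrow> 'u)) set" where
  "Ops = (SIGMA \<alpha>:Field \<mu>. \<Pi>\<^sub>E t\<in>Ty \<alpha>. U (fst t))"

definition opc :: "'u \<times> ('o \<times> ('u \<Rightarrow> 'u) \<Rightarrow> 'u) \<Rightarrow> 'u" where
  "opc = (SOME c. inj_on c Ops)"

definition sortc :: "'o \<Rightarrow> 'u" where
  "sortc = (SOME c. inj_on c S)"

text \<open>The ordinal 1, as an element of the well-order \<mu>; it is the arity of the sort
  predicates, and \<open>pt\<close> is its only element.\<close>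

definition one :: 'u where
  "one = (SOME \<alpha>. \<alpha> \<in> Field \<mu> \<and> (\<exists>\<iota>. underS \<mu> \<alpha> = {\<iota>}))"

definition pt :: 'u where
  "pt = (SOME \<iota>. underS \<mu> one = {\<iota>})"

lemma one_pt: "one \<in> Field \<mu>" "underS \<mu> one = {pt}"
proof -
  obtain \<alpha> f where a: "\<alpha> \<in> Field \<mu>" "bij_betw f (underS \<mu> \<alpha>) {True}"
    using less_mu_enum[OF less_mu_finite[of "{True}"]] by auto
  have "inj_on f (underS \<mu> \<alpha>)" "f ` underS \<mu> \<alpha> = {True}" using a(2) by (auto simp: bij_betw_def)
  then have "card (underS \<mu> \<alpha>) = 1" using card_image[of f "underS \<mu> \<alpha>"] by simp
  then have "\<exists>\<iota>. underS \<mu> \<alpha> = {\<iota>}" by (simp add: card_1_singleton_iff)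
  with a(1) have "\<alpha> \<in> Field \<mu> \<and> (\<exists>\<iota>. underS \<mu> \<alpha> = {\<iota>})" by (rule conjI)
  then have "one \<in> Field \<mu> \<and> (\<exists>\<iota>. underS \<mu> one = {\<iota>})" unfolding one_def by (rule someI)
  then have "one \<in> Field \<mu>" "\<exists>\<iota>. underS \<mu> one = {\<iota>}" by simp_all
  from this(1) someI_ex[OF this(2)] show "one \<in> Field \<mu>" "underS \<mu> one = {pt}" unfolding pt_def by simp_all
qed

lemma Ops_small: "small TYPE('u) Ops"
  unfolding Ops_def
proof (rule small_Sigma[OF small_Field_mu])
  fix \<alpha> assume \<alpha>: "\<alpha> \<in> Field \<mu>"
  show "small TYPE('u) (\<Pi>\<^sub>E t\<in>Ty \<alpha>. U (fst t))"
    by (rule small_PiE[OF Ty_small[OF \<alpha>] U_small]) (simp add: Ty_tuple[OF \<alpha>])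
qed

lemma opc_inj: "inj_on opc Ops"
  unfolding opc_def using small_code[OF Ops_small] by (rule someI_ex)

lemma sortc_inj: "inj_on sortc S"
  unfolding sortc_def using small_code[OF S_small] by (rule someI_ex)

definition voc :: "'u vocab" where
  "voc = \<lparr>Fsym = opc ` Ops, Rsym = sortc ` S, far = (\<lambda>s. fst (inv_into Ops opc s)), rar = (\<lambda>_. one)\<rparr>"

lemma far_opc: "p \<in> Ops \<Longrightarrow> far voc (opc p) = fst p"
  by (simp add: voc_def opc_inj)

lemma Fsym_voc: "s \<in> Fsym voc \<longleftrightarrow> (\<exists>\<alpha> e. s = opc (\<alpha>, e) \<and> (\<alpha>, e) \<in> Ops)"
  by (auto simp: voc_def)

lemma Rsym_voc: "s \<in> Rsym voc \<longleftrightarrow> (\<exists>A\<in>S. s = sortc A)"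
  by (auto simp: voc_def)

lemma rar_voc: "rar voc s = one"
  by (simp add: voc_def)

lemma vocabulary_voc: "vocabulary \<mu> voc"
  unfolding vocabulary_def
proof (intro conjI ballI)
  show "small TYPE('u) (Fsym voc)" "small TYPE('u) (Rsym voc)"
    using small_image[OF Ops_small] small_image[OF S_small] by (simp_all add: voc_def)
  show "far voc s \<in> Field \<mu>" if "s \<in> Fsym voc" for s
    using that unfolding Fsym_voc by (auto simp: far_opc) (auto simp: Ops_def)
  show "rar voc s \<in> Field \<mu>" for s using one_pt by (simp add: rar_voc)
qed

end

sublocale presented_category \<subseteq> vocab_universe \<mu> voc
  by unfold_locales (rule vocabulary_voc)

context presented_category
begin

definition act :: "'o \<Rightarrow> 'u \<Rightarrow> ('u \<Rightarrow> 'u) \<Rightarrow> 'u" where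
  "act X s x = (case inv_into Ops opc s of (\<alpha>, e) \<Rightarrow> Cmp C (hm \<alpha> X x) (e (ty \<alpha> X x)))"

lemma act_opc: "(\<alpha>, e) \<in> Ops \<Longrightarrow> act X (opc (\<alpha>, e)) x = Cmp C (hm \<alpha> X x) (e (ty \<alpha> X x))"
  by (simp add: act_def opc_inj)

definition E :: "'o \<Rightarrow> 'u str" where
  "E X = \<lparr>univ = U X, fns = (\<lambda>s\<in>Fsym voc. \<lambda>x\<in>tuples \<mu> (far voc s) (U X). act X s x),
     rels = (\<lambda>s. if s \<in> Rsym voc then {x \<in> tuples \<mu> one (U X). sortc (Src C (x pt)) = s} else {})\<rparr>"

lemma E_univ[simp]: "univ (E X) = U X"
  by (simp add: E_def)

lemma E_fns: "(\<alpha>, e) \<in> Ops \<Longrightarrow> x \<in> tuples \<mu> \<alpha> (U X) \<Longrightarrow> fns (E X) (opc (\<alpha>, e)) x = Cmp C (hm \<alpha> X x) (e (ty \<alpha> X x))"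
  using far_opc[of "(\<alpha>, e)"] act_opc[of \<alpha> e X x] by (auto simp: E_def Fsym_voc)

lemma E_rels: "A \<in> S \<Longrightarrow> x \<in> rels (E X) (sortc A) \<longleftrightarrow> x \<in> tuples \<mu> one (U X) \<and> Src C (x pt) = A"
proof -
  assume A: "A \<in> S"
  have "Src C (x pt) \<in> S" if "x \<in> tuples \<mu> one (U X)" using that one_pt by (auto simp: tuples_def points_def)
  then show ?thesis using A inj_on_eq_iff[OF sortc_inj] by (auto simp: E_def Rsym_voc)
qed

lemma E_str: assumes X: "X \<in> Ob C" shows "str (E X)"
  unfolding str_of_def
proof (intro conjI ballI allI impI)
  show "small TYPE('u) (univ (E X))" using U_small[OF X] by simp
  have cl: "fns (E X) s x \<in> U X" if s: "s \<in> Fsym voc" and x: "x \<in> ftuples s (U X)" for s x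
  proof -
    obtain \<alpha> e where e: "s = opc (\<alpha>, e)" "(\<alpha>, e) \<in> Ops" using s unfolding Fsym_voc by blast
    have x': "x \<in> tuples \<mu> \<alpha> (U X)" using x e far_opc[OF e(2)] by simp
    have \<alpha>: "\<alpha> \<in> Field \<mu>" and eP: "e \<in> (\<Pi>\<^sub>E t\<in>Ty \<alpha>. U (fst t))" using e(2) by (auto simp: Ops_def)
    have "e (ty \<alpha> X x) \<in> U (fst (ty \<alpha> X x))" using PiE_mem[OF eP ty_Ty[OF \<alpha> X x']] .
    then show ?thesis using points_Cmp[OF cat hm_Hom[OF \<alpha> X x']] E_fns[OF e(2) x'] e(1) by simp
  qed
  then show "fns (E X) \<in> (\<Pi>\<^sub>E s\<in>Fsym voc. ftuples s (univ (E X)) \<rightarrow>\<^sub>E univ (E X))"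
    by (auto simp: E_def)
  show "rels (E X) s \<subseteq> rtuples s (univ (E X))" if "s \<in> Rsym voc" for s by (auto simp: E_def rar_voc)
  show "rels (E X) s = {}" if "s \<notin> Rsym voc" for s using that by (simp add: E_def)
qed

text \<open>Operations are preserved since a tuple and its image have the same type, sorts since
  composition keeps sources. For injectivity, equal composites must first be seen to have equal
  sources; then the monomorphism \<open>f\<close> cancels.\<close>

lemma E_emb:
  assumes f: "f \<in> Hom C X Y"
  shows "emb (E X) (Cmp C f) (E Y)"
  unfolding embedding_def
proof (intro conjI ballI)
  have X: "X \<in> Ob C" and Y: "Y \<in> Ob C" using Hom_Ob1[OF cat f] Hom_Ob2[OF cat f] .
  have fU: "Cmp C f \<in> U X \<rightarrow> U Y" using points_Cmp[OF cat f] by blast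
  show "Cmp C f \<in> univ (E X) \<rightarrow> univ (E Y)" using fU by simp
  have sm: "Src C (Cmp C f b) = Src C b" if "b \<in> U X" for b
    using that f cat by (simp add: points_def Hom_iff cat_simps)
  show "inj_on (Cmp C f) (univ (E X))"
  proof (rule inj_onI)
    fix b b' assume b: "b \<in> univ (E X)" "b' \<in> univ (E X)" and e: "Cmp C f b = Cmp C f b'"
    then have s: "Src C b = Src C b'" using sm by (metis E_univ)
    have "b \<in> Hom C (Src C b) X" "b' \<in> Hom C (Src C b) X" using b s by (auto simp: points_def Hom_iff)
    then show "b = b'" using e by (rule mono_cancel[OF cat mono _ _ f])
  qed
  fix s x assume s: "s \<in> Fsym voc" and x: "x \<in> ftuples s (univ (E X))"
  obtain \<alpha> e where e: "s = opc (\<alpha>, e)" "(\<alpha>, e) \<in> Ops" using s unfolding Fsym_voc by blast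
  have fs: "far voc s = \<alpha>" using e far_opc[OF e(2)] by simp
  have x': "x \<in> tuples \<mu> \<alpha> (U X)" using x fs by simp
  have \<alpha>: "\<alpha> \<in> Field \<mu>" and eP: "e \<in> (\<Pi>\<^sub>E t\<in>Ty \<alpha>. U (fst t))" using e(2) by (auto simp: Ops_def)
  have y: "fcmp s (Cmp C f) x \<in> tuples \<mu> \<alpha> (U Y)" using tuples_compose[OF x' fU] fs by simp
  note h = hm_Hom[OF \<alpha> X x'] and t = ty_Ty[OF \<alpha> X x']
  have "Cmp C (Cmp C f (hm \<alpha> X x)) (snd (ty \<alpha> X x) i) = fcmp s (Cmp C f) x i" if i: "i \<in> underS \<mu> \<alpha>" for i
  proof -
    have "snd (ty \<alpha> X x) i \<in> U (fst (ty \<alpha> X x))" using Ty_tuple[OF \<alpha> t] i by (auto simp: tuples_def)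
    then have "snd (ty \<alpha> X x) i \<in> Hom C (Src C (snd (ty \<alpha> X x) i)) (fst (ty \<alpha> X x))" by (simp add: points_Hom)
    then show ?thesis using Hom_assoc[OF cat _ h f] hm_tuple[OF \<alpha> X x' i] i fs by (simp add: compose_def)
  qed
  note ty = ty_hm_eq[OF \<alpha> t Cmp_Hom[OF cat h f] y this]
  have eH: "e (ty \<alpha> X x) \<in> Hom C (Src C (e (ty \<alpha> X x))) (fst (ty \<alpha> X x))"
    using PiE_mem[OF eP t] by (simp add: points_Hom)
  show "Cmp C f (fns (E X) s x) = fns (E Y) s (fcmp s (Cmp C f) x)"
    using E_fns[OF e(2) x'] E_fns[OF e(2) y] ty Hom_assoc[OF cat eH h f] e(1) by simp
next
  fix s x assume s: "s \<in> Rsym voc" and x: "x \<in> rtuples s (univ (E X))"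
  obtain A where A: "A \<in> S" "s = sortc A" using s unfolding Rsym_voc by blast
  have x': "x \<in> tuples \<mu> one (U X)" using x by (simp add: rar_voc)
  have fU: "Cmp C f \<in> U X \<rightarrow> U Y" using points_Cmp[OF cat f] by blast
  have "x pt \<in> U X" using x' one_pt by (auto simp: tuples_def)
  then have "Src C (Cmp C f (x pt)) = Src C (x pt)" using f cat by (simp add: points_def Hom_iff cat_simps)
  then show "x \<in> rels (E X) s \<longleftrightarrow> rcmp s (Cmp C f) x \<in> rels (E Y) s"
    using tuples_compose[OF x' fU] x' A one_pt by (simp add: E_rels rar_voc compose_def)
qed

text \<open>The legs of a presentation of \<open>X\<close> are themselves points, and arrows out of
  the colimit \<open>X\<close> are determined on them.\<close>

lemma E_faithful:
  assumes f: "f \<in> Hom C X Y" and g: "g \<in> Hom C X Y" and e: "\<And>b. b \<in> U X \<Longrightarrow> Cmp C f b = Cmp C g b"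
  shows "f = g"
proof -
  have X: "X \<in> Ob C" by (rule Hom_Ob1[OF cat f])
  obtain I r D c where D: "directed_poset \<mu> I r" "is_functor (poset_cat I r) C D" "\<forall>i\<in>I. FO D i \<in> S" "is_colimit C (poset_cat I r) D X c"
    using pres[OF X] by (elim exE conjE)
  have c: "cocone C (poset_cat I r) D X c" using D(4) by (simp add: is_colimit_iff)
  have d: "cocone C (poset_cat I r) D Y (\<lambda>j\<in>I. Cmp C f (c j))"
    using cocone_comp[OF cat category_poset[OF D(1)] D(2) c f] by simp
  have "c i \<in> U X" if "i \<in> I" for i using points_HomI[of "c i" C "FO D i"] cocone_arrow[OF c] D(3) that by simp
  then show ?thesis
    by (intro cocone_map_unique[OF D(4) d]) (use f g e in \<open>auto simp: cocone_map_def\<close>)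
qed

lemma E_preserves_sort:
  assumes \<phi>: "emb (E X) \<phi> (E Y)" and b: "b \<in> U X"
  shows "Src C (\<phi> b) = Src C b"
proof -
  let ?x = "\<lambda>i\<in>underS \<mu> one. b"
  have A: "Src C b \<in> S" using b by (simp add: points_def)
  have x: "?x \<in> tuples \<mu> one (U X)" using b by (auto simp: tuples_def)
  have "sortc (Src C b) \<in> Rsym voc" using A by (auto simp: Rsym_voc)
  from emb_rels[OF \<phi> this, of ?x] have "?x \<in> rels (E X) (sortc (Src C b)) \<longleftrightarrow> compose (underS \<mu> one) \<phi> ?x \<in> rels (E Y) (sortc (Src C b))"
    using x by (simp add: rar_voc)
  then show ?thesis using x b one_pt by (simp add: E_rels[OF A] compose_def)
qed

text \<open>A choice function decides by the sort of the one-element tuple. On sort \<open>A\<close>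
  the point is precomposed with \<open>g\<close>; on other sorts, where \<open>g\<close> does not
  apply, the point itself is a default value.\<close>

lemma E_precompose:
  assumes A: "A \<in> S" and g: "g \<in> Hom C B A" and B: "B \<in> S"
  shows "\<exists>s\<in>Fsym voc. far voc s = one \<and> (\<forall>X\<in>Ob C. \<forall>b\<in>U X. Src C b = A \<longrightarrow> fns (E X) s (\<lambda>i\<in>underS \<mu> one. b) = Cmp C b g)"
proof -
  define e where "e = (\<lambda>t\<in>Ty one. if Src C (snd t pt) = A then Cmp C (snd t pt) g else snd t pt)"
  have sp: "snd t pt \<in> U (fst t)" if "t \<in> Ty one" for t
    using Ty_tuple[OF one_pt(1) that] one_pt(2) by (auto simp: tuples_def)
  have "e t \<in> U (fst t)" if t: "t \<in> Ty one" for t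
  proof (cases "Src C (snd t pt) = A")
    case True
    then have "snd t pt \<in> Hom C A (fst t)" using sp[OF t] by (auto simp: points_Hom)
    then have "Cmp C (snd t pt) g \<in> Hom C B (fst t)" by (rule Cmp_Hom[OF cat g])
    then show ?thesis using points_HomI B t True by (simp add: e_def)
  qed (use sp[OF t] t in \<open>simp add: e_def\<close>)
  then have e: "(one, e) \<in> Ops" using one_pt(1) by (auto simp: Ops_def e_def)
  have "fns (E X) (opc (one, e)) (\<lambda>i\<in>underS \<mu> one. b) = Cmp C b g" if X: "X \<in> Ob C" and b: "b \<in> U X" "Src C b = A" for X b
  proof -
    let ?x = "\<lambda>i\<in>underS \<mu> one. b"
    have x: "?x \<in> tuples \<mu> one (U X)" using b by (auto simp: tuples_def)
    note t = ty_Ty[OF one_pt(1) X x] and h = hm_Hom[OF one_pt(1) X x]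
    have hb: "Cmp C (hm one X ?x) (snd (ty one X ?x) pt) = b" using hm_tuple[OF one_pt(1) X x, of pt] one_pt(2) by simp
    have p: "snd (ty one X ?x) pt \<in> Hom C (Src C (snd (ty one X ?x) pt)) (fst (ty one X ?x))" using sp[OF t] by (simp add: points_Hom)
    have "Src C (snd (ty one X ?x) pt) = Src C (Cmp C (hm one X ?x) (snd (ty one X ?x) pt))"
      using Cmp_Hom[OF cat p h] by (simp add: Hom_iff)
    then have sA: "Src C (snd (ty one X ?x) pt) = A" unfolding hb using b(2) by simp
    have pA: "snd (ty one X ?x) pt \<in> Hom C A (fst (ty one X ?x))" using p sA by simp
    have "Cmp C (hm one X ?x) (Cmp C (snd (ty one X ?x) pt) g) = Cmp C b g"
      using Hom_assoc[OF cat g pA h] hb by simp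
    then show ?thesis using E_fns[OF e x] t sA by (simp add: e_def)
  qed
  then show ?thesis using e far_opc[OF e] by (intro bexI[of _ "opc (one, e)"]) (auto simp: Fsym_voc)
qed

lemma emb_precompose:
  assumes \<phi>: "emb (E X) \<phi> (E Y)" and X: "X \<in> Ob C" and Y: "Y \<in> Ob C" and b: "b \<in> U X"
    and g: "g \<in> Hom C B (Src C b)" and B: "B \<in> S"
  shows "\<phi> (Cmp C b g) = Cmp C (\<phi> b) g"
proof -
  have A: "Src C b \<in> S" using b by (simp add: points_def)
  obtain s where s: "s \<in> Fsym voc" "far voc s = one"
     "\<forall>X\<in>Ob C. \<forall>b'\<in>U X. Src C b' = Src C b \<longrightarrow> fns (E X) s (\<lambda>i\<in>underS \<mu> one. b') = Cmp C b' g"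
    using E_precompose[OF A g B] by blast
  have x: "(\<lambda>i\<in>underS \<mu> one. b) \<in> ftuples s (univ (E X))" using b s(2) by (auto simp: tuples_def)
  have "compose (underS \<mu> one) \<phi> (\<lambda>i\<in>underS \<mu> one. b) = (\<lambda>i\<in>underS \<mu> one. \<phi> b)" by (auto simp: compose_def)
  moreover have "\<phi> b \<in> U Y" using emb_fn[OF \<phi>] b by auto
  ultimately show ?thesis
    using emb_fns[OF \<phi> s(1) x] s(2,3) X Y b E_preserves_sort[OF \<phi> b] by simp
qed

text \<open>An embedding keeps sorts and commutes with precomposition by arrows between members of
  \<open>S\<close>, so it takes the legs of a presentation of \<open>X\<close> to a cocone on
  \<open>Y\<close>. The induced arrow agrees with it on every point, because a point, its source
  being \<open>factoring\<close>, factors through a leg.\<close>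

lemma E_full:
  assumes \<phi>: "emb (E X) \<phi> (E Y)" and X: "X \<in> Ob C" and Y: "Y \<in> Ob C"
  shows "\<exists>f\<in>Hom C X Y. \<forall>b\<in>U X. \<phi> b = Cmp C f b"
proof -
  obtain I r D c where D: "directed_poset \<mu> I r" "is_functor (poset_cat I r) C D" "\<forall>i\<in>I. FO D i \<in> S" "is_colimit C (poset_cat I r) D X c"
    using pres[OF X] by (elim exE conjE)
  have c: "cocone C (poset_cat I r) D X c" using D(4) by (simp add: is_colimit_iff)
  have cH: "c i \<in> Hom C (FO D i) X" if "i \<in> I" for i using cocone_arrow[OF c] that by simp
  have cU: "c i \<in> U X" if "i \<in> I" for i using points_HomI[OF cH[OF that]] D(3) that by blast
  have \<phi>U: "\<phi> b \<in> U Y" if "b \<in> U X" for b using emb_fn[OF \<phi>] that by auto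
  have \<phi>H: "\<phi> b \<in> Hom C (Src C b) Y" if "b \<in> U X" for b
    using \<phi>U[OF that] E_preserves_sort[OF \<phi> that] by (simp add: points_Hom)
  have cS: "Src C (c i) = FO D i" if "i \<in> I" for i using cH[OF that] by (simp add: Hom_iff)
  define d where "d = (\<lambda>i\<in>I. \<phi> (c i))"
  have "Cmp C (d j) (FA D (i, j)) = d i" if ij: "(i, j) \<in> r" for i j
  proof -
    have I: "i \<in> I" "j \<in> I" using directed_poset_facts[OF D(1)] ij by blast+
    have DH: "FA D (i, j) \<in> Hom C (FO D i) (FO D j)" using FA_Hom[OF D(2), of "(i, j)" i j] ij by (simp add: Hom_iff)
    have "Cmp C (c j) (FA D (i, j)) = c i" using cocone_commute[OF c, of "(i, j)"] ij by simp
    then show ?thesis using emb_precompose[OF \<phi> X Y cU[OF I(2)], of "FA D (i, j)" "FO D i"] DH cS[OF I(2)] D(3) I by (simp add: d_def)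
  qed
  then have d: "cocone C (poset_cat I r) D Y d"
    by (rule cocone_posetI[rotated 3]) (use Y \<phi>H[OF cU] cS in \<open>auto simp: d_def extensional_def\<close>)
  obtain f where f: "cocone_map C (poset_cat I r) X c Y d f" using cocone_map_exists[OF D(4) d] by blast
  have fH: "f \<in> Hom C X Y" using f by (simp add: cocone_map_def)
  have "\<phi> b = Cmp C f b" if b: "b \<in> U X" for b
  proof -
    have "Src C b \<in> S" "b \<in> Hom C (Src C b) X" using b by (auto simp: points_Hom)
    then obtain i g where i: "i \<in> I" and g: "g \<in> Hom C (Src C b) (FO D i)" "b = Cmp C (c i) g"
      using S_fac D(1,2,4) unfolding factoring_def by blast
    have "\<phi> b = Cmp C (\<phi> (c i)) g"
      using emb_precompose[OF \<phi> X Y cU[OF i], of g "Src C b"] g cS[OF i] \<open>Src C b \<in> S\<close> by simp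
    also have "\<phi> (c i) = Cmp C f (c i)" using f i by (simp add: cocone_map_def d_def)
    also have "Cmp C (Cmp C f (c i)) g = Cmp C f b" using Hom_assoc[OF cat g(1) cH[OF i] fH] g(2) by simp
    finally show ?thesis .
  qed
  then show ?thesis using fH by blast
qed

end

section \<open>Axioms for the structures of points\<close>

definition code_of :: "'a set \<Rightarrow> 'a \<Rightarrow> 'u" where
  "code_of X = (SOME c. inj_on c X)"

text \<open>\<open>Conj\<close> takes index sets in \<open>'u\<close> only; types and formulas are
  used as indices through their codes.\<close>

definition bconj :: "'a set \<Rightarrow> ('a \<Rightarrow> 'u qff) \<Rightarrow> 'u qff" where
  "bconj X F = Conj (code_of X ` X) (\<lambda>i. F (inv_into X (code_of X) i))"

definition bdisj :: "'a set \<Rightarrow> ('a \<Rightarrow> 'u qff) \<Rightarrow> 'u qff" where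
  "bdisj X F = Disj (code_of X ` X) (\<lambda>i. F (inv_into X (code_of X) i))"

context regular_universe
begin

lemma code_of_inj: "small TYPE('u) X \<Longrightarrow> inj_on (code_of X :: _ \<Rightarrow> 'u) X"
  unfolding code_of_def by (rule someI_ex[OF small_code])

lemma sat_bconj: "small TYPE('u) X \<Longrightarrow> sat \<mu> \<tau> M \<rho> (bconj X F) \<longleftrightarrow> (\<forall>x\<in>X. sat \<mu> \<tau> M \<rho> (F x))"
  using code_of_inj[of X] by (auto simp: bconj_def)

lemma sat_bdisj: "small TYPE('u) X \<Longrightarrow> sat \<mu> \<tau> M \<rho> (bdisj X F) \<longleftrightarrow> (\<exists>x\<in>X. sat \<mu> \<tau> M \<rho> (F x))"
  using code_of_inj[of X] by (auto simp: bdisj_def)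

lemma wf_bconj: "small TYPE('u) X \<Longrightarrow> (\<And>x. x \<in> X \<Longrightarrow> wf_qff \<mu> \<tau> V (F x)) \<Longrightarrow> wf_qff \<mu> \<tau> V (bconj X F)"
  using code_of_inj[of X] small_image[of X "code_of X :: _ \<Rightarrow> 'u"] by (auto simp: bconj_def)

lemma wf_bdisj: "small TYPE('u) X \<Longrightarrow> (\<And>x. x \<in> X \<Longrightarrow> wf_qff \<mu> \<tau> V (F x)) \<Longrightarrow> wf_qff \<mu> \<tau> V (bdisj X F)"
  using code_of_inj[of X] small_image[of X "code_of X :: _ \<Rightarrow> 'u"] by (auto simp: bdisj_def)

end

text \<open>The counterpart of \<open>Kemb_factor\<close> for plain embeddings: the two images are
  comparable substructures of \<open>N\<close>, and \<open>g\<close> is inverted on its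
  image.\<close>

lemma (in vocab_universe) emb_factor:
  assumes M: "str M" and P: "str P" and f: "emb M f N" and g: "emb P g N" and sub: "f ` univ M \<subseteq> g ` univ P"
  shows "\<exists>h. emb M h P \<and> (\<forall>x\<in>univ M. g (h x) = f x)"
proof -
  let ?h = "\<lambda>x. inv_into (univ P) g (f x)"
  note i = img_str_iso[OF M emb_inj[OF f]] and j = img_str_iso[OF P emb_inj[OF g]]
  have s: "substr \<mu> \<tau> (img f M) (img g P)"
    by (rule sub_subset[OF emb_img[OF M f] emb_img[OF P g]]) (use sub in simp)
  have "emb M f (img g P)"
    by (rule emb_comp[OF M iso_emb[OF i(2)] sub_emb[OF i(1) s, of "\<lambda>x. x"]]) simp_all
  then have "emb M ?h P"
    by (rule emb_comp[OF M _ iso_emb[OF iso_inv[OF P j(2)]]]) simp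
  moreover have "\<forall>x\<in>univ M. g (?h x) = f x" using sub by (auto simp: f_inv_into_f)
  ultimately show ?thesis by (intro exI[of _ ?h]) simp
qed

context presented_category
begin

definition Fa :: "'u \<Rightarrow> 'u set" where
  "Fa \<alpha> = {s \<in> Fsym voc. far voc s = \<alpha>}"

text \<open>
  The literals of depth at most two suffice to express that a map from the structure of points of
  a type is well defined and an embedding.
\<close>

definition lits :: "'u \<Rightarrow> 'u qff set" where
  "lits \<alpha> =
     (\<lambda>(s, s'). Eq (Fn s Var) (Fn s' Var)) ` (Fa \<alpha> \<times> Fa \<alpha>) \<union>
     (\<lambda>(i, s). Eq (Var i) (Fn s Var)) ` (underS \<mu> \<alpha> \<times> Fa \<alpha>) \<union>
     (\<lambda>(q, s). Rl q (\<lambda>_. Fn s Var)) ` (Rsym voc \<times> Fa \<alpha>) \<union>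
     (\<lambda>(s', k, s). Eq (Fn s' (\<lambda>j. Fn (k j) Var)) (Fn s Var)) `
       (SIGMA s':Fsym voc. (underS \<mu> (far voc s') \<rightarrow>\<^sub>E Fa \<alpha>) \<times> Fa \<alpha>)"

lemma lits_small: assumes \<alpha>: "\<alpha> \<in> Field \<mu>" shows "small TYPE('u) (lits \<alpha>)"
proof -
  have F: "small TYPE('u) (Fsym voc)" and R: "small TYPE('u) (Rsym voc)"
    using vocabulary_voc by (auto simp: vocabulary_def)
  have Fa: "small TYPE('u) (Fa \<alpha>)" by (rule small_subset[OF F]) (auto simp: Fa_def)
  have "small TYPE('u) (SIGMA s':Fsym voc. (underS \<mu> (far voc s') \<rightarrow>\<^sub>E Fa \<alpha>) \<times> Fa \<alpha>)"
    using F by (rule small_Sigma) (rule small_Sigma[OF small_PiE[OF small_underS[OF far_Field] Fa] Fa])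
  then show ?thesis unfolding lits_def
    by (intro small_Un small_image small_Sigma[OF Fa Fa] small_Sigma[OF small_underS[OF \<alpha>] Fa] small_Sigma[OF R Fa])
qed

lemma lits_wf: "\<phi> \<in> lits \<alpha> \<Longrightarrow> wf_qff \<mu> voc (underS \<mu> \<alpha>) \<phi>"
  by (auto simp: lits_def Fa_def PiE_def Pi_iff)

text \<open>The inner conjunction is the diagram of \<open>(E P, p)\<close> restricted to
  \<open>lits \<alpha>\<close>, positive and negative. The axiom thus says that every tuple of
  length \<alpha> has the same literals as some type.\<close>

definition ax :: "'u \<Rightarrow> 'u usentence" where
  "ax \<alpha> = Forall \<alpha> (bdisj (Ty \<alpha>) (\<lambda>t. bconj (lits \<alpha>) (\<lambda>\<phi>. if sat \<mu> voc (E (fst t)) (snd t) \<phi> then \<phi> else Neg \<phi>)))"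

definition Th :: "'u usentence set" where
  "Th = ax ` Field \<mu>"

lemma holds_ax:
  assumes \<alpha>: "\<alpha> \<in> Field \<mu>"
  shows "holds \<mu> voc M (ax \<alpha>) \<longleftrightarrow> (\<forall>\<rho>\<in>tuples \<mu> \<alpha> (univ M). \<exists>t\<in>Ty \<alpha>. \<forall>\<phi>\<in>lits \<alpha>. sat \<mu> voc M \<rho> \<phi> \<longleftrightarrow> sat \<mu> voc (E (fst t)) (snd t) \<phi>)"
proof -
  have "sat \<mu> voc M \<rho> (if b then \<phi> else Neg \<phi>) \<longleftrightarrow> (sat \<mu> voc M \<rho> \<phi> \<longleftrightarrow> b)" for \<rho> \<phi> b by simp
  then show ?thesis unfolding ax_def holds.simps sat_bdisj[OF Ty_small[OF \<alpha>]] sat_bconj[OF lits_small[OF \<alpha>]] by simp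
qed

lemma Th_universal: "universal_theory \<mu> voc Th"
  unfolding universal_theory_def
proof (intro conjI ballI)
  show "small TYPE('u) Th" unfolding Th_def by (rule small_image[OF small_Field_mu])
  fix \<sigma> assume "\<sigma> \<in> Th"
  then obtain \<alpha> where \<alpha>: "\<alpha> \<in> Field \<mu>" "\<sigma> = ax \<alpha>" by (auto simp: Th_def)
  have "wf_qff \<mu> voc (underS \<mu> \<alpha>) (bdisj (Ty \<alpha>) (\<lambda>t. bconj (lits \<alpha>) (\<lambda>\<phi>. if sat \<mu> voc (E (fst t)) (snd t) \<phi> then \<phi> else Neg \<phi>)))"
    by (rule wf_bdisj[OF Ty_small[OF \<alpha>(1)] wf_bconj[OF lits_small[OF \<alpha>(1)]]]) (use lits_wf in auto)
  then show "universal_sentence \<mu> voc \<sigma>" using \<alpha> by (simp add: ax_def)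
qed

text \<open>The comparison arrow of a tuple \<rho> induces an embedding of \<open>E P\<close> that
  carries \<open>p\<close> to \<rho>, so \<rho> satisfies the same literals as its type.\<close>

lemma E_model: assumes X: "X \<in> Ob C" shows "E X \<in> models \<mu> voc Th"
  unfolding models_def
proof (intro CollectI conjI ballI)
  show "str (E X)" by (rule E_str[OF X])
  fix \<sigma> assume "\<sigma> \<in> Th"
  then obtain \<alpha> where \<alpha>: "\<alpha> \<in> Field \<mu>" "\<sigma> = ax \<alpha>" by (auto simp: Th_def)
  show "holds \<mu> voc (E X) \<sigma>" unfolding \<alpha>(2) holds_ax[OF \<alpha>(1)]
  proof
    fix \<rho> assume "\<rho> \<in> tuples \<mu> \<alpha> (univ (E X))"
    then have \<rho>: "\<rho> \<in> tuples \<mu> \<alpha> (U X)" by simp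
    let ?t = "ty \<alpha> X \<rho>"
    have t: "?t \<in> Ty \<alpha>" by (rule ty_Ty[OF \<alpha>(1) X \<rho>])
    have P: "fst ?t \<in> Ob C" "snd ?t \<in> tuples \<mu> \<alpha> (U (fst ?t))" using Ty_tuple[OF \<alpha>(1) t] by auto
    have "sat \<mu> voc (E (fst ?t)) (snd ?t) \<phi> \<longleftrightarrow> sat \<mu> voc (E X) \<rho> \<phi>" if "\<phi> \<in> lits \<alpha>" for \<phi>
      by (rule sat_embedding[OF E_str[OF P(1)] E_emb[OF hm_Hom[OF \<alpha>(1) X \<rho>]] _ lits_wf[OF that]])
        (use P(2) hm_tuple[OF \<alpha>(1) X \<rho>] in \<open>auto simp: tuples_def\<close>)
    then show "\<exists>t\<in>Ty \<alpha>. \<forall>\<phi>\<in>lits \<alpha>. sat \<mu> voc (E X) \<rho> \<phi> \<longleftrightarrow> sat \<mu> voc (E (fst t)) (snd t) \<phi>" using t by blast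
  qed
qed

section \<open>Every model is a structure of points\<close>

lemma val_Fa: "s \<in> Fa \<alpha> \<Longrightarrow> \<rho> \<in> tuples \<mu> \<alpha> A \<Longrightarrow> val \<mu> voc M \<rho> (Fn s Var) = fns M s \<rho>"
  by (simp add: Fa_def tuples_def PiE_def extensional_restrict)

text \<open>The operation is a choice function with the value \<open>b\<close> at \<open>t\<close>
  and default points elsewhere. The tuple of \<open>t\<close> has type \<open>t\<close> with the
  identity as comparison arrow, so there the value is \<open>b\<close>.\<close>

lemma type_element:
  assumes \<alpha>: "\<alpha> \<in> Field \<mu>" and t: "t \<in> Ty \<alpha>" and b: "b \<in> U (fst t)"
  shows "\<exists>s\<in>Fa \<alpha>. fns (E (fst t)) s (snd t) = b"
proof -
  define e where "e = (\<lambda>t'\<in>Ty \<alpha>. if t' = t then b else SOME a. a \<in> U (fst t'))"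
  have "(SOME a. a \<in> U (fst t')) \<in> U (fst t')" if "t' \<in> Ty \<alpha>" for t'
    using U_nonempty Ty_tuple[OF \<alpha> that] by (simp add: some_in_eq)
  then have e: "(\<alpha>, e) \<in> Ops" using \<alpha> b by (auto simp: Ops_def e_def)
  have P: "fst t \<in> Ob C" "snd t \<in> tuples \<mu> \<alpha> (U (fst t))" using Ty_tuple[OF \<alpha> t] by auto
  have id: "Idt C (fst t) \<in> Hom C (fst t) (fst t)" by (rule Idt_Hom[OF cat P(1)])
  have "Cmp C (Idt C (fst t)) a = a" if "a \<in> U (fst t)" for a
    using that Hom_Idt_left[OF cat] by (auto simp: points_Hom)
  note idl = this
  have "ty \<alpha> (fst t) (snd t) = t" "hm \<alpha> (fst t) (snd t) = Idt C (fst t)"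
    by (rule ty_hm_eq[OF \<alpha> t id P(2)], use P(2) idl in \<open>auto simp: tuples_def\<close>)+
  then have "fns (E (fst t)) (opc (\<alpha>, e)) (snd t) = b" using E_fns[OF e P(2)] t idl[OF b] by (simp add: e_def)
  moreover have "opc (\<alpha>, e) \<in> Fa \<alpha>" using e far_opc[OF e] by (auto simp: Fa_def Fsym_voc)
  ultimately show ?thesis by blast
qed

text \<open>If \<rho> has the literals of \<open>t\<close>, send the value at \<open>p\<close> of an
  operation to its value at \<rho>. The four families of literals give, in turn, well-definedness
  with injectivity, the values on the entries, preservation of sorts and of operations. The last
  clause says that the image is the least closed set containing \<rho>, and so independent of the
  chosen type and embedding.\<close>

lemma model_local:
  assumes M: "str M" and h: "holds \<mu> voc M (ax \<alpha>)" and \<alpha>: "\<alpha> \<in> Field \<mu>" and \<rho>: "\<rho> \<in> tuples \<mu> \<alpha> (univ M)"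
  shows "\<exists>P\<in>Ob C. \<exists>\<phi>. emb (E P) \<phi> M \<and> (\<forall>i\<in>underS \<mu> \<alpha>. \<rho> i \<in> \<phi> ` U P) \<and>
    (\<forall>B. (\<forall>i\<in>underS \<mu> \<alpha>. \<rho> i \<in> B) \<longrightarrow> (\<forall>s\<in>Fsym voc. \<forall>x\<in>ftuples s B. fns M s x \<in> B) \<longrightarrow> \<phi> ` U P \<subseteq> B)"
proof -
  obtain t where t: "t \<in> Ty \<alpha>" and agree: "\<forall>\<phi>\<in>lits \<alpha>. sat \<mu> voc M \<rho> \<phi> \<longleftrightarrow> sat \<mu> voc (E (fst t)) (snd t) \<phi>"
    using h \<rho> unfolding holds_ax[OF \<alpha>] by blast
  define P where "P = fst t"
  define p where "p = snd t"
  have PO: "P \<in> Ob C" and p: "p \<in> tuples \<mu> \<alpha> (U P)" using Ty_tuple[OF \<alpha> t] by (auto simp: P_def p_def)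
  have Pstr: "str (E P)" by (rule E_str[OF PO])
  \<comment> \<open>An operation naming each point of \<open>P\<close> as a value at
    \<open>p\<close>.\<close>
  obtain \<sigma> where \<sigma>: "\<And>b. b \<in> U P \<Longrightarrow> \<sigma> b \<in> Fa \<alpha>" "\<And>b. b \<in> U P \<Longrightarrow> fns (E P) (\<sigma> b) p = b"
    using type_element[OF \<alpha> t] unfolding P_def p_def by metis
  note vM = val_Fa[OF _ \<rho>, of _ M] and vP = val_Fa[OF _ p, of _ "E P"]
  have ag: "sat \<mu> voc M \<rho> \<phi> \<longleftrightarrow> sat \<mu> voc (E P) p \<phi>" if "\<phi> \<in> lits \<alpha>" for \<phi> using agree that by (simp add: P_def p_def)
  have La: "fns M s \<rho> = fns M s' \<rho> \<longleftrightarrow> fns (E P) s p = fns (E P) s' p" if s: "s \<in> Fa \<alpha>" "s' \<in> Fa \<alpha>" for s s'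
  proof -
    have "Eq (Fn s Var) (Fn s' Var) \<in> lits \<alpha>" unfolding lits_def using s by (intro UnI1 image_eqI[of _ _ "(s, s')"]) auto
    from ag[OF this] show ?thesis using vM[OF s(1)] vM[OF s(2)] vP[OF s(1)] vP[OF s(2)] by (simp del: val.simps)
  qed
  have Lb: "\<rho> i = fns M s \<rho> \<longleftrightarrow> p i = fns (E P) s p" if s: "s \<in> Fa \<alpha>" "i \<in> underS \<mu> \<alpha>" for s i
  proof -
    have "Eq (Var i) (Fn s Var) \<in> lits \<alpha>" unfolding lits_def using s by (intro UnI1 UnI2[of _ "_ ` _"] image_eqI[of _ _ "(i, s)"]) auto
    from ag[OF this] show ?thesis using vM[OF s(1)] vP[OF s(1)] by (simp del: val.simps(2))
  qed
  have Lc: "(\<lambda>i\<in>underS \<mu> one. fns M s \<rho>) \<in> rels M q \<longleftrightarrow> (\<lambda>i\<in>underS \<mu> one. fns (E P) s p) \<in> rels (E P) q"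
    if s: "s \<in> Fa \<alpha>" "q \<in> Rsym voc" for s q
  proof -
    have "Rl q (\<lambda>_. Fn s Var) \<in> lits \<alpha>" unfolding lits_def
      using s by (intro UnI1[of _ "_ \<union> _"] UnI2[of _ "_ ` _"] image_eqI[of _ _ "(q, s)"]) auto
    from ag[OF this] show ?thesis using vM[OF s(1)] vP[OF s(1)] by (simp add: rar_voc del: val.simps)
  qed
  have Ld: "fns M s' (\<lambda>j\<in>underS \<mu> (far voc s'). fns M (k j) \<rho>) = fns M s \<rho> \<longleftrightarrow>
      fns (E P) s' (\<lambda>j\<in>underS \<mu> (far voc s'). fns (E P) (k j) p) = fns (E P) s p"
    if s: "s \<in> Fa \<alpha>" "s' \<in> Fsym voc" "k \<in> underS \<mu> (far voc s') \<rightarrow>\<^sub>E Fa \<alpha>" for s s' k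
  proof -
    have L: "Eq (Fn s' (\<lambda>j. Fn (k j) Var)) (Fn s Var) \<in> lits \<alpha>" unfolding lits_def
      using s by (intro UnI2 image_eqI[of _ _ "(s', k, s)"]) auto
    have k: "k j \<in> Fa \<alpha>" if "j \<in> underS \<mu> (far voc s')" for j using s(3) that by auto
    have 1: "val \<mu> voc M \<rho> (Fn s' (\<lambda>j. Fn (k j) Var)) = fns M s' (\<lambda>j\<in>underS \<mu> (far voc s'). fns M (k j) \<rho>)"
      by (subst val.simps(2), rule arg_cong[where f = "fns M s'"], rule restrict_ext, rule vM[OF k])
    have 2: "val \<mu> voc (E P) p (Fn s' (\<lambda>j. Fn (k j) Var)) = fns (E P) s' (\<lambda>j\<in>underS \<mu> (far voc s'). fns (E P) (k j) p)"
      by (subst val.simps(2), rule arg_cong[where f = "fns (E P) s'"], rule restrict_ext, rule vP[OF k])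
    from ag[OF L] show ?thesis unfolding sat.simps 1 2 vM[OF s(1)] vP[OF s(1)] .
  qed
  define \<phi> where "\<phi> b = fns M (\<sigma> b) \<rho>" for b
  have \<phi>_s: "\<phi> (fns (E P) s p) = fns M s \<rho>" if s: "s \<in> Fa \<alpha>" for s
  proof -
    have "fns (E P) s p \<in> U P" using fns_closed[OF Pstr, of s p] s p by (auto simp: Fa_def)
    then show ?thesis unfolding \<phi>_def using La[OF \<sigma>(1) s] \<sigma>(2) by blast
  qed
  have \<phi>M: "\<phi> b \<in> univ M" if b: "b \<in> U P" for b
    unfolding \<phi>_def using fns_closed[OF M, of "\<sigma> b" \<rho>] \<sigma>(1)[OF b] \<rho> by (auto simp: Fa_def)
  have e: "emb (E P) \<phi> M" unfolding embedding_def
  proof (intro conjI ballI)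
    show "\<phi> \<in> univ (E P) \<rightarrow> univ M" using \<phi>M by auto
    show "inj_on \<phi> (univ (E P))"
    proof (rule inj_onI)
      fix b b' assume b: "b \<in> univ (E P)" "b' \<in> univ (E P)" "\<phi> b = \<phi> b'"
      then show "b = b'" using La[OF \<sigma>(1) \<sigma>(1), of b b'] \<sigma>(2) by (simp add: \<phi>_def)
    qed
    fix s x assume s: "s \<in> Fsym voc" and x: "x \<in> ftuples s (univ (E P))"
    have xU: "x j \<in> U P" if "j \<in> underS \<mu> (far voc s)" for j using x that by (auto simp: tuples_def)
    let ?k = "\<lambda>j\<in>underS \<mu> (far voc s). \<sigma> (x j)"
    have k: "?k \<in> underS \<mu> (far voc s) \<rightarrow>\<^sub>E Fa \<alpha>" using \<sigma>(1) xU by auto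
    have y: "fns (E P) s x \<in> U P" using fns_closed[OF Pstr s x] by simp
    have "(\<lambda>j\<in>underS \<mu> (far voc s). fns (E P) (?k j) p) = x"
      using x \<sigma>(2) xU by (auto simp: tuples_def PiE_def extensional_def fun_eq_iff)
    moreover have "(\<lambda>j\<in>underS \<mu> (far voc s). fns M (?k j) \<rho>) = fcmp s \<phi> x"
      by (auto simp: compose_def \<phi>_def fun_eq_iff)
    ultimately show "\<phi> (fns (E P) s x) = fns M s (fcmp s \<phi> x)"
      using Ld[OF \<sigma>(1)[OF y] s k] \<sigma>(2)[OF y] unfolding \<phi>_def by simp
  next
    fix q x assume q: "q \<in> Rsym voc" and x: "x \<in> rtuples q (univ (E P))"
    have x': "x \<in> tuples \<mu> one (U P)" using x by (simp add: rar_voc)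
    have xp: "x pt \<in> U P" using x' one_pt(2) by (auto simp: tuples_def)
    have "(\<lambda>i\<in>underS \<mu> one. fns (E P) (\<sigma> (x pt)) p) = x"
      using x' \<sigma>(2)[OF xp] one_pt(2) by (auto simp: tuples_def PiE_def extensional_def fun_eq_iff)
    moreover have "(\<lambda>i\<in>underS \<mu> one. fns M (\<sigma> (x pt)) \<rho>) = rcmp q \<phi> x"
      using one_pt(2) by (auto simp: compose_def \<phi>_def fun_eq_iff rar_voc)
    ultimately show "x \<in> rels (E P) q \<longleftrightarrow> rcmp q \<phi> x \<in> rels M q" using Lc[OF \<sigma>(1)[OF xp] q] by simp
  qed
  have "\<rho> i \<in> \<phi> ` U P" if i: "i \<in> underS \<mu> \<alpha>" for i
  proof -
    have pi: "p i \<in> U P" using p i by (auto simp: tuples_def)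
    then have "\<phi> (p i) = \<rho> i" using Lb[OF \<sigma>(1)[OF pi] i] \<sigma>(2)[OF pi] by (simp add: \<phi>_def)
    then show ?thesis using pi by (metis imageI)
  qed
  moreover have "\<phi> ` U P \<subseteq> B" if B: "\<forall>i\<in>underS \<mu> \<alpha>. \<rho> i \<in> B" "\<forall>s\<in>Fsym voc. \<forall>x\<in>ftuples s B. fns M s x \<in> B" for B
  proof
    fix y assume "y \<in> \<phi> ` U P"
    then obtain b where b: "b \<in> U P" "y = \<phi> b" by blast
    have s: "\<sigma> b \<in> Fsym voc" "far voc (\<sigma> b) = \<alpha>" using \<sigma>(1)[OF b(1)] by (auto simp: Fa_def)
    have "\<rho> \<in> ftuples (\<sigma> b) B" using \<rho> B(1) s(2) by (auto simp: tuples_def PiE_def)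
    then show "y \<in> B" using B(2) s(1) b(2) by (simp add: \<phi>_def)
  qed
  ultimately show ?thesis using PO e by blast
qed

text \<open>Short subsets of \<open>M\<close> are enumerated as tuples, and each gives a copy of
  some \<open>E P\<close> in \<open>M\<close>. The enumerations are arbitrary choices; minimality of
  the copies is what makes them increase with the subset, and \<open>E_full\<close> turns the
  inclusions into arrows of a directed diagram with colimit \<open>X\<close>.\<close>

lemma model_iso:
  assumes M: "M \<in> models \<mu> voc Th"
  shows "\<exists>X\<in>Ob C. \<exists>\<psi>. siso (E X) \<psi> M"
proof -
  have Mstr: "str M" and hold: "\<And>\<alpha>. \<alpha> \<in> Field \<mu> \<Longrightarrow> holds \<mu> voc M (ax \<alpha>)" using M by (auto simp: models_def Th_def)
  obtain I r dec where dir: "directed_poset \<mu> I r" and dec: "bij_betw dec I {A. A \<subseteq> univ M \<and> |A| <o \<mu>}"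
    and r: "\<And>i j. (i, j) \<in> r \<longleftrightarrow> i \<in> I \<and> j \<in> I \<and> dec i \<subseteq> dec j"
    by (rule subset_poset[OF str_small[OF Mstr]], rule that)
  note po = directed_poset_facts[OF dir]
  have decI: "dec i \<subseteq> univ M" "|dec i| <o \<mu>" if "i \<in> I" for i using bij_betwE[OF dec] that by auto
  have "\<exists>P. P \<in> Ob C \<and> (\<exists>\<phi>. emb (E P) \<phi> M \<and> dec i \<subseteq> \<phi> ` U P \<and>
     (\<forall>B. dec i \<subseteq> B \<longrightarrow> (\<forall>s\<in>Fsym voc. \<forall>x\<in>ftuples s B. fns M s x \<in> B) \<longrightarrow> \<phi> ` U P \<subseteq> B))" if i: "i \<in> I" for i
  proof -
    obtain \<alpha> f where \<alpha>: "\<alpha> \<in> Field \<mu>" and f: "bij_betw f (underS \<mu> \<alpha>) (dec i)"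
      using less_mu_enum[OF decI(2)[OF i]] by blast
    let ?\<rho> = "restrict f (underS \<mu> \<alpha>)"
    have im: "f ` underS \<mu> \<alpha> = dec i" using f by (simp add: bij_betw_def)
    have \<rho>: "?\<rho> \<in> tuples \<mu> \<alpha> (univ M)" using im decI(1)[OF i] by (auto simp: tuples_def)
    obtain P \<phi> where P: "P \<in> Ob C" "emb (E P) \<phi> M" "\<forall>i\<in>underS \<mu> \<alpha>. ?\<rho> i \<in> \<phi> ` U P"
      "\<forall>B. (\<forall>i\<in>underS \<mu> \<alpha>. ?\<rho> i \<in> B) \<longrightarrow> (\<forall>s\<in>Fsym voc. \<forall>x\<in>ftuples s B. fns M s x \<in> B) \<longrightarrow> \<phi> ` U P \<subseteq> B"
      using model_local[OF Mstr hold[OF \<alpha>] \<alpha> \<rho>] by (elim bexE exE conjE)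
    have sub: "(\<forall>i\<in>underS \<mu> \<alpha>. ?\<rho> i \<in> B) \<longleftrightarrow> dec i \<subseteq> B" for B unfolding im[symmetric] by auto
    show ?thesis using P(1,2) P(3,4)[unfolded sub] by (intro exI[of _ P] conjI exI[of _ \<phi>])
  qed
  then obtain P \<phi> where PO: "\<And>i. i \<in> I \<Longrightarrow> P i \<in> Ob C" and \<phi>: "\<And>i. i \<in> I \<Longrightarrow> emb (E (P i)) (\<phi> i) M"
    and cov: "\<And>i. i \<in> I \<Longrightarrow> dec i \<subseteq> \<phi> i ` U (P i)"
    and min: "\<And>i B. i \<in> I \<Longrightarrow> dec i \<subseteq> B \<Longrightarrow> (\<forall>s\<in>Fsym voc. \<forall>x\<in>ftuples s B. fns M s x \<in> B) \<Longrightarrow> \<phi> i ` U (P i) \<subseteq> B"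
    by metis
  have Pstr: "str (E (P i))" if "i \<in> I" for i by (rule E_str[OF PO[OF that]])
  have \<phi>inj: "\<phi> i b = \<phi> i b' \<longleftrightarrow> b = b'" if "i \<in> I" "b \<in> U (P i)" "b' \<in> U (P i)" for i b b'
    using inj_on_eq_iff[OF emb_inj[OF \<phi>[OF that(1)]]] that(2,3) by simp
  \<comment> \<open>The copy at \<open>j\<close> is closed under the functions of \<open>M\<close>
    and contains \<open>dec i\<close>, so it contains the least such set, the copy at
    \<open>i\<close>.\<close>
  have inc: "\<phi> i ` U (P i) \<subseteq> \<phi> j ` U (P j)" if ij: "(i, j) \<in> r" for i j
  proof (rule min)
    have I: "i \<in> I" "j \<in> I" "dec i \<subseteq> dec j" using r ij by blast+
    show "i \<in> I" by (rule I(1))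
    show "dec i \<subseteq> \<phi> j ` U (P j)" using cov[OF I(2)] I(3) by blast
    have N: "str (img (\<phi> j) (E (P j)))" "substr \<mu> voc (img (\<phi> j) (E (P j))) M"
      using img_str_iso(1)[OF Pstr[OF I(2)] emb_inj[OF \<phi>[OF I(2)]]] emb_img[OF Pstr[OF I(2)] \<phi>[OF I(2)]] .
    show "\<forall>s\<in>Fsym voc. \<forall>x\<in>ftuples s (\<phi> j ` U (P j)). fns M s x \<in> \<phi> j ` U (P j)"
      using fns_closed[OF N(1)] N(2) by (simp add: substr_def)
  qed
  have "\<exists>f\<in>Hom C (P i) (P j). \<forall>b\<in>U (P i). \<phi> j (Cmp C f b) = \<phi> i b" if ij: "(i, j) \<in> r" for i j
  proof -
    have I: "i \<in> I" "j \<in> I" using r ij by blast+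
    obtain h where h: "emb (E (P i)) h (E (P j))" "\<forall>b\<in>U (P i). \<phi> j (h b) = \<phi> i b"
      using emb_factor[OF Pstr[OF I(1)] Pstr[OF I(2)] \<phi>[OF I(1)] \<phi>[OF I(2)]] inc[OF ij] by auto
    obtain f where "f \<in> Hom C (P i) (P j)" "\<forall>b\<in>U (P i). h b = Cmp C f b" using E_full[OF h(1) PO[OF I(1)] PO[OF I(2)]] by blast
    then show ?thesis using h(2) by auto
  qed
  then obtain a where a: "\<And>i j. (i, j) \<in> r \<Longrightarrow> a i j \<in> Hom C (P i) (P j)"
    "\<And>i j b. (i, j) \<in> r \<Longrightarrow> b \<in> U (P i) \<Longrightarrow> \<phi> j (Cmp C (a i j) b) = \<phi> i b" by metis
  \<comment> \<open>An arrow is determined by its effect in \<open>M\<close>, as the embeddings are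
    injective and \<open>E\<close> is faithful; functoriality of the diagram follows.\<close>
  have a_eq: "f = a i j" if ij: "(i, j) \<in> r" and f: "f \<in> Hom C (P i) (P j)" and e: "\<And>b. b \<in> U (P i) \<Longrightarrow> \<phi> j (Cmp C f b) = \<phi> i b" for i j f
  proof (rule E_faithful[OF f a(1)[OF ij]])
    fix b assume b: "b \<in> U (P i)"
    have j: "j \<in> I" using r ij by blast
    show "Cmp C f b = Cmp C (a i j) b"
      using \<phi>inj[OF j points_Cmp[OF cat f b] points_Cmp[OF cat a(1)[OF ij] b]] e[OF b] a(2)[OF ij b] by simp
  qed
  have asc: "Cmp C (Cmp C g f) b = Cmp C g (Cmp C f b)" if "b \<in> U X" "f \<in> Hom C X Y" "g \<in> Hom C Y Z" for b f g X Y Z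
    using that Hom_assoc[OF cat _ that(2,3)] by (auto simp: points_Hom)
  define D where "D = \<lparr>FO = P, FA = (\<lambda>(i, j). a i j)\<rparr>"
  have D: "is_functor (poset_cat I r) C D" unfolding is_functor_def
  proof (intro conjI ballI impI)
    fix i assume "i \<in> Ob (poset_cat I r)"
    then have i: "i \<in> I" by simp
    show "FO D i \<in> Ob C" using PO[OF i] by (simp add: D_def)
    have "Idt C (P i) = a i i"
      by (rule a_eq[OF po(4)[OF i] Idt_Hom[OF cat PO[OF i]]]) (use Hom_Idt_left[OF cat] in \<open>auto simp: points_Hom\<close>)
    then show "FA D (Idt (poset_cat I r) i) = Idt C (FO D i)" by (simp add: D_def)
  next
    fix p assume "p \<in> Ar (poset_cat I r)"
    then show "FA D p \<in> Hom C (FO D (Src (poset_cat I r) p)) (FO D (Tgt (poset_cat I r) p))"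
      using a(1) by (cases p) (simp add: D_def)
  next
    fix p q assume "p \<in> Ar (poset_cat I r)" "q \<in> Ar (poset_cat I r)" "Tgt (poset_cat I r) p = Src (poset_cat I r) q"
    then obtain i j k where p: "p = (i, j)" "q = (j, k)" and ij: "(i, j) \<in> r" and jk: "(j, k) \<in> r" by (cases p, cases q) auto
    have "Cmp C (a j k) (a i j) = a i k"
    proof (rule a_eq[OF po(5)[OF ij jk] Cmp_Hom[OF cat a(1)[OF ij] a(1)[OF jk]]])
      fix b assume b: "b \<in> U (P i)"
      show "\<phi> k (Cmp C (Cmp C (a j k) (a i j)) b) = \<phi> i b"
        using asc[OF b a(1)[OF ij] a(1)[OF jk]] a(2)[OF jk points_Cmp[OF cat a(1)[OF ij] b]] a(2)[OF ij b] by simp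
    qed
    then show "FA D (Cmp (poset_cat I r) q p) = Cmp C (FA D q) (FA D p)" using p by (simp add: D_def)
  qed
  obtain X c where col: "is_colimit C (poset_cat I r) D X c" using dc dir D unfolding has_directed_colimits_def by blast
  have cc: "cocone C (poset_cat I r) D X c" using col by (simp add: is_colimit_iff)
  have X: "X \<in> Ob C" by (rule cocone_Ob[OF cc])
  have Xstr: "str (E X)" by (rule E_str[OF X])
  have cH: "c i \<in> Hom C (P i) X" if "i \<in> I" for i using cocone_arrow[OF cc, of i] that by (simp add: D_def)
  have cU: "Cmp C (c i) b \<in> U X" if "i \<in> I" "b \<in> U (P i)" for i b by (rule points_Cmp[OF cat cH[OF that(1)] that(2)])
  have c_up: "Cmp C (c j) (Cmp C (a i j) b) = Cmp C (c i) b" if ij: "(i, j) \<in> r" and b: "b \<in> U (P i)" for i j b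
  proof -
    have j: "j \<in> I" using r ij by blast
    have "Cmp C (c j) (a i j) = c i" using cocone_commute[OF cc, of "(i, j)"] ij by (simp add: D_def)
    then show ?thesis using asc[OF b a(1)[OF ij] cH[OF j]] by simp
  qed
  have c_inj: "Cmp C (c i) b = Cmp C (c i) b' \<longleftrightarrow> b = b'" if "i \<in> I" "b \<in> U (P i)" "b' \<in> U (P i)" for i b b'
    using inj_on_eq_iff[OF emb_inj[OF E_emb[OF cH[OF that(1)]]]] that(2,3) by simp
  \<comment> \<open>At a common later stage both the leg into \<open>X\<close> and the embedding
    into \<open>M\<close> are injective, so \<open>X\<close> and \<open>M\<close> make the same
    identifications.\<close>
  have eq: "Cmp C (c i) b = Cmp C (c j) b' \<longleftrightarrow> \<phi> i b = \<phi> j b'"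
    if ij: "i \<in> I" "j \<in> I" and b: "b \<in> U (P i)" and b': "b' \<in> U (P j)" for i j b b'
  proof -
    obtain k where k: "k \<in> I" "(i, k) \<in> r" "(j, k) \<in> r" using directed_upper2[OF dir ij] by blast
    note u = points_Cmp[OF cat a(1)[OF k(2)] b] and u' = points_Cmp[OF cat a(1)[OF k(3)] b']
    show ?thesis using c_up[OF k(2) b] c_up[OF k(3) b'] a(2)[OF k(2) b] a(2)[OF k(3) b'] c_inj[OF k(1) u u'] \<phi>inj[OF k(1) u u'] by simp
  qed
  \<comment> \<open>The source of a point of \<open>X\<close> is in \<open>S\<close>, so the point
    factors through a stage.\<close>
  have "\<exists>i b. i \<in> I \<and> b \<in> U (P i) \<and> x = Cmp C (c i) b" if x: "x \<in> U X" for x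
  proof -
    have xS: "Src C x \<in> S" "x \<in> Hom C (Src C x) X" using x by (auto simp: points_Hom)
    then obtain i g where "i \<in> I" "g \<in> Hom C (Src C x) (FO D i)" "x = Cmp C (c i) g"
      using S_fac[OF xS(1)] dir D col unfolding factoring_def by blast
    then show ?thesis using points_HomI[of g C "Src C x" "P i" S] xS(1) by (auto simp: D_def)
  qed
  then obtain ix bv where ix: "\<And>x. x \<in> U X \<Longrightarrow> ix x \<in> I" "\<And>x. x \<in> U X \<Longrightarrow> bv x \<in> U (P (ix x))" "\<And>x. x \<in> U X \<Longrightarrow> x = Cmp C (c (ix x)) (bv x)"
    by metis
  define \<psi> where "\<psi> x = \<phi> (ix x) (bv x)" for x
  have \<psi>: "\<psi> (Cmp C (c i) b) = \<phi> i b" if i: "i \<in> I" and b: "b \<in> U (P i)" for i b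
  proof -
    note x = cU[OF i b]
    show ?thesis unfolding \<psi>_def using eq[OF i ix(1)[OF x] b ix(2)[OF x]] ix(3)[OF x] by simp
  qed
  have \<phi>M: "\<phi> i b \<in> univ M" if "i \<in> I" "b \<in> U (P i)" for i b using emb_fn[OF \<phi>[OF that(1)]] that(2) by auto
  \<comment> \<open>A tuple of length below \<mu> comes from a single stage \<open>k\<close>, so the
    conditions on \<psi> reduce to those on the embedding at \<open>k\<close>.\<close>
  have tup: "\<exists>k\<in>I. \<exists>y\<in>tuples \<mu> \<beta> (U (P k)). x = compose (underS \<mu> \<beta>) (Cmp C (c k)) y \<and>
      compose (underS \<mu> \<beta>) \<psi> x = compose (underS \<mu> \<beta>) (\<phi> k) y" if \<beta>: "\<beta> \<in> Field \<mu>" and x: "x \<in> tuples \<mu> \<beta> (U X)" for \<beta> x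
  proof -
    have xU: "x l \<in> U X" if "l \<in> underS \<mu> \<beta>" for l using x that by (auto simp: tuples_def)
    obtain k where k: "k \<in> I" "\<forall>l\<in>underS \<mu> \<beta>. (ix (x l), k) \<in> r"
      using directed_upper[OF dir card_underS_less[OF \<beta>], of "\<lambda>l. ix (x l)"] ix(1)[OF xU] by blast
    let ?y = "\<lambda>l\<in>underS \<mu> \<beta>. Cmp C (a (ix (x l)) k) (bv (x l))"
    have yU: "?y l \<in> U (P k)" "Cmp C (c k) (?y l) = x l" if l: "l \<in> underS \<mu> \<beta>" for l
      using points_Cmp[OF cat a(1)[OF bspec[OF k(2) l]] ix(2)[OF xU[OF l]]]
        c_up[OF bspec[OF k(2) l] ix(2)[OF xU[OF l]]] ix(3)[OF xU[OF l]] l by simp_all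
    have 1: "?y \<in> tuples \<mu> \<beta> (U (P k))" using yU(1) by (auto simp: tuples_def)
    have 2: "x = compose (underS \<mu> \<beta>) (Cmp C (c k)) ?y"
      using yU(2) x by (auto simp: compose_def fun_eq_iff tuples_def PiE_def extensional_def)
    have 3: "compose (underS \<mu> \<beta>) \<psi> x = compose (underS \<mu> \<beta>) (\<phi> k) ?y"
    proof -
      have "\<psi> (x l) = \<phi> k (?y l)" if l: "l \<in> underS \<mu> \<beta>" for l using \<psi>[OF k(1) yU(1)[OF l]] yU(2)[OF l] by simp
      then show ?thesis by (auto simp: compose_def fun_eq_iff)
    qed
    show ?thesis using k(1) 1 2 3 by blast
  qed
  have "emb (E X) \<psi> M" unfolding embedding_def
  proof (intro conjI ballI)
    show "\<psi> \<in> univ (E X) \<rightarrow> univ M" using \<phi>M ix(1,2) by (auto simp: \<psi>_def)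
    show "inj_on \<psi> (univ (E X))"
    proof (rule inj_onI)
      fix x y assume xy: "x \<in> univ (E X)" "y \<in> univ (E X)" "\<psi> x = \<psi> y"
      then have u: "x \<in> U X" "y \<in> U X" by simp_all
      show "x = y"
        using eq[OF ix(1)[OF u(1)] ix(1)[OF u(2)] ix(2)[OF u(1)] ix(2)[OF u(2)]] ix(3)[OF u(1)] ix(3)[OF u(2)] xy(3)
        by (simp add: \<psi>_def)
    qed
    fix s x assume s: "s \<in> Fsym voc" and x: "x \<in> ftuples s (univ (E X))"
    then have "x \<in> tuples \<mu> (far voc s) (U X)" by simp
    from tup[OF far_Field[OF s] this] obtain k y where k: "k \<in> I" and y: "y \<in> ftuples s (U (P k))"
      and xy: "x = fcmp s (Cmp C (c k)) y" "fcmp s \<psi> x = fcmp s (\<phi> k) y" by blast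
    have y': "y \<in> ftuples s (univ (E (P k)))" using y by simp
    have "fns (E (P k)) s y \<in> U (P k)" using fns_closed[OF Pstr[OF k] s y'] by simp
    then have "\<psi> (fns (E X) s x) = \<phi> k (fns (E (P k)) s y)"
      using emb_fns[OF E_emb[OF cH[OF k]] s y'] xy(1) \<psi>[OF k] by metis
    then show "\<psi> (fns (E X) s x) = fns M s (fcmp s \<psi> x)" using emb_fns[OF \<phi>[OF k] s y'] xy(2) by simp
  next
    fix s x assume s: "s \<in> Rsym voc" and x: "x \<in> rtuples s (univ (E X))"
    then have "x \<in> tuples \<mu> (rar voc s) (U X)" by simp
    from tup[OF rar_Field[OF s] this] obtain k y where k: "k \<in> I" and y: "y \<in> rtuples s (U (P k))"
      and xy: "x = rcmp s (Cmp C (c k)) y" "rcmp s \<psi> x = rcmp s (\<phi> k) y" by blast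
    have y': "y \<in> rtuples s (univ (E (P k)))" using y by simp
    show "x \<in> rels (E X) s \<longleftrightarrow> rcmp s \<psi> x \<in> rels M s"
      using emb_rels[OF E_emb[OF cH[OF k]] s y'] emb_rels[OF \<phi>[OF k] s y'] xy by simp
  qed
  moreover have "\<psi> ` univ (E X) = univ M"
  proof
    show "\<psi> ` univ (E X) \<subseteq> univ M" using \<phi>M ix(1,2) by (auto simp: \<psi>_def)
    show "univ M \<subseteq> \<psi> ` univ (E X)"
    proof
      fix m assume m: "m \<in> univ M"
      have "{m} \<in> {A. A \<subseteq> univ M \<and> |A| <o \<mu>}" using m less_mu_finite[of "{m}"] by simp
      then obtain i where i: "i \<in> I" "dec i = {m}" using bij_betw_imp_surj_on[OF dec] by (metis (no_types, lifting) imageE)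
      obtain b where b: "b \<in> U (P i)" "m = \<phi> i b" using cov[OF i(1)] i(2) by auto
      show "m \<in> \<psi> ` univ (E X)" using \<psi>[OF i(1) b(1)] b(2) cU[OF i(1) b(1)] by (metis E_univ imageI)
    qed
  qed
  ultimately show ?thesis using X by (auto simp: str_iso_def)
qed

section \<open>The equivalence with the category of models\<close>

lemma models_universal_class: "universal_class \<mu> voc (models \<mu> voc Th)"
  by unfold_locales (rule models_universal[OF Th_universal])

lemma Emb_class_cat: "Emb \<mu> voc Th = class_cat \<mu> voc (models \<mu> voc Th) (substr_rel \<mu> voc (models \<mu> voc Th))"
  unfolding Emb_def universal_class.class_cat_eq[OF models_universal_class] ..

lemma models_pseudo_class: "pseudo_class \<mu> voc (models \<mu> voc Th) (substr_rel \<mu> voc (models \<mu> voc Th))"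
  by unfold_locales (rule universal_class.pseudo_universal[OF models_universal_class])

theorem weak_equivalence_Emb:
  "weak_equivalence C (Emb \<mu> voc Th)
     \<lparr>FO = E, FA = (\<lambda>f. (E (Src C f), restrict (Cmp C f) (U (Src C f)), E (Tgt C f)))\<rparr>" (is "weak_equivalence C ?D ?F")
  unfolding weak_equivalence_def
proof (intro conjI ballI allI impI)
  have D: "?D = concrete_cat (models \<mu> voc Th) univ emb" by (simp add: Emb_def)
  have FA: "FA ?F f = (E X, restrict (Cmp C f) (U X), E Y)" if "f \<in> Hom C X Y" for f X Y using that by (simp add: Hom_iff)
  have FO: "FO ?F X = E X" for X by simp
  show "is_functor C ?D ?F" unfolding is_functor_def
  proof (intro conjI ballI impI)
    show "FO ?F X \<in> Ob ?D" if "X \<in> Ob C" for X using E_model[OF that] by (simp add: D)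
    show "FA ?F f \<in> Hom ?D (FO ?F (Src C f)) (FO ?F (Tgt C f))" if f: "f \<in> Ar C" for f
    proof -
      have fH: "f \<in> Hom C (Src C f) (Tgt C f)" using f by (simp add: Hom_iff)
      have "emb (E (Src C f)) (restrict (Cmp C f) (U (Src C f))) (E (Tgt C f))"
        by (rule emb_cong[OF E_str[OF Src_Ob[OF cat f]] _ E_emb[OF fH]]) simp
      then show ?thesis using E_model[OF Src_Ob[OF cat f]] E_model[OF Tgt_Ob[OF cat f]] by (simp add: D concrete_Hom)
    qed
    show "FA ?F (Idt C X) = Idt ?D (FO ?F X)" if X: "X \<in> Ob C" for X
    proof -
      have "restrict (Cmp C (Idt C X)) (U X) = (\<lambda>x\<in>U X. x)"
        using Hom_Idt_left[OF cat] by (auto simp: fun_eq_iff points_Hom)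
      then show ?thesis using FA[OF Idt_Hom[OF cat X]] by (simp add: D)
    qed
    show "FA ?F (Cmp C g f) = Cmp ?D (FA ?F g) (FA ?F f)" if f: "f \<in> Ar C" and g: "g \<in> Ar C" and e: "Tgt C f = Src C g" for f g
    proof -
      have fH: "f \<in> Hom C (Src C f) (Src C g)" and gH: "g \<in> Hom C (Src C g) (Tgt C g)" using f g e by (simp_all add: Hom_iff)
      have "Cmp C (Cmp C g f) b = Cmp C g (Cmp C f b)" "Cmp C f b \<in> U (Src C g)" if "b \<in> U (Src C f)" for b
        using that Hom_assoc[OF cat _ fH gH] points_Cmp[OF cat fH that] by (auto simp: points_Hom)
      then have "restrict (Cmp C (Cmp C g f)) (U (Src C f)) =
         compose (U (Src C f)) (restrict (Cmp C g) (U (Src C g))) (restrict (Cmp C f) (U (Src C f)))"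
        by (auto simp: compose_def fun_eq_iff)
      then show ?thesis unfolding FA[OF fH] FA[OF gH] FA[OF Cmp_Hom[OF cat fH gH]] by (simp add: D)
    qed
  qed
  show "\<exists>f\<in>Hom C X Y. FA ?F f = g" if X: "X \<in> Ob C" and Y: "Y \<in> Ob C" and g: "g \<in> Hom ?D (FO ?F X) (FO ?F Y)" for X Y g
  proof -
    obtain \<phi> where \<phi>: "g = (E X, \<phi>, E Y)" "\<phi> \<in> extensional (U X)" "emb (E X) \<phi> (E Y)"
      using g by (auto simp: D concrete_Hom)
    obtain f where f: "f \<in> Hom C X Y" "\<forall>b\<in>U X. \<phi> b = Cmp C f b" using E_full[OF \<phi>(3) X Y] by blast
    have "\<phi> = restrict (Cmp C f) (U X)" using f(2) \<phi>(2) by (auto simp: fun_eq_iff extensional_def)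
    then show ?thesis using f(1) FA[OF f(1)] \<phi>(1) by blast
  qed
  show "f = g" if f: "f \<in> Hom C X Y" and g: "g \<in> Hom C X Y" and e: "FA ?F f = FA ?F g" for X Y f g
  proof (rule E_faithful[OF f g])
    fix b assume b: "b \<in> U X"
    have "restrict (Cmp C f) (U X) = restrict (Cmp C g) (U X)" using e unfolding FA[OF f] FA[OF g] by simp
    from fun_cong[OF this, of b] show "Cmp C f b = Cmp C g b" using b by simp
  qed
  show "\<exists>X\<in>Ob C. \<exists>u v. inverse_arrows ?D M (FO ?F X) u v" if "M \<in> Ob ?D" for M
  proof -
    have M: "M \<in> models \<mu> voc Th" using that by (simp add: D)
    obtain X \<psi> where X: "X \<in> Ob C" "siso (E X) \<psi> M" using model_iso[OF M] by blast
    have "img \<psi> (E X) = M" by (rule iso_img_eq[OF E_str[OF X(1)] _ X(2)]) (use M in \<open>simp add: models_def\<close>)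
    then have "\<exists>u v. inverse_arrows ?D (E X) M u v"
      using pseudo_class.img_inverse_arrows[OF models_pseudo_class E_model[OF X(1)] emb_inj[OF iso_emb[OF X(2)]]]
      unfolding Emb_class_cat by metis
    then show ?thesis using X(1) inverse_arrows_sym by (metis FO)
  qed
qed

end

section \<open>The equivalences\<close>

text \<open>At most |'u| many objects with small hom-sets have at most |'u| many arrows, so these
  can be renamed by elements of \<open>'u\<close>. A functor is provided in each direction: one
  transfers hypotheses to the copy, the other leads from \<open>K\<close> into it.\<close>

lemma (in regular_universe) recode_arrows:
  fixes K :: "('o, 'm) cat"
  assumes cat: "category K" and ls: "locally_small TYPE('u) K" and Ob: "|Ob K| \<le>o |UNIV :: 'u set|"
  shows "\<exists>(K' :: ('o, 'u) cat) F G. category K' \<and> locally_small TYPE('u) K' \<and>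
    weak_equivalence K' K F \<and> weak_equivalence K K' G"
proof -
  have inf: "infinite (UNIV :: 'u set)" using Cinfinite_univ by (simp add: cinfinite_def Field_card_of)
  have "|Ob K \<times> Ob K| \<le>o |UNIV :: 'u set|"
    by (rule card_of_Sigma_ordLeq_infinite[OF inf Ob]) (use Ob in simp)
  then have "|\<Union>p\<in>Ob K \<times> Ob K. Hom K (fst p) (snd p)| \<le>o |UNIV :: 'u set|"
    by (rule card_of_UNION_ordLeq_infinite[OF inf])
      (use ls in \<open>auto simp: locally_small_def small_def intro: ordLess_imp_ordLeq\<close>)
  moreover have "Ar K \<subseteq> (\<Union>p\<in>Ob K \<times> Ob K. Hom K (fst p) (snd p))"
  proof
    fix f assume f: "f \<in> Ar K"
    then have "(Src K f, Tgt K f) \<in> Ob K \<times> Ob K" using cat by (simp add: cat_simps)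
    then show "f \<in> (\<Union>p\<in>Ob K \<times> Ob K. Hom K (fst p) (snd p))" using f by (intro UN_I[of "(Src K f, Tgt K f)"]) (auto simp: Hom_iff)
  qed
  ultimately have "|Ar K| \<le>o |UNIV :: 'u set|" using card_of_mono1 ordLeq_transitive by blast
  then obtain cod :: "'m \<Rightarrow> 'u" where cod: "inj_on cod (Ar K)" by (meson card_of_ordLeq)
  define de where "de = inv_into (Ar K) cod"
  have de[simp]: "de (cod f) = f" if "f \<in> Ar K" for f using cod that by (simp add: de_def)
  define K' where "K' = \<lparr>Ob = Ob K, Ar = cod ` Ar K, Src = (\<lambda>x. Src K (de x)), Tgt = (\<lambda>x. Tgt K (de x)),
     Idt = (\<lambda>A. cod (Idt K A)), Cmp = (\<lambda>y x. cod (Cmp K (de y) (de x)))\<rparr>"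
  have K'[simp]: "Ob K' = Ob K" "Ar K' = cod ` Ar K" "Src K' x = Src K (de x)" "Tgt K' x = Tgt K (de x)"
    "Idt K' A = cod (Idt K A)" "Cmp K' y x = cod (Cmp K (de y) (de x))" for x y A
    by (simp_all add: K'_def)
  have Hom': "Hom K' A B = cod ` Hom K A B" for A B by (auto simp: Hom_iff)
  have cat': "category K'" unfolding category_def
    using cat by (auto simp: Hom' Hom_iff cat_simps)
  have ls': "locally_small TYPE('u) K'" using ls small_image unfolding locally_small_def Hom' K'(1) by blast
  have F: "weak_equivalence K' K \<lparr>FO = (\<lambda>A. A), FA = de\<rparr>"
    unfolding weak_equivalence_def is_functor_def
  proof (intro conjI ballI allI impI)
    show "\<exists>X\<in>Ob K'. \<exists>u v. inverse_arrows K Y (FO \<lparr>FO = (\<lambda>A. A), FA = de\<rparr> X) u v" if Y: "Y \<in> Ob K" for Y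
      using inverse_arrows_Idt[OF cat Y] Y by auto
  qed (use cat in \<open>auto simp: Hom' Hom_iff cat_simps\<close>)
  have G: "weak_equivalence K K' \<lparr>FO = (\<lambda>A. A), FA = cod\<rparr>"
    unfolding weak_equivalence_def is_functor_def
  proof (intro conjI ballI allI impI)
    show "\<exists>X\<in>Ob K. \<exists>u v. inverse_arrows K' Y (FO \<lparr>FO = (\<lambda>A. A), FA = cod\<rparr> X) u v" if Y: "Y \<in> Ob K'" for Y
      using inverse_arrows_Idt[OF cat' Y] Y by auto
  qed (use cat inj_onD[OF cod] in \<open>auto simp: Hom' Hom_iff cat_simps\<close>)
  show ?thesis using cat' ls' F G by blast
qed

theorem theorem5p9:
  fixes K :: "('o, 'm) cat" and \<mu> :: "'u rel"
  assumes "inaccessible_universe TYPE('u)"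
    and "category K" and "locally_small TYPE('u) K" and "|Ob K| \<le>o |UNIV :: 'u set|"
    and "regular_cardinal \<mu>"
  shows "let
      c1 = (locally_multipresentable \<mu> K \<and> (\<forall>f \<in> Ar K. mono_arrow K f));
      c2 = (\<exists>\<tau> T. vocabulary \<mu> \<tau> \<and> universal_theory \<mu> \<tau> T \<and> equivalent K (Emb \<mu> \<tau> T));
      c3 = (\<exists>\<tau> \<K> le. universal_mu_AEC \<mu> \<tau> \<K> le \<and> equivalent K (class_cat \<mu> \<tau> \<K> le));
      c4 = (\<exists>\<tau> \<K> le. pseudo_universal_mu_AEC \<mu> \<tau> \<K> le \<and> equivalent K (class_cat \<mu> \<tau> \<K> le))
    in (c1 \<longleftrightarrow> c2) \<and> (c2 \<longleftrightarrow> c3) \<and> (c3 \<longleftrightarrow> c4)"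
proof -
  interpret regular_universe \<mu> by unfold_locales (fact assms(1), fact assms(5))
  note cat = assms(2) and ls = assms(3)
  have 12: "\<exists>\<tau> T. vocabulary \<mu> \<tau> \<and> universal_theory \<mu> \<tau> T \<and> equivalent K (Emb \<mu> \<tau> T)"
    if c1: "locally_multipresentable \<mu> K" and mono: "\<forall>f \<in> Ar K. mono_arrow K f"
  proof -
    \<comment> \<open>The hypotheses pass to the recoded category along \<open>F\<close>; composing
      \<open>G\<close> with the embedding of \<open>K'\<close> into models gives the equivalence for
      \<open>K\<close>.\<close>
    obtain K' :: "('o, 'u) cat" and F G where K': "category K'" "locally_small TYPE('u) K'"
      and F: "weak_equivalence K' K F" and G: "weak_equivalence K K' G"
      using recode_arrows[OF cat ls assms(4)] by (elim exE conjE)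
    obtain S Ty where "presented_category \<mu> K' S Ty"
      using locally_multipresentable_presented[OF K' weq_mono[OF F K'(1) mono cat]
          weq_locally_multipresentable[OF F K'(1) cat K'(2) ls mono c1]] by (elim exE)
    then interpret P: presented_category \<mu> K' S Ty .
    have D: "category (Emb \<mu> P.voc P.Th)"
      unfolding P.Emb_class_cat by (rule pseudo_class.category_CC[OF P.models_pseudo_class])
    have "equivalent K (Emb \<mu> P.voc P.Th)"
      by (rule weak_equivalence_imp_equivalent[OF weak_equivalence_comp[OF G P.weak_equivalence_Emb cat K'(1) D] cat D])
    then show ?thesis using P.vocabulary_voc P.Th_universal by blast
  qed
  have 23: "\<exists>\<tau> \<K> le. universal_mu_AEC \<mu> \<tau> \<K> le \<and> equivalent K (class_cat \<mu> \<tau> \<K> le)"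
    if "vocabulary \<mu> \<tau>" "universal_theory \<mu> \<tau> T" "equivalent K (Emb \<mu> \<tau> T)" for \<tau> T
  proof -
    interpret vocab_universe \<mu> \<tau> by unfold_locales (fact that(1))
    interpret universal_class \<mu> \<tau> "models \<mu> \<tau> T" by unfold_locales (rule models_universal[OF that(2)])
    have "equivalent K (class_cat \<mu> \<tau> (models \<mu> \<tau> T) le)" using that(3) unfolding class_cat_eq Emb_def .
    then show ?thesis using uni by blast
  qed
  have 34: "\<exists>\<tau> \<K> le. pseudo_universal_mu_AEC \<mu> \<tau> \<K> le \<and> equivalent K (class_cat \<mu> \<tau> \<K> le)"
    if u: "universal_mu_AEC \<mu> \<tau> \<K> le" and e: "equivalent K (class_cat \<mu> \<tau> \<K> le)" for \<tau> \<K> le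
  proof -
    have le: "le = substr_rel \<mu> \<tau> \<K>" and voc: "vocabulary \<mu> \<tau>" using u by (simp_all add: universal_mu_AEC_def)
    interpret vocab_universe \<mu> \<tau> by unfold_locales (fact voc)
    interpret U: universal_class \<mu> \<tau> \<K> by unfold_locales (use u le in simp)
    show ?thesis using U.pseudo_universal e unfolding le by blast
  qed
  have 41: "locally_multipresentable \<mu> K \<and> (\<forall>f \<in> Ar K. mono_arrow K f)"
    if u: "pseudo_universal_mu_AEC \<mu> \<tau> \<K> le" and e: "equivalent K (class_cat \<mu> \<tau> \<K> le)" for \<tau> \<K> le
  proof -
    have voc: "vocabulary \<mu> \<tau>" using u by (simp add: pseudo_universal_mu_AEC_def mu_AEC_def abstract_class_def)
    interpret vocab_universe \<mu> \<tau> by unfold_locales (fact voc)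
    interpret U: pseudo_class \<mu> \<tau> \<K> le by unfold_locales (fact u)
    obtain F where F: "weak_equivalence K (class_cat \<mu> \<tau> \<K> le) F"
      using equivalent_imp_weak_equivalence[OF e cat U.category_CC] by blast
    show ?thesis
      using weq_locally_multipresentable[OF F cat U.category_CC ls U.locally_small_CC U.mono_CC
          U.class_cat_locally_multipresentable]
        weq_mono[OF F cat U.mono_CC U.category_CC] by blast
  qed
  show ?thesis unfolding Let_def using 12 23 34 41 by blast
qed

end
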